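(* Let $\ell\ge 3$ and let $\mathcal{A}$ be an irreducible supersolvable simplicial $\ell$-arrangement (in a real vector space of dimension $\ell$). Then one of the following cases holds: (1) $\ell=3$ and $\mathcal{A}$ is $L$-equivalent to exactly one of the arrangements in $\mathcal{R}(1)\cup\mathcal{R}(2)$, where $\mathcal{R}(1)=\{\mathcal{A}(2n,1)\mid n\ge 3\}$ and $\mathcal{R}(2)=\{\mathcal{A}(4m+1,1)\mid m\ge 2\}$; or (2) $\ell\ge 4$ and $\mathcal{A}$ is linearly isomorphic to exactly one of the reflection arrangements $\mathcal{A}(A_\ell)$, $\mathcal{A}(C_\ell)$, or to $\mathcal{A}_\ell^{\ell-1}=\mathcal{A}(C_\ell)\setminus\{\{x_1=0\}\}$. In particular, $\mathcal{A}$ is crystallographic.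
   Context: An $\ell$-arrangement is a finite set $\mathcal{A}$ of linear hyperplanes in a vector space $V$ of dimension $\ell$ (here $V\cong\mathbb{R}^\ell$). $L(\mathcal{A})$ is the set of all intersections of subsets of $\mathcal{A}$ (including $V$, the empty intersection), ordered by reverse inclusion; the rank of $X\in L(\mathcal{A})$ is $\operatorname{codim} X$. $\mathcal{A}$ is irreducible if it cannot be written as a non-trivial product, i.e. there is no decomposition $V=V_1\oplus V_2$ with $V_1,V_2\neq 0$ such that every $H\in\mathcal{A}$ is of the form $H_1\oplus V_2$ or $V_1\oplus H_2$ with $H_i$ a hyperplane of $V_i$. $\mathcal{A}$ is simplicial if every connected component (chamber) of $V\setminus\bigcup_{H\in\mathcal{A}}H$ is an open simplicial cone. $X\in L(\mathcal{A})$ is modular if $X+Y\in L(\mathcal{A})$ for all $Y\in L(\mathcal{A})$. An $\ell$-arrangement of rank $\ell$ is supersolvable if there is a maximal chain $V=X_0<X_1<\dots<X_\ell=\bigcap_{H\in\mathcal{A}}H$ of modular elements of $L(\mathcal{A})$. Two arrangements are $L$-equivalent if their intersection lattices are isomorphic; they are linearly isomorphic if an invertible linear map carries one to the other. A matrix gives an arrangement by taking its columns as normal vectors of the hyperplanes. For $n\ge 3$, with $c_n(m)=\cos\frac{2\pi m}{2n}$ and $s_n(m)=\sin\frac{2\pi m}{2n}$, $\mathcal{A}(2n,1)$ is the arrangement of $2n$ planes in $\mathbb{R}^3$ with normals $(-s_n(i),c_n(i),0)$ for $i=0,\dots,n-1$ and $(c_n(2j-1),s_n(2j-1),1)$ for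 $j=1,\dots,n$. For $m\ge 2$, $\mathcal{A}(4m+1,1)=\mathcal{A}(4m,1)\cup\{(0,0,1)^\perp\}$. $\mathcal{A}(A_\ell)$ and $\mathcal{A}(C_\ell)$ are the arrangements of reflecting hyperplanes of the finite Coxeter groups of type $A_\ell$ and $C_\ell$ (acting on $\mathbb{R}^\ell$ with full rank); concretely $\mathcal{A}(C_\ell)=\{\ker(x_i\pm x_j)\mid 1\le i<j\le\ell\}\cup\{\ker(x_i)\mid 1\le i\le\ell\}$. Crystallographic: for a chamber $K$ its walls are the $H\in\mathcal{A}$ with $\dim(H\cap\overline{K})=\ell-1$. A (reduced) root system for $\mathcal{A}$ is a finite $R\subseteq V^*$ with $\mathcal{A}=\{\ker\alpha\mid\alpha\in R\}$ and $\mathbb{R}\alpha\cap R=\{\pm\alpha\}$ for all $\alpha\in R$. For a chamber $K$ put $B_R^K=\{\alpha\in R\mid \ker\alpha\text{ is a wall of }K,\ \alpha>0\text{ on }K\}$. A simplicial arrangement $\mathcal{A}$ is crystallographic if it has a root system $R$ with $R\subseteq\sum_{\alpha\in B_R^K}\mathbb{Z}\alpha$ for all chambers $K$. *)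

theory Defs
  imports "HOL-Analysis.Analysis"
begin

(* The ambient vector space of an arrangement is a linear subspace V of some euclidean space, passed
   as an explicit carrier. This is needed for the Coxeter arrangement of type A, which
   lives on a hyperplane of R^(l+1). The sum of sets H + K is the elementwise sum. *)

subsection \<open>Arrangements and intersection lattices\<close>

definition hyperplane_of :: "'a::euclidean_space set \<Rightarrow> 'a set \<Rightarrow> bool" where
  "hyperplane_of V H \<longleftrightarrow> subspace H \<and> H \<subseteq> V \<and> dim H + 1 = dim V"

definition arrangement :: "'a::euclidean_space set \<Rightarrow> 'a set set \<Rightarrow> bool" where
  "arrangement V A \<longleftrightarrow> subspace V \<and> finite A \<and> (\<forall>H\<in>A. hyperplane_of V H)"

(* Intersecting with V makes the empty intersection equal to V. *)
definition arr_center :: "'a::euclidean_space set \<Rightarrow> 'a set set \<Rightarrow> 'a set" where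
  "arr_center V A = V \<inter> \<Inter>A"

definition int_lattice :: "'a::euclidean_space set \<Rightarrow> 'a set set \<Rightarrow> 'a set set" where
  "int_lattice V A = {V \<inter> \<Inter>B | B. B \<subseteq> A}"

definition codim_in :: "'a::euclidean_space set \<Rightarrow> 'a set \<Rightarrow> nat" where
  "codim_in V X = dim V - dim X"

definition arr_rank :: "'a::euclidean_space set \<Rightarrow> 'a set set \<Rightarrow> nat" where
  "arr_rank V A = codim_in V (arr_center V A)"

definition irreducible_arr :: "'a::euclidean_space set \<Rightarrow> 'a set set \<Rightarrow> bool" where
  "irreducible_arr V A \<longleftrightarrow>
     \<not> (\<exists>V1 V2. subspace V1 \<and> subspace V2 \<and> V1 + V2 = V \<and> V1 \<inter> V2 = {0} \<and>
          V1 \<noteq> {0} \<and> V2 \<noteq> {0} \<and>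
          (\<forall>H\<in>A. (\<exists>H1. hyperplane_of V1 H1 \<and> H = H1 + V2) \<or>
                 (\<exists>H2. hyperplane_of V2 H2 \<and> H = V1 + H2)))"

subsection \<open>Chambers and simplicial arrangements\<close>

definition chambers :: "'a::euclidean_space set \<Rightarrow> 'a set set \<Rightarrow> 'a set set" where
  "chambers V A = components (V - \<Union>A)"

definition open_simplicial_cone :: "'a::euclidean_space set \<Rightarrow> 'a set \<Rightarrow> bool" where
  "open_simplicial_cone V K \<longleftrightarrow>
     (\<exists>B. independent B \<and> span B = V \<and>
          K = {\<Sum>b\<in>B. c b *\<^sub>R b | c. \<forall>b\<in>B. c b > 0})"

definition simplicial_arr :: "'a::euclidean_space set \<Rightarrow> 'a set set \<Rightarrow> bool" where
  "simplicial_arr V A \<longleftrightarrow> (\<forall>K\<in>chambers V A. open_simplicial_cone V K)"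

subsection \<open>Supersolvability\<close>

definition modular_element :: "'a::euclidean_space set \<Rightarrow> 'a set set \<Rightarrow> 'a set \<Rightarrow> bool" where
  "modular_element V A X \<longleftrightarrow>
     X \<in> int_lattice V A \<and> (\<forall>Y\<in>int_lattice V A. X + Y \<in> int_lattice V A)"

(* The lattice order is reverse inclusion, so the chain decreases as a chain of sets. A strict
   chain of length dim V in a lattice of rank dim V is automatically maximal. *)
definition supersolvable_arr :: "'a::euclidean_space set \<Rightarrow> 'a set set \<Rightarrow> bool" where
  "supersolvable_arr V A \<longleftrightarrow>
     arr_rank V A = dim V \<and>
     (\<exists>X :: nat \<Rightarrow> 'a set. X 0 = V \<and> X (dim V) = arr_center V A \<and>
          (\<forall>i<dim V. X (Suc i) \<subset> X i) \<and>
          (\<forall>i\<le>dim V. modular_element V A (X i)))"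

subsection \<open>Equivalence of arrangements\<close>

definition L_equivalent ::
    "'a::euclidean_space set \<Rightarrow> 'a set set \<Rightarrow> 'b::euclidean_space set \<Rightarrow> 'b set set \<Rightarrow> bool" where
  "L_equivalent V A W B \<longleftrightarrow>
     (\<exists>f. bij_betw f (int_lattice V A) (int_lattice W B) \<and>
          (\<forall>X\<in>int_lattice V A. \<forall>Y\<in>int_lattice V A. X \<supseteq> Y \<longleftrightarrow> f X \<supseteq> f Y))"

definition linearly_isomorphic ::
    "'a::euclidean_space set \<Rightarrow> 'a set set \<Rightarrow> 'b::euclidean_space set \<Rightarrow> 'b set set \<Rightarrow> bool" where
  "linearly_isomorphic V A W B \<longleftrightarrow>
     (\<exists>f :: 'a \<Rightarrow> 'b. linear f \<and> bij_betw f V W \<and> B = (\<lambda>H. f ` H) ` A)"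

subsection \<open>Crystallographic arrangements\<close>

(* Linear forms on V, represented by functions that vanish outside V. *)
definition dual_space :: "'a::euclidean_space set \<Rightarrow> ('a \<Rightarrow> real) set" where
  "dual_space V = {\<alpha>. (\<forall>x\<in>V. \<forall>y\<in>V. \<alpha> (x + y) = \<alpha> x + \<alpha> y) \<and>
                      (\<forall>c. \<forall>x\<in>V. \<alpha> (c *\<^sub>R x) = c * \<alpha> x) \<and>
                      (\<forall>x. x \<notin> V \<longrightarrow> \<alpha> x = 0)}"

definition form_ker :: "'a::euclidean_space set \<Rightarrow> ('a \<Rightarrow> real) \<Rightarrow> 'a set" where
  "form_ker V \<alpha> = {x\<in>V. \<alpha> x = 0}"

definition root_system_for ::
    "'a::euclidean_space set \<Rightarrow> 'a set set \<Rightarrow> ('a \<Rightarrow> real) set \<Rightarrow> bool" where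
  "root_system_for V A R \<longleftrightarrow>
     finite R \<and> R \<subseteq> dual_space V \<and> A = form_ker V ` R \<and>
     (\<forall>\<alpha>\<in>R. {(\<lambda>x. c * \<alpha> x) | c. True} \<inter> R = {\<alpha>, (\<lambda>x. - \<alpha> x)})"

(* dim of a set is the dimension of its linear span. *)
definition walls :: "'a::euclidean_space set \<Rightarrow> 'a set set \<Rightarrow> 'a set \<Rightarrow> 'a set set" where
  "walls V A K = {H\<in>A. dim (H \<inter> closure K) + 1 = dim V}"

definition chamber_basis ::
    "'a::euclidean_space set \<Rightarrow> 'a set set \<Rightarrow> ('a \<Rightarrow> real) set \<Rightarrow> 'a set \<Rightarrow> ('a \<Rightarrow> real) set" where
  "chamber_basis V A R K = {\<alpha>\<in>R. form_ker V \<alpha> \<in> walls V A K \<and> (\<forall>x\<in>K. \<alpha> x > 0)}"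

definition crystallographic_arr :: "'a::euclidean_space set \<Rightarrow> 'a set set \<Rightarrow> bool" where
  "crystallographic_arr V A \<longleftrightarrow> simplicial_arr V A \<and>
     (\<exists>R. root_system_for V A R \<and>
        (\<forall>K\<in>chambers V A.
           R \<subseteq> {(\<lambda>x. \<Sum>\<beta>\<in>chamber_basis V A R K. of_int (k \<beta>) * \<beta> x) | k :: ('a \<Rightarrow> real) \<Rightarrow> int. True}))"

subsection \<open>The rank three families\<close>

definition normal_arr :: "'a::euclidean_space set \<Rightarrow> 'a set set" where
  "normal_arr N = (\<lambda>v. {x. v \<bullet> x = 0}) ` N"

definition cs :: "nat \<Rightarrow> nat \<Rightarrow> real" where
  "cs n m = cos (2 * pi * real m / (2 * real n))"

definition sn :: "nat \<Rightarrow> nat \<Rightarrow> real" where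
  "sn n m = sin (2 * pi * real m / (2 * real n))"

(* A(2n,1) *)
definition arr_even :: "nat \<Rightarrow> (real^3) set set" where
  "arr_even n = normal_arr
     ((\<lambda>i. vector [- sn n i, cs n i, 0]) ` {0..<n} \<union>
      (\<lambda>j. vector [cs n (2*j - 1), sn n (2*j - 1), 1]) ` {1..n})"

(* A(4m+1,1) *)
definition arr_odd :: "nat \<Rightarrow> (real^3) set set" where
  "arr_odd m = arr_even (2*m) \<union> normal_arr {vector [0, 0, 1]}"

definition family_R1 :: "(real^3) set set set" where
  "family_R1 = {arr_even n | n. n \<ge> 3}"

definition family_R2 :: "(real^3) set set set" where
  "family_R2 = {arr_odd m | m. m \<ge> 2}"

subsection \<open>Reflection arrangements\<close>

(* Type A_l, l = CARD('n): the symmetric group on the l + 1 coordinates indexed by 'n option acts on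
   the l-dimensional space of vectors with coordinate sum 0; its reflections are the
   transpositions (i j), with reflecting hyperplane x_i = x_j. *)
definition coxeter_A_space :: "(real ^ ('n::finite option)) set" where
  "coxeter_A_space = {x. (\<Sum>i\<in>UNIV. x $ i) = 0}"

definition coxeter_A :: "(real ^ ('n::finite option)) set set" where
  "coxeter_A = {{x \<in> coxeter_A_space. x $ i - x $ j = 0} | i j. i \<noteq> j}"

definition coxeter_C :: "(real ^ 'n) set set" where
  "coxeter_C = {{x. x $ i + x $ j = 0} | i j. i \<noteq> j} \<union>
               {{x. x $ i - x $ j = 0} | i j. i \<noteq> j} \<union>
               {{x. x $ i = 0} | i. True}"

(* The arrangement A_l^(l-1); the removed coordinate hyperplane x_p = 0 is a parameter, since the
   index type carries no distinguished first element. *)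
definition coxeter_C_minus :: "'n \<Rightarrow> (real ^ 'n) set set" where
  "coxeter_C_minus p = coxeter_C - {{x. x $ p = 0}}"

definition exactly_one :: "bool list \<Rightarrow> bool" where
  "exactly_one ps \<longleftrightarrow> length (filter (\<lambda>p. p) ps) = 1"

end

(* A supersolvable arrangement has a modular line, spanned by a unit vector p. The hyperplanes through it
   have normals R in W = orthogonal complement of p, the others have normals p - f with f in a finite
   subset F of W, and modularity makes every difference of two points of F a multiple of some r in R.
   Simpliciality forces points of F that are consecutive along a generic direction w to differ by a
   multiple of a simple root of the chamber of w. So the points of F, listed along w, spell a word in the
   simple roots.

   Looking at F along two simple roots s, t spanning k >= 3 roots gives allowable sequences of planar
   point sets in which consecutive points are swapped now or were swapped in the previous step. Such a
   sequence is that of a regular k-gon, or of a regular 2c-gon together with its centre. In rank three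
   this determines all incidences, hence the intersection lattice.

   In higher rank the planar views restrict the word so much that it is s_1 ... s_n or a palindrome
   s_1 ... s_n s_n ... s_1 or s_1 ... s_(n-1) s_n s_(n-1) ... s_1. In the first case F is a simplex
   (type A), in the others a cross polytope with or without its centre (type C, or C without one
   coordinate hyperplane). *)

theory Submission
  imports Defs
begin

section \<open>Allowable sequences\<close>

text \<open>Simpliciality enters through single chambers. The hyperplane of \<open>p - f\<close>
  meets the line of points \<open>w + t p\<close> at the height \<open>f . w\<close>, so the segment
  between consecutive heights lies in one chamber. This chamber has one wall facing down and one
  facing up; its walls form a basis, and merging these two into \<open>g - f\<close> leaves a basis
  of \<open>W\<close>, which is the simple system of \<open>R\<close> at \<open>w\<close>.
  Irreducibility enters through the word: simple roots that are never letters span a fixed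
  complement of the span of all differences of \<open>F\<close>, unchanged when walls are crossed,
  and would split off a factor. Lengths are not visible in the word. Two letters whose plane has
  three roots leave one intermediate direction, which fixes the ratio of two steps; at a turn of
  order four there are two, and coincidences among them make the steps before and after the turn
  agree. So in rank at least four \<open>F\<close> is known up to a linear map. In rank three the
  plane may have many roots and only incidences survive, hence mere equivalence of lattices.
  Integrality is checked in the coordinates of the model roots, because the inner product of the
  ambient space is unrelated to the arrangement.\<close>

text \<open>The order \<open>L i\<close> is the one in which a planar point set is seen after \<open>i\<close> of its \<open>k\<close> directions have
  been passed, as in the allowable sequences of Goodman and Pollack; \<open>d q q'\<close> is the direction of the
  line through \<open>q\<close> and \<open>q'\<close>. The condition \<open>consec\<close> is not part of the usual notion: it is what
  simpliciality gives.\<close>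

locale allowable_sequence =
  fixes Q :: "'q set" and k :: nat and L :: "nat \<Rightarrow> 'q \<Rightarrow> 'q \<Rightarrow> bool" and d :: "'q \<Rightarrow> 'q \<Rightarrow> nat"
  assumes finite_Q: "finite Q" and k_ge: "3 \<le> k"
    and L_irrefl: "q \<in> Q \<Longrightarrow> \<not> L i q q"
    and L_trans: "q \<in> Q \<Longrightarrow> q' \<in> Q \<Longrightarrow> q'' \<in> Q \<Longrightarrow> L i q q' \<Longrightarrow> L i q' q'' \<Longrightarrow> L i q q''"
    and L_total: "q \<in> Q \<Longrightarrow> q' \<in> Q \<Longrightarrow> q \<noteq> q' \<Longrightarrow> L i q q' \<or> L i q' q"
    and d_less: "q \<in> Q \<Longrightarrow> q' \<in> Q \<Longrightarrow> q \<noteq> q' \<Longrightarrow> d q q' < k"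
    and d_sym: "q \<in> Q \<Longrightarrow> q' \<in> Q \<Longrightarrow> d q q' = d q' q"
    and d_trans: "q \<in> Q \<Longrightarrow> q' \<in> Q \<Longrightarrow> q'' \<in> Q \<Longrightarrow> q \<noteq> q' \<Longrightarrow> q' \<noteq> q'' \<Longrightarrow> q \<noteq> q'' \<Longrightarrow>
      d q q' = d q' q'' \<Longrightarrow> d q q'' = d q q'"
    and cross: "q \<in> Q \<Longrightarrow> q' \<in> Q \<Longrightarrow> q \<noteq> q' \<Longrightarrow>
      L (Suc i) q q' \<longleftrightarrow> (if d q q' = i mod k then L i q' q else L i q q')"
    and consec: "q \<in> Q \<Longrightarrow> q' \<in> Q \<Longrightarrow> L i q q' \<Longrightarrow> (\<forall>z\<in>Q. \<not> (L i q z \<and> L i z q')) \<Longrightarrow>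
      d q q' = i mod k \<or> Suc (d q q') mod k = i mod k"
begin

definition pos :: "nat \<Rightarrow> 'q \<Rightarrow> nat" where
  "pos i q = card {z\<in>Q. L i z q}"

lemma L_asym: "q \<in> Q \<Longrightarrow> q' \<in> Q \<Longrightarrow> L i q q' \<Longrightarrow> \<not> L i q' q"
  using L_irrefl L_trans by blast

lemma pos_less: 
  assumes "q \<in> Q" "q' \<in> Q" "L i q q'" shows "pos i q < pos i q'"
  unfolding pos_def
proof (rule psubset_card_mono)
  show "finite {z\<in>Q. L i z q'}" using finite_Q by simp
  have "q \<notin> {z\<in>Q. L i z q}" using L_irrefl assms by blast
  moreover have "q \<in> {z\<in>Q. L i z q'}" using assms by blast
  moreover have "{z\<in>Q. L i z q} \<subseteq> {z\<in>Q. L i z q'}" using L_trans assms by blast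
  ultimately show "{z\<in>Q. L i z q} \<subset> {z\<in>Q. L i z q'}" by blast
qed

lemma L_iff_pos: "q \<in> Q \<Longrightarrow> q' \<in> Q \<Longrightarrow> L i q q' \<longleftrightarrow> pos i q < pos i q'"
  by (metis pos_less L_total less_irrefl less_asym)

lemma pos_inj: "q \<in> Q \<Longrightarrow> q' \<in> Q \<Longrightarrow> pos i q = pos i q' \<Longrightarrow> q = q'"
  by (metis pos_less L_total less_irrefl)

lemma pos_less_card: assumes "q \<in> Q" shows "pos i q < card Q"
  unfolding pos_def
proof (rule psubset_card_mono[OF finite_Q])
  show "{z\<in>Q. L i z q} \<subset> Q" using L_irrefl assms by blast
qed

lemma bij_pos: "bij_betw (pos i) Q {..<card Q}"
proof -
  have "inj_on (pos i) Q" using pos_inj by (auto intro: inj_onI)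
  moreover have "pos i ` Q = {..<card Q}"
    by (rule card_subset_eq) (use pos_less_card card_image calculation in auto)
  ultimately show ?thesis by (simp add: bij_betw_def)
qed

lemma ex_pos: "j < card Q \<Longrightarrow> \<exists>q\<in>Q. pos i q = j"
  using bij_pos[of i] unfolding bij_betw_def by (metis imageE lessThan_iff)

lemma pos_consec:
  assumes "q \<in> Q" "q' \<in> Q" "pos i q' = Suc (pos i q)"
  shows "d q q' = i mod k \<or> Suc (d q q') mod k = i mod k"
  by (rule consec) (use assms L_iff_pos in auto)

text \<open>Recognises an initial segment by its size, so that a set which is initial at two times
  occupies the same positions at both.\<close>

lemma lower_set_pos:
  assumes "D \<subseteq> Q" "\<And>a b. a \<in> D \<Longrightarrow> b \<in> Q \<Longrightarrow> b \<notin> D \<Longrightarrow> L i a b" "q \<in> Q"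
  shows "pos i q < card D \<longleftrightarrow> q \<in> D"
proof
  assume "q \<in> D"
  have "{z\<in>Q. L i z q} \<subset> D"
  proof -
    have "{z\<in>Q. L i z q} \<subseteq> D" using assms L_asym \<open>q \<in> D\<close> by blast
    moreover have "q \<notin> {z\<in>Q. L i z q}" using L_irrefl assms by blast
    ultimately show ?thesis using \<open>q \<in> D\<close> by blast
  qed
  then show "pos i q < card D"
    unfolding pos_def by (meson psubset_card_mono assms(1) finite_Q finite_subset)
next
  assume *: "pos i q < card D"
  show "q \<in> D"
  proof (rule ccontr)
    assume "q \<notin> D"
    then have "D \<subseteq> {z\<in>Q. L i z q}" using assms by blast
    then have "card D \<le> pos i q" unfolding pos_def by (intro card_mono) (use finite_Q in auto)
    then show False using * by simp
  qed
qed

text \<open>After the step \<open>c\<close> precedes \<open>a\<close>, so \<open>b\<close>, which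
  lay between them, has changed places with one of the two. It then lies on a line of the same
  direction through that point, and \<open>d_trans\<close> makes all three collinear.\<close>

lemma mid_of_swapped:
  assumes Q: "a \<in> Q" "b \<in> Q" "c \<in> Q" and "L i a b" "L i b c" "d a c = i mod k"
  shows "d a b = i mod k" "d b c = i mod k"
proof -
  have ne: "a \<noteq> b" "b \<noteq> c" "a \<noteq> c" using assms L_irrefl L_asym by blast+
  have "L (Suc i) c a" using cross[of c a i] ne assms d_sym[of a c] L_trans by metis
  show 1: "d a b = i mod k"
  proof (rule ccontr)
    assume n: "d a b \<noteq> i mod k"
    then have "L (Suc i) a b" using cross[of a b i] ne assms by auto
    then have "L (Suc i) c b" using L_trans \<open>L (Suc i) c a\<close> Q by blast
    then have "d b c = i mod k" using cross[of c b i] ne assms d_sym[of b c] L_asym by metis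
    then have "d a c = d c b" using assms d_sym by metis
    then have "d a b = d a c" using d_trans[of a c b] ne Q by auto
    then show False using n assms by simp
  qed
  have "d b a = d a c" using 1 assms d_sym by metis
  then show "d b c = i mod k" using d_trans[of b a c] ne Q 1 d_sym by metis
qed

text \<open>The same argument run backwards in time.\<close>

lemma mid_of_swapped':
  assumes Q: "a \<in> Q" "b \<in> Q" "c \<in> Q" and "L (Suc i) a b" "L (Suc i) b c" "d a c = i mod k"
  shows "d a b = i mod k" "d b c = i mod k"
proof -
  have ne: "a \<noteq> b" "b \<noteq> c" "a \<noteq> c" using assms L_irrefl L_asym by blast+
  have "L (Suc i) a c" using assms L_trans by blast
  then have "L i c a" using cross[of a c i] ne assms by auto
  show 1: "d a b = i mod k"
  proof (rule ccontr)
    assume n: "d a b \<noteq> i mod k"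
    then have "L i a b" using cross[of a b i] ne assms by auto
    then have "L i c b" using L_trans \<open>L i c a\<close> Q by blast
    then have "d b c = i mod k" using cross[of b c i] ne assms L_asym by metis
    then have "d a c = d c b" using assms d_sym by metis
    then have "d a b = d a c" using d_trans[of a c b] ne Q by auto
    then show False using n assms by simp
  qed
  have "d b a = d a c" using 1 assms d_sym by metis
  then show "d b c = i mod k" using d_trans[of b a c] ne Q 1 d_sym by metis
qed

text \<open>Gaps are indexed by the position of their upper end, and a gap is open if the two neighbours
  are about to be swapped.\<close>

definition gap :: "nat \<Rightarrow> nat \<Rightarrow> bool" where
  "gap i c \<longleftrightarrow> (\<exists>q\<in>Q. \<exists>q'\<in>Q. Suc (pos i q) = c \<and> pos i q' = c \<and> d q q' = i mod k)"

lemma gap_iff: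
  assumes "q \<in> Q" "q' \<in> Q" "pos i q' = Suc (pos i q)"
  shows "gap i (Suc (pos i q)) \<longleftrightarrow> d q q' = i mod k"
  unfolding gap_def using assms pos_inj by (metis Suc_inject)

text \<open>An exchanged pair drags along everything between its positions, by
  \<open>mid_of_swapped\<close>. So \<open>a\<close> may be replaced by the lower neighbour
  \<open>u\<close> of the gap and then \<open>b\<close> by the upper neighbour \<open>v\<close>,
  which are not exchanged.\<close>

lemma no_swap_across:
  assumes "\<not> gap i c" "a \<in> Q" "b \<in> Q" "pos i a < c" "c \<le> pos i b"
  shows "d a b \<noteq> i mod k"
proof
  assume dab: "d a b = i mod k"
  have c: "0 < c" "c < card Q" using assms pos_less_card[of b i] by auto
  obtain u where u: "u \<in> Q" "pos i u = c - 1" using ex_pos[of "c-1" i] c by fastforce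
  obtain v where v: "v \<in> Q" "pos i v = c" using ex_pos[of c i] c by auto
  have duv: "d u v \<noteq> i mod k" using assms(1) u v c unfolding gap_def by auto
  have "d u b = i mod k"
  proof (cases "a = u")
    case False
    then have "pos i a < pos i u" using assms u pos_inj[of a u i] by fastforce
    then show ?thesis using mid_of_swapped(2)[of a u b i] assms u c dab L_iff_pos by auto
  qed (use dab in simp)
  have "d u v = i mod k"
  proof (cases "b = v")
    case False
    then have "pos i v < pos i b" using assms v pos_inj[of b v i] by fastforce
    then show ?thesis using mid_of_swapped(1)[of u v b i] assms u v c \<open>d u b = i mod k\<close> L_iff_pos by auto
  qed (use \<open>d u b = i mod k\<close> in simp)
  then show False using duv by simp
qed

lemma card_pos_less: assumes "c \<le> card Q" shows "card {q\<in>Q. pos i q < c} = c"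
proof -
  have "bij_betw (pos i) {q\<in>Q. pos i q < c} {..<c}"
    unfolding bij_betw_def inj_on_def using pos_inj ex_pos assms
    by (auto simp: image_iff) (metis order_less_le_trans)
  then show ?thesis by (metis bij_betw_same_card card_lessThan)
qed

text \<open>A closed gap splits the order into two blocks that are permuted separately in this
  step.\<close>

lemma cut:
  assumes "\<not> gap i c" "c \<le> card Q" "q \<in> Q"
  shows "pos (Suc i) q < c \<longleftrightarrow> pos i q < c"
proof -
  let ?D = "{q\<in>Q. pos i q < c}"
  have "L (Suc i) a b" if "a \<in> ?D" "b \<in> Q" "b \<notin> ?D" for a b
  proof -
    have *: "pos i a < c" "c \<le> pos i b" "a \<in> Q" using that by auto
    then have "L i a b" "a \<noteq> b" using L_iff_pos that by auto
    then show ?thesis using no_swap_across[OF assms(1), of a b] * that cross[of a b i] by auto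
  qed
  then show ?thesis using lower_set_pos[of ?D "Suc i" q] card_pos_less[of c i] assms by auto
qed

text \<open>With \<open>3 \<le> k\<close> three successive steps have three different directions;
  the contradictions about gaps below rest on this.\<close>

lemma mod_Suc_neq: "Suc i mod k \<noteq> i mod k" "Suc (Suc i) mod k \<noteq> i mod k"
proof -
  have "\<not> k dvd 1" "\<not> k dvd 2" using k_ge by (auto dest: dvd_imp_le)
  then show "Suc i mod k \<noteq> i mod k" "Suc (Suc i) mod k \<noteq> i mod k"
    using mod_eq_dvd_iff_nat[of i "Suc i" k] mod_eq_dvd_iff_nat[of i "Suc (Suc i)" k]
    by (auto simp: numeral_2_eq_2)
qed

lemma Suc_mod_cancel: "n < k \<Longrightarrow> Suc n mod k = Suc i mod k \<Longrightarrow> n = i mod k"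
  by (metis Suc_inject mod_Suc mod_less nat.distinct(1))

text \<open>By \<open>consec\<close>, neighbours are either about to be exchanged or were exchanged
  in the step before. Across a closed gap nothing is exchanged, so its next neighbours must be about
  to be exchanged. Conversely, if a gap is open after the step, its neighbours have the new
  direction, so nothing has crossed it in the step.\<close>

lemma gap_step:
  assumes "0 < c" "c < card Q"
  shows "gap (Suc i) c \<longleftrightarrow> \<not> gap i c"
proof
  assume g1: "gap (Suc i) c"
  show "\<not> gap i c"
  proof
    assume g0: "gap i c"
    obtain u v where uv: "u \<in> Q" "v \<in> Q" "Suc (pos (Suc i) u) = c" "pos (Suc i) v = c" "d u v = Suc i mod k"
      using g1 unfolding gap_def by auto
    have duv: "d u v \<noteq> i mod k" using uv mod_Suc_neq by simp
    let ?D = "{q\<in>Q. pos (Suc i) q < c}"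
    have no: "d a b \<noteq> i mod k" if "a \<in> ?D" "b \<in> Q" "b \<notin> ?D" for a b
    proof
      assume dab: "d a b = i mod k"
      have "d u b = i mod k"
      proof (cases "a = u")
        case False
        then have "pos (Suc i) a < pos (Suc i) u" using that uv pos_inj[of a u "Suc i"] by fastforce
        then show ?thesis using mid_of_swapped'(2)[of a u b i] that uv dab L_iff_pos by auto
      qed (use dab in simp)
      have "d u v = i mod k"
      proof (cases "b = v")
        case False
        then have "pos (Suc i) v < pos (Suc i) b" using that uv pos_inj[of b v "Suc i"] by fastforce
        then show ?thesis using mid_of_swapped'(1)[of u v b i] that uv \<open>d u b = i mod k\<close> L_iff_pos by auto
      qed (use \<open>d u b = i mod k\<close> in simp)
      then show False using duv by simp
    qed
    have low: "L i a b" if "a \<in> ?D" "b \<in> Q" "b \<notin> ?D" for a b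
    proof -
      have "L (Suc i) a b" "a \<noteq> b" using that L_iff_pos by auto
      then show ?thesis using no[OF that] cross[of a b i] that by auto
    qed
    obtain a b where ab: "a \<in> Q" "b \<in> Q" "Suc (pos i a) = c" "pos i b = c" "d a b = i mod k"
      using g0 unfolding gap_def by auto
    have "a \<in> ?D" "b \<notin> ?D"
      using lower_set_pos[of ?D i a] lower_set_pos[of ?D i b] low ab card_pos_less[of c "Suc i"] assms by auto
    then show False using no ab by blast
  qed
next
  assume g0: "\<not> gap i c"
  obtain u where u: "u \<in> Q" "pos (Suc i) u = c - 1" using ex_pos[of "c-1" "Suc i"] assms by fastforce
  obtain v where v: "v \<in> Q" "pos (Suc i) v = c" using ex_pos[of c] assms by auto
  have "u \<noteq> v" using u v assms by auto
  have "pos i u < c" "c \<le> pos i v"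
    using cut[OF g0 _ u(1)] cut[OF g0 _ v(1)] u v assms by auto
  then have "d u v \<noteq> i mod k" using no_swap_across[OF g0] u v by blast
  moreover have "d u v = Suc i mod k \<or> Suc (d u v) mod k = Suc i mod k"
    using pos_consec[of u v "Suc i"] u v assms by auto
  ultimately have "d u v = Suc i mod k" 
    using Suc_mod_cancel d_less[OF u(1) v(1) \<open>u \<noteq> v\<close>] by blast
  then show "gap (Suc i) c" unfolding gap_def using u v assms by (intro bexI[of _ u] bexI[of _ v]) auto
qed

lemma not_gap_end: "\<not> gap i 0" "\<not> gap i (card Q)"
  unfolding gap_def using pos_less_card by (auto dest: less_irrefl_nat) (metis less_irrefl_nat)


text \<open>One step later all three gaps are closed, so the two points in the middle stay put and
  are neighbours at the times \<open>i + 1\<close> and \<open>i + 2\<close>. At \<open>i + 1\<close>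
  their direction must be the one just passed, which is too old for \<open>consec\<close> at
  \<open>i + 2\<close>.\<close>

lemma no_triple_gap:
  assumes "0 < c" "c + 2 < card Q"
  shows "\<not> (gap i c \<and> gap i (Suc c) \<and> gap i (Suc (Suc c)))"
proof
  assume g: "gap i c \<and> gap i (Suc c) \<and> gap i (Suc (Suc c))"
  then have n: "\<not> gap (Suc i) c" "\<not> gap (Suc i) (Suc c)" "\<not> gap (Suc i) (Suc (Suc c))"
    using gap_step assms by auto
  obtain a where a: "a \<in> Q" "pos (Suc i) a = c" using ex_pos[of c "Suc i"] assms by auto
  obtain b where b: "b \<in> Q" "pos (Suc i) b = Suc c" using ex_pos[of "Suc c" "Suc i"] assms by auto
  have "a \<noteq> b" using a b by auto
  then have dless: "d a b < k" using d_less a b by blast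
  have "d a b \<noteq> Suc i mod k" using n(2) gap_iff[of a b "Suc i"] a b by auto
  have "d a b = Suc i mod k \<or> Suc (d a b) mod k = Suc i mod k" using pos_consec[of a b "Suc i"] a b by simp
  then have dab: "d a b = i mod k" using \<open>d a b \<noteq> Suc i mod k\<close> Suc_mod_cancel[OF dless] by blast
  have "pos (Suc (Suc i)) a = c"
    using cut[OF n(1) _ a(1)] cut[OF n(2) _ a(1)] a assms by auto
  moreover have "pos (Suc (Suc i)) b = Suc c"
    using cut[OF n(2) _ b(1)] cut[OF n(3) _ b(1)] b assms by auto
  ultimately have "d a b = Suc (Suc i) mod k \<or> Suc (d a b) mod k = Suc (Suc i) mod k"
    using pos_consec[of a b "Suc (Suc i)"] a b by auto
  then have "d a b = Suc (Suc i) mod k \<or> d a b = Suc i mod k"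
    using Suc_mod_cancel[OF dless] by blast
  then show False using dab mod_Suc_neq[of i] mod_Suc_neq[of "Suc i"] by auto
qed

text \<open>Three closed gaps in a row turn into three open ones after one step.\<close>

lemma no_triple:
  assumes "0 < c" "c + 2 < card Q" "gap i c = gap i (Suc c)"
  shows "gap i (Suc (Suc c)) \<noteq> gap i c"
  using no_triple_gap[OF assms(1,2), of i] no_triple_gap[OF assms(1,2), of "Suc i"] assms
    gap_step[of c i] gap_step[of "Suc c" i] gap_step[of "Suc (Suc c)" i] by auto

lemma fixed_step:
  assumes c: "0 < c" "Suc c < card Q" and g: "gap i c = gap i (Suc c)" and q: "q \<in> Q" "pos i q = c"
  shows "pos (Suc i) q = c"
proof (cases "gap i c")
  case False
  then show ?thesis using cut[of i c q] cut[of i "Suc c" q] assms by auto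
next
  case True
  \<comment> \<open>The gaps on both outer sides are closed, so the step reverses a block of exactly
    three points and fixes the middle one.\<close>
  have n1: "\<not> gap i (c - 1)"
  proof (cases "c = 1")
    case False
    then show ?thesis using no_triple[of "c - 1" i] c g True by auto
  qed (use not_gap_end in auto)
  have n2: "\<not> gap i (c + 2)"
  proof (cases "c + 2 = card Q")
    case False
    then show ?thesis using no_triple[of c i] c g True by auto
  qed (use not_gap_end in metis)
  obtain a where a: "a \<in> Q" "pos i a = c - 1" using ex_pos[of "c - 1" i] c by fastforce
  obtain b where b: "b \<in> Q" "pos i b = Suc c" using ex_pos[of "Suc c" i] c by auto
  have ne: "a \<noteq> q" "q \<noteq> b" "a \<noteq> b" using a b c q by auto
  have "d a q = i mod k" using gap_iff[of a q i] a q c True by auto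
  moreover have "d q b = i mod k" using gap_iff[of q b i] b q c True g by auto
  ultimately have "L (Suc i) b q" "L (Suc i) q a"
    using cross[of b q i] cross[of q a i] ne a b q d_sym c L_iff_pos by auto
  then have "pos (Suc i) b < pos (Suc i) q" "pos (Suc i) q < pos (Suc i) a"
    using L_iff_pos a b q by auto
  moreover have "pos (Suc i) a < c + 2" "\<not> pos (Suc i) b < c - 1" 
    using cut[OF n1 _ b(1)] cut[OF n2 _ a(1)] a b c by auto
  ultimately show ?thesis by auto
qed

lemma fixed:
  assumes c: "0 < c" "Suc c < card Q" and g: "gap i c = gap i (Suc c)" and q: "q \<in> Q" "pos i q = c"
  shows "pos (i + n) q = c"
proof -
  have "gap (i + n) c = gap (i + n) (Suc c)" for n
    by (induction n) (use c g gap_step in auto)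
  then show ?thesis
    by (induction n) (use c q fixed_step in auto)
qed

text \<open>Within \<open>k\<close> steps each direction is met at most once, so no pair is
  exchanged twice.\<close>

lemma L_add:
  assumes "q \<in> Q" "q' \<in> Q" "q \<noteq> q'" "n \<le> k"
  shows "L (i + n) q q' \<longleftrightarrow> (if \<exists>m<n. (i + m) mod k = d q q' then L i q' q else L i q q')"
  using assms(4)
proof (induction n)
  case (Suc n)
  have "\<not> (\<exists>m<n. (i + m) mod k = d q q')" if "(i + n) mod k = d q q'"
  proof
    assume "\<exists>m<n. (i + m) mod k = d q q'"
    then obtain m where m: "m < n" "(i + m) mod k = d q q'" by blast
    then have "(i + n) mod k = (i + m) mod k" using that by simp
    then have "k dvd (i + n) - (i + m)" using m mod_eq_dvd_iff_nat[of "i+m" "i+n" k] by auto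
    then show False using m Suc.prems dvd_imp_le[of k "n - m"] by auto
  qed
  moreover have "L i q' q \<longleftrightarrow> \<not> L i q q'" using assms L_asym L_total by blast
  moreover have "L (i + n) q' q \<longleftrightarrow> \<not> L (i + n) q q'" using assms L_asym L_total by blast
  ultimately show ?case using Suc cross[of q q' "i + n"] assms by (auto simp: less_Suc_eq)
qed simp

lemma L_add_k:
  assumes "q \<in> Q" "q' \<in> Q" "q \<noteq> q'"
  shows "L (i + k) q q' \<longleftrightarrow> L i q' q"
proof -
  have k: "0 < k" using k_ge by simp
  \<comment> \<open>The residue of \<open>d q q' - i\<close>; the summand \<open>k * i\<close> keeps
    the subtraction of natural numbers from being truncated.\<close>
  define m where "m = (d q q' + k * i - i) mod k"
  have "(i + m) mod k = (i + (d q q' + k * i - i)) mod k" unfolding m_def by (simp add: mod_simps)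
  also have "i + (d q q' + k * i - i) = d q q' + k * i"
  proof -
    have "i \<le> k * i" using k by simp
    then show ?thesis by linarith
  qed
  finally have "(i + m) mod k = d q q'" using d_less[OF assms] by simp
  moreover have "m < k" using k unfolding m_def by simp
  ultimately show ?thesis using L_add[OF assms, of k i] by auto
qed

lemma pos_reverse:
  assumes q: "q \<in> Q" and rev: "\<And>q'. q' \<in> Q \<Longrightarrow> q' \<noteq> q \<Longrightarrow> L j q' q \<longleftrightarrow> L i q q'"
  shows "Suc (pos j q + pos i q) = card Q"
proof -
  have "Q = insert q ({z\<in>Q. L j z q} \<union> {z\<in>Q. L i z q})"
    using rev q L_total by blast
  moreover have "q \<notin> {z\<in>Q. L j z q} \<union> {z\<in>Q. L i z q}" using L_irrefl by auto
  moreover have "{z\<in>Q. L j z q} \<inter> {z\<in>Q. L i z q} = {}" using rev q L_asym L_irrefl by blast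
  ultimately have "card Q = Suc (card ({z\<in>Q. L j z q} \<union> {z\<in>Q. L i z q}))"
    using finite_Q by (metis (no_types, lifting) card_insert_disjoint finite_insert)
  also have "card ({z\<in>Q. L j z q} \<union> {z\<in>Q. L i z q}) = pos j q + pos i q"
    unfolding pos_def using finite_Q \<open>_ \<inter> _ = {}\<close> by (intro card_Un_disjoint) auto
  finally show ?thesis by simp
qed

lemma pos_add_k: "q \<in> Q \<Longrightarrow> Suc (pos (i + k) q + pos i q) = card Q"
  using pos_reverse[of q "i + k" i] L_add_k by blast

text \<open>The point between two gaps of the same kind never moves, while \<open>k\<close> steps
  reverse the order. A position that equals its mirror image is the middle one.\<close>

lemma double_gap:
  assumes c: "0 < c" "Suc c < card Q" and g: "gap i c = gap i (Suc c)"
  shows "card Q = 2 * c + 1"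
proof -
  obtain q where q: "q \<in> Q" "pos i q = c" using ex_pos[of c i] c by auto
  then show ?thesis using fixed[OF c g q, of k] pos_add_k[of q i] by auto
qed

lemma card_ge_3:
  assumes "2 \<le> card Q" shows "3 \<le> card Q"
proof (rule ccontr)
  assume "\<not> 3 \<le> card Q"
  then have r: "card Q = 2" using assms by simp
  then obtain a b where ab: "a \<in> Q" "b \<in> Q" "a \<noteq> b" by (metis card_2_iff insertCI)
  have "d a b = i mod k \<or> Suc (d a b) mod k = i mod k" for i
  proof -
    have "pos i a \<noteq> pos i b" "pos i a < 2" "pos i b < 2" 
      using ab pos_inj pos_less_card r by (metis, metis, metis)
    then have "pos i b = Suc (pos i a) \<or> pos i a = Suc (pos i b)" by auto
    then show ?thesis using pos_consec[of a b i] pos_consec[of b a i] ab d_sym by metis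
  qed
  from this[of "d a b + 2"] show False 
    using mod_Suc_neq[of "d a b"] mod_Suc_neq[of "Suc (d a b)"] d_less[OF ab] by auto
qed

text \<open>Start just after an exchange of the pair: the next one is \<open>k\<close> steps away,
  so fewer steps cannot reverse the pair.\<close>

lemma swapped_once:
  assumes "q \<in> Q" "q' \<in> Q" "q \<noteq> q'" "0 < n" "\<And>i. L (i + n) q q' \<longleftrightarrow> L i q' q"
  shows "k \<le> n"
proof (rule ccontr)
  assume nk: "\<not> k \<le> n"
  let ?i = "Suc (d q q')"
  have "(?i + m) mod k \<noteq> d q q'" if "m < n" for m
  proof
    assume "(?i + m) mod k = d q q'"
    then have "(d q q' + Suc m) mod k = d q q' mod k" using d_less[OF assms(1-3)] by simp
    then have "k dvd Suc m" using mod_eq_dvd_iff_nat[of "d q q'" "d q q' + Suc m" k] by auto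
    then show False using nk that dvd_imp_le[of k "Suc m"] by auto
  qed
  then have "L (?i + n) q q' \<longleftrightarrow> L ?i q q'" using L_add[OF assms(1-3), of n ?i] nk by auto
  then show False using assms L_asym L_total by metis
qed

end

section \<open>Alternating sequences: the regular polygons\<close>

locale alternating_sequence = allowable_sequence Q k L d
  for Q :: "'q set" and k L d +
  assumes card_ge: "2 \<le> card Q"
    and alternate: "\<And>i c. 0 < c \<Longrightarrow> Suc c < card Q \<Longrightarrow> gap i (Suc c) \<longleftrightarrow> \<not> gap i c"
begin

text \<open>The kind of the lowest gap at time \<open>0\<close>. It determines all other gaps, as
  they alternate both in position and in time.\<close>

definition phase :: nat where "phase = (if gap 0 1 then 0 else 1)"

lemma gap_parity: "0 < c \<Longrightarrow> c < card Q \<Longrightarrow> gap i c \<longleftrightarrow> odd (i + c + phase)"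
proof (induction i arbitrary: c)
  case 0
  then show ?case
  proof (induction c)
    case (Suc c)
    then show ?case using alternate[of c 0] by (cases "c = 0") (auto simp: phase_def)
  qed simp
qed (use gap_step in auto)

text \<open>The positions are folded out to the residues modulo \<open>2 * card Q\<close>: lines moving up occupy the
  first half and lines moving down the second half, and each step of the sequence is a rotation.\<close>

definition slot :: "nat \<Rightarrow> 'q \<Rightarrow> nat" where
  "slot i q = (if even (i + pos i q + phase) then pos i q else 2 * card Q - 1 - pos i q)"

lemma slot_less: "q \<in> Q \<Longrightarrow> slot i q < 2 * card Q"
  using pos_less_card[of q i] unfolding slot_def by auto

lemma slot_parity: "q \<in> Q \<Longrightarrow> even (i + slot i q + phase)"
  using pos_less_card[of q i] unfolding slot_def by auto

lemma pos_slot: "q \<in> Q \<Longrightarrow> pos i q = (if slot i q < card Q then slot i q else 2 * card Q - 1 - slot i q)"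
  using pos_less_card[of q i] unfolding slot_def by auto

text \<open>An open gap above a point carries it up, an open gap below carries it down, and at the
  two ends the point rests for one step and turns round. In the folded picture the rests are the
  passages from \<open>card Q - 1\<close> to \<open>card Q\<close> and from
  \<open>2 * card Q - 1\<close> to \<open>0\<close>, so all cases are the same rotation.\<close>

lemma slot_step:
  assumes q: "q \<in> Q" shows "slot (Suc i) q = Suc (slot i q) mod (2 * card Q)"
proof -
  let ?j = "pos i q" let ?r = "card Q"
  have jr: "?j < ?r" using pos_less_card q by blast
  show ?thesis
  proof (cases "even (i + ?j + phase)")
    case ev: True
    have n: "\<not> gap i ?j" using gap_parity[of ?j i] ev jr not_gap_end by (cases "?j = 0") auto
    show ?thesis
    proof (cases "Suc ?j = ?r")
      case True
      then have "pos (Suc i) q = ?j" 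
        using cut[OF n _ q] jr pos_less_card[OF q, of "Suc i"] by auto
      then show ?thesis using ev True unfolding slot_def by auto
    next
      case False
      have n2: "\<not> gap i (Suc (Suc ?j))" 
        using gap_parity[of "Suc (Suc ?j)" i] ev jr False not_gap_end(2)[of i] 
        by (cases "Suc (Suc ?j) = ?r") auto
      have g: "gap i (Suc ?j)" using gap_parity[of "Suc ?j" i] ev jr False by auto
      obtain b where b: "b \<in> Q" "pos i b = Suc ?j" using ex_pos[of "Suc ?j" i] jr False by auto
      then have "d q b = i mod k" using gap_iff[of q b i] q g by auto
      then have "L (Suc i) b q" using cross[of b q i] b q d_sym[of b q] L_iff_pos[of q b i] by fastforce
      then have "pos (Suc i) b < pos (Suc i) q" using L_iff_pos b q by auto
      moreover have "\<not> pos (Suc i) b < ?j" "pos (Suc i) q < Suc (Suc ?j)"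
        using cut[OF n _ b(1)] cut[OF n2 _ q] b jr False by auto
      ultimately have "pos (Suc i) q = Suc ?j" by auto
      then show ?thesis using ev jr unfolding slot_def by auto
    qed
  next
    case od: False
    have n: "\<not> gap i (Suc ?j)" using gap_parity[of "Suc ?j" i] od jr not_gap_end(2)[of i] 
      by (cases "Suc ?j = ?r") auto
    show ?thesis
    proof (cases "?j = 0")
      case True
      then have "pos (Suc i) q = ?j" using cut[OF n _ q] jr by auto
      then show ?thesis using od True jr unfolding slot_def by auto
    next
      case False
      have n2: "\<not> gap i (?j - 1)" 
        using gap_parity[of "?j - 1" i] od jr False not_gap_end(1)[of i] by (cases "?j = 1") auto
      have g: "gap i ?j" using gap_parity[of "?j" i] od jr False by auto
      obtain b where b: "b \<in> Q" "pos i b = ?j - 1" using ex_pos[of "?j - 1" i] jr False by fastforce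
      then have "d b q = i mod k" using gap_iff[of b q i] q g False by auto
      then have "L (Suc i) q b" using cross[of q b i] b q d_sym[of b q] L_iff_pos[of b q i] False by fastforce
      then have "pos (Suc i) q < pos (Suc i) b" using L_iff_pos b q by auto
      moreover have "pos (Suc i) b < Suc ?j" "\<not> pos (Suc i) q < ?j - 1"
        using cut[OF n _ b(1)] cut[OF n2 _ q] b jr False by auto
      ultimately have "pos (Suc i) q = ?j - 1" by auto
      then show ?thesis using od jr False unfolding slot_def by auto
    qed
  qed
qed

lemma slot_add: "q \<in> Q \<Longrightarrow> slot (i + n) q = (slot i q + n) mod (2 * card Q)"
proof (induction n)
  case 0 then show ?case using slot_less by simp
next
  case (Suc n) then show ?case using slot_step[of q "i + n"] by (simp add: mod_simps)
qed

text \<open>Half of a full rotation exchanges the slots of upward and downward motion and thereby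
  reflects positions.\<close>

lemma pos_add_card:
  assumes "q \<in> Q" shows "Suc (pos (i + card Q) q + pos i q) = card Q"
proof -
  have "slot (i + card Q) q = (if slot i q < card Q then slot i q + card Q else slot i q - card Q)"
    using slot_add[OF assms, of i "card Q"] slot_less[OF assms, of i] 
      le_mod_geq[of "2 * card Q" "slot i q + card Q"] by auto
  then show ?thesis
    using pos_slot[OF assms, of i] pos_slot[OF assms, of "i + card Q"] slot_less[OF assms, of i] by auto
qed

text \<open>Both \<open>k\<close> and \<open>card Q\<close> steps reverse the order, and no pair is
  reversed at all times by fewer than \<open>k\<close> steps; this gives
  \<open>k \<le> card Q\<close>. For the other bound take a point at the bottom that is about to
  rise and, at a time of the other parity, one that has just arrived there. If
  \<open>k < card Q\<close>, they reach the positions \<open>k\<close> and \<open>k - 1\<close>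
  after \<open>k\<close> steps, whereas the reversal puts both at the top.\<close>

lemma card_eq_k: "card Q = k"
proof (rule antisym)
  have r3: "3 \<le> card Q" using card_ge_3 card_ge .
  obtain a where a: "a \<in> Q" "pos 0 a = 0" using ex_pos[of 0 0] r3 by auto
  obtain b where b: "b \<in> Q" "pos 1 b = 0" using ex_pos[of 0 1] r3 by auto
  have bnd: "card Q \<le> k" if "q \<in> Q" "pos i q = 0" "pos j p = 0" "p \<in> Q" "even (i + phase)" "odd (j + phase)" for q p i j
  proof -
    have "slot i q = 0" "slot j p = 2 * card Q - 1" using that r3 unfolding slot_def by auto
    then have s: "slot (i + k) q = k mod (2 * card Q)" "slot (j + k) p = (2 * card Q - 1 + k) mod (2 * card Q)"
      using slot_add that by auto
    show ?thesis
    proof (rule ccontr)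
      assume "\<not> card Q \<le> k"
      moreover have "(2 * card Q - 1 + k) mod (2 * card Q) = k - 1" if "k < card Q"
      proof -
        have "2 * card Q - 1 + k = (k - 1) + 2 * card Q" using k_ge that by simp
        moreover have "((k - 1) + 2 * card Q) mod (2 * card Q) = k - 1" using that by simp
        ultimately show ?thesis by metis
      qed
      ultimately have "slot (i + k) q = k" "slot (j + k) p = k - 1" using s by auto
      then have "pos (i + k) q = k" "pos (j + k) p = k - 1" 
        using pos_slot that \<open>\<not> card Q \<le> k\<close> by auto
      then show False using pos_add_k[of q i] pos_add_k[of p j] that k_ge by auto
    qed
  qed
  show "card Q \<le> k" using bnd[of a 0 1 b] bnd[of b 1 0 a] a b by (cases "even phase") auto
  obtain c where c: "c \<in> Q" "pos 0 c = 1" using ex_pos[of 1 0] r3 by auto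
  have "L (i + card Q) a c \<longleftrightarrow> L i c a" for i
    using pos_add_card[of a i] pos_add_card[of c i] L_iff_pos[of a c "i + card Q"] L_iff_pos[of c a i] a c by auto
  then show "k \<le> card Q" using swapped_once[of a c "card Q"] a c r3 by fastforce
qed

lemma pos_step: "q \<in> Q \<Longrightarrow> pos (Suc i) q \<le> Suc (pos i q) \<and> pos i q \<le> Suc (pos (Suc i) q)"
  using slot_step[of q i] pos_slot[of q i] pos_slot[of q "Suc i"] slot_less[of q i]
  by (auto simp: mod_Suc split: if_splits)

lemma slot_up: "q \<in> Q \<Longrightarrow> pos (Suc i) q = Suc (pos i q) \<Longrightarrow> slot i q = pos i q"
  using slot_step[of q i] pos_slot[of q i] pos_slot[of q "Suc i"] slot_less[of q i]
  by (auto simp: mod_Suc split: if_splits)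

lemma slot_down: "q \<in> Q \<Longrightarrow> pos i q = Suc (pos (Suc i) q) \<Longrightarrow> slot i q = 2 * card Q - 1 - pos i q"
  using slot_step[of q i] pos_slot[of q i] pos_slot[of q "Suc i"] slot_less[of q i]
  by (auto simp: mod_Suc split: if_splits)

text \<open>At time \<open>d q q'\<close> the two points are neighbours, one going up from
  \<open>j\<close> and the other down from \<open>j + 1\<close>, so their slots add up to
  \<open>2 * card Q - 2\<close>. Rotating back to time \<open>0\<close> gives the
  congruence.\<close>

lemma dvd_slot_sum:
  assumes "q \<in> Q" "q' \<in> Q" "q \<noteq> q'"
  shows "2 * card Q dvd slot 0 q + slot 0 q' + 2 * d q q' + 2"
proof -
  let ?i = "d q q'"
  have *: "slot ?i p + slot ?i p' + 2 = 2 * card Q" 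
    if "p \<in> Q" "p' \<in> Q" "L ?i p p'" "d p p' = ?i" "p \<noteq> p'" for p p'
  proof -
    have "L (Suc ?i) p' p" using cross[of p' p ?i] that d_sym[of p p'] d_less[of p p'] by auto
    then have "pos ?i p < pos ?i p'" "pos (Suc ?i) p' < pos (Suc ?i) p" using L_iff_pos that by auto
    then have "pos (Suc ?i) p = Suc (pos ?i p)" "pos ?i p' = Suc (pos (Suc ?i) p')" "pos ?i p' = Suc (pos ?i p)"
      using pos_step[of p ?i] pos_step[of p' ?i] that by auto
    then show ?thesis using slot_up[of p ?i] slot_down[of p' ?i] that pos_less_card[of p' ?i] by auto
  qed
  have "slot ?i q + slot ?i q' + 2 = 2 * card Q"
  proof (cases "L ?i q q'")
    case True then show ?thesis using *[of q q'] assms by blast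
  next
    case False
    then have "L ?i q' q" "d q' q = ?i" using assms L_total d_sym by metis+
    then have "slot ?i q' + slot ?i q + 2 = 2 * card Q" using *[of q' q] assms by blast
    then show ?thesis by simp
  qed
  moreover have "slot ?i q = (slot 0 q + ?i) mod (2 * card Q)" "slot ?i q' = (slot 0 q' + ?i) mod (2 * card Q)"
    using slot_add[of _ 0 ?i] assms by auto
  ultimately have "2 * card Q dvd (slot 0 q + ?i) mod (2 * card Q) + (slot 0 q' + ?i) mod (2 * card Q) + 2"
    by simp
  then have "2 * card Q dvd (slot 0 q + ?i) + (slot 0 q' + ?i) + 2"
    unfolding dvd_eq_mod_eq_0 by (metis mod_add_eq mod_add_left_eq)
  then show ?thesis by (simp add: algebra_simps mult_2)
qed

text \<open>At time \<open>0\<close> all slots have the parity of \<open>phase\<close>, so halving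
  loses nothing; the points get numbered like the vertices of a regular polygon.\<close>

definition label :: "'q \<Rightarrow> nat" where "label q = slot 0 q div 2"

lemma slot_label: "q \<in> Q \<Longrightarrow> slot 0 q = 2 * label q + phase"
  using slot_parity[of q 0] unfolding label_def phase_def by (auto split: if_splits)

lemma bij_label: "bij_betw label Q {..<card Q}"
proof -
  have "inj_on label Q"
  proof (rule inj_onI)
    fix x y assume "x \<in> Q" "y \<in> Q" "label x = label y"
    then have "slot 0 x = slot 0 y" using slot_label by simp
    then show "x = y" using pos_slot pos_inj \<open>x \<in> Q\<close> \<open>y \<in> Q\<close> by metis
  qed
  moreover have "label ` Q \<subseteq> {..<card Q}" using slot_less[of _ 0] unfolding label_def by (auto simp: less_mult_imp_div_less mult.commute)
  ultimately show ?thesis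
    by (simp add: bij_betw_def card_image card_subset_eq)
qed

text \<open>As for the chords of a regular polygon with \<open>k\<close> vertices: the direction
  depends only on the sum of the two vertex numbers modulo \<open>k\<close>.\<close>

lemma dvd_label_sum:
  assumes "q \<in> Q" "q' \<in> Q" "q \<noteq> q'"
  shows "k dvd label q + label q' + phase + d q q' + 1"
proof -
  have "slot 0 q + slot 0 q' + 2 * d q q' + 2 = 2 * (label q + label q' + phase + d q q' + 1)"
    using slot_label assms by simp
  then show ?thesis using dvd_slot_sum[OF assms] card_eq_k by (metis dvd_mult_cancel1 nat_mult_dvd_cancel_disj zero_neq_numeral)
qed

end

section \<open>The centred case: a regular polygon together with its centre\<close>

context allowable_sequence
begin

lemma alternatingI:
  assumes "2 \<le> card Q" "\<And>i c. 0 < c \<Longrightarrow> Suc c < card Q \<Longrightarrow> gap i (Suc c) \<longleftrightarrow> \<not> gap i c"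
  shows "alternating_sequence Q k L d"
  by unfold_locales (use assms in auto)

text \<open>All inner gaps change their kind in every step, so two neighbouring gaps that agree at
  some time agree at time \<open>0\<close>.\<close>

lemma alternating_or_centred:
  assumes "2 \<le> card Q"
  obtains "alternating_sequence Q k L d"
  | c where "0 < c" "Suc c < card Q" "gap 0 c = gap 0 (Suc c)" "card Q = 2 * c + 1"
proof (cases "\<forall>i c. 0 < c \<longrightarrow> Suc c < card Q \<longrightarrow> (gap i (Suc c) \<longleftrightarrow> \<not> gap i c)")
  case True
  then show ?thesis using alternatingI assms that(1) by blast
next
  case False
  then obtain i c where c: "0 < c" "Suc c < card Q" "gap i (Suc c) = gap i c" by blast
  then have "gap 0 (Suc c) = gap 0 c"
    by (induction i) (use gap_step in auto)
  then show ?thesis using that(2)[of c] c double_gap[of c i] by auto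
qed

context
  fixes c m
  assumes c: "0 < c" "Suc c < card Q" and g: "gap 0 c = gap 0 (Suc c)" and m: "m \<in> Q" "pos 0 m = c"
begin

lemma pos_centre: "pos i m = c"
  using fixed[OF c g m, of i] by simp

lemma gap_centre: "gap i c = gap i (Suc c)"
  by (induction i) (use c g gap_step in auto)

lemma card_centred: "card Q = 2 * c + 1"
  using double_gap[OF c g] .

text \<open>Only \<open>consec\<close> for the two points next to the centre is at stake. The two
  gaps at \<open>m\<close> are of the same kind, so both neighbours are seen from \<open>m\<close>
  in the same direction and the three points are collinear.\<close>

lemma remove_centre_allowable: "allowable_sequence (Q - {m}) k L d"
proof (unfold_locales, goal_cases)
  case 1 then show ?case using finite_Q by simp
next
  case 2 then show ?case by (rule k_ge)
next
  case (3 q i) then show ?case using L_irrefl by simp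
next
  case (4 q q' q'' i) then show ?case using L_trans[of q q' q'' i] by simp
next
  case (5 q q' i) then show ?case using L_total[of q q' i] by simp
next
  case (6 q q') then show ?case using d_less by simp
next
  case (7 q q') then show ?case using d_sym by simp
next
  case (8 q q' q'') then show ?case using d_trans[of q q' q''] by simp
next
  case (9 q q' i) then show ?case using cross[of q q' i] by simp
next
  case (10 q q' i)
  then have q: "q \<in> Q - {m}" "q' \<in> Q - {m}" "L i q q'" and cons: "\<forall>z\<in>Q - {m}. \<not> (L i q z \<and> L i z q')"
    by auto
  show "d q q' = i mod k \<or> Suc (d q q') mod k = i mod k"
  proof (cases "L i q m \<and> L i m q'")
    case False
    then show ?thesis using consec[of q q' i] q cons by blast
  next
    case True
    have cQ: "\<forall>z\<in>Q. \<not> (L i q z \<and> L i z m)" "\<forall>z\<in>Q. \<not> (L i m z \<and> L i z q')"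
      using cons True L_trans L_irrefl q m by (metis DiffI singletonD DiffD1)+
    have pq: "pos i q < c" "c < pos i q'" using True L_iff_pos pos_centre q m by (metis DiffD1)+
    have "pos i q = c - 1"
    proof (rule ccontr)
      assume "pos i q \<noteq> c - 1"
      moreover obtain z where "z \<in> Q" "pos i z = c - 1" using ex_pos[of "c - 1" i] c by fastforce
      ultimately have "pos i q < pos i z" "pos i z < pos i m" "z \<in> Q" using pq c pos_centre[of i] by linarith+
      then show False using cQ(1) L_iff_pos q m by blast
    qed
    moreover have "pos i q' = Suc c"
    proof (rule ccontr)
      assume "pos i q' \<noteq> Suc c"
      moreover obtain z where "z \<in> Q" "pos i z = Suc c" using ex_pos[of "Suc c" i] c by auto
      ultimately have "pos i z < pos i q'" "pos i m < pos i z" "z \<in> Q" using pq c pos_centre[of i] by linarith+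
      then show False using cQ(2) L_iff_pos q m by blast
    qed
    ultimately have gp: "gap i c \<longleftrightarrow> d q m = i mod k" "gap i (Suc c) \<longleftrightarrow> d m q' = i mod k"
      using gap_iff[of q m i] gap_iff[of m q' i] pos_centre q m c by auto
    have ne: "q \<noteq> m" "q' \<noteq> m" "q \<noteq> q'" using q pq by auto
    have cc: "d q m = i mod k \<or> Suc (d q m) mod k = i mod k" "d m q' = i mod k \<or> Suc (d m q') mod k = i mod k"
      using consec[of q m i] consec[of m q' i] True cQ q m by blast+
    have "d q m = d m q'"
    proof (cases "gap i c")
      case True then show ?thesis using gp gap_centre by simp
    next
      case False
      then have "Suc (d q m) mod k = Suc (d m q') mod k" using cc gp gap_centre by metis
      moreover have "d q m < k" "d m q' < k" using d_less q m ne by auto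
      ultimately show ?thesis using Suc_mod_cancel[of "d q m" "d m q'"] by simp
    qed
    then have "d q q' = d q m" using d_trans[of q m q'] q m ne by auto
    then show ?thesis using cc by simp
  qed
qed

text \<open>An even number of points is left, while \<open>double_gap\<close> would make it
  odd.\<close>

lemma remove_centre: "alternating_sequence (Q - {m}) k L d"
proof -
  interpret R: allowable_sequence "Q - {m}" k L d by (rule remove_centre_allowable)
  have cR: "card (Q - {m}) = 2 * c" using card_centred m finite_Q by simp
  show ?thesis
  proof (rule R.alternatingI)
    show "2 \<le> card (Q - {m})" using cR c by simp
    show "R.gap i (Suc b) \<longleftrightarrow> \<not> R.gap i b" if "0 < b" "Suc b < card (Q - {m})" for i b
      using R.double_gap[of b i] that cR by (metis dvd_triv_left even_plus_one_iff)
  qed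
qed

lemma k_centred: "k = 2 * c"
proof -
  interpret R: alternating_sequence "Q - {m}" k L d by (rule remove_centre)
  show ?thesis using R.card_eq_k card_centred m finite_Q by simp
qed

text \<open>When \<open>q\<close> passes the centre, it moves between the positions
  \<open>c - 1\<close> and \<open>c\<close> of the remaining points, either up from slot
  \<open>c - 1\<close> or down from slot \<open>3 * c - 1\<close>. Both are \<open>c - 1\<close>
  modulo \<open>2 * c\<close>, and rotating back to time \<open>0\<close> gives the
  congruence.\<close>

lemma dvd_label_centre:
  assumes q: "q \<in> Q" "q \<noteq> m"
  shows "k dvd 2 * alternating_sequence.label (Q - {m}) k L d q + alternating_sequence.phase (Q - {m}) k L d
           + d m q + 1 + c"
proof -
  interpret R: alternating_sequence "Q - {m}" k L d by (rule remove_centre)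
  let ?i = "d m q"
  have cR: "card (Q - {m}) = 2 * c" using card_centred m finite_Q by simp
  have posR: "R.pos i q = (if L i m q then pos i q - 1 else pos i q)" for i
  proof -
    have "{z\<in>Q - {m}. L i z q} = {z\<in>Q. L i z q} - {m}" by auto
    then show ?thesis unfolding R.pos_def pos_def using m by (simp add: card_Diff_singleton_if)
  qed
  have L1: "L (Suc ?i) m q \<longleftrightarrow> L ?i q m" using cross[of m q ?i] q m d_less[of m q] by auto
  have qR: "q \<in> Q - {m}" using q by simp
  have "R.slot ?i q mod (2 * c) = c - 1"
  proof (cases "L ?i q m")
    case True
    then have "pos ?i q < c" "c < pos (Suc ?i) q" "\<not> L ?i m q" "L (Suc ?i) m q"
      using L1 L_iff_pos q m pos_centre L_asym by metis+
    then have "R.pos ?i q < c" "c \<le> R.pos (Suc ?i) q" using posR by auto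
    then have "R.pos ?i q = c - 1" "R.pos (Suc ?i) q = Suc (R.pos ?i q)" 
      using R.pos_step[OF qR, of ?i] by auto
    then have "R.slot ?i q = c - 1" using R.slot_up[OF qR, of ?i] by simp
    then show ?thesis using c by simp
  next
    case False
    then have "\<not> L (Suc ?i) m q" "L ?i m q" using L1 L_total q m by metis+
    moreover have "L (Suc ?i) q m" using L_total q m calculation by metis
    ultimately have "c < pos ?i q" "pos (Suc ?i) q < c"
      using L_iff_pos q m pos_centre by metis+
    then have "c \<le> R.pos ?i q" "R.pos (Suc ?i) q < c" 
      using posR \<open>\<not> L (Suc ?i) m q\<close> \<open>L ?i m q\<close> by auto
    then have "R.pos ?i q = c" "R.pos ?i q = Suc (R.pos (Suc ?i) q)" 
      using R.pos_step[OF qR, of ?i] by auto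
    then have "R.slot ?i q = 2 * c + (c - 1)" using R.slot_down[OF qR, of ?i] cR c by simp
    then have "R.slot ?i q mod (2 * c) = (c - 1) mod (2 * c)" by (metis mod_add_self1)
    then show ?thesis using c by (metis diff_less less_trans mod_less mult_2 trans_less_add1 zero_less_one)
  qed
  moreover have "R.slot ?i q mod (2 * c) = (R.slot 0 q + ?i) mod (2 * c)"
  proof -
    have "R.slot ?i q = (R.slot 0 q + ?i) mod (2 * (2 * c))" using R.slot_add[OF qR, of 0 ?i] cR by simp
    then show ?thesis by (simp add: mod_mod_cancel)
  qed
  ultimately have "(R.slot 0 q + ?i) mod (2 * c) + 1 + c = 2 * c" using c by simp
  then have "((R.slot 0 q + ?i) mod (2 * c) + (1 + c)) mod (2 * c) = 0" by (simp only: add.assoc mod_self)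
  then have "2 * c dvd (R.slot 0 q + ?i) + 1 + c"
    by (simp only: mod_add_left_eq dvd_eq_mod_eq_0 add.assoc)
  then show ?thesis using R.slot_label[OF qR] k_centred by (simp add: algebra_simps)
qed

end

text \<open>Agreement with the gaps on both sides would put the middle of \<open>Q\<close> in two
  places. Near the ends only three points would remain, but a centred sequence has
  \<open>k + 1 > 3\<close> points. For words this says that every letter has the other letter of the
  plane beside it.\<close>

lemma gap_neighbour:
  assumes "0 < c" "c < card Q"
  shows "(1 < c \<and> gap 0 (c - 1) \<noteq> gap 0 c) \<or> (Suc c < card Q \<and> gap 0 (Suc c) \<noteq> gap 0 c)"
proof -
  have r3: "3 \<le> card Q" using card_ge_3 assms by linarith
  have bad: "card Q > 3" if b: "0 < b" "Suc b < card Q" "gap 0 b = gap 0 (Suc b)" for b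
  proof -
    obtain m where "m \<in> Q" "pos 0 m = b" using ex_pos[of b 0] b by auto
    then show ?thesis using k_centred[of b m] card_centred[of b m] b k_ge by auto
  qed
  show ?thesis
  proof (rule ccontr)
    assume n: "\<not> ?thesis"
    have up: "card Q = 2 * c + 1 \<and> 3 < card Q" if "Suc c < card Q"
      using n that bad[of c] double_gap[of c 0] assms by metis
    have lo: "card Q = 2 * (c - 1) + 1 \<and> 3 < card Q" if "1 < c"
    proof -
      have "0 < c - 1" "Suc (c - 1) < card Q" "gap 0 (c - 1) = gap 0 (Suc (c - 1))" using n that assms by auto
      then show ?thesis using bad[of "c - 1"] double_gap[of "c - 1" 0] by metis
    qed
    show False using up lo assms r3 by linarith
  qed
qed

lemma card_k: 
  assumes "2 \<le> card Q" 
  shows "card Q = k \<or> (card Q = Suc k \<and> even k)"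
  using assms
proof (cases rule: alternating_or_centred)
  case 1
  then show ?thesis using alternating_sequence.card_eq_k by blast
next
  case (2 c)
  obtain m where "m \<in> Q" "pos 0 m = c" using ex_pos[of c 0] 2 by auto
  then show ?thesis using k_centred[of c m] card_centred[of c m] 2 by auto
qed

lemma card_k_double:
  assumes "0 < c" "Suc c < card Q" "gap 0 c = gap 0 (Suc c)"
  shows "card Q = Suc k"
proof -
  obtain m where "m \<in> Q" "pos 0 m = c" using ex_pos[of c 0] assms by auto
  then show ?thesis using k_centred[of c m] card_centred[of c m] assms by auto
qed

end

section \<open>Words along a path\<close>

text \<open>Abstracts what planar views say about the word: letters are simple roots,
  \<open>kk s t\<close> counts the roots in their plane up to scaling, and adjacency means that
  there are at least three. A maximal run of \<open>b - a\<close> letters from \<open>s\<close> and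
  \<open>t\<close> stands for \<open>b - a + 1\<close> points, which are \<open>kk s t\<close>
  points or one more.\<close>

locale path_word =
  fixes w :: "nat \<Rightarrow> 's" and N :: nat and adj :: "'s \<Rightarrow> 's \<Rightarrow> bool" and kk :: "'s \<Rightarrow> 's \<Rightarrow> nat"
  assumes card_letters: "3 \<le> card (w ` {..<N})"
    and adj_sym: "adj s t \<Longrightarrow> adj t s"
    and adj_irrefl: "\<not> adj s s"
    and neighbour: "i < N \<Longrightarrow> adj (w i) t \<Longrightarrow> (0 < i \<and> w (i - 1) = t) \<or> (Suc i < N \<and> w (Suc i) = t)"
    and adj_Suc: "Suc i < N \<Longrightarrow> w i \<noteq> w (Suc i) \<Longrightarrow> adj (w i) (w (Suc i))"
    and run: "adj s t \<Longrightarrow> a < b \<Longrightarrow> b \<le> N \<Longrightarrow> (\<And>i. a \<le> i \<Longrightarrow> i < b \<Longrightarrow> w i = s \<or> w i = t) \<Longrightarrow>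
      a = 0 \<or> (w (a - 1) \<noteq> s \<and> w (a - 1) \<noteq> t) \<Longrightarrow> b = N \<or> (w b \<noteq> s \<and> w b \<noteq> t) \<Longrightarrow>
      (kk s t = 3 \<longleftrightarrow> b = a + 2) \<and> (b = a + 3 \<longrightarrow> kk s t = 4) \<and>
      (b = a + 4 \<and> w (a + 1) = w (a + 2) \<longrightarrow> kk s t = 4)"
begin

lemma N_ge: "3 \<le> N"
  using card_letters card_image_le[of "{..<N}" w] by simp

lemma other_letter: "\<exists>i<N. w i \<noteq> s \<and> w i \<noteq> t"
proof (rule ccontr)
  assume "\<not> ?thesis"
  then have "w ` {..<N} \<subseteq> {s, t}" by auto
  then have "card (w ` {..<N}) \<le> card {s, t}" by (intro card_mono) auto
  also have "\<dots> \<le> 2" by (simp add: card_insert_if)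
  finally show False using card_letters by simp
qed

text \<open>The first position has a neighbour on one side only.\<close>

lemma first_adj: "adj (w 0) t \<Longrightarrow> t = w 1"
  using neighbour[of 0 t] N_ge by auto

lemma first_ne: "w 0 \<noteq> w 1"
proof -
  define b where "b = (LEAST i. i < N \<and> w i \<noteq> w 0)"
  have "\<exists>i. i < N \<and> w i \<noteq> w 0" using other_letter by blast
  then have b: "b < N" "w b \<noteq> w 0" unfolding b_def by (metis (mono_tags, lifting) LeastI_ex)+
  then obtain j where j: "b = Suc j" by (cases b) auto
  then have "w j = w 0" using not_less_Least[of j "\<lambda>i. i < N \<and> w i \<noteq> w 0"] b unfolding b_def by auto
  then have "adj (w 0) (w b)" using adj_Suc[of j] b j by auto
  then show ?thesis using first_adj b by auto
qed

text \<open>Length of the longest prefix without repetition. In the end this prefix contains every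
  letter, so it spells the path that the word may retrace.\<close>

definition n :: nat where "n = Max {n. n \<le> N \<and> inj_on w {..<n}}"

lemma n_props: "n \<le> N" "inj_on w {..<n}" "m \<le> N \<Longrightarrow> inj_on w {..<m} \<Longrightarrow> m \<le> n"
proof -
  let ?X = "{n. n \<le> N \<and> inj_on w {..<n}}"
  have f: "finite ?X" by (rule finite_subset[of _ "{..N}"]) auto
  have "0 \<in> ?X" by simp
  then have "n \<in> ?X" unfolding n_def using Max_in[OF f] by blast
  then show "n \<le> N" "inj_on w {..<n}" by auto
  show "m \<le> N \<Longrightarrow> inj_on w {..<m} \<Longrightarrow> m \<le> n" unfolding n_def using Max_ge[OF f] by auto
qed

lemma w_eq_iff: "i < n \<Longrightarrow> j < n \<Longrightarrow> w i = w j \<longleftrightarrow> i = j"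
  using n_props(2) by (auto dest: inj_onD)

lemma w_n: "n < N \<Longrightarrow> \<exists>i<n. w n = w i"
proof (rule ccontr)
  assume *: "n < N" "\<not> (\<exists>i<n. w n = w i)"
  then have "inj_on w {..<Suc n}" using n_props(2) by (auto simp: lessThan_Suc inj_on_insert)
  then show False using n_props(3)[of "Suc n"] * by auto
qed

lemma n_ge_2: "2 \<le> n"
  using n_props(3)[of 2] N_ge first_ne by (auto simp: numeral_2_eq_2 lessThan_Suc)

text \<open>If the third letter is already a repetition, consider the first letter outside
  \<open>w 0\<close> and \<open>w 1\<close>. It is adjacent to its predecessor, which cannot be
  \<open>w 0\<close>, so it is adjacent to \<open>w 1\<close>. Then it must stand beside position
  \<open>1\<close>, where both places are taken.\<close>

lemma n_ge: "3 \<le> n"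
proof (rule ccontr)
  assume "\<not> 3 \<le> n"
  then have n2: "n = 2" using n_ge_2 by simp
  have w2: "w 2 = w 0 \<or> w 2 = w 1" using w_n n2 N_ge by (auto simp: less_2_cases_iff)
  define P where "P i \<longleftrightarrow> i < N \<and> w i \<noteq> w 0 \<and> w i \<noteq> w 1" for i
  define b where "b = (LEAST i. P i)"
  have "P b" unfolding b_def using other_letter[of "w 0" "w 1"] LeastI_ex[of P] unfolding P_def by blast
  then obtain j where j: "b = Suc j" unfolding P_def by (cases b) auto
  then have "\<not> P j" unfolding b_def by (metis not_less_Least lessI)
  then have wj: "w j = w 0 \<or> w j = w 1" using \<open>P b\<close> j unfolding P_def by auto
  have "adj (w j) (w b)" using adj_Suc[of j] \<open>P b\<close> wj j unfolding P_def by auto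
  then have "adj (w 1) (w b)" using wj first_adj \<open>P b\<close> unfolding P_def by metis
  then have "w 2 = w b" using neighbour[of 1 "w b"] N_ge \<open>P b\<close> unfolding P_def by (auto simp: numeral_2_eq_2)
  then show False using w2 \<open>P b\<close> unfolding P_def by auto
qed

lemma adj_path: "Suc i < n \<Longrightarrow> adj (w i) (w (Suc i))"
  using adj_Suc[of i] w_eq_iff[of i "Suc i"] n_props(1) by auto

text \<open>As no letter of the prefix is repeated, the run of two consecutive letters has length
  two.\<close>

lemma kk_path: assumes "i + 2 < n" shows "kk (w i) (w (Suc i)) = 3"
proof -
  have "(kk (w i) (w (Suc i)) = 3 \<longleftrightarrow> i + 2 = i + 2)"
  proof (rule run[THEN conjunct1])
    show "adj (w i) (w (Suc i))" using adj_path assms by auto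
    show "w j = w i \<or> w j = w (Suc i)" if "i \<le> j" "j < i + 2" for j
      using that by (metis add_2_eq_Suc' le_SucE le_antisym less_Suc_eq_le)
    show "i = 0 \<or> (w (i - 1) \<noteq> w i \<and> w (i - 1) \<noteq> w (Suc i))" using assms w_eq_iff by auto
    show "i + 2 = N \<or> (w (i + 2) \<noteq> w i \<and> w (i + 2) \<noteq> w (Suc i))" using assms w_eq_iff by auto
  qed (use assms n_props(1) in auto)
  then show ?thesis by simp
qed

text \<open>Back at \<open>w 0\<close>, the word could only go on with \<open>w 0\<close> or
  \<open>w 1\<close>. The final run of these two letters would then be longer than two, although
  their order is three.\<close>

lemma no_bounce:
  assumes P: "2 \<le> P" "w P = w 0" "w (P - 1) = w 1" "w (P - 2) = w 2" "P < N"
  shows "N = Suc P"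
proof (rule ccontr)
  assume "N \<noteq> Suc P"
  then have PN: "Suc P < N" using P by simp
  have wP: "w (Suc P) = w 0 \<or> w (Suc P) = w 1" using adj_Suc[OF PN] first_adj P by metis
  define R where "R b \<longleftrightarrow> Suc P < b \<and> (b = N \<or> (w b \<noteq> w 0 \<and> w b \<noteq> w 1))" for b
  define b where "b = (LEAST b. R b)"
  have "R N" using PN unfolding R_def by simp
  then have Rb: "R b" "b \<le> N" unfolding b_def by (auto intro: LeastI Least_le)
  have inb: "w i = w 0 \<or> w i = w 1" if "P - 1 \<le> i" "i < b" for i
  proof -
    have "i = P - 1 \<or> i = P \<or> i = Suc P \<or> Suc P < i" using that by linarith
    moreover have "\<not> R i" using that not_less_Least unfolding b_def by blast
    ultimately show ?thesis using P wP unfolding R_def by auto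
  qed
  have "(kk (w 0) (w 1) = 3 \<longleftrightarrow> b = (P - 1) + 2)"
    by (rule run[THEN conjunct1])
      (use inb P w_eq_iff[of 2 0] w_eq_iff[of 2 1] n_ge Rb adj_path[of 0] in \<open>auto simp: R_def numeral_2_eq_2\<close>)
  moreover have "kk (w 0) (w 1) = 3" using kk_path[of 0] n_ge by simp
  ultimately show False using Rb P unfolding R_def by auto
qed

text \<open>Once the word has turned round, it retraces the path: each letter demands the preceding
  letter of the path beside it, and the place before it is taken by another one. The number
  \<open>e\<close> is \<open>1\<close> if the last letter is doubled at the turn and
  \<open>0\<close> if not.\<close>

lemma down:
  assumes e: "n - 1 + e < N" "w (n - 1 + e) = w (n - 1)" "(e = 0 \<and> n < N \<and> w n = w (n - 2)) \<or> e = 1"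
    and m: "m \<le> n - 1"
  shows "n - 1 + e + m < N \<and> w (n - 1 + e + m) = w (n - 1 - m)"
  using m
proof (induction m rule: less_induct)
  case (less m)
  show ?case
  proof (cases m)
    case 0
    then show ?thesis using e by simp
  next
    case (Suc l)
    let ?P = "n - 1 + e + l" let ?j = "n - 1 - l"
    have IH: "?P < N" "w ?P = w ?j" using less.IH[of l] less.prems Suc by auto
    show ?thesis
    proof (cases "e = 0 \<and> l = 0")
      case True
      then show ?thesis using e Suc n_ge by (auto simp: numeral_2_eq_2)
    next
      case False
      have j: "0 < ?j" "?j < n" using less.prems Suc n_ge by auto
      have "Suc (?j - 1) = ?j" using j by simp
      then have "adj (w (?j - 1)) (w ?j)" using adj_path[of "?j - 1"] j by metis
      then have "adj (w ?P) (w (?j - 1))" using adj_sym IH(2) by metis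
      moreover have "w (?P - 1) \<noteq> w (?j - 1)"
      proof (cases l)
        case 0
        then have "?P - 1 = n - 1" using e False by auto
        then show ?thesis using w_eq_iff[of "n - 1" "?j - 1"] 0 j by auto
      next
        case l: (Suc l')
        have "w (n - 1 + e + l') = w (n - 1 - l')" using less.IH[of l'] less.prems Suc l by auto
        moreover have "?P - 1 = n - 1 + e + l'" using l by simp
        ultimately show ?thesis using w_eq_iff[of "n - 1 - l'" "?j - 1"] l j by auto
      qed
      ultimately have "Suc ?P < N \<and> w (Suc ?P) = w (?j - 1)" using neighbour[OF IH(1)] by blast
      then show ?thesis using Suc by simp
    qed
  qed
qed

theorem classification:
  shows "(N = n \<and> kk (w (n - 2)) (w (n - 1)) = 3) \<or>
    (N = 2 * n - 1 \<and> (\<forall>i<n. w (2 * n - 2 - i) = w i) \<and> kk (w (n - 2)) (w (n - 1)) = 4) \<or>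
    (N = 2 * n \<and> (\<forall>i<n. w (2 * n - 1 - i) = w i) \<and> kk (w (n - 2)) (w (n - 1)) = 4)"
    and "w ` {..<N} = w ` {..<n}"
proof -
  have adj: "adj (w (n - 2)) (w (n - 1))" using adj_path[of "n - 2"] n_ge by (auto simp: Suc_diff_Suc numeral_2_eq_2)
  have lo: "w (n - 3) \<noteq> w (n - 2) \<and> w (n - 3) \<noteq> w (n - 1)" using w_eq_iff[of "n-3"] n_ge by auto
  \<comment> \<open>The run of \<open>w (n - 2)\<close> and \<open>w (n - 1)\<close> around the turn
    has \<open>3 + e\<close> letters, which forces order four.\<close>
  have E: "N = n - 1 + e + n \<and> (\<forall>i<n. w (2 * n - 2 + e - i) = w i) \<and> kk (w (n - 2)) (w (n - 1)) = 4 \<and>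
      w ` {..<N} = w ` {..<n}"
    if e: "n - 1 + e < N" "w (n - 1 + e) = w (n - 1)" "(e = 0 \<and> n < N \<and> w n = w (n - 2)) \<or> e = 1" for e
  proof -
    note down = down[OF e]
    let ?P = "n - 1 + e + (n - 1)"
    have dP: "?P < N" "w ?P = w 0" "w (?P - 1) = w 1" "w (?P - 2) = w 2"
    proof -
      have "n - 1 + e + (n - 2) = ?P - 1" "n - 1 + e + (n - 3) = ?P - 2" using n_ge by auto
      moreover have "n - 1 - (n - 2) = 1" "n - 1 - (n - 3) = 2" using n_ge by auto
      ultimately show "w (?P - 1) = w 1" "w (?P - 2) = w 2" using down[of "n-2"] down[of "n - 3"] by auto
    qed (use down[of "n - 1"] in auto)
    have "N = Suc ?P" by (rule no_bounce) (use dP n_ge in \<open>simp_all\<close>)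
    then have N: "N = n - 1 + e + n" using n_ge by simp
    have sym: "w (2 * n - 2 + e - i) = w i" if "i < n" for i
    proof -
      have "n - 1 + e + (n - 1 - i) = 2 * n - 2 + e - i" "n - 1 - (n - 1 - i) = i" using that by auto
      then show ?thesis using down[of "n - 1 - i"] by auto
    qed
    have "kk (w (n - 2)) (w (n - 1)) = 4"
    proof -
      define a where "a = n - 2"
      define b where "b = n + 1 + e"
      have na: "n = a + 2" using n_ge unfolding a_def by simp
      have w1: "w (a + 1 + e) = w (a + 1)" using e na by simp
      have w2: "w (a + 2 + e) = w a" using down[of 1] na by (simp add: add.commute add.left_commute)
      have w3: "w b = w (n - 3)" "b < N" using down[of 2] na n_ge unfolding b_def by (auto simp: add.commute)
      have na': "n - 2 = a" "n - 1 = a + 1" using na by linarith+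
      have 1: "adj (w a) (w (a + 1))" using adj unfolding na' .
      have 2: "w i = w a \<or> w i = w (a + 1)" if "a \<le> i" "i < b" for i
      proof -
        have "i = a \<or> i = a + 1 \<or> i = a + 1 + e \<or> i = a + 2 + e" 
          using that na e(3) unfolding b_def by linarith
        then show ?thesis using w1 w2 by metis
      qed
      have 3: "a = 0 \<or> (w (a - 1) \<noteq> w a \<and> w (a - 1) \<noteq> w (a + 1))"
      proof -
        have "n - 3 = a - 1" using na by linarith
        then show ?thesis using lo unfolding na' by metis
      qed
      have 4: "b = N \<or> (w b \<noteq> w a \<and> w b \<noteq> w (a + 1))" using w3 lo unfolding na' by metis
      have 5: "a < b" "b \<le> N" using na w3 unfolding b_def by linarith+
      note R = run[OF 1 5 2 3 4]
      have "b = a + 3 \<or> (b = a + 4 \<and> w (a + 1) = w (a + 2))"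
      proof (cases "e = 0")
        case True then show ?thesis using na unfolding b_def by simp
      next
        case False
        then have "e = 1" using e(3) by simp
        then show ?thesis using w1 na unfolding b_def by simp
      qed
      then have "kk (w a) (w (a + 1)) = 4" using R by blast
      then show ?thesis unfolding na' .
    qed
    moreover have "w ` {..<N} = w ` {..<n}"
    proof
      show "w ` {..<N} \<subseteq> w ` {..<n}"
      proof
        fix x assume "x \<in> w ` {..<N}"
        then obtain i where i: "i < N" "x = w i" by auto
        show "x \<in> w ` {..<n}"
        proof (cases "i < n")
          case False
          have "i = 2 * n - 2 + e - (2 * n - 2 + e - i)" using i N n_ge by auto
          moreover have "2 * n - 2 + e - i < n" using False e(3) n_ge by auto
          ultimately show ?thesis using sym i by (metis imageI lessThan_iff)
        qed (use i in auto)
      qed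
      show "w ` {..<n} \<subseteq> w ` {..<N}" using n_props(1) by auto
    qed
    ultimately show ?thesis using N sym by blast
  qed
  have main: "((N = n \<and> kk (w (n - 2)) (w (n - 1)) = 3) \<or>
    (N = 2 * n - 1 \<and> (\<forall>i<n. w (2 * n - 2 - i) = w i) \<and> kk (w (n - 2)) (w (n - 1)) = 4) \<or>
    (N = 2 * n \<and> (\<forall>i<n. w (2 * n - 1 - i) = w i) \<and> kk (w (n - 2)) (w (n - 1)) = 4)) \<and>
    w ` {..<N} = w ` {..<n}"
  proof (cases "n = N")
    case True
    have "(kk (w (n - 2)) (w (n - 1)) = 3 \<longleftrightarrow> n = (n - 2) + 2)"
    proof (rule run[THEN conjunct1])
      show "w i = w (n - 2) \<or> w i = w (n - 1)" if "n - 2 \<le> i" "i < n" for i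
      proof -
        have "i = n - 2 \<or> i = n - 1" using that by linarith
        then show ?thesis by auto
      qed
      have "n - 2 - 1 = n - 3" by simp
      then show "n - 2 = 0 \<or> (w (n - 2 - 1) \<noteq> w (n - 2) \<and> w (n - 2 - 1) \<noteq> w (n - 1))" using lo by metis
    qed (use adj True n_ge in auto)
    then show ?thesis using True n_ge by auto
  next
    case False
    then have nN: "n < N" using n_props(1) by simp
    then obtain i where i: "i < n" "w n = w i" using w_n by blast
    show ?thesis
    proof (cases "w n = w (n - 1)")
      case True
      then have F: "N = n - 1 + 1 + n \<and> (\<forall>i<n. w (2 * n - 2 + 1 - i) = w i) \<and> kk (w (n - 2)) (w (n - 1)) = 4 \<and>
        w ` {..<N} = w ` {..<n}"
        by (intro E) (use nN n_ge in auto)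
      have "N = 2 * n" "2 * n - 2 + 1 = 2 * n - 1" using F n_ge by linarith+
      then show ?thesis using F by metis
    next
      case False
      have "adj (w (n - 1)) (w n)" using adj_Suc[of "n - 1"] nN n_ge False by simp
      \<comment> \<open>The prefix contains each of its letters once, so a letter \<open>w i\<close>
        adjacent to \<open>w (n - 1)\<close> must stand next to position \<open>n - 1\<close>; this
        leaves \<open>i = n - 2\<close>.\<close>
      then have ad: "adj (w i) (w (n - 1))" using i adj_sym by simp
      have "i \<noteq> n - 1" using False i by auto
      then have "w (n - 1) = w (i - 1) \<or> w (n - 1) = w (Suc i)" using neighbour[OF _ ad] i n_props(1) by auto
      then have "n - 1 = i - 1 \<or> n - 1 = Suc i" 
        using w_eq_iff[of "n - 1" "i - 1"] w_eq_iff[of "n - 1" "Suc i"] i \<open>i \<noteq> n - 1\<close> by auto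
      then have "i = n - 2" using i n_ge by auto
      then have "w n = w (n - 2)" using i by simp
      then have F: "N = n - 1 + 0 + n \<and> (\<forall>i<n. w (2 * n - 2 + 0 - i) = w i) \<and> kk (w (n - 2)) (w (n - 1)) = 4 \<and>
        w ` {..<N} = w ` {..<n}"
        by (intro E) (use nN in auto)
      have "N = 2 * n - 1" using F n_ge by linarith
      then show ?thesis using F by simp
    qed
  qed
  then show "(N = n \<and> kk (w (n - 2)) (w (n - 1)) = 3) \<or>
    (N = 2 * n - 1 \<and> (\<forall>i<n. w (2 * n - 2 - i) = w i) \<and> kk (w (n - 2)) (w (n - 1)) = 4) \<or>
    (N = 2 * n \<and> (\<forall>i<n. w (2 * n - 1 - i) = w i) \<and> kk (w (n - 2)) (w (n - 1)) = 4)" by blast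
  show "w ` {..<N} = w ` {..<n}" using main by blast
qed

end

section \<open>Simple systems\<close>

lemma orthogonal_span_eq_0:
  fixes y :: "'a::euclidean_space"
  assumes "y \<in> span D" "\<And>d. d \<in> D \<Longrightarrow> d \<bullet> y = 0"
  shows "y = 0"
proof -
  have "orthogonal y y"
    by (rule orthogonal_to_span[OF assms(1)]) (use assms(2) in \<open>auto simp: orthogonal_def inner_commute\<close>)
  then show ?thesis by (simp add: orthogonal_def)
qed

text \<open>Taken inside \<open>span D\<close>, which makes it unique for independent
  \<open>D\<close>; the ambient space may be larger than the carrier.\<close>

definition dual_vec :: "'a::euclidean_space set \<Rightarrow> 'a \<Rightarrow> 'a" where
  "dual_vec D d = (SOME v. v \<in> span D \<and> (\<forall>e\<in>D. e \<bullet> v = (if e = d then 1 else 0)))"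

lemma dual_vec:
  assumes "independent D"
  shows "dual_vec D d \<in> span D" "e \<in> D \<Longrightarrow> e \<bullet> dual_vec D d = (if e = d then 1 else 0)"
proof -
  obtain g :: "'a \<Rightarrow> real" where g: "linear g" "\<forall>e\<in>D. g e = (if e = d then 1 else 0)"
    using linear_independent_extend[OF assms, of "\<lambda>e. if e = d then 1 else 0"] by blast
  \<comment> \<open>The vector \<open>adjoint g 1\<close> represents the form \<open>g\<close>; its
    component in \<open>span D\<close> has the same values on \<open>D\<close>.\<close>
  obtain y z where yz: "adjoint g 1 = y + z" "y \<in> span D" "\<And>u. u \<in> span D \<Longrightarrow> orthogonal z u"
    by (metis orthogonal_subspace_decomp_exists[of D "adjoint g 1"])
  have "e \<bullet> y = (if e = d then 1 else 0)" if "e \<in> D" for e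
  proof -
    have "z \<bullet> e = 0" using yz(3)[of e] span_base[OF that] by (simp add: orthogonal_def)
    then have "e \<bullet> y = e \<bullet> adjoint g 1" by (simp add: yz(1) inner_add_right inner_commute)
    also have "\<dots> = g e \<bullet> 1" by (rule adjoint_works[OF g(1)])
    finally show ?thesis using g(2) that by simp
  qed
  then have "\<exists>v. v \<in> span D \<and> (\<forall>e\<in>D. e \<bullet> v = (if e = d then 1 else 0))" using yz(2) by blast
  then have "dual_vec D d \<in> span D \<and> (\<forall>e\<in>D. e \<bullet> dual_vec D d = (if e = d then 1 else 0))"
    unfolding dual_vec_def by (rule someI_ex)
  then show "dual_vec D d \<in> span D" "e \<in> D \<Longrightarrow> e \<bullet> dual_vec D d = (if e = d then 1 else 0)" by auto
qed

lemma dual_expand: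
  assumes D: "independent D" and x: "x \<in> span D"
  shows "x = (\<Sum>d\<in>D. (x \<bullet> dual_vec D d) *\<^sub>R d)" and "x = (\<Sum>d\<in>D. (d \<bullet> x) *\<^sub>R dual_vec D d)"
proof -
  have f: "finite D" using D by (rule finiteI_independent)
  have 2: "x = (\<Sum>d\<in>D. (d \<bullet> x) *\<^sub>R dual_vec D d)" if "x \<in> span D" for x
  proof -
    have "x - (\<Sum>d\<in>D. (d \<bullet> x) *\<^sub>R dual_vec D d) = 0"
    proof (rule orthogonal_span_eq_0)
      show "x - (\<Sum>d\<in>D. (d \<bullet> x) *\<^sub>R dual_vec D d) \<in> span D"
        by (intro span_diff that span_sum span_scale dual_vec D)
      show "e \<bullet> (x - (\<Sum>d\<in>D. (d \<bullet> x) *\<^sub>R dual_vec D d)) = 0" if "e \<in> D" for e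
        using that f by (simp add: inner_diff_right inner_sum_right dual_vec(2)[OF D that] if_distrib cong: if_cong)
    qed
    then show ?thesis by simp
  qed
  have "x - (\<Sum>d\<in>D. (x \<bullet> dual_vec D d) *\<^sub>R d) = 0" (is "?z = 0")
  proof -
    have zs: "?z \<in> span D" by (intro span_diff x span_sum span_scale span_base)
    have "?z \<bullet> dual_vec D e = 0" if "e \<in> D" for e
    proof -
      have "(\<Sum>d\<in>D. (x \<bullet> dual_vec D d) * (d \<bullet> dual_vec D e)) = (\<Sum>d\<in>D. if d = e then x \<bullet> dual_vec D e else 0)"
        by (intro sum.cong) (auto simp: dual_vec(2)[OF D])
      then show ?thesis using that f by (simp add: inner_diff_left inner_sum_left)
    qed
    then have "?z \<bullet> ?z = 0"
      by (subst (2) 2[OF zs]) (simp add: inner_sum_right)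
    then show ?thesis by simp
  qed
  then show "x = (\<Sum>d\<in>D. (x \<bullet> dual_vec D d) *\<^sub>R d)" by simp
  show "x = (\<Sum>d\<in>D. (d \<bullet> x) *\<^sub>R dual_vec D d)" by (rule 2[OF x])
qed

lemma perturbation_bound:
  fixes x u :: "'a::real_inner"
  assumes "finite R"
  shows "\<exists>\<epsilon>>0. \<forall>r\<in>R. r \<bullet> x \<noteq> 0 \<longrightarrow> \<epsilon> * \<bar>r \<bullet> u\<bar> < \<bar>r \<bullet> x\<bar>"
  using assms
proof (induction R)
  case empty
  then show ?case by (auto intro: exI[of _ 1])
next
  case (insert r R)
  then obtain \<epsilon> where e: "\<epsilon> > 0" "\<forall>r\<in>R. r \<bullet> x \<noteq> 0 \<longrightarrow> \<epsilon> * \<bar>r \<bullet> u\<bar> < \<bar>r \<bullet> x\<bar>" by blast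
  show ?case
  proof (cases "r \<bullet> x = 0")
    case True
    then show ?thesis using e by (intro exI[of _ \<epsilon>]) auto
  next
    case False
    define \<eta> where "\<eta> = min \<epsilon> (\<bar>r \<bullet> x\<bar> / (\<bar>r \<bullet> u\<bar> + 1))"
    have \<eta>: "\<eta> > 0" "\<eta> \<le> \<epsilon>" using e False unfolding \<eta>_def by auto
    have "\<eta> * \<bar>r \<bullet> u\<bar> < \<bar>r \<bullet> x\<bar>"
    proof -
      have "\<eta> * (\<bar>r \<bullet> u\<bar> + 1) \<le> \<bar>r \<bullet> x\<bar>" unfolding \<eta>_def
        by (metis abs_ge_zero add_nonneg_pos min.cobounded2 pos_le_divide_eq zero_less_one)
      then show ?thesis using \<eta> by (simp add: algebra_simps)
    qed
    moreover have "\<eta> * \<bar>r' \<bullet> u\<bar> < \<bar>r' \<bullet> x\<bar>" if "r' \<in> R" "r' \<bullet> x \<noteq> 0" for r'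
      using e(2) that \<eta> by (meson abs_ge_zero le_less_trans mult_right_mono)
    ultimately show ?thesis using \<eta> by (intro exI[of _ \<eta>]) auto
  qed
qed

definition root_of :: "'a::real_vector set \<Rightarrow> 'a \<Rightarrow> bool" where
  "root_of R \<beta> \<longleftrightarrow> (\<exists>r\<in>R. \<exists>c. c \<noteq> 0 \<and> \<beta> = c *\<^sub>R r)"

text \<open>The analogue of the simple roots of a Weyl chamber without a reflection group: the walls
  of the chamber of \<open>w\<close>, each up to a positive factor.\<close>

definition simple_system :: "'a::euclidean_space set \<Rightarrow> 'a set \<Rightarrow> 'a \<Rightarrow> 'a set \<Rightarrow> bool" where
  "simple_system W R w D \<longleftrightarrow> independent D \<and> span D = W \<and> (\<forall>d\<in>D. root_of R d \<and> 0 < d \<bullet> w) \<and>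
     (\<forall>\<beta>. root_of R \<beta> \<and> 0 < \<beta> \<bullet> w \<longrightarrow> (\<exists>c. (\<forall>d\<in>D. 0 \<le> c d) \<and> \<beta> = (\<Sum>d\<in>D. c d *\<^sub>R d)))"

lemma root_of_scale: "root_of R \<beta> \<Longrightarrow> c \<noteq> 0 \<Longrightarrow> root_of R (c *\<^sub>R \<beta>)"
  unfolding root_of_def by (metis mult_eq_0_iff scaleR_scaleR)

lemma root_of_minus: "root_of R (- \<beta>) \<longleftrightarrow> root_of R \<beta>"
  using root_of_scale[of R \<beta> "-1"] root_of_scale[of R "-\<beta>" "-1"] by auto

lemma root_of_base: "r \<in> R \<Longrightarrow> root_of R r"
  unfolding root_of_def by (intro bexI[of _ r] exI[of _ 1]) auto

lemma perturbation:
  fixes x u :: "'a::real_inner"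
  assumes "finite R"
  obtains \<epsilon> :: real where "\<epsilon> > 0" "\<And>\<beta>. root_of R \<beta> \<Longrightarrow> \<beta> \<bullet> x \<noteq> 0 \<Longrightarrow> sgn (\<beta> \<bullet> (x + \<epsilon> *\<^sub>R u)) = sgn (\<beta> \<bullet> x)"
proof -
  obtain \<epsilon> where e: "\<epsilon> > 0" "\<forall>r\<in>R. r \<bullet> x \<noteq> 0 \<longrightarrow> \<epsilon> * \<bar>r \<bullet> u\<bar> < \<bar>r \<bullet> x\<bar>"
    using perturbation_bound[OF assms] by blast
  have *: "sgn (r \<bullet> (x + \<epsilon> *\<^sub>R u)) = sgn (r \<bullet> x)" if "r \<in> R" "r \<bullet> x \<noteq> 0" for r
  proof -
    have "\<bar>\<epsilon> * (r \<bullet> u)\<bar> < \<bar>r \<bullet> x\<bar>" using e that by (simp add: abs_mult)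
    moreover have "sgn (a + b) = sgn a" if "\<bar>b\<bar> < \<bar>a\<bar>" for a b :: real
      using that by (cases "a > 0") (auto simp: sgn_if abs_if split: if_splits)
    ultimately show ?thesis by (simp add: inner_add_right)
  qed
  have "sgn (\<beta> \<bullet> (x + \<epsilon> *\<^sub>R u)) = sgn (\<beta> \<bullet> x)" if "root_of R \<beta>" "\<beta> \<bullet> x \<noteq> 0" for \<beta>
  proof -
    obtain r c where r: "r \<in> R" "c \<noteq> 0" "\<beta> = c *\<^sub>R r" using \<open>root_of R \<beta>\<close> unfolding root_of_def by blast
    then have "r \<bullet> x \<noteq> 0" using that by auto
    then have "sgn (r \<bullet> (x + \<epsilon> *\<^sub>R u)) = sgn (r \<bullet> x)" by (rule *[OF r(1)])
    then show ?thesis unfolding r(3) inner_scaleR_left sgn_mult by simp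
  qed
  then show ?thesis using that e by blast
qed

text \<open>\<open>R\<close> consists of normals of the hyperplanes through a modular line, and the remaining hyperplanes
  meet a parallel of this line in points given by the linear forms in \<open>F\<close>.\<close>

locale fibred_arrangement =
  fixes W R F :: "'a::euclidean_space set"
  assumes subspace_W: "subspace W" and finite_R: "finite R" and R_W: "R \<subseteq> W" and R_nz: "0 \<notin> R"
    and finite_F: "finite F" and F_W: "F \<subseteq> W" and F_ne: "F \<noteq> {}"
    and F_diff: "f \<in> F \<Longrightarrow> g \<in> F \<Longrightarrow> f \<noteq> g \<Longrightarrow> root_of R (f - g)"
    and simple_ex: "w \<in> W \<Longrightarrow> (\<forall>r\<in>R. r \<bullet> w \<noteq> 0) \<Longrightarrow> \<exists>D. simple_system W R w D"
    and F_consec: "w \<in> W \<Longrightarrow> (\<forall>r\<in>R. r \<bullet> w \<noteq> 0) \<Longrightarrow> simple_system W R w D \<Longrightarrow> f \<in> F \<Longrightarrow> g \<in> F \<Longrightarrow>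
      f \<bullet> w < g \<bullet> w \<Longrightarrow> (\<forall>h\<in>F. \<not> (f \<bullet> w < h \<bullet> w \<and> h \<bullet> w < g \<bullet> w)) \<Longrightarrow>
      \<exists>d\<in>D. \<exists>c>0. g - f = c *\<^sub>R d"
begin

abbreviation root :: "'a \<Rightarrow> bool" where "root \<equiv> root_of R"
abbreviation simple :: "'a \<Rightarrow> 'a set \<Rightarrow> bool" where "simple \<equiv> simple_system W R"

definition regular :: "'a \<Rightarrow> bool" where "regular w \<longleftrightarrow> w \<in> W \<and> (\<forall>r\<in>R. r \<bullet> w \<noteq> 0)"

lemma root_W: "root \<beta> \<Longrightarrow> \<beta> \<in> W"
  unfolding root_of_def using R_W subspace_W by (auto intro: subspace_scale)

lemma root_nz: "root \<beta> \<Longrightarrow> \<beta> \<noteq> 0"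
  unfolding root_of_def using R_nz by auto

lemma regular_root: "regular w \<Longrightarrow> root \<beta> \<Longrightarrow> \<beta> \<bullet> w \<noteq> 0"
  unfolding root_of_def regular_def by auto

lemma regularI: "w \<in> W \<Longrightarrow> (\<And>\<beta>. root \<beta> \<Longrightarrow> \<beta> \<bullet> w \<noteq> 0) \<Longrightarrow> regular w"
  unfolding regular_def using root_of_base by blast

lemma simpleD:
  assumes "simple w D"
  shows "independent D" "span D = W" "finite D" "d \<in> D \<Longrightarrow> root d" "d \<in> D \<Longrightarrow> 0 < d \<bullet> w"
  using assms unfolding simple_system_def by (auto intro: finiteI_independent)

lemma simple_coeff_nonneg:
  assumes "simple w D" "root \<beta>" "0 < \<beta> \<bullet> w" "d \<in> D"
  shows "0 \<le> \<beta> \<bullet> dual_vec D d"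
proof -
  obtain c where c: "\<forall>d\<in>D. 0 \<le> c d" "\<beta> = (\<Sum>d\<in>D. c d *\<^sub>R d)"
    using assms unfolding simple_system_def by blast
  have "\<beta> \<bullet> dual_vec D d = (\<Sum>e\<in>D. c e * (e \<bullet> dual_vec D d))" unfolding c(2) by (simp add: inner_sum_left)
  also have "\<dots> \<ge> 0" using c(1) dual_vec(2)[OF simpleD(1)[OF assms(1)]] by (intro sum_nonneg) auto
  finally show ?thesis .
qed

lemma simple_expand:
  assumes "simple w D" "x \<in> W"
  shows "x = (\<Sum>d\<in>D. (x \<bullet> dual_vec D d) *\<^sub>R d)" "x = (\<Sum>d\<in>D. (d \<bullet> x) *\<^sub>R dual_vec D d)"
  using dual_expand[of D x] simpleD[OF assms(1)] assms(2) by auto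

lemma dual_W: "simple w D \<Longrightarrow> dual_vec D d \<in> W"
  using dual_vec(1)[of D d] simpleD by metis

lemma simple_cong:
  assumes "simple w D" "\<And>\<beta>. root \<beta> \<Longrightarrow> 0 < \<beta> \<bullet> w \<longleftrightarrow> 0 < \<beta> \<bullet> w'"
  shows "simple w' D"
  using assms unfolding simple_system_def by metis

lemma same_chamber:
  assumes D: "simple w D" and w': "w' \<in> W" "\<And>d. d \<in> D \<Longrightarrow> 0 < d \<bullet> w'" and w: "regular w" and \<beta>: "root \<beta>"
  shows "0 < \<beta> \<bullet> w \<longleftrightarrow> 0 < \<beta> \<bullet> w'"
proof -
  have pos: "0 < \<gamma> \<bullet> w'" if g: "root \<gamma>" "0 < \<gamma> \<bullet> w" for \<gamma>
  proof -
    have ex: "\<gamma> \<bullet> w' = (\<Sum>d\<in>D. (\<gamma> \<bullet> dual_vec D d) * (d \<bullet> w'))"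
      by (subst simple_expand(1)[OF D root_W[OF g(1)]]) (simp add: inner_sum_left)
    have nn: "\<forall>d\<in>D. 0 \<le> (\<gamma> \<bullet> dual_vec D d) * (d \<bullet> w')" 
      using simple_coeff_nonneg[OF D g] w'(2) by (simp add: less_imp_le)
    have "\<exists>d\<in>D. \<gamma> \<bullet> dual_vec D d \<noteq> 0"
    proof (rule ccontr)
      assume "\<not> ?thesis"
      then have "\<gamma> = 0" by (subst simple_expand(1)[OF D root_W[OF g(1)]]) simp
      then show False using root_nz g by simp
    qed
    then obtain d where d: "d \<in> D" "\<gamma> \<bullet> dual_vec D d \<noteq> 0" by blast
    then have "0 < (\<gamma> \<bullet> dual_vec D d) * (d \<bullet> w')" using nn w'(2)[OF d(1)] by (simp add: order_less_le)
    then show ?thesis unfolding ex using nn d simpleD(3)[OF D] by (intro sum_pos2[of D d]) auto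
  qed
  show ?thesis
    using pos[OF \<beta>] pos[of "- \<beta>"] \<beta> root_of_minus regular_root[OF w \<beta>] 
    by (metis inner_minus_left less_asym linorder_neqE_linordered_idom neg_0_less_iff_less)
qed

text \<open>Positive roots have nonnegative coefficients, so nothing can cancel: a sum on the line
  of \<open>d\<close> has no summand with another nonzero coefficient.\<close>

lemma simple_extremal:
  assumes D: "simple w D" and d: "d \<in> D" and ab: "0 < a" "0 < b" and g: "root \<gamma>" "root \<gamma>'" "0 < \<gamma> \<bullet> w" "0 < \<gamma>' \<bullet> w"
    and eq: "k *\<^sub>R d = a *\<^sub>R \<gamma> + b *\<^sub>R \<gamma>'"
  shows "\<exists>c>0. \<gamma> = c *\<^sub>R d"
proof -
  have z: "\<gamma> \<bullet> dual_vec D e = 0" if "e \<in> D" "e \<noteq> d" for e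
  proof -
    have "a * (\<gamma> \<bullet> dual_vec D e) + b * (\<gamma>' \<bullet> dual_vec D e) = (k *\<^sub>R d) \<bullet> dual_vec D e"
      unfolding eq by (simp add: inner_add_left)
    also have "\<dots> = 0" using dual_vec(2)[OF simpleD(1)[OF D] d, of e] that by simp
    finally have "a * (\<gamma> \<bullet> dual_vec D e) + b * (\<gamma>' \<bullet> dual_vec D e) = 0" .
    moreover have "0 \<le> a * (\<gamma> \<bullet> dual_vec D e)" "0 \<le> b * (\<gamma>' \<bullet> dual_vec D e)"
      using simple_coeff_nonneg[OF D _ _ that(1)] g ab by auto
    ultimately have "a * (\<gamma> \<bullet> dual_vec D e) = 0" by linarith
    then show ?thesis using ab by simp
  qed
  define m where "m = \<gamma> \<bullet> dual_vec D d"
  have "\<gamma> = (\<Sum>e\<in>D. (\<gamma> \<bullet> dual_vec D e) *\<^sub>R e)" by (rule simple_expand(1)[OF D root_W[OF g(1)]])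
  also have "\<dots> = (\<Sum>e\<in>D. if e = d then m *\<^sub>R d else 0)"
    using z by (intro sum.cong) (auto simp: m_def)
  also have "\<dots> = m *\<^sub>R d" using d simpleD(3)[OF D] by simp
  finally have 1: "\<gamma> = m *\<^sub>R d" .
  then have "m \<noteq> 0" using root_nz[OF g(1)] by (metis scaleR_zero_left)
  then have "m > 0" using simple_coeff_nonneg[OF D g(1,3) d] unfolding m_def by simp
  then show ?thesis using 1 by blast
qed

text \<open>If no simple root were parallel to \<open>\<beta>\<close>, all of them would be positive
  at \<open>w0\<close>. Since \<open>\<beta>\<close> vanishes there and has nonnegative
  coefficients, it would be zero. Walls of chambers are found in this way below.\<close>

lemma wall_criterion:
  assumes D: "simple w D" and b: "root \<beta>" "0 < \<beta> \<bullet> w" and w0: "w0 \<in> W" "\<beta> \<bullet> w0 = 0"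
    and oth: "\<And>\<gamma>. root \<gamma> \<Longrightarrow> 0 < \<gamma> \<bullet> w \<Longrightarrow> (\<nexists>c. \<gamma> = c *\<^sub>R \<beta>) \<Longrightarrow> 0 < \<gamma> \<bullet> w0"
  shows "\<exists>d\<in>D. \<exists>c>0. \<beta> = c *\<^sub>R d"
proof (rule ccontr)
  assume n: "\<not> ?thesis"
  have npar: "\<nexists>c. d = c *\<^sub>R \<beta>" if "d \<in> D" for d
  proof
    assume "\<exists>c. d = c *\<^sub>R \<beta>"
    then obtain c where c: "d = c *\<^sub>R \<beta>" by blast
    have "0 < c * (\<beta> \<bullet> w)" using simpleD(5)[OF D that] c by simp
    then have "c > 0" by (rule zero_less_mult_pos2[OF _ b(2)])
    then have "\<beta> = (1/c) *\<^sub>R d" "1/c > 0" using c by auto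
    then show False using n that by blast
  qed
  have dp: "0 < d \<bullet> w0" if "d \<in> D" for d
    using oth[OF simpleD(4)[OF D that] simpleD(5)[OF D that] npar[OF that]] .
  have ex: "(\<Sum>d\<in>D. (\<beta> \<bullet> dual_vec D d) * (d \<bullet> w0)) = 0"
    using w0(2) by (subst (asm) simple_expand(1)[OF D root_W[OF b(1)]]) (simp add: inner_sum_left)
  have "\<forall>d\<in>D. 0 \<le> (\<beta> \<bullet> dual_vec D d) * (d \<bullet> w0)" 
    using simple_coeff_nonneg[OF D b] dp by (simp add: less_imp_le)
  then have "\<forall>d\<in>D. (\<beta> \<bullet> dual_vec D d) * (d \<bullet> w0) = 0"
    using ex simpleD(3)[OF D] by (simp add: sum_nonneg_eq_0_iff)
  then have "\<forall>d\<in>D. \<beta> \<bullet> dual_vec D d = 0" using dp by (metis less_irrefl mult_eq_0_iff)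
  then have "\<beta> = 0" by (subst simple_expand(1)[OF D root_W[OF b(1)]]) simp
  then show False using root_nz b by simp
qed

end

section \<open>Planar views of a fibre\<close>

locale rank_two_view = fibred_arrangement W R F
  for W R F :: "'a::euclidean_space set" +
  fixes w :: 'a and D :: "'a set" and s t :: 'a
  assumes regular_w: "regular w" and simple_w: "simple w D" and sD: "s \<in> D" and tD: "t \<in> D" and st: "s \<noteq> t"
begin

definition ray :: "real \<Rightarrow> 'a" where "ray \<tau> = (1 - \<tau>) *\<^sub>R s + \<tau> *\<^sub>R t"

definition T :: "real set" where "T = {\<tau>. 0 \<le> \<tau> \<and> \<tau> \<le> 1 \<and> root (ray \<tau>)}"

text \<open>A point inside the face of codimension two where \<open>s\<close> and \<open>t\<close>
  vanish; the roots vanishing there are exactly those in the plane of \<open>s\<close> and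
  \<open>t\<close>.\<close>

definition x0 :: 'a where "x0 = (\<Sum>d\<in>D - {s, t}. dual_vec D d)"

text \<open>The points \<open>u m\<close> run through a half turn around \<open>x0\<close>: the value of \<open>ray \<tau>\<close> at \<open>u m\<close> is \<open>\<tau> - m\<close>,
  so the chambers around \<open>x0\<close> correspond to the gaps of \<open>T\<close> on the line.\<close>

definition u :: "real \<Rightarrow> 'a" where "u m = (- m) *\<^sub>R dual_vec D s + (1 - m) *\<^sub>R dual_vec D t"

definition k :: nat where "k = card T"

definition tau :: "nat \<Rightarrow> real" where "tau i = sorted_list_of_set T ! i"

lemma indep: "independent D" and finD: "finite D"
  using simpleD[OF simple_w] by auto

lemma dual_eq: "e \<in> D \<Longrightarrow> e \<bullet> dual_vec D d = (if e = d then 1 else 0)"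
  by (rule dual_vec(2)[OF indep])

lemma ray_dual: "ray \<tau> \<bullet> dual_vec D s = 1 - \<tau>" "ray \<tau> \<bullet> dual_vec D t = \<tau>"
  using dual_eq[OF sD] dual_eq[OF tD] st unfolding ray_def by (simp_all add: inner_add_left)

lemma ray_u: "ray \<tau> \<bullet> u m = \<tau> - m"
  unfolding u_def by (simp add: inner_add_right ray_dual algebra_simps)

lemma D_x0: "d \<in> D \<Longrightarrow> d \<bullet> x0 = (if d = s \<or> d = t then 0 else 1)"
proof -
  assume d: "d \<in> D"
  have "d \<bullet> x0 = (\<Sum>e\<in>D - {s, t}. if d = e then 1 else 0)"
    unfolding x0_def inner_sum_right by (intro sum.cong) (auto simp: dual_eq[OF d])
  then show ?thesis using finD d by simp
qed

lemma ray_x0: "ray \<tau> \<bullet> x0 = 0"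
  unfolding ray_def using D_x0[OF sD] D_x0[OF tD] by (simp add: inner_add_left)

lemma x0_W: "x0 \<in> W"
  unfolding x0_def using dual_W[OF simple_w] subspace_W by (intro subspace_sum) auto

lemma u_W: "u m \<in> W"
  unfolding u_def using dual_W[OF simple_w] subspace_W by (intro subspace_add subspace_scale) auto

lemma ray_01: "ray 0 = s" "ray 1 = t"
  unfolding ray_def by simp_all

lemma T_01: "0 \<in> T" "1 \<in> T"
  unfolding T_def using simpleD(4)[OF simple_w] sD tD by (auto simp: ray_01)

lemma scale_ray_eq:
  assumes "c *\<^sub>R ray \<tau> = c' *\<^sub>R ray \<tau>'" "c \<noteq> 0"
  shows "c = c'" "\<tau> = \<tau>'"
proof -
  have "(c *\<^sub>R ray \<tau>) \<bullet> dual_vec D s = (c' *\<^sub>R ray \<tau>') \<bullet> dual_vec D s"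
    "(c *\<^sub>R ray \<tau>) \<bullet> dual_vec D t = (c' *\<^sub>R ray \<tau>') \<bullet> dual_vec D t"
    using assms(1) by simp_all
  then have 1: "c * (1 - \<tau>) = c' * (1 - \<tau>')" "c * \<tau> = c' * \<tau>'" by (simp_all add: ray_dual)
  then show "c = c'" by (simp add: algebra_simps)
  then show "\<tau> = \<tau>'" using 1 assms(2) by simp
qed

lemma ray_nz: "ray \<tau> \<noteq> 0"
proof
  assume "ray \<tau> = 0"
  then have "1 - \<tau> = 0" "\<tau> = 0" using ray_dual[of \<tau>] by simp_all
  then show False by simp
qed

lemma finite_T: "finite T"
proof -
  have "T \<subseteq> (\<Union>r\<in>R. {\<tau>. \<exists>c. c \<noteq> 0 \<and> ray \<tau> = c *\<^sub>R r})" unfolding T_def root_of_def by blast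
  moreover have "finite {\<tau>. \<exists>c. c \<noteq> 0 \<and> ray \<tau> = c *\<^sub>R r}" for r
  proof -
    have "\<tau> = \<tau>'" if "c \<noteq> 0" "ray \<tau> = c *\<^sub>R r" "c' \<noteq> 0" "ray \<tau>' = c' *\<^sub>R r" for \<tau> \<tau>' c c'
    proof -
      have "c' *\<^sub>R ray \<tau> = c *\<^sub>R ray \<tau>'" using that by simp
      then show ?thesis using scale_ray_eq(2) that by blast
    qed
    then have "\<exists>x. {\<tau>. \<exists>c. c \<noteq> 0 \<and> ray \<tau> = c *\<^sub>R r} \<subseteq> {x}" by blast
    then show ?thesis using finite_subset by blast
  qed
  ultimately show ?thesis using finite_subset finite_R by blast
qed

lemma tau_mem: "i < k \<Longrightarrow> tau i \<in> T"
  using nth_mem[of i "sorted_list_of_set T"] finite_T unfolding tau_def k_def by simp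

lemma tau_less: "i < j \<Longrightarrow> j < k \<Longrightarrow> tau i < tau j"
  using strict_sorted_list_of_set[of T] sorted_wrt_nth_less[of "(<)" "sorted_list_of_set T" i j] 
  unfolding tau_def k_def by simp

lemma tau_less_iff: "i < k \<Longrightarrow> j < k \<Longrightarrow> tau i < tau j \<longleftrightarrow> i < j"
  by (metis tau_less less_asym linorder_neqE_nat)

lemma tau_eq_iff: "i < k \<Longrightarrow> j < k \<Longrightarrow> tau i = tau j \<longleftrightarrow> i = j"
  by (metis tau_less less_irrefl linorder_neqE_nat)

lemma ex_tau: "\<tau> \<in> T \<Longrightarrow> \<exists>i<k. tau i = \<tau>"
  using finite_T in_set_conv_nth[of \<tau> "sorted_list_of_set T"] unfolding tau_def k_def by simp

lemma k_ge_2: "2 \<le> k"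
proof -
  have "card {0, 1::real} \<le> card T" using T_01 finite_T by (intro card_mono) auto
  then show ?thesis unfolding k_def by simp
qed

lemma tau_0: "tau 0 = 0"
proof -
  obtain i where i: "i < k" "tau i = 0" using ex_tau T_01 by blast
  have "0 \<le> tau 0" using tau_mem[of 0] k_ge_2 unfolding T_def by simp
  then show ?thesis using tau_less[of 0 i] i by (cases "i = 0") auto
qed

lemma tau_last: "tau (k - 1) = 1"
proof -
  obtain i where i: "i < k" "tau i = 1" using ex_tau T_01 by blast
  have "tau (k - 1) \<le> 1" using tau_mem[of "k - 1"] k_ge_2 unfolding T_def by simp
  have "i = k - 1 \<or> tau i < tau (k - 1)" using tau_less[of i "k - 1"] i by linarith
  then show ?thesis using i \<open>tau (k - 1) \<le> 1\<close> by auto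
qed

lemma ray_pos: "0 \<le> \<tau> \<Longrightarrow> \<tau> \<le> 1 \<Longrightarrow> 0 < ray \<tau> \<bullet> w"
proof -
  assume "0 \<le> \<tau>" "\<tau> \<le> 1"
  moreover have "0 < s \<bullet> w" "0 < t \<bullet> w" using simpleD(5)[OF simple_w] sD tD by auto
  ultimately show ?thesis unfolding ray_def
    by (cases "\<tau> = 0") (auto simp: inner_add_left intro: add_nonneg_pos)
qed

text \<open>The other simple roots have value \<open>1\<close> at \<open>x0\<close> and all
  coefficients are nonnegative, so only \<open>s\<close> and \<open>t\<close> contribute. Dividing
  by the sum of the two coefficients gives a point of the segment from \<open>s\<close> to
  \<open>t\<close>.\<close>

lemma root_plane_pos:
  assumes b: "root \<beta>" "0 < \<beta> \<bullet> w" "\<beta> \<bullet> x0 = 0"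
  shows "\<exists>d<k. \<exists>c>0. \<beta> = c *\<^sub>R ray (tau d)"
proof -
  define cf where "cf e = \<beta> \<bullet> dual_vec D e" for e
  have nn: "0 \<le> cf e" if "e \<in> D" for e using simple_coeff_nonneg[OF simple_w b(1,2) that] unfolding cf_def .
  have ex: "\<beta> = (\<Sum>e\<in>D. cf e *\<^sub>R e)" unfolding cf_def by (rule simple_expand(1)[OF simple_w root_W[OF b(1)]])
  have "\<beta> \<bullet> x0 = (\<Sum>e\<in>D. cf e * (e \<bullet> x0))" by (subst ex) (simp add: inner_sum_left)
  also have "\<dots> = (\<Sum>e\<in>D - {s, t}. cf e)"
    using finD D_x0 by (intro sum.mono_neutral_cong_right) auto
  finally have "(\<Sum>e\<in>D - {s, t}. cf e) = 0" using b(3) by simp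
  then have z: "cf e = 0" if "e \<in> D - {s, t}" for e
    using nn finD that by (subst (asm) sum_nonneg_eq_0_iff) auto
  have "(\<Sum>e\<in>D. cf e *\<^sub>R e) = (\<Sum>e\<in>{s, t}. cf e *\<^sub>R e)"
    using finD sD tD z by (intro sum.mono_neutral_right) auto
  then have st': "\<beta> = cf s *\<^sub>R s + cf t *\<^sub>R t" using ex st by simp
  define a where "a = cf s"
  define b' where "b' = cf t"
  have ab: "0 \<le> a" "0 \<le> b'" "\<beta> = a *\<^sub>R s + b' *\<^sub>R t" 
    using nn sD tD st' unfolding a_def b'_def by auto
  have "a + b' \<noteq> 0"
  proof
    assume "a + b' = 0"
    then have "a = 0" "b' = 0" using ab by auto
    then show False using ab root_nz[OF b(1)] by simp
  qed
  then have p: "0 < a + b'" using ab by simp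
  define \<tau> where "\<tau> = b' / (a + b')"
  have "(a + b') * (1 - \<tau>) = a" "(a + b') * \<tau> = b'" using p unfolding \<tau>_def by (auto simp: field_simps)
  then have b1: "\<beta> = (a + b') *\<^sub>R ray \<tau>" using ab(3) unfolding ray_def by (simp add: scaleR_add_right)
  then have "ray \<tau> = (1 / (a + b')) *\<^sub>R \<beta>" using p by simp
  then have "root (ray \<tau>)" using root_of_scale[OF b(1), of "1 / (a + b')"] p by simp
  moreover have "0 \<le> \<tau>" "\<tau> \<le> 1" using ab p unfolding \<tau>_def by auto
  ultimately have "\<tau> \<in> T" unfolding T_def by simp
  then show ?thesis using ex_tau b1 p by metis
qed

lemma root_plane:
  assumes b: "root \<beta>" "\<beta> \<bullet> x0 = 0"
  shows "\<exists>d<k. \<exists>c. c \<noteq> 0 \<and> \<beta> = c *\<^sub>R ray (tau d)"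
proof (cases "0 < \<beta> \<bullet> w")
  case True
  then show ?thesis using root_plane_pos[OF b(1) _ b(2)] by (metis less_irrefl)
next
  case False
  then have "0 < - \<beta> \<bullet> w" using regular_root[OF regular_w b(1)] by (simp add: order_less_le)
  moreover have "root (- \<beta>)" "- \<beta> \<bullet> x0 = 0" using b root_of_minus by auto
  ultimately obtain d c where "d < k" "c > 0" "- \<beta> = c *\<^sub>R ray (tau d)" using root_plane_pos by blast
  then have "\<beta> = (- c) *\<^sub>R ray (tau d)" "- c \<noteq> 0" using \<open>c > 0\<close> by (metis minus_minus scaleR_minus_left, simp)
  then show ?thesis using \<open>d < k\<close> by blast
qed

lemma root_ray: "d < k \<Longrightarrow> root (ray (tau d))"
  using tau_mem unfolding T_def by auto

text \<open>The value \<open>- 1\<close> lies below all of \<open>T\<close>, so index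
  \<open>0\<close> gives the side of \<open>x0\<close> on which the chamber of \<open>w\<close>
  lies.\<close>

definition mid :: "nat \<Rightarrow> real" where "mid j = (if j = 0 then - 1 else (tau (j - 1) + tau j) / 2)"

lemma mid_less: "j \<le> d \<Longrightarrow> d < k \<Longrightarrow> mid j < tau d"
proof -
  assume "j \<le> d" "d < k"
  then have "j = 0 \<or> (j - 1 < j \<and> j < k)" "j = d \<or> j < d" by linarith+
  then have "j = 0 \<or> tau (j - 1) < tau j" "j = d \<or> tau j < tau d"
    using tau_less[of "j - 1" j] tau_less[of j d] \<open>d < k\<close> by blast+
  moreover have "0 \<le> tau d" using tau_mem[OF \<open>d < k\<close>] unfolding T_def by simp
  ultimately show ?thesis unfolding mid_def by auto
qed

lemma less_mid: "d < j \<Longrightarrow> j < k \<Longrightarrow> tau d < mid j"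
proof -
  assume "d < j" "j < k"
  then have "j \<noteq> 0" "j - 1 < j" "j - 1 < k" "d = j - 1 \<or> d < j - 1" by linarith+
  then have "j \<noteq> 0" "tau (j - 1) < tau j" "d = j - 1 \<or> tau d < tau (j - 1)" 
    using tau_less[of "j - 1" j] tau_less[of d "j - 1"] \<open>j < k\<close> by blast+
  then show ?thesis unfolding mid_def by auto
qed

text \<open>Directions into the \<open>2 * k\<close> chambers around \<open>x0\<close> in cyclic
  order; after \<open>k\<close> steps the sign changes and the opposite chambers follow.\<close>

definition U :: "nat \<Rightarrow> 'a" where "U i = (if even (i div k) then 1 else - 1) *\<^sub>R u (mid (i mod k))"

definition sg :: "nat \<Rightarrow> nat \<Rightarrow> real" where "sg i d = (if even (i div k) = (i mod k \<le> d) then 1 else - 1)"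

lemma mod_k_less: "i mod k < k"
  using k_ge_2 by simp

lemma sgn_ray_U: "d < k \<Longrightarrow> sgn (ray (tau d) \<bullet> U i) = sg i d"
  using mid_less[of "i mod k" d] less_mid[of d "i mod k"] mod_k_less[of i]
  unfolding U_def sg_def by (cases "i mod k \<le> d") (auto simp: ray_u)

text \<open>Consecutive indices are separated by one line. When \<open>i mod k\<close> falls back
  from \<open>k - 1\<close> to \<open>0\<close>, the change of the global sign compensates for the
  jump of \<open>mid\<close>.\<close>

lemma sg_Suc: "d < k \<Longrightarrow> sg (Suc i) d = (if d = i mod k then - sg i d else sg i d)"
proof -
  assume d: "d < k"
  show ?thesis
  proof (cases "Suc (i mod k) = k")
    case True
    then have "Suc i mod k = 0" "Suc i div k = Suc (i div k)" by (auto simp: mod_Suc div_Suc)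
    then show ?thesis using True d unfolding sg_def by auto
  next
    case False
    then have "Suc i mod k = Suc (i mod k)" "Suc i div k = i div k" by (auto simp: mod_Suc div_Suc)
    then show ?thesis using d unfolding sg_def by auto
  qed
qed

lemma sg_cases: "sg i d = 1 \<or> sg i d = - 1"
  unfolding sg_def by auto

lemma U_W: "U i \<in> W"
  unfolding U_def using u_W subspace_W by (intro subspace_scale)

lemma chamber_point:
  obtains \<epsilon> where "0 < \<epsilon>" "regular (x0 + \<epsilon> *\<^sub>R U i)"
    "\<And>\<beta>. root \<beta> \<Longrightarrow> \<beta> \<bullet> x0 \<noteq> 0 \<Longrightarrow> sgn (\<beta> \<bullet> (x0 + \<epsilon> *\<^sub>R U i)) = sgn (\<beta> \<bullet> x0)"
proof -
  obtain \<epsilon> where e: "0 < \<epsilon>" "\<And>\<beta>. root \<beta> \<Longrightarrow> \<beta> \<bullet> x0 \<noteq> 0 \<Longrightarrow> sgn (\<beta> \<bullet> (x0 + \<epsilon> *\<^sub>R U i)) = sgn (\<beta> \<bullet> x0)"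
    using perturbation[OF finite_R, of x0 "U i"] by blast
  have "regular (x0 + \<epsilon> *\<^sub>R U i)"
  proof (rule regularI)
    show "x0 + \<epsilon> *\<^sub>R U i \<in> W" using x0_W U_W subspace_W by (intro subspace_add subspace_scale)
    fix \<beta> assume b: "root \<beta>"
    show "\<beta> \<bullet> (x0 + \<epsilon> *\<^sub>R U i) \<noteq> 0"
    proof (cases "\<beta> \<bullet> x0 = 0")
      case True
      then obtain d c where "d < k" "c \<noteq> 0" "\<beta> = c *\<^sub>R ray (tau d)" using root_plane[OF b] by blast
      then show ?thesis using sgn_ray_U[of d i] sg_cases[of i d] e(1) ray_x0
        by (auto simp: inner_add_right)
    next
      case False
      then show ?thesis using e(2)[OF b] by (metis sgn_0 sgn_zero_iff)
    qed
  qed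
  then show ?thesis using that e by blast
qed

definition Q :: "real \<Rightarrow> 'a set" where "Q v = {f\<in>F. f \<bullet> x0 = v}"

definition L :: "nat \<Rightarrow> 'a \<Rightarrow> 'a \<Rightarrow> bool" where "L i q q' \<longleftrightarrow> q \<bullet> U i < q' \<bullet> U i"

definition dir :: "'a \<Rightarrow> 'a \<Rightarrow> nat" where
  "dir q q' = (THE d. d < k \<and> (\<exists>c. c \<noteq> 0 \<and> q' - q = c *\<^sub>R ray (tau d)))"

lemma dirI: "d < k \<Longrightarrow> c \<noteq> 0 \<Longrightarrow> q' - q = c *\<^sub>R ray (tau d) \<Longrightarrow> dir q q' = d"
  unfolding dir_def by (rule the_equality) (use scale_ray_eq(2) tau_eq_iff in \<open>metis+\<close>)

lemma dir_ex:
  assumes "q \<in> Q v" "q' \<in> Q v" "q \<noteq> q'"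
  obtains c where "c \<noteq> 0" "q' - q = c *\<^sub>R ray (tau (dir q q'))" "dir q q' < k"
proof -
  have "root (q' - q)" "(q' - q) \<bullet> x0 = 0" using assms F_diff unfolding Q_def by (auto simp: inner_diff_left)
  then obtain d c where "d < k" "c \<noteq> 0" "q' - q = c *\<^sub>R ray (tau d)" using root_plane by blast
  then show ?thesis using that dirI by blast
qed

lemma L_iff: "q' - q = c *\<^sub>R ray (tau d) \<Longrightarrow> d < k \<Longrightarrow> L i q q' \<longleftrightarrow> 0 < c * sg i d"
proof -
  assume *: "q' - q = c *\<^sub>R ray (tau d)" "d < k"
  have "L i q q' \<longleftrightarrow> 0 < (q' - q) \<bullet> U i" unfolding L_def by (simp add: inner_diff_left)
  also have "\<dots> \<longleftrightarrow> 0 < c * (ray (tau d) \<bullet> U i)" using * by simp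
  also have "\<dots> \<longleftrightarrow> 0 < c * sg i d"
    unfolding sgn_ray_U[OF *(2), of i, symmetric] by (simp add: zero_less_mult_iff)
  finally show ?thesis .
qed

lemma L_0: "q \<in> Q v \<Longrightarrow> q' \<in> Q v \<Longrightarrow> L 0 q q' \<longleftrightarrow> q \<bullet> w < q' \<bullet> w"
proof (cases "q = q'")
  case False
  assume q: "q \<in> Q v" "q' \<in> Q v"
  obtain c where c: "c \<noteq> 0" "q' - q = c *\<^sub>R ray (tau (dir q q'))" "dir q q' < k" using dir_ex[OF q False] .
  have "q \<bullet> w < q' \<bullet> w \<longleftrightarrow> 0 < (q' - q) \<bullet> w" by (simp add: inner_diff_left)
  also have "\<dots> \<longleftrightarrow> 0 < c * (ray (tau (dir q q')) \<bullet> w)" using c by simp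
  also have "\<dots> \<longleftrightarrow> 0 < c" using ray_pos[of "tau (dir q q')"] tau_mem[OF c(3)] unfolding T_def 
    by (simp add: zero_less_mult_iff)
  also have "\<dots> \<longleftrightarrow> L 0 q q'" using L_iff[OF c(2,3), of 0] by (simp add: sg_def)
  finally show ?thesis by simp
qed (simp add: L_def)

text \<open>Of the walls of this chamber, those through \<open>x0\<close> in the plane are the line
  about to be passed and the one passed last. With the signs of the chamber, any other root of the
  plane is a positive combination of these two, which \<open>simple_extremal\<close> forbids for a
  simple root.\<close>

lemma simple_dir:
  assumes wi: "regular (x0 + \<epsilon> *\<^sub>R U i)" "0 < \<epsilon>" and D': "simple (x0 + \<epsilon> *\<^sub>R U i) D'" "d' \<in> D'" 
    and d: "d < k" and eq: "ray (tau d) = c *\<^sub>R d'"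
  shows "d = i mod k \<or> Suc d mod k = i mod k"
proof (rule ccontr)
  assume n: "\<not> ?thesis"
  let ?j = "i mod k" let ?w = "x0 + \<epsilon> *\<^sub>R U i"
  have j: "?j < k" by (rule mod_k_less)
  have pos: "0 < (sg i e *\<^sub>R ray (tau e)) \<bullet> ?w" "root (sg i e *\<^sub>R ray (tau e))" if e: "e < k" for e
  proof -
    have "sgn ((sg i e *\<^sub>R ray (tau e)) \<bullet> ?w) = sg i e * sg i e"
      using sgn_ray_U[OF e, of i] wi(2) ray_x0[of "tau e"] sg_cases[of i e] by (auto simp: inner_add_right sgn_mult)
    also have "\<dots> = 1" using sg_cases[of i e] by auto
    finally show "0 < (sg i e *\<^sub>R ray (tau e)) \<bullet> ?w" by (metis sgn_greater zero_less_one)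
    show "root (sg i e *\<^sub>R ray (tau e))" using root_of_scale[OF root_ray[OF e], of "sg i e"] sg_cases[of i e] by fastforce
  qed
  have no: False if e: "e < k" "e' < k" "e \<noteq> d" and comb: "ray (tau d) = a *\<^sub>R ray (tau e) + b *\<^sub>R ray (tau e')"
    and sgn: "0 < a * (sg i e * sg i d)" "0 < b * (sg i e' * sg i d)" for e e' a b
  proof -
    have sq: "sg i e * sg i e = 1" "sg i e' * sg i e' = 1" "sg i d * sg i d = 1" 
      using sg_cases[of i e] sg_cases[of i e'] sg_cases[of i d] by auto
    have "(c * sg i d) *\<^sub>R d' = sg i d *\<^sub>R ray (tau d)" using eq by simp
    also have "\<dots> = (a * (sg i e * sg i d)) *\<^sub>R (sg i e *\<^sub>R ray (tau e)) + (b * (sg i e' * sg i d)) *\<^sub>R (sg i e' *\<^sub>R ray (tau e'))"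
    proof -
      have "a * (sg i e * sg i d) * sg i e = sg i d * a * (sg i e * sg i e)" 
        "b * (sg i e' * sg i d) * sg i e' = sg i d * b * (sg i e' * sg i e')" by (simp_all only: ac_simps)
      then have "a * (sg i e * sg i d) * sg i e = sg i d * a" "b * (sg i e' * sg i d) * sg i e' = sg i d * b" 
        unfolding sq by simp_all
      then show ?thesis unfolding comb by (simp only: scaleR_add_right scaleR_scaleR)
    qed
    finally obtain c' where "c' > 0" "sg i e *\<^sub>R ray (tau e) = c' *\<^sub>R d'"
      using simple_extremal[OF D' sgn pos(2)[OF e(1)] pos(2)[OF e(2)] pos(1)[OF e(1)] pos(1)[OF e(2)]] by blast
    then have "(c * sg i e) *\<^sub>R ray (tau e) = c' *\<^sub>R ray (tau d)" using eq by (metis mult.commute scaleR_scaleR)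
    moreover have "c * sg i e \<noteq> 0" using eq ray_nz[of "tau d"] sg_cases[of i e] by auto
    ultimately show False using scale_ray_eq(2) tau_eq_iff e d by metis
  qed
  \<comment> \<open>The map \<open>ray\<close> is affine, so the coefficients are the barycentric
    coordinates of \<open>x\<close> with respect to \<open>y\<close> and \<open>z\<close>.\<close>
  have lin: "ray x = ((x - z) / (y - z)) *\<^sub>R ray y + ((y - x) / (y - z)) *\<^sub>R ray z" if "y \<noteq> z" for x y z
  proof -
    have 1: "((x - z) / (y - z)) * y + ((y - x) / (y - z)) * z = x"
      using that by (simp add: add_divide_distrib[symmetric] divide_eq_eq algebra_simps)
    have "(x - z) / (y - z) + (y - x) / (y - z) = 1"
      using that by (simp add: add_divide_distrib[symmetric])
    then have "((x - z) / (y - z)) * (1 - y) + ((y - x) / (y - z)) * (1 - z) = 1 - x"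
      using 1 by (simp only: right_diff_distrib)
    note 2 = this 1
    define p q where "p = (x - z) / (y - z)" and "q = (y - x) / (y - z)"
    have pq: "p * (1 - y) + q * (1 - z) = 1 - x" "p * y + q * z = x" using 2 unfolding p_def q_def by auto
    have "p *\<^sub>R ray y + q *\<^sub>R ray z = (p * (1 - y) + q * (1 - z)) *\<^sub>R s + (p * y + q * z) *\<^sub>R t"
      unfolding ray_def by (simp add: scaleR_add_right scaleR_left_distrib)
    then show ?thesis unfolding pq unfolding p_def q_def ray_def by simp
  qed
  have dj: "d \<noteq> ?j" "?j = 0 \<Longrightarrow> d \<noteq> k - 1" "0 < ?j \<Longrightarrow> d \<noteq> ?j - 1"
  proof -
    show "d \<noteq> ?j" using n by auto
    show "d \<noteq> k - 1" if "?j = 0" using n that k_ge_2 by auto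
    show "d \<noteq> ?j - 1" if "0 < ?j"
    proof
      assume "d = ?j - 1"
      then have "Suc d = ?j" using that by simp
      then show False using n j by simp
    qed
  qed
  show False
  proof (cases "?j = 0")
    case True
    have 1: "tau 0 < tau d" "tau d < tau (k - 1)"
      using tau_less_iff[of 0 d] tau_less_iff[of d "k - 1"] dj True d by auto
    show False
    proof (rule no)
      show "ray (tau d) = ((tau d - tau (k-1)) / (tau 0 - tau (k-1))) *\<^sub>R ray (tau 0) + ((tau 0 - tau d) / (tau 0 - tau (k-1))) *\<^sub>R ray (tau (k-1))"
        by (rule lin) (use 1 in auto)
      show "0 < (tau d - tau (k-1)) / (tau 0 - tau (k-1)) * (sg i 0 * sg i d)"
        "0 < (tau 0 - tau d) / (tau 0 - tau (k-1)) * (sg i (k-1) * sg i d)"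
        using 1 True unfolding sg_def by (auto intro: divide_neg_neg)
    qed (use k_ge_2 True dj in auto)
  next
    case False
    then have jj: "tau (?j - 1) < tau ?j" "?j - 1 < k" using tau_less_iff[of "?j - 1" "?j"] j by auto
    show False
    proof (cases "?j < d")
      case True
      then have 1: "tau ?j < tau d" using tau_less_iff j d by blast
      show False
      proof (rule no)
        show "ray (tau d) = ((tau d - tau (?j - 1)) / (tau ?j - tau (?j - 1))) *\<^sub>R ray (tau ?j) + ((tau ?j - tau d) / (tau ?j - tau (?j - 1))) *\<^sub>R ray (tau (?j - 1))"
          by (rule lin) (use jj in auto)
        show "0 < (tau d - tau (?j - 1)) / (tau ?j - tau (?j - 1)) * (sg i ?j * sg i d)"
          "0 < (tau ?j - tau d) / (tau ?j - tau (?j - 1)) * (sg i (?j - 1) * sg i d)"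
          using 1 jj True False unfolding sg_def by (auto simp: divide_less_0_iff)
      qed (use j jj dj in auto)
    next
      case F: False
      then have dd: "d < ?j - 1" using dj False by auto
      then have 1: "tau d < tau (?j - 1)" using tau_less_iff[of d "?j - 1"] jj d by blast
      show False
      proof (rule no)
        show "ray (tau d) = ((tau d - tau (?j - 1)) / (tau ?j - tau (?j - 1))) *\<^sub>R ray (tau ?j) + ((tau ?j - tau d) / (tau ?j - tau (?j - 1))) *\<^sub>R ray (tau (?j - 1))"
          by (rule lin) (use jj in auto)
        show "0 < (tau d - tau (?j - 1)) / (tau ?j - tau (?j - 1)) * (sg i ?j * sg i d)"
          "0 < (tau ?j - tau d) / (tau ?j - tau (?j - 1)) * (sg i (?j - 1) * sg i d)"
          using 1 jj dd False unfolding sg_def by (auto simp: divide_less_0_iff)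
      qed (use j jj dj in auto)
    qed
  qed
qed

text \<open>For small \<open>\<epsilon>\<close> the value at \<open>x0\<close> dominates the order
  along \<open>x0 + \<epsilon> U i\<close>, and on one level the order is that of
  \<open>U i\<close>. So neighbours in \<open>Q v\<close> are neighbours in \<open>F\<close>, and
  \<open>F_consec\<close> applies.\<close>

lemma dir_consec:
  assumes q: "q \<in> Q v" "q' \<in> Q v" "L i q q'" "\<forall>z\<in>Q v. \<not> (L i q z \<and> L i z q')"
  shows "dir q q' = i mod k \<or> Suc (dir q q') mod k = i mod k"
proof -
  obtain \<epsilon> where e: "0 < \<epsilon>" "regular (x0 + \<epsilon> *\<^sub>R U i)"
    "\<And>\<beta>. root \<beta> \<Longrightarrow> \<beta> \<bullet> x0 \<noteq> 0 \<Longrightarrow> sgn (\<beta> \<bullet> (x0 + \<epsilon> *\<^sub>R U i)) = sgn (\<beta> \<bullet> x0)"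
    using chamber_point[of i] by blast
  let ?w = "x0 + \<epsilon> *\<^sub>R U i"
  have ne: "q \<noteq> q'" using q(3) unfolding L_def by auto
  have inQ: "f \<bullet> ?w < g \<bullet> ?w \<longleftrightarrow> L i f g" if "f \<in> Q v" "g \<in> Q v" for f g
    using that e(1) unfolding Q_def L_def by (simp add: inner_add_right)
  have outQ: "f \<bullet> ?w < g \<bullet> ?w \<longleftrightarrow> f \<bullet> x0 < g \<bullet> x0" if "f \<in> F" "g \<in> F" "f \<bullet> x0 \<noteq> g \<bullet> x0" for f g
  proof -
    have "root (g - f)" using F_diff that by auto
    moreover have "(g - f) \<bullet> x0 \<noteq> 0" using that by (simp add: inner_diff_left)
    ultimately have s: "sgn ((g - f) \<bullet> ?w) = sgn ((g - f) \<bullet> x0)" by (rule e(3))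
    have "f \<bullet> ?w < g \<bullet> ?w \<longleftrightarrow> 0 < sgn ((g - f) \<bullet> ?w)" by (simp add: inner_diff_left)
    also have "\<dots> \<longleftrightarrow> f \<bullet> x0 < g \<bullet> x0" unfolding s by (simp add: inner_diff_left)
    finally show ?thesis .
  qed
  have cons: "\<forall>h\<in>F. \<not> (q \<bullet> ?w < h \<bullet> ?w \<and> h \<bullet> ?w < q' \<bullet> ?w)"
  proof (intro ballI notI)
    fix h assume h: "h \<in> F" "q \<bullet> ?w < h \<bullet> ?w \<and> h \<bullet> ?w < q' \<bullet> ?w"
    have qv: "q \<in> F" "q' \<in> F" "q \<bullet> x0 = v" "q' \<bullet> x0 = v" using q unfolding Q_def by auto
    show False
    proof (cases "h \<bullet> x0 = v")
      case True
      then have "h \<in> Q v" using h unfolding Q_def by simp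
      then show False using h q inQ by blast
    next
      case False
      then show False using outQ[of q h] outQ[of h q'] h qv by auto
    qed
  qed
  have reg: "?w \<in> W" "\<forall>r\<in>R. r \<bullet> ?w \<noteq> 0" using e(2) unfolding regular_def by auto
  obtain D' where D': "simple ?w D'" using simple_ex[OF reg] by blast
  have "\<exists>d\<in>D'. \<exists>c>0. q' - q = c *\<^sub>R d"
    using F_consec[OF reg D', of q q'] cons q inQ unfolding Q_def by blast
  then obtain d' c' where d': "d' \<in> D'" "c' > 0" "q' - q = c' *\<^sub>R d'" by blast
  obtain c where c: "c \<noteq> 0" "q' - q = c *\<^sub>R ray (tau (dir q q'))" "dir q q' < k" using dir_ex[OF q(1,2) ne] .
  have "(1/c) *\<^sub>R (c *\<^sub>R ray (tau (dir q q'))) = (1/c) *\<^sub>R (c' *\<^sub>R d')" using c d' by simp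
  then have "ray (tau (dir q q')) = (c'/c) *\<^sub>R d'" using c by simp
  then show ?thesis using simple_dir[OF e(2,1) D' d'(1) c(3)] by blast
qed

lemma dir_sym:
  assumes q: "q \<in> Q v" "q' \<in> Q v"
  shows "dir q q' = dir q' q"
proof (cases "q = q'")
  case False
  obtain c where c: "c \<noteq> 0" "q' - q = c *\<^sub>R ray (tau (dir q q'))" "dir q q' < k" using dir_ex[OF q(1,2) False] .
  have "q - q' = (- c) *\<^sub>R ray (tau (dir q q'))" using c(2) by (metis minus_diff_eq scaleR_minus_left)
  then show ?thesis using dirI[of "dir q q'" "- c" q q'] c by simp
qed simp

theorem allowable: "3 \<le> k \<Longrightarrow> allowable_sequence (Q v) k L dir"
proof (unfold_locales, goal_cases)
  case 1 then show ?case using finite_F unfolding Q_def by simp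
next
  case 2 then show ?case .
next
  case (3 q i) then show ?case unfolding L_def by simp
next
  case (4 q q' q'' i) then show ?case unfolding L_def by simp
next
  case (5 q q' i)
  obtain c where c: "c \<noteq> 0" "q' - q = c *\<^sub>R ray (tau (dir q q'))" "dir q q' < k" using dir_ex[OF 5(2-4)] .
  then have "(q' - q) \<bullet> U i \<noteq> 0" using sgn_ray_U[OF c(3), of i] sg_cases[of i "dir q q'"] by auto
  then show ?case unfolding L_def by (auto simp: inner_diff_left)
next
  case (6 q q') then show ?case using dir_ex by metis
next
  case (7 q q') then show ?case using dir_sym by blast
next
  case (8 q q' q'')
  obtain c where c: "c \<noteq> 0" "q' - q = c *\<^sub>R ray (tau (dir q q'))" "dir q q' < k" using dir_ex[OF 8(2,3,5)] .
  obtain c' where c': "c' \<noteq> 0" "q'' - q' = c' *\<^sub>R ray (tau (dir q' q''))" using dir_ex[OF 8(3,4,6)] .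
  have eq: "q'' - q = (c + c') *\<^sub>R ray (tau (dir q q'))"
  proof -
    have "q'' - q = (q' - q) + (q'' - q')" by simp
    also have "\<dots> = (c + c') *\<^sub>R ray (tau (dir q q'))" using c(2) c'(2) 8(8) by (simp add: scaleR_left_distrib)
    finally show ?thesis .
  qed
  moreover have "c + c' \<noteq> 0" using eq 8(7) by auto
  ultimately show ?case using dirI c(3) by blast
next
  case (9 q q' i)
  obtain c where c: "c \<noteq> 0" "q' - q = c *\<^sub>R ray (tau (dir q q'))" "dir q q' < k" using dir_ex[OF 9(2-4)] .
  have c2: "q - q' = (- c) *\<^sub>R ray (tau (dir q q'))" using c(2) by (metis minus_diff_eq scaleR_minus_left)
  show ?case using L_iff[OF c(2,3)] L_iff[OF c2 c(3)] sg_Suc[OF c(3), of i] by simp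
next
  case (10 q q' i) then show ?case using dir_consec by blast
qed

text \<open>If the plane contains only the lines of \<open>s\<close> and \<open>t\<close>, no
  difference of two points can have positive coefficients at both.\<close>

lemma same_direction:
  assumes "k = 2" and q: "q \<in> Q v" "q' \<in> Q v" "q'' \<in> Q v" and d: "q' - q = c *\<^sub>R s" "q'' - q' = c' *\<^sub>R t" and c: "c > 0" "c' > 0"
  shows False
proof -
  have "(q'' - q) = c *\<^sub>R s + c' *\<^sub>R t" using d by (metis add.commute diff_add_cancel add_diff_eq)
  then have e: "(q'' - q) \<bullet> dual_vec D s = c" "(q'' - q) \<bullet> dual_vec D t = c'"
    using dual_eq[OF sD] dual_eq[OF tD] st by (auto simp: inner_add_left)
  then have ne: "q \<noteq> q''" using c by auto
  obtain b where b: "q'' - q = b *\<^sub>R ray (tau (dir q q''))" "dir q q'' < k" using dir_ex[OF q(1,3) ne] .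
  then have "dir q q'' = 0 \<or> dir q q'' = k - 1" using assms(1) by auto
  then have "tau (dir q q'') = 0 \<or> tau (dir q q'') = 1" using tau_0 tau_last by auto
  then show False using e b(1) c by (auto simp: ray_dual)
qed

end

section \<open>The word of a chamber\<close>

lemma ex_increasing_enum:
  fixes g :: "'b \<Rightarrow> real"
  assumes "finite F" "inj_on g F"
  shows "\<exists>e. bij_betw e {..<card F} F \<and> (\<forall>i j. i < j \<longrightarrow> j < card F \<longrightarrow> g (e i) < g (e j))"
proof -
  let ?l = "sorted_list_of_set (g ` F)"
  have len: "length ?l = card F" using assms by (simp add: card_image)
  have set: "set ?l = g ` F" using assms by simp
  define e where "e i = inv_into F g (?l ! i)" for i
  have ge: "g (e i) = ?l ! i" "e i \<in> F" if "i < card F" for i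
    using that nth_mem[of i ?l] len set unfolding e_def 
    by (metis f_inv_into_f, metis inv_into_into)
  have less: "g (e i) < g (e j)" if "i < j" "j < card F" for i j
    using that ge[of i] ge[of j] sorted_wrt_nth_less[OF strict_sorted_list_of_set, of i j "g ` F"] len by simp
  have inj: "inj_on e {..<card F}"
  proof (rule inj_onI)
    fix i j assume "i \<in> {..<card F}" "j \<in> {..<card F}" "e i = e j"
    then show "i = j" using less[of i j] less[of j i] by (cases i j rule: linorder_cases) auto
  qed
  have "e ` {..<card F} = F"
    by (rule card_subset_eq) (use ge assms inj in \<open>auto simp: card_image\<close>)
  then show ?thesis using inj less unfolding bij_betw_def by blast
qed

context fibred_arrangement
begin

text \<open>Number of roots in the plane of two simple roots up to scaling. In a Coxeter arrangement
  it is the order of the product of the two reflections.\<close>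

definition order2 :: "'a \<Rightarrow> 'a \<Rightarrow> nat" where
  "order2 s t = card {\<tau>. 0 \<le> \<tau> \<and> \<tau> \<le> 1 \<and> root ((1 - \<tau>) *\<^sub>R s + \<tau> *\<^sub>R t)}"

lemma order2_sym: "order2 s t = order2 t s"
proof -
  have "bij_betw (\<lambda>\<tau>. 1 - \<tau>) {\<tau>. 0 \<le> \<tau> \<and> \<tau> \<le> 1 \<and> root ((1 - \<tau>) *\<^sub>R s + \<tau> *\<^sub>R t)}
     {\<tau>. 0 \<le> \<tau> \<and> \<tau> \<le> 1 \<and> root ((1 - \<tau>) *\<^sub>R t + \<tau> *\<^sub>R s)}"
    by (rule bij_betw_byWitness[where f' = "\<lambda>\<tau>. 1 - \<tau>"]) (auto simp: add.commute)
  then show ?thesis unfolding order2_def by (rule bij_betw_same_card)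
qed

lemma inner_inj: "regular w \<Longrightarrow> inj_on (\<lambda>f. f \<bullet> w) F"
proof (rule inj_onI, rule ccontr)
  fix f g assume "regular w" "f \<in> F" "g \<in> F" "f \<bullet> w = g \<bullet> w" "f \<noteq> g"
  then show False using F_diff regular_root[of w "f - g"] by (auto simp: inner_diff_left)
qed

end

locale chamber_word = fibred_arrangement W R F
  for W R F :: "'a::euclidean_space set" +
  fixes w :: 'a and D :: "'a set" and e :: "nat \<Rightarrow> 'a"
  assumes regular_w: "regular w" and simple_w: "simple w D"
    and bij_e: "bij_betw e {..<card F} F"
    and e_less: "i < j \<Longrightarrow> j < card F \<Longrightarrow> e i \<bullet> w < e j \<bullet> w"
begin

lemma e_F: "i < card F \<Longrightarrow> e i \<in> F"
  using bij_e unfolding bij_betw_def by auto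

lemma e_surj: "f \<in> F \<Longrightarrow> \<exists>i<card F. f = e i"
  using bij_e unfolding bij_betw_def by auto

lemma e_less_iff: "i < card F \<Longrightarrow> j < card F \<Longrightarrow> e i \<bullet> w < e j \<bullet> w \<longleftrightarrow> i < j"
  by (metis e_less less_asym less_irrefl linorder_neqE_nat)

definition letter :: "nat \<Rightarrow> 'a" where
  "letter i = (SOME d. d \<in> D \<and> (\<exists>c>0. e (Suc i) - e i = c *\<^sub>R d))"

lemma letter:
  assumes "Suc i < card F"
  shows "letter i \<in> D" "\<exists>c>0. e (Suc i) - e i = c *\<^sub>R letter i"
proof -
  have "\<forall>h\<in>F. \<not> (e i \<bullet> w < h \<bullet> w \<and> h \<bullet> w < e (Suc i) \<bullet> w)"
  proof (intro ballI notI)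
    fix h assume "h \<in> F" and h: "e i \<bullet> w < h \<bullet> w \<and> h \<bullet> w < e (Suc i) \<bullet> w"
    then obtain j where "j < card F" "h = e j" using e_surj by blast
    then show False using h e_less_iff[of i j] e_less_iff[of j "Suc i"] assms by auto
  qed
  then have "\<exists>d\<in>D. \<exists>c>0. e (Suc i) - e i = c *\<^sub>R d"
    using F_consec[of w D "e i" "e (Suc i)"] regular_w simple_w e_F assms e_less[of i "Suc i"]
    unfolding regular_def by auto
  then have "letter i \<in> D \<and> (\<exists>c>0. e (Suc i) - e i = c *\<^sub>R letter i)"
    unfolding letter_def by (intro someI_ex[of "\<lambda>d. d \<in> D \<and> (\<exists>c>0. e (Suc i) - e i = c *\<^sub>R d)"]) blast
  then show "letter i \<in> D" "\<exists>c>0. e (Suc i) - e i = c *\<^sub>R letter i" by auto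
qed

lemma dual_eq: "d \<in> D \<Longrightarrow> d \<bullet> dual_vec D d' = (if d = d' then 1 else 0)"
  by (rule dual_vec(2)[OF simpleD(1)[OF simple_w]])

end

locale chamber_word_view = chamber_word W R F w D e + rank_two_view W R F w D s t
  for W R F :: "'a::euclidean_space set" and w D e s t
begin

lemma k_order2: "k = order2 s t"
  unfolding k_def order2_def T_def ray_def ..

lemma x0_step:
  assumes "Suc i < card F"
  shows "e i \<bullet> x0 \<le> e (Suc i) \<bullet> x0" "e (Suc i) \<bullet> x0 = e i \<bullet> x0 \<longleftrightarrow> letter i \<in> {s, t}"
proof -
  obtain c where c: "c > 0" "e (Suc i) - e i = c *\<^sub>R letter i" using letter[OF assms] by blast
  then have "(e (Suc i) - e i) \<bullet> x0 = c * (if letter i \<in> {s, t} then 0 else 1)"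
    using D_x0[OF letter(1)[OF assms]] by simp
  then show "e i \<bullet> x0 \<le> e (Suc i) \<bullet> x0" "e (Suc i) \<bullet> x0 = e i \<bullet> x0 \<longleftrightarrow> letter i \<in> {s, t}"
    using c(1) by (auto simp: inner_diff_left split: if_splits)
qed

lemma x0_mono: "i \<le> j \<Longrightarrow> j < card F \<Longrightarrow> e i \<bullet> x0 \<le> e j \<bullet> x0"
proof (induction j)
  case (Suc j)
  then show ?case using x0_step(1)[of j] by (cases "i = Suc j") auto
qed simp

text \<open>Whole levels of \<open>x0\<close>. By \<open>x0_step\<close> these are the maximal
  stretches of letters from \<open>s\<close> and \<open>t\<close>, so a view of a level is a view of
  such a stretch.\<close>

definition is_run :: "nat \<Rightarrow> nat \<Rightarrow> bool" where
  "is_run a b \<longleftrightarrow> a \<le> b \<and> b < card F \<and> (\<forall>j<card F. e j \<bullet> x0 = e a \<bullet> x0 \<longleftrightarrow> a \<le> j \<and> j \<le> b)"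

lemma ex_run: 
  assumes "i < card F" obtains a b where "is_run a b" "a \<le> i" "i \<le> b"
proof -
  define X where "X = {j. j < card F \<and> e j \<bullet> x0 = e i \<bullet> x0}"
  have fX: "finite X" "i \<in> X" unfolding X_def using assms by auto
  define a where "a = Min X"
  define b where "b = Max X"
  have "a \<in> X" "b \<in> X" unfolding a_def b_def using fX Min_in[OF fX(1)] Max_in[OF fX(1)] by blast+
  moreover have "\<And>j. j \<in> X \<Longrightarrow> a \<le> j \<and> j \<le> b" unfolding a_def b_def using fX by simp
  ultimately have ab: "a \<in> X" "b \<in> X" "a \<le> i" "i \<le> b" "\<And>j. j \<in> X \<Longrightarrow> a \<le> j \<and> j \<le> b"
    using fX by blast+
  have "j \<in> X" if "a \<le> j" "j \<le> b" for j
  proof -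
    have "b < card F" "e a \<bullet> x0 = e i \<bullet> x0" "e b \<bullet> x0 = e i \<bullet> x0" using ab unfolding X_def by auto
    then show ?thesis using that x0_mono[of a j] x0_mono[of j b] unfolding X_def by auto
  qed
  moreover have Xiff: "j \<in> X \<longleftrightarrow> e j \<bullet> x0 = e a \<bullet> x0" if "j < card F" for j
    using ab(1) that unfolding X_def by simp
  moreover have "a \<le> b" "b < card F" using ab(2,3,4) unfolding X_def by auto
  ultimately have "is_run a b" unfolding is_run_def using ab(5) by blast
  then show ?thesis using that ab by blast
qed

lemma is_runI:
  assumes "a \<le> b" "b < card F" "\<And>i. a \<le> i \<Longrightarrow> i < b \<Longrightarrow> letter i \<in> {s, t}"
    "a = 0 \<or> letter (a - 1) \<notin> {s, t}" "Suc b = card F \<or> letter b \<notin> {s, t}"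
  shows "is_run a b"
proof -
  have const: "e j \<bullet> x0 = e a \<bullet> x0" if "a \<le> j" "j \<le> b" for j
    using that
  proof (induction j)
    case (Suc j)
    show ?case
    proof (cases "a = Suc j")
      case False
      then have "letter j \<in> {s, t}" "e j \<bullet> x0 = e a \<bullet> x0" using assms(3)[of j] Suc by auto
      then show ?thesis using x0_step(2)[of j] Suc assms(2) by auto
    qed simp
  qed simp
  have lo: "e j \<bullet> x0 \<noteq> e a \<bullet> x0" if "j < a" for j
  proof -
    have a: "Suc (a - 1) = a" "letter (a - 1) \<notin> {s, t}" using that assms(4) by auto
    have "e (a - 1) \<bullet> x0 \<noteq> e a \<bullet> x0" "e (a - 1) \<bullet> x0 \<le> e a \<bullet> x0"
      using x0_step[of "a - 1"] a assms(1,2) by auto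
    moreover have "e j \<bullet> x0 \<le> e (a - 1) \<bullet> x0" using x0_mono[of j "a - 1"] that assms by auto
    ultimately show ?thesis by auto
  qed
  have hi: "e j \<bullet> x0 \<noteq> e a \<bullet> x0" if "b < j" "j < card F" for j
  proof -
    have "e b \<bullet> x0 \<noteq> e (Suc b) \<bullet> x0" "e b \<bullet> x0 \<le> e (Suc b) \<bullet> x0"
      using x0_step[of b] that assms(5) by auto
    moreover have "e (Suc b) \<bullet> x0 \<le> e j \<bullet> x0" using x0_mono[of "Suc b" j] that by auto
    ultimately show ?thesis using const[of b] assms(1) by auto
  qed
  show ?thesis unfolding is_run_def using assms(1,2) const lo hi by (meson not_le)
qed

lemma run_letters:
  assumes "is_run a b"
  shows "a \<le> i \<Longrightarrow> i < b \<Longrightarrow> letter i \<in> {s, t}"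
    and "0 < a \<Longrightarrow> letter (a - 1) \<notin> {s, t}" and "Suc b < card F \<Longrightarrow> letter b \<notin> {s, t}"
proof -
  have r: "a \<le> b" "b < card F" "\<And>j. j < card F \<Longrightarrow> e j \<bullet> x0 = e a \<bullet> x0 \<longleftrightarrow> a \<le> j \<and> j \<le> b"
    using assms unfolding is_run_def by auto
  show "letter i \<in> {s, t}" if "a \<le> i" "i < b"
  proof -
    have "e i \<bullet> x0 = e a \<bullet> x0" "e (Suc i) \<bullet> x0 = e a \<bullet> x0" using r(3)[of i] r(3)[of "Suc i"] that r by simp_all
    then have "e (Suc i) \<bullet> x0 = e i \<bullet> x0" by simp
    moreover have "Suc i < card F" using that r(2) by linarith
    ultimately show ?thesis using x0_step(2) by blast
  qed
  show "letter (a - 1) \<notin> {s, t}" if "0 < a"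
  proof -
    have "Suc (a - 1) = a" "a - 1 < card F" "\<not> a \<le> a - 1" using that r(1,2) by linarith+
    then have "e a \<bullet> x0 \<noteq> e (a - 1) \<bullet> x0" using r(3)[of "a - 1"] by metis
    moreover have "Suc (a - 1) < card F" using that r(1,2) by linarith
    ultimately show ?thesis using x0_step(2)[of "a - 1"] \<open>Suc (a - 1) = a\<close> by metis
  qed
  show "letter b \<notin> {s, t}" if "Suc b < card F"
  proof -
    have "e (Suc b) \<bullet> x0 \<noteq> e a \<bullet> x0" "e b \<bullet> x0 = e a \<bullet> x0" using r(3)[of "Suc b"] r(3)[of b] that r(1,2) by auto
    then show ?thesis using x0_step(2)[OF that] by metis
  qed
qed

lemma run_Q:
  assumes "is_run a b" shows "Q (e a \<bullet> x0) = e ` {a..b}"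
  using assms e_surj e_F unfolding Q_def is_run_def by (fastforce simp: image_iff)

lemma e_inj: "i < card F \<Longrightarrow> j < card F \<Longrightarrow> e i = e j \<longleftrightarrow> i = j"
  using bij_e unfolding bij_betw_def inj_on_def by auto

lemma run_card: "is_run a b \<Longrightarrow> card (Q (e a \<bullet> x0)) = Suc b - a"
  unfolding run_Q using e_inj by (subst card_image) (auto simp: inj_on_def is_run_def)

context
  fixes a b assumes r: "is_run a b" and k3: "3 \<le> k"
begin

interpretation A: allowable_sequence "Q (e a \<bullet> x0)" k L dir
  by (rule allowable[OF k3])

lemma ab: "a \<le> b" "b < card F"
  using r unfolding is_run_def by auto

lemma run_pos:
  assumes "a \<le> i" "i \<le> b" shows "A.pos 0 (e i) = i - a"
proof -
  have "{z \<in> Q (e a \<bullet> x0). L 0 z (e i)} = e ` {a..<i}"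
  proof -
    have Qe: "e j \<in> Q (e a \<bullet> x0)" if "a \<le> j" "j \<le> b" for j using run_Q[OF r] that by auto
    have "L 0 (e j) (e i) \<longleftrightarrow> j < i" if "a \<le> j" "j \<le> b" for j
      using L_0[OF Qe[OF that] Qe[OF assms]] e_less_iff[of j i] that assms ab by auto
    then show ?thesis unfolding run_Q[OF r] using assms by auto
  qed
  moreover have "inj_on e {a..<i}" using e_inj assms ab by (auto simp: inj_on_def)
  ultimately show ?thesis unfolding A.pos_def by (simp add: card_image)
qed

text \<open>At time \<open>0\<close> the direction about to be passed is \<open>0\<close>, which is
  \<open>s\<close> because \<open>tau 0 = 0\<close>; the letter \<open>t\<close> has the last
  direction \<open>k - 1\<close>.\<close>

lemma run_gap:
  assumes "a \<le> i" "i < b" shows "A.gap 0 (Suc i - a) \<longleftrightarrow> letter i = s"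
proof -
  have Qe: "e i \<in> Q (e a \<bullet> x0)" "e (Suc i) \<in> Q (e a \<bullet> x0)" using run_Q[OF r] assms by auto
  obtain c where c: "c > 0" "e (Suc i) - e i = c *\<^sub>R letter i" using letter[of i] ab assms by auto
  have "letter i = s \<or> letter i = t" using run_letters(1)[OF r] assms by auto
  then have "dir (e i) (e (Suc i)) = 0 \<longleftrightarrow> letter i = s"
  proof
    assume "letter i = s"
    then show ?thesis using dirI[of 0 c "e (Suc i)" "e i"] c k3 tau_0 ray_01 by auto
  next
    assume "letter i = t"
    then show ?thesis using dirI[of "k - 1" c "e (Suc i)" "e i"] c k3 tau_last ray_01 st by auto
  qed
  moreover have "Suc i - a = Suc (A.pos 0 (e i))" "A.pos 0 (e (Suc i)) = Suc (A.pos 0 (e i))"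
    using run_pos[of i] run_pos[of "Suc i"] assms by auto
  ultimately show ?thesis using A.gap_iff[of "e i" "e (Suc i)" 0] Qe by simp
qed

lemma run_neighbour:
  assumes "a \<le> i" "i < b"
  shows "(a < i \<and> letter (i - 1) \<noteq> letter i) \<or> (Suc i < b \<and> letter (Suc i) \<noteq> letter i)"
proof -
  have "0 < Suc i - a" "Suc i - a < card (Q (e a \<bullet> x0))" using assms run_card[OF r] by auto
  then have "(1 < Suc i - a \<and> A.gap 0 (Suc i - a - 1) \<noteq> A.gap 0 (Suc i - a)) \<or>
    (Suc (Suc i - a) < card (Q (e a \<bullet> x0)) \<and> A.gap 0 (Suc (Suc i - a)) \<noteq> A.gap 0 (Suc i - a))"
    by (rule A.gap_neighbour)
  then show ?thesis
  proof
    assume *: "1 < Suc i - a \<and> A.gap 0 (Suc i - a - 1) \<noteq> A.gap 0 (Suc i - a)"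
    then have i: "a < i" "Suc i - a - 1 = Suc (i - 1) - a" by linarith+
    then have "A.gap 0 (Suc (i - 1) - a) \<noteq> A.gap 0 (Suc i - a)" using * by simp
    moreover have "A.gap 0 (Suc (i - 1) - a) \<longleftrightarrow> letter (i - 1) = s" by (rule run_gap) (use i assms in auto)
    ultimately show ?thesis using run_gap[OF assms] i by metis
  next
    assume *: "Suc (Suc i - a) < card (Q (e a \<bullet> x0)) \<and> A.gap 0 (Suc (Suc i - a)) \<noteq> A.gap 0 (Suc i - a)"
    then have i: "Suc i < b" "Suc (Suc i - a) = Suc (Suc i) - a" using run_card[OF r] assms by linarith+
    then have "A.gap 0 (Suc (Suc i) - a) \<noteq> A.gap 0 (Suc i - a)" using * by simp
    moreover have "A.gap 0 (Suc (Suc i) - a) \<longleftrightarrow> letter (Suc i) = s" by (rule run_gap) (use i assms in auto)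
    ultimately show ?thesis using run_gap[OF assms] i by metis
  qed
qed

text \<open>By \<open>A.card_k\<close> there are \<open>k\<close> points, or \<open>k + 1\<close>
  with \<open>k\<close> even. Equal letters in the middle of five points reveal a centre and decide
  between the two.\<close>

lemma run_k:
  assumes "a < b"
  shows "(k = 3 \<longleftrightarrow> b = a + 2)" "b = a + 3 \<Longrightarrow> k = 4"
    "b = a + 4 \<Longrightarrow> letter (a + 1) = letter (a + 2) \<Longrightarrow> k = 4"
proof -
  have c: "card (Q (e a \<bullet> x0)) = Suc b - a" by (rule run_card[OF r])
  then have "2 \<le> card (Q (e a \<bullet> x0))" using assms by auto
  then have K: "card (Q (e a \<bullet> x0)) = k \<or> (card (Q (e a \<bullet> x0)) = Suc k \<and> even k)" by (rule A.card_k)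
  then show "k = 3 \<longleftrightarrow> b = a + 2" using K c k3 assms by presburger
  show "k = 4" if "b = a + 3" using K c that k3 by presburger
  show "k = 4" if b: "b = a + 4" and "letter (a + 1) = letter (a + 2)"
  proof -
    have "A.gap 0 2 = A.gap 0 (Suc 2)" using run_gap[of "a+1"] run_gap[of "a+2"] that by (simp add: numeral_2_eq_2 numeral_3_eq_3)
    then show ?thesis using A.card_k_double[of 2] c b by auto
  qed
qed

end

text \<open>A change of letter inside a run yields two points whose difference has positive
  coefficients at both \<open>s\<close> and \<open>t\<close>, but with \<open>k = 2\<close> there is
  no such root.\<close>

lemma run_constant:
  assumes "k = 2" "is_run a b" "a \<le> i" "Suc i < b" shows "letter (Suc i) = letter i"
proof (rule ccontr)
  assume ne: "letter (Suc i) \<noteq> letter i"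
  have ab: "b < card F" using assms unfolding is_run_def by auto
  have Qe: "e j \<in> Q (e a \<bullet> x0)" if "a \<le> j" "j \<le> b" for j using run_Q[OF assms(2)] that by auto
  obtain c where c: "c > 0" "e (Suc i) - e i = c *\<^sub>R letter i" using letter[of i] ab assms by auto
  obtain c' where c': "c' > 0" "e (Suc (Suc i)) - e (Suc i) = c' *\<^sub>R letter (Suc i)" using letter[of "Suc i"] ab assms by auto
  have "letter i \<in> {s, t}" "letter (Suc i) \<in> {s, t}" using run_letters(1)[OF assms(2)] assms by auto
  then consider "letter i = s" "letter (Suc i) = t" | "letter i = t" "letter (Suc i) = s" using ne by auto
  then show False
  proof cases
    case 1
    then show ?thesis using same_direction[OF assms(1) Qe Qe Qe, of i "Suc i" "Suc (Suc i)" c c'] c c' assms by auto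
  next
    case 2
    have "k = order2 t s" using k_order2 order2_sym by simp
    have "(e (Suc (Suc i)) - e i) = c' *\<^sub>R s + c *\<^sub>R t" using 2 c c' by (metis add.commute diff_add_cancel add_diff_eq)
    then have e: "(e (Suc (Suc i)) - e i) \<bullet> dual_vec D s = c'" "(e (Suc (Suc i)) - e i) \<bullet> dual_vec D t = c"
      using dual_eq[OF sD] dual_eq[OF tD] st by (auto simp: inner_add_left)
    then have "e i \<noteq> e (Suc (Suc i))" using c c' by auto
    then obtain b' where b': "e (Suc (Suc i)) - e i = b' *\<^sub>R ray (tau (dir (e i) (e (Suc (Suc i)))))" "dir (e i) (e (Suc (Suc i))) < k"
      using dir_ex[OF Qe Qe, of i "Suc (Suc i)"] assms by auto
    then have "dir (e i) (e (Suc (Suc i))) = 0 \<or> dir (e i) (e (Suc (Suc i))) = k - 1" using assms(1) by auto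
    then have "tau (dir (e i) (e (Suc (Suc i)))) = 0 \<or> tau (dir (e i) (e (Suc (Suc i)))) = 1" using tau_0 tau_last by auto
    then show False using e b'(1) c c' by (auto simp: ray_dual)
  qed
qed

end

context chamber_word
begin

definition adjacent :: "'a \<Rightarrow> 'a \<Rightarrow> bool" where
  "adjacent s t \<longleftrightarrow> s \<in> D \<and> t \<in> D \<and> s \<noteq> t \<and> 3 \<le> order2 s t"

lemma view: "s \<in> D \<Longrightarrow> t \<in> D \<Longrightarrow> s \<noteq> t \<Longrightarrow> chamber_word_view W R F w D e s t"
  by unfold_locales (use regular_w simple_w in auto)

lemma letter_adjacent_Suc:
  assumes i: "Suc (Suc i) < card F" and ne: "letter i \<noteq> letter (Suc i)"
  shows "adjacent (letter i) (letter (Suc i))"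
proof -
  have D: "letter i \<in> D" "letter (Suc i) \<in> D" using letter i by auto
  interpret V: chamber_word_view W R F w D e "letter i" "letter (Suc i)" by (rule view[OF D ne])
  obtain a b where ab: "V.is_run a b" "a \<le> i" "i \<le> b" using V.ex_run[of i] i by auto
  have "Suc i < b"
  proof (rule ccontr)
    assume "\<not> ?thesis"
    then have "b = i \<or> b = Suc i" using ab by linarith
    then show False using V.run_letters(3)[OF ab(1)] i by auto
  qed
  then have "V.k \<noteq> 2" using V.run_constant[OF _ ab(1,2)] ne by auto
  then show ?thesis using V.k_ge_2 V.k_order2 D ne unfolding adjacent_def by auto
qed

text \<open>In the run through position \<open>i\<close> in the plane of \<open>letter i\<close> and
  \<open>t\<close>, a different letter beside it can only be \<open>t\<close>.\<close>

lemma letter_neighbour: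
  assumes i: "Suc i < card F" and adj: "adjacent (letter i) t"
  shows "(0 < i \<and> letter (i - 1) = t) \<or> (Suc (Suc i) < card F \<and> letter (Suc i) = t)"
proof -
  interpret V: chamber_word_view W R F w D e "letter i" t using adj view unfolding adjacent_def by auto
  have k: "3 \<le> V.k" using adj V.k_order2 unfolding adjacent_def by simp
  obtain a b where ab: "V.is_run a b" "a \<le> i" "i \<le> b" using V.ex_run[of i] i by auto
  have ib: "i < b" using V.run_letters(3)[OF ab(1)] i ab(3) by (cases "i = b") auto
  have bF: "b < card F" using ab(1) unfolding V.is_run_def by auto
  have "(a < i \<and> letter (i - 1) \<noteq> letter i) \<or> (Suc i < b \<and> letter (Suc i) \<noteq> letter i)"
    by (rule V.run_neighbour[OF ab(1) k ab(2) ib])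
  then show ?thesis
  proof
    assume *: "a < i \<and> letter (i - 1) \<noteq> letter i"
    then have "letter (i - 1) \<in> {letter i, t}" by (intro V.run_letters(1)[OF ab(1)]) (use ib in auto)
    then show ?thesis using * by auto
  next
    assume *: "Suc i < b \<and> letter (Suc i) \<noteq> letter i"
    then have "letter (Suc i) \<in> {letter i, t}" by (intro V.run_letters(1)[OF ab(1)]) (use ab in auto)
    then show ?thesis using * bF by auto
  qed
qed

lemma letter_run:
  assumes adj: "adjacent s t" and ab: "a < b" "Suc b \<le> card F"
    and l: "\<And>i. a \<le> i \<Longrightarrow> i < b \<Longrightarrow> letter i = s \<or> letter i = t"
    and lo: "a = 0 \<or> (letter (a - 1) \<noteq> s \<and> letter (a - 1) \<noteq> t)"
    and hi: "Suc b = card F \<or> (letter b \<noteq> s \<and> letter b \<noteq> t)"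
  shows "(order2 s t = 3 \<longleftrightarrow> b = a + 2) \<and> (b = a + 3 \<longrightarrow> order2 s t = 4) \<and>
      (b = a + 4 \<and> letter (a + 1) = letter (a + 2) \<longrightarrow> order2 s t = 4)"
proof -
  interpret V: chamber_word_view W R F w D e s t using adj view unfolding adjacent_def by auto
  have k: "3 \<le> V.k" using adj V.k_order2 unfolding adjacent_def by simp
  have "V.is_run a b" by (rule V.is_runI) (use assms in auto)
  then show ?thesis using V.run_k[OF _ k ab(1)] V.k_order2 by auto
qed

text \<open>A fibre of \<open>card F\<close> points has \<open>card F - 1\<close> steps; this is the
  shift between the bounds of the two settings.\<close>

lemma path_word:
  assumes "3 \<le> card (letter ` {..<card F - 1})"
  shows "path_word letter (card F - 1) adjacent order2"
proof (unfold_locales, goal_cases)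
  case 1 then show ?case by (rule assms)
next
  case (2 s t) then show ?case unfolding adjacent_def using order2_sym by metis
next
  case (3 s) then show ?case unfolding adjacent_def by blast
next
  case (4 i t) 
  then have "Suc i < card F" by linarith
  then show ?case using letter_neighbour[of i t] 4 by auto
next
  case (5 i) then show ?case by (intro letter_adjacent_Suc) auto
next
  case (6 s t a b)
  then have "Suc b \<le> card F" "b = card F - 1 \<longleftrightarrow> Suc b = card F" by linarith+
  then show ?case using letter_run[of s t a b] 6 by simp
qed

end

section \<open>Crossing walls, and splitting off the simple roots that are not letters\<close>

lemma ex_not_orthogonal:
  fixes N :: "'a::real_inner set"
  assumes "finite N" "subspace S" "\<And>n. n \<in> N \<Longrightarrow> \<exists>x\<in>S. n \<bullet> x \<noteq> 0"
  shows "\<exists>x\<in>S. \<forall>n\<in>N. n \<bullet> x \<noteq> 0"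
  using assms(1,3)
proof (induction N)
  case empty
  then show ?case using subspace_0[OF assms(2)] by blast
next
  case (insert n N)
  then obtain x where x: "x \<in> S" "\<forall>n\<in>N. n \<bullet> x \<noteq> 0" by blast
  show ?case
  proof (cases "n \<bullet> x = 0")
    case True
    obtain y where y: "y \<in> S" "n \<bullet> y \<noteq> 0" using insert.prems by blast
    obtain \<epsilon> where e: "\<epsilon> > 0" "\<forall>r\<in>N. r \<bullet> x \<noteq> 0 \<longrightarrow> \<epsilon> * \<bar>r \<bullet> y\<bar> < \<bar>r \<bullet> x\<bar>"
      using perturbation_bound[OF insert.hyps(1)] by blast
    have "r \<bullet> (x + \<epsilon> *\<^sub>R y) \<noteq> 0" if "r \<in> N" for r
    proof
      assume "r \<bullet> (x + \<epsilon> *\<^sub>R y) = 0"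
      then have "r \<bullet> x = - (\<epsilon> * (r \<bullet> y))" by (simp add: inner_add_right)
      then have "\<bar>r \<bullet> x\<bar> = \<epsilon> * \<bar>r \<bullet> y\<bar>" using e(1) by (simp add: abs_mult)
      then show False using e(2) x(2) that by fastforce
    qed
    moreover have "n \<bullet> (x + \<epsilon> *\<^sub>R y) \<noteq> 0" using True y e(1) by (simp add: inner_add_right)
    moreover have "x + \<epsilon> *\<^sub>R y \<in> S" using x y assms(2) by (intro subspace_add subspace_scale)
    ultimately show ?thesis by blast
  qed (use x in blast)
qed

lemma sum_over_scaled:
  fixes D D' :: "'a::euclidean_space set"
  assumes "independent D" "independent D'" "span D = span D'" "\<And>d. d \<in> D \<Longrightarrow> \<phi> d \<in> D'" "inj_on \<phi> D"
  shows "\<phi> ` D = D'"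
proof (rule card_subset_eq)
  show "finite D'" using assms(2) by (rule finiteI_independent)
  have "card D = card D'" using assms(1-3) by (metis dim_eq_card_independent dim_span)
  then show "card (\<phi> ` D) = card D'" using assms(5) by (simp add: card_image)
qed (use assms(4) in auto)

context fibred_arrangement
begin

lemma ex_regular: "\<exists>w. regular w"
proof -
  have "\<exists>x\<in>W. \<forall>r\<in>R. r \<bullet> x \<noteq> 0"
    by (rule ex_not_orthogonal[OF finite_R subspace_W]) (metis R_W R_nz inner_eq_zero_iff subsetD)
  then show ?thesis unfolding regular_def by blast
qed

lemma regular_simple_ex: "regular w \<Longrightarrow> \<exists>D. simple w D"
  using simple_ex unfolding regular_def by blast

lemma ex_chamber_word: "regular w \<Longrightarrow> simple w D \<Longrightarrow> \<exists>e. chamber_word W R F w D e"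
proof -
  assume w: "regular w" and D: "simple w D"
  obtain e where e: "bij_betw e {..<card F} F" "\<forall>i j. i < j \<longrightarrow> j < card F \<longrightarrow> e i \<bullet> w < e j \<bullet> w"
    using ex_increasing_enum[OF finite_F inner_inj[OF w]] by blast
  have "chamber_word W R F w D e" by unfold_locales (use w D e in auto)
  then show ?thesis by blast
qed

text \<open>A point in the relative interior of the facet that belongs to \<open>d\<close>.\<close>

definition wall_point :: "'a set \<Rightarrow> 'a \<Rightarrow> 'a" where
  "wall_point D d = (\<Sum>e\<in>D - {d}. dual_vec D e)"

lemma wall_point:
  assumes D: "simple w D" and d: "d \<in> D"
  shows "wall_point D d \<in> W" "d \<bullet> wall_point D d = 0"
    "root \<gamma> \<Longrightarrow> 0 < \<gamma> \<bullet> w \<Longrightarrow> (\<nexists>c. \<gamma> = c *\<^sub>R d) \<Longrightarrow> 0 < \<gamma> \<bullet> wall_point D d"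
proof -
  note fD = simpleD(3)[OF D]
  show "wall_point D d \<in> W"
    unfolding wall_point_def using dual_W[OF D] subspace_W by (intro subspace_sum) auto
  have e: "e \<bullet> wall_point D d = (if e = d then 0 else 1)" if "e \<in> D" for e
  proof -
    have "e \<bullet> wall_point D d = (\<Sum>e'\<in>D - {d}. if e = e' then 1 else 0)"
      unfolding wall_point_def inner_sum_right
      by (intro sum.cong) (auto simp: dual_vec(2)[OF simpleD(1)[OF D] that])
    then show ?thesis using fD that by simp
  qed
  show "d \<bullet> wall_point D d = 0" using e[OF d] by simp
  show "0 < \<gamma> \<bullet> wall_point D d" if g: "root \<gamma>" "0 < \<gamma> \<bullet> w" "\<nexists>c. \<gamma> = c *\<^sub>R d"
  proof -
    define cf where "cf x = \<gamma> \<bullet> dual_vec D x" for x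
    have ex: "\<gamma> = (\<Sum>x\<in>D. cf x *\<^sub>R x)" unfolding cf_def by (rule simple_expand(1)[OF D root_W[OF g(1)]])
    have nn: "0 \<le> cf x" if "x \<in> D" for x unfolding cf_def by (rule simple_coeff_nonneg[OF D g(1,2) that])
    have "\<gamma> \<bullet> wall_point D d = (\<Sum>x\<in>D. cf x * (x \<bullet> wall_point D d))" by (subst ex) (simp add: inner_sum_left)
    also have "\<dots> = (\<Sum>x\<in>D - {d}. cf x)" using fD e by (intro sum.mono_neutral_cong_right) auto
    finally have eq: "\<gamma> \<bullet> wall_point D d = (\<Sum>x\<in>D - {d}. cf x)" .
    have "\<exists>x\<in>D - {d}. cf x \<noteq> 0"
    proof (rule ccontr)
      assume "\<not> ?thesis"
      then have "(\<Sum>x\<in>D. cf x *\<^sub>R x) = (\<Sum>x\<in>{d}. cf x *\<^sub>R x)" using fD d by (intro sum.mono_neutral_right) auto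
      then show False using ex g(3) by auto
    qed
    then obtain x where x: "x \<in> D - {d}" "0 < cf x" using nn by (metis DiffD1 order_less_le)
    then show ?thesis unfolding eq using nn fD by (intro sum_pos2[of _ x]) auto
  qed
qed

lemma simple_unique:
  assumes D: "simple w D" and D': "simple w D'" and d: "d \<in> D"
  shows "\<exists>d'\<in>D'. \<exists>c>0. d = c *\<^sub>R d'"
  by (rule wall_criterion[OF D' simpleD(4,5)[OF D d] wall_point(1,2)[OF D d]]) (use wall_point(3)[OF D d] in blast)

text \<open>\<open>w'\<close> lies in the chamber obtained from that of \<open>w\<close> by crossing the wall of \<open>s\<close>.\<close>

definition crossing :: "'a \<Rightarrow> 'a \<Rightarrow> 'a \<Rightarrow> bool" where
  "crossing w s w' \<longleftrightarrow> s \<bullet> w' < 0 \<and> (\<forall>\<beta>. root \<beta> \<longrightarrow> 0 < \<beta> \<bullet> w \<longrightarrow> (\<nexists>c. \<beta> = c *\<^sub>R s) \<longrightarrow> 0 < \<beta> \<bullet> w')"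

text \<open>A small step along \<open>- s\<close> from an inner point of the facet changes the sign
  of \<open>s\<close> and its multiples only.\<close>

lemma ex_crossing:
  assumes D: "simple w D" and s: "s \<in> D" and w: "regular w"
  obtains w' where "regular w'" "crossing w s w'"
proof -
  let ?p = "wall_point D s"
  obtain \<epsilon> where e: "\<epsilon> > 0" "\<And>\<beta>. root \<beta> \<Longrightarrow> \<beta> \<bullet> ?p \<noteq> 0 \<Longrightarrow> sgn (\<beta> \<bullet> (?p + \<epsilon> *\<^sub>R (- s))) = sgn (\<beta> \<bullet> ?p)"
    using perturbation[OF finite_R, of ?p "- s"] by blast
  let ?w = "?p + \<epsilon> *\<^sub>R (- s)"
  have ss: "s \<bullet> s > 0" using root_nz[OF simpleD(4)[OF D s]] by simp
  have sw: "s \<bullet> ?w < 0" using wall_point(2)[OF D s] ss e(1) by (simp add: inner_diff_right)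
  have pos: "0 < \<beta> \<bullet> ?w" if b: "root \<beta>" "0 < \<beta> \<bullet> w" "\<nexists>c. \<beta> = c *\<^sub>R s" for \<beta>
  proof -
    have p: "0 < \<beta> \<bullet> ?p" by (rule wall_point(3)[OF D s b])
    then have "sgn (\<beta> \<bullet> ?w) = sgn (\<beta> \<bullet> ?p)" by (intro e(2) b) simp
    then show ?thesis using p by (metis sgn_greater)
  qed
  have "crossing w s ?w" unfolding crossing_def using sw pos by blast
  moreover have "regular ?w"
  proof (rule regularI)
    show "?w \<in> W" using wall_point(1)[OF D s] root_W[OF simpleD(4)[OF D s]] subspace_W
      by (intro subspace_add subspace_scale subspace_neg)
    fix \<beta> assume b: "root \<beta>"
    show "\<beta> \<bullet> ?w \<noteq> 0"
    proof (cases "\<exists>c. \<beta> = c *\<^sub>R s")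
      case True
      then show ?thesis using sw root_nz[OF b] by auto
    next
      case False
      have "\<nexists>c. - \<beta> = c *\<^sub>R s" using False by (metis minus_minus scaleR_minus_left)
      moreover have "0 < \<beta> \<bullet> w \<or> 0 < - \<beta> \<bullet> w" using regular_root[OF w b] by (auto simp: not_less order_less_le)
      ultimately show ?thesis using pos[of \<beta>] pos[of "- \<beta>"] False b root_of_minus[of R \<beta>] 
        by (metis inner_minus_left less_irrefl neg_0_less_iff_less)
    qed
  qed
  ultimately show ?thesis using that by blast
qed

text \<open>Direction space of the affine hull of \<open>F\<close>. The aim is that in an
  irreducible arrangement no simple root lies outside it.\<close>

definition dspan :: "'a set" where "dspan = span {f - g | f g. f \<in> F \<and> g \<in> F}"

lemma dspan_W: "dspan \<subseteq> W"
  unfolding dspan_def using F_W subspace_W by (intro span_minimal) (auto intro: subspace_diff)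

end

context chamber_word
begin

lemma letter_U: "Suc i < card F \<Longrightarrow> letter i \<in> dspan"
proof -
  assume i: "Suc i < card F"
  obtain c where c: "c > 0" "e (Suc i) - e i = c *\<^sub>R letter i" using letter[OF i] by blast
  have "e (Suc i) - e i \<in> dspan" unfolding dspan_def using e_F[of i] e_F[of "Suc i"] i by (intro span_base) auto
  then have "(1/c) *\<^sub>R (c *\<^sub>R letter i) \<in> dspan" unfolding dspan_def c(2) by (rule span_scale)
  then show ?thesis using c(1) by simp
qed

lemma U_letters: "dspan = span (letter ` {..<card F - 1})"
proof
  have step: "e j - e i \<in> span (letter ` {..<card F - 1})" if "i \<le> j" "j < card F" for i j
    using that
  proof (induction j)
    case (Suc j)
    show ?case
    proof (cases "i = Suc j")
      case True
      then show ?thesis by (simp add: span_zero)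
    next
      case False
      then have IH: "e j - e i \<in> span (letter ` {..<card F - 1})" using Suc by auto
      obtain c where c: "e (Suc j) - e j = c *\<^sub>R letter j" using letter[of j] Suc by blast
      have eq: "e (Suc j) - e i = (e j - e i) + c *\<^sub>R letter j" using c by (simp add: algebra_simps)
      have "letter j \<in> span (letter ` {..<card F - 1})" using Suc.prems by (intro span_base) auto
      then show ?thesis unfolding eq by (intro span_add span_scale IH)
    qed
  qed (simp add: span_zero)
  have "f - g \<in> span (letter ` {..<card F - 1})" if fg: "f \<in> F" "g \<in> F" for f g
  proof -
    obtain i where i: "i < card F" "f = e i" using e_surj[OF fg(1)] by blast
    obtain j where j: "j < card F" "g = e j" using e_surj[OF fg(2)] by blast
    note ij = i(1) j(1) i(2) j(2)
    have "e j - e i \<in> span (letter ` {..<card F - 1})" if "j \<le> i"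
    proof -
      have "- (e i - e j) \<in> span (letter ` {..<card F - 1})" using step[OF that ij(1)] by (rule span_neg)
      then show ?thesis by simp
    qed
    then show ?thesis using step[of i j] step[of j i] ij by (cases "j \<le> i") (auto dest: span_neg)
  qed
  then show "dspan \<subseteq> span (letter ` {..<card F - 1})" unfolding dspan_def by (intro span_minimal) auto
  show "span (letter ` {..<card F - 1}) \<subseteq> dspan"
  proof (rule span_minimal)
    show "letter ` {..<card F - 1} \<subseteq> dspan" using letter_U by auto
    show "subspace dspan" unfolding dspan_def by simp
  qed
qed

text \<open>The letters belong to the independent set \<open>D\<close> and span
  \<open>dspan\<close>, so a further element of \<open>D\<close> cannot lie there.\<close>

lemma letter_iff_U: "d \<in> D \<Longrightarrow> d \<in> dspan \<longleftrightarrow> d \<in> letter ` {..<card F - 1}"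
proof
  assume d: "d \<in> D" "d \<in> dspan"
  show "d \<in> letter ` {..<card F - 1}"
  proof (rule ccontr)
    assume n: "d \<notin> letter ` {..<card F - 1}"
    have "letter ` {..<card F - 1} \<subseteq> D - {d}" using letter(1) n by auto
    then have "d \<in> span (D - {d})" using d(2) unfolding U_letters using span_mono by blast
    then show False using simpleD(1)[OF simple_w] d(1) unfolding dependent_def by blast
  qed
qed (use letter_U in auto)

text \<open>Otherwise \<open>t\<close> would be adjacent to the letter \<open>s\<close> and, by
  \<open>letter_neighbour\<close>, would itself occur in the word.\<close>

lemma order2_mixed:
  assumes s: "s \<in> D" "s \<in> dspan" and t: "t \<in> D" "t \<notin> dspan"
  shows "order2 s t = 2"
proof (rule ccontr)
  assume n: "order2 s t \<noteq> 2"
  have st: "s \<noteq> t" using s t by auto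
  interpret V: chamber_word_view W R F w D e s t by (rule view[OF s(1) t(1) st])
  have "3 \<le> order2 s t" using n V.k_ge_2 V.k_order2 by simp
  then have adj: "adjacent s t" unfolding adjacent_def using s t st by simp
  obtain i where i: "i < card F - 1" "s = letter i" using s letter_iff_U by auto
  have "(0 < i \<and> letter (i - 1) = t) \<or> (Suc (Suc i) < card F \<and> letter (Suc i) = t)"
    by (rule letter_neighbour) (use i adj in auto)
  then have "t \<in> dspan"
  proof
    assume *: "0 < i \<and> letter (i - 1) = t"
    then have "Suc (i - 1) < card F" using i by auto
    then show ?thesis using letter_U[of "i - 1"] * by simp
  next
    assume "Suc (Suc i) < card F \<and> letter (Suc i) = t"
    then show ?thesis using letter_U[of "Suc i"] by auto
  qed
  then show False using t by simp
qed

end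

context rank_two_view
begin

lemma tau_1_pos: "0 < tau 1"
  using tau_less[of 0 1] k_ge_2 tau_0 by simp

text \<open>In the plane of \<open>s\<close> and \<open>t\<close> the new chamber lies between the
  line of \<open>s\<close> and the next line \<open>tau 1\<close>. The point
  \<open>x0 + \<epsilon> u (tau 1)\<close> on this next line is the witness for
  \<open>wall_criterion\<close>.\<close>

lemma second_wall:
  assumes w': "regular w'" "crossing w s w'" and D': "simple w' D'"
  shows "\<exists>d'\<in>D'. \<exists>c>0. ray (tau 1) = c *\<^sub>R d'"
proof -
  have k1: "1 < k" using k_ge_2 by simp
  have npar: "\<nexists>c. c *\<^sub>R ray (tau d) = c' *\<^sub>R s" if "d < k" "d \<noteq> 0" "False" for d c' using that by simp
  have rs: "(\<exists>c'. c *\<^sub>R ray (tau d) = c' *\<^sub>R s) \<longleftrightarrow> d = 0" if "d < k" "c \<noteq> 0" for d c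
  proof
    assume "\<exists>c'. c *\<^sub>R ray (tau d) = c' *\<^sub>R s"
    then obtain c' where "c *\<^sub>R ray (tau d) = c' *\<^sub>R ray (tau 0)" using tau_0 ray_01 by auto
    then show "d = 0" using scale_ray_eq(2) that tau_eq_iff[of d 0] k1 by fastforce
  qed (use tau_0 ray_01 in auto)
  have sp: "0 < ray (tau d) \<bullet> w" if "d < k" for d 
    using tau_mem[OF that] unfolding T_def by (intro ray_pos) auto
  have cr: "s \<bullet> w' < 0" "\<And>\<beta>. root \<beta> \<Longrightarrow> 0 < \<beta> \<bullet> w \<Longrightarrow> (\<nexists>c. \<beta> = c *\<^sub>R s) \<Longrightarrow> 0 < \<beta> \<bullet> w'"
    using w'(2) unfolding crossing_def by auto
  have rayw': "0 < ray (tau d) \<bullet> w'" if "d < k" "d \<noteq> 0" for d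
    by (rule cr(2)[OF root_ray[OF that(1)] sp[OF that(1)]]) (use rs[of d 1] that in auto)
  obtain \<epsilon> where e: "0 < \<epsilon>" "\<And>\<beta>. root \<beta> \<Longrightarrow> \<beta> \<bullet> x0 \<noteq> 0 \<Longrightarrow> sgn (\<beta> \<bullet> (x0 + \<epsilon> *\<^sub>R u (tau 1))) = sgn (\<beta> \<bullet> x0)"
    using perturbation[OF finite_R, of x0 "u (tau 1)"] by blast
  let ?w0 = "x0 + \<epsilon> *\<^sub>R u (tau 1)"
  have ray0: "ray \<tau> \<bullet> ?w0 = \<epsilon> * (\<tau> - tau 1)" for \<tau> by (simp add: inner_add_right ray_x0 ray_u)
  show ?thesis
  proof (rule wall_criterion[OF D'])
    show "root (ray (tau 1))" "0 < ray (tau 1) \<bullet> w'" using root_ray[OF k1] rayw'[of 1] k1 by auto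
    show "?w0 \<in> W" using x0_W u_W subspace_W by (intro subspace_add subspace_scale)
    show "ray (tau 1) \<bullet> ?w0 = 0" unfolding ray0 by simp
    fix \<gamma> assume g: "root \<gamma>" "0 < \<gamma> \<bullet> w'" "\<nexists>c. \<gamma> = c *\<^sub>R ray (tau 1)"
    show "0 < \<gamma> \<bullet> ?w0"
    proof (cases "\<gamma> \<bullet> x0 = 0")
      case True
      obtain d c where d: "d < k" "c \<noteq> 0" "\<gamma> = c *\<^sub>R ray (tau d)" using root_plane[OF g(1) True] by blast
      have d1: "d \<noteq> 1" using d g(3) by auto
      show ?thesis
      proof (cases "d = 0")
        case True
        then have "0 < c * (s \<bullet> w')" using g(2) d tau_0 ray_01 by simp
        then have "c < 0" using cr(1) by (simp add: zero_less_mult_iff)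
        moreover have "\<gamma> \<bullet> ?w0 = c * (\<epsilon> * (tau 0 - tau 1))" unfolding d(3) True inner_scaleR_left ray0 ..
        ultimately show ?thesis using e(1) tau_0 tau_1_pos by (simp add: mult_less_0_iff)
      next
        case False
        then have "0 < c * (ray (tau d) \<bullet> w')" using g(2) d by simp
        then have "0 < c" using rayw'[OF d(1) False] by (simp add: zero_less_mult_iff)
        moreover have "tau 1 < tau d" using tau_less[of 1 d] d1 False d(1) by auto
        moreover have "\<gamma> \<bullet> ?w0 = c * (\<epsilon> * (tau d - tau 1))" unfolding d(3) inner_scaleR_left ray0 ..
        ultimately show ?thesis using e(1) by simp
      qed
    next
      case False
      have ns: "\<nexists>c. \<gamma> = c *\<^sub>R s" using False D_x0[OF sD] by auto
      have "0 < \<gamma> \<bullet> w"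
      proof (rule ccontr)
        assume "\<not> ?thesis"
        then have "0 < - \<gamma> \<bullet> w" using regular_root[OF regular_w g(1)] by (simp add: order_less_le)
        moreover have "\<nexists>c. - \<gamma> = c *\<^sub>R s" using ns by (metis minus_minus scaleR_minus_left)
        ultimately have "0 < - \<gamma> \<bullet> w'" using cr(2)[of "- \<gamma>"] g(1) root_of_minus by blast
        then show False using g(2) by simp
      qed
      then have nn: "0 \<le> \<gamma> \<bullet> dual_vec D d" if "d \<in> D" for d using simple_coeff_nonneg[OF simple_w g(1)] that by blast
      have "\<gamma> \<bullet> x0 = (\<Sum>d\<in>D - {s, t}. \<gamma> \<bullet> dual_vec D d)" unfolding x0_def inner_sum_right ..
      also have "\<dots> \<ge> 0" by (rule sum_nonneg) (use nn in auto)
      finally have "0 \<le> \<gamma> \<bullet> x0" .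
      then have "0 < \<gamma> \<bullet> x0" using False by simp
      then show ?thesis using e(2)[OF g(1) False] by (metis sgn_greater)
    qed
  qed
qed

end

context fibred_arrangement
begin

text \<open>Behind the wall of \<open>s\<close> the simple roots are \<open>- s\<close> and, for
  each other \<open>t\<close>, the root next to \<open>s\<close> in the plane of \<open>s\<close>
  and \<open>t\<close>. If exactly one of \<open>s\<close> and \<open>t\<close> lies in
  \<open>dspan\<close>, this root is \<open>t\<close> itself by \<open>order2_mixed\<close>, so the
  two kinds of simple roots never mix.\<close>

lemma crossing_step:
  assumes w: "regular w" "simple w D" "s \<in> D" and w': "regular w'" "simple w' D'" "crossing w s w'"
    and d': "d' \<in> D'" "d' \<notin> dspan"
  shows "d' \<in> span {d\<in>D. d \<notin> dspan}"
proof -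
  obtain e where e: "chamber_word W R F w D e" using ex_chamber_word w by blast
  interpret C: chamber_word W R F w D e by (rule e)
  have subU: "subspace dspan" unfolding dspan_def by simp
  have V: "rank_two_view W R F w D s t" if "t \<in> D" "t \<noteq> s" for t
    by unfold_locales (use w that in auto)
  have ex: "\<exists>\<beta>. (if t = s then \<beta> = - s else (\<exists>\<tau>. 0 < \<tau> \<and> \<beta> = (1 - \<tau>) *\<^sub>R s + \<tau> *\<^sub>R t \<and> (order2 s t = 2 \<longrightarrow> \<tau> = 1)))
     \<and> (\<exists>d'\<in>D'. \<exists>c>0. \<beta> = c *\<^sub>R d')" if t: "t \<in> D" for t
  proof (cases "t = s")
    case True
    have "\<exists>d'\<in>D'. \<exists>c>0. - s = c *\<^sub>R d'"
    proof (rule wall_criterion[OF w'(2) _ _ wall_point(1)[OF w(2,3)]])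
      show "root (- s)" using simpleD(4)[OF w(2,3)] root_of_minus by auto
      show "0 < - s \<bullet> w'" using w'(3) unfolding crossing_def by simp
      show "- s \<bullet> wall_point D s = 0" using wall_point(2)[OF w(2,3)] by simp
      fix \<gamma> assume g: "root \<gamma>" "0 < \<gamma> \<bullet> w'" "\<nexists>c. \<gamma> = c *\<^sub>R - s"
      have ns: "\<nexists>c. \<gamma> = c *\<^sub>R s" using g(3) by (metis minus_minus scaleR_minus_left scaleR_minus_right)
      have "0 < \<gamma> \<bullet> w"
      proof (rule ccontr)
        assume "\<not> ?thesis"
        then have "0 < - \<gamma> \<bullet> w" using regular_root[OF w(1) g(1)] by (simp add: order_less_le)
        moreover have "\<nexists>c. - \<gamma> = c *\<^sub>R s" using ns by (metis minus_minus scaleR_minus_left)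
        ultimately have "0 < - \<gamma> \<bullet> w'" using w'(3) g(1) root_of_minus unfolding crossing_def by blast
        then show False using g(2) by simp
      qed
      then show "0 < \<gamma> \<bullet> wall_point D s" using wall_point(3)[OF w(2,3) g(1) _ ns] by blast
    qed
    then show ?thesis using True by auto
  next
    case False
    interpret V: rank_two_view W R F w D s t by (rule V[OF t False])
    have "V.k = order2 s t" unfolding V.k_def order2_def V.T_def V.ray_def ..
    then have "order2 s t = 2 \<longrightarrow> V.tau 1 = 1" using V.tau_last by auto
    then show ?thesis using V.second_wall[OF w'(1,3,2)] V.tau_1_pos False unfolding V.ray_def by auto
  qed
  define P where "P t \<beta> \<longleftrightarrow> (if t = s then \<beta> = - s else (\<exists>\<tau>. 0 < \<tau> \<and> \<beta> = (1 - \<tau>) *\<^sub>R s + \<tau> *\<^sub>R t \<and> (order2 s t = 2 \<longrightarrow> \<tau> = 1)))" for t \<beta>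
  have "\<forall>t\<in>D. \<exists>d'. d' \<in> D' \<and> (\<exists>\<beta> c. P t \<beta> \<and> 0 < c \<and> \<beta> = c *\<^sub>R d')" using ex unfolding P_def by blast
  then obtain \<phi> where \<phi>: "\<And>t. t \<in> D \<Longrightarrow> \<phi> t \<in> D' \<and> (\<exists>\<beta> c. P t \<beta> \<and> 0 < c \<and> \<beta> = c *\<^sub>R \<phi> t)" by metis
  \<comment> \<open>Modulo \<open>s\<close> the new wall belonging to \<open>t \<noteq> s\<close> is
    a multiple of \<open>t\<close>. So different \<open>t\<close> give different walls, and by
    counting these are all walls of the new chamber.\<close>
  have dd: "\<phi> t \<bullet> dual_vec D t' \<noteq> 0 \<longleftrightarrow> t' = t" if tt: "t \<in> D" "t' \<in> D" "t' \<noteq> s" for t t'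
  proof -
    obtain \<beta> c where b: "P t \<beta>" "0 < c" "\<beta> = c *\<^sub>R \<phi> t" using \<phi>[OF tt(1)] by blast
    have "\<beta> \<bullet> dual_vec D t' \<noteq> 0 \<longleftrightarrow> t' = t"
      using b(1) C.dual_eq[OF tt(1), of t'] C.dual_eq[OF w(3), of t'] tt unfolding P_def
      by (auto simp: inner_add_left split: if_splits)
    then show ?thesis using b by simp
  qed
  have "inj_on \<phi> D"
  proof (rule inj_onI)
    fix t t' assume t: "t \<in> D" "t' \<in> D" "\<phi> t = \<phi> t'"
    then show "t = t'" using dd[of t t'] dd[of t' t] dd[of t t] dd[of t' t'] by metis
  qed
  then have "\<phi> ` D = D'"
    by (intro sum_over_scaled) (use simpleD[OF w(2)] simpleD[OF w'(2)] \<phi> in auto)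
  then obtain t where t: "t \<in> D" "d' = \<phi> t" using d' by auto
  obtain \<beta> c where b: "P t \<beta>" "0 < c" "\<beta> = c *\<^sub>R d'" using \<phi>[OF t(1)] t(2) by blast
  have bU: "\<beta> \<notin> dspan"
  proof
    assume "\<beta> \<in> dspan"
    then have "(1/c) *\<^sub>R \<beta> \<in> dspan" by (rule subspace_scale[OF subU])
    then show False using b d' by simp
  qed
  have "\<beta> \<in> span {d\<in>D. d \<notin> dspan}"
  proof (cases "t = s")
    case True
    then have "\<beta> = - s" using b(1) unfolding P_def by simp
    then have "s \<notin> dspan" using bU subspace_neg[OF subU] by auto
    then show ?thesis unfolding \<open>\<beta> = - s\<close> using w(3) by (intro span_neg span_base) simp
  next
    case False
    then obtain \<tau> where \<tau>: "0 < \<tau>" "\<beta> = (1 - \<tau>) *\<^sub>R s + \<tau> *\<^sub>R t" "order2 s t = 2 \<longrightarrow> \<tau> = 1"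
      using b(1) unfolding P_def by auto
    consider "s \<in> dspan" "t \<in> dspan" | "s \<in> dspan" "t \<notin> dspan" | "s \<notin> dspan" "t \<in> dspan" | "s \<notin> dspan" "t \<notin> dspan" by blast
    then show ?thesis
    proof cases
      case 1
      then have "\<beta> \<in> dspan" unfolding \<tau>(2) by (intro subspace_add subspace_scale subU)
      then show ?thesis using bU by simp
    next
      case 2
      then have "\<beta> = t" using \<tau> C.order2_mixed[OF w(3) _ t(1)] by simp
      then show ?thesis using 2 t by (auto intro: span_base)
    next
      case 3
      then have "\<beta> = t" using \<tau> C.order2_mixed[OF t(1) _ w(3)] order2_sym by simp
      then show ?thesis using bU 3 by simp
    next
      case 4
      then show ?thesis unfolding \<tau>(2) using t w(3) by (intro span_add span_scale span_base) auto
    qed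
  qed
  then have "(1/c) *\<^sub>R \<beta> \<in> span {d\<in>D. d \<notin> dspan}" by (rule span_scale)
  then show ?thesis using b by simp
qed

text \<open>In \<open>gallery\<close> the induction goes from \<open>w\<close> to \<open>w'\<close>,
  while \<open>crossing_step\<close> is applied from \<open>w'\<close> to \<open>w\<close>.\<close>

lemma crossing_back:
  assumes w: "regular w" "simple w D" "s \<in> D" and w': "regular w'" "simple w' D'" "crossing w s w'"
  obtains s' where "s' \<in> D'" "crossing w' s' w"
proof -
  have "\<exists>d'\<in>D'. \<exists>c>0. - s = c *\<^sub>R d'"
  proof (rule wall_criterion[OF w'(2) _ _ wall_point(1)[OF w(2,3)]])
    show "root (- s)" using simpleD(4)[OF w(2,3)] root_of_minus by auto
    show "0 < - s \<bullet> w'" using w'(3) unfolding crossing_def by simp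
    show "- s \<bullet> wall_point D s = 0" using wall_point(2)[OF w(2,3)] by simp
    fix \<gamma> assume g: "root \<gamma>" "0 < \<gamma> \<bullet> w'" "\<nexists>c. \<gamma> = c *\<^sub>R - s"
    have ns: "\<nexists>c. \<gamma> = c *\<^sub>R s" using g(3) by (metis minus_minus scaleR_minus_left scaleR_minus_right)
    have "0 < \<gamma> \<bullet> w"
    proof (rule ccontr)
      assume "\<not> ?thesis"
      then have "0 < - \<gamma> \<bullet> w" using regular_root[OF w(1) g(1)] by (simp add: order_less_le)
      moreover have "\<nexists>c. - \<gamma> = c *\<^sub>R s" using ns by (metis minus_minus scaleR_minus_left)
      ultimately have "0 < - \<gamma> \<bullet> w'" using w'(3) g(1) root_of_minus unfolding crossing_def by blast
      then show False using g(2) by simp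
    qed
    then show "0 < \<gamma> \<bullet> wall_point D s" using wall_point(3)[OF w(2,3) g(1) _ ns] by blast
  qed
  then obtain s' c where s': "s' \<in> D'" "c > 0" "- s = c *\<^sub>R s'" by blast
  have par: "(\<exists>a. \<gamma> = a *\<^sub>R s) \<longleftrightarrow> (\<exists>a. \<gamma> = a *\<^sub>R s')" for \<gamma>
  proof -
    have 1: "s = (- c) *\<^sub>R s'" using s'(3) by (metis minus_minus scaleR_minus_left)
    then have 2: "s' = (- (1/c)) *\<^sub>R s" using s'(2) by simp
    show ?thesis using 1 2 by (metis scaleR_scaleR)
  qed
  have "0 < \<beta> \<bullet> w" if b: "root \<beta>" "0 < \<beta> \<bullet> w'" "\<nexists>a. \<beta> = a *\<^sub>R s'" for \<beta>
  proof (rule ccontr)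
    assume "\<not> ?thesis"
    then have "0 < - \<beta> \<bullet> w" using regular_root[OF w(1) b(1)] by (simp add: order_less_le)
    moreover have "\<nexists>c. - \<beta> = c *\<^sub>R s" using b(3) par by (metis minus_minus scaleR_minus_left)
    ultimately have "0 < - \<beta> \<bullet> w'" using w'(3) b(1) root_of_minus unfolding crossing_def by blast
    then show False using b(2) by simp
  qed
  moreover have "s' \<bullet> w < 0"
  proof -
    have "c * (s' \<bullet> w) = - (s \<bullet> w)" using s'(3) by (metis inner_minus_left inner_scaleR_left)
    then have "c * (s' \<bullet> w) < 0" using simpleD(5)[OF w(2,3)] by simp
    then show ?thesis using s'(2) by (simp add: mult_less_0_iff)
  qed
  ultimately have "crossing w' s' w" unfolding crossing_def by blast
  then show ?thesis using that s'(1) by blast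
qed

text \<open>Induction on the number of normals in \<open>R\<close> that separate \<open>w\<close>
  from \<open>w0\<close>. As long as the chambers differ, some wall of the chamber of
  \<open>w\<close> separates them, and crossing it lowers the number.\<close>

lemma gallery:
  assumes w0: "regular w0" "simple w0 D0" and w: "regular w" "simple w D" and d: "d \<in> D" "d \<notin> dspan"
  shows "d \<in> span {d\<in>D0. d \<notin> dspan}"
  using w d
proof (induction "card {r\<in>R. sgn (r \<bullet> w) \<noteq> sgn (r \<bullet> w0)}" arbitrary: w D d rule: less_induct)
  case less
  let ?S = "\<lambda>w. {r\<in>R. sgn (r \<bullet> w) \<noteq> sgn (r \<bullet> w0)}"
  have subU: "subspace dspan" unfolding dspan_def by simp
  show ?case
  proof (cases "\<forall>d\<in>D. 0 < d \<bullet> w0")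
    case True
    have "0 < \<beta> \<bullet> w \<longleftrightarrow> 0 < \<beta> \<bullet> w0" if "root \<beta>" for \<beta>
      by (rule same_chamber[OF less.prems(2) _ _ less.prems(1) that]) (use w0(1) True in \<open>auto simp: regular_def\<close>)
    then have "simple w0 D" using simple_cong[OF less.prems(2)] by blast
    then obtain d0 c where d0: "d0 \<in> D0" "c > 0" "d = c *\<^sub>R d0" using simple_unique[OF _ w0(2) less.prems(3)] by blast
    then have "d0 \<notin> dspan" using less.prems(4) subspace_scale[OF subU] by blast
    then show ?thesis using d0 by (auto intro: span_scale span_base)
  next
    case False
    then obtain s where s: "s \<in> D" "s \<bullet> w0 < 0" 
      using regular_root[OF w0(1) simpleD(4)[OF less.prems(2)]] by (metis linorder_neqE_linordered_idom)
    obtain w' where w': "regular w'" "crossing w s w'" using ex_crossing[OF less.prems(2) s(1) less.prems(1)] .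
    obtain D' where D': "simple w' D'" using regular_simple_ex[OF w'(1)] by blast
    obtain s' where s': "s' \<in> D'" "crossing w' s' w" using crossing_back[OF less.prems(1,2) s(1) w'(1) D' w'(2)] .
    have sw: "0 < s \<bullet> w" by (rule simpleD(5)[OF less.prems(2) s(1)])
    have sw': "s \<bullet> w' < 0" using w'(2) unfolding crossing_def by simp
    have same: "sgn (r \<bullet> w') = sgn (r \<bullet> w)" if r: "r \<in> R" "\<nexists>c. r = c *\<^sub>R s" for r
    proof -
      have rr: "root r" "root (- r)" using root_of_base[OF r(1)] root_of_minus by auto
      have "\<nexists>c. - r = c *\<^sub>R s" using r(2) by (metis minus_minus scaleR_minus_left)
      then have "0 < r \<bullet> w \<Longrightarrow> 0 < r \<bullet> w'" "0 < - r \<bullet> w \<Longrightarrow> 0 < - r \<bullet> w'"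
        using w'(2) r(2) rr unfolding crossing_def by blast+
      then show ?thesis using regular_root[OF less.prems(1) rr(1)] by (cases "0 < r \<bullet> w") auto
    qed
    have opp: "sgn (r \<bullet> w') = sgn (r \<bullet> w0)" "sgn (r \<bullet> w) \<noteq> sgn (r \<bullet> w0)" if r: "r \<in> R" "r = c *\<^sub>R s" for r c
    proof -
      have "c \<noteq> 0" using r R_nz by auto
      then show "sgn (r \<bullet> w') = sgn (r \<bullet> w0)" "sgn (r \<bullet> w) \<noteq> sgn (r \<bullet> w0)" 
        using sw sw' s(2) unfolding r(2) by (auto simp: sgn_mult sgn_zero_iff)
    qed
    obtain r c where r: "r \<in> R" "c \<noteq> 0" "s = c *\<^sub>R r" using simpleD(4)[OF less.prems(2) s(1)] unfolding root_of_def by blast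
    then have rs: "r = (1/c) *\<^sub>R s" by simp
    have "?S w' \<subset> ?S w"
    proof
      show "?S w' \<subseteq> ?S w" using same opp by (smt (verit) Collect_mono_iff mem_Collect_eq subsetI)
      have "r \<in> ?S w" "r \<notin> ?S w'" using opp[OF r(1) rs] r(1) by auto
      then show "?S w' \<noteq> ?S w" by blast
    qed
    then have "card (?S w') < card (?S w)" using finite_R by (intro psubset_card_mono) auto
    then have IH: "d' \<in> span {d\<in>D0. d \<notin> dspan}" if "d' \<in> D'" "d' \<notin> dspan" for d'
      using less.hyps[OF _ w'(1) D' that] by blast
    have "d \<in> span {d'\<in>D'. d' \<notin> dspan}"
      by (rule crossing_step[OF w'(1) D' s'(1) less.prems(1,2) s'(2) less.prems(3,4)])
    also have "\<dots> \<subseteq> span {d\<in>D0. d \<notin> dspan}" by (intro span_minimal) (use IH in auto)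
    finally show ?thesis .
  qed
qed

text \<open>Take a generic point of the kernel of \<open>\<beta>\<close> and move off it by a small
  multiple of \<open>\<beta>\<close>.\<close>

lemma root_is_wall:
  assumes b: "root \<beta>"
  obtains w D d c where "regular w" "simple w D" "d \<in> D" "0 < c" "\<beta> = c *\<^sub>R d"
proof -
  let ?N = "{r\<in>R. \<nexists>c. r = c *\<^sub>R \<beta>}"
  have bb: "\<beta> \<bullet> \<beta> > 0" using root_nz[OF b] by simp
  have sub: "subspace {x\<in>W. \<beta> \<bullet> x = 0}" using subspace_W
    by (auto simp: subspace_def inner_add_right)
  have "\<exists>x\<in>{x\<in>W. \<beta> \<bullet> x = 0}. \<forall>n\<in>?N. n \<bullet> x \<noteq> 0"
  proof (rule ex_not_orthogonal[OF _ sub])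
    show "finite ?N" using finite_R by simp
    fix n assume n: "n \<in> ?N"
    define x where "x = n - ((n \<bullet> \<beta>) / (\<beta> \<bullet> \<beta>)) *\<^sub>R \<beta>"
    have "x \<noteq> 0" using n unfolding x_def by auto
    have bx: "\<beta> \<bullet> x = 0" using bb unfolding x_def by (simp add: inner_diff_right inner_commute)
    have "n \<bullet> x = x \<bullet> x + ((n \<bullet> \<beta>) / (\<beta> \<bullet> \<beta>)) * (\<beta> \<bullet> x)"
    proof -
      have "n = x + ((n \<bullet> \<beta>) / (\<beta> \<bullet> \<beta>)) *\<^sub>R \<beta>" unfolding x_def by simp
      then show ?thesis by (metis inner_add_left inner_scaleR_left)
    qed
    then have "n \<bullet> x \<noteq> 0" using bx \<open>x \<noteq> 0\<close> by simp
    moreover have "x \<in> W" unfolding x_def using n R_W root_W[OF b] subspace_W by (intro subspace_diff subspace_scale) auto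
    ultimately show "\<exists>x\<in>{x\<in>W. \<beta> \<bullet> x = 0}. n \<bullet> x \<noteq> 0" using bx by blast
  qed
  then obtain x where x: "x \<in> W" "\<beta> \<bullet> x = 0" "\<And>r. r \<in> R \<Longrightarrow> \<nexists>c. r = c *\<^sub>R \<beta> \<Longrightarrow> r \<bullet> x \<noteq> 0" by blast
  have x3: "\<gamma> \<bullet> x \<noteq> 0" if g: "root \<gamma>" "\<nexists>c. \<gamma> = c *\<^sub>R \<beta>" for \<gamma>
  proof -
    obtain r c where r: "r \<in> R" "c \<noteq> 0" "\<gamma> = c *\<^sub>R r" using g(1) unfolding root_of_def by blast
    have "\<nexists>c. r = c *\<^sub>R \<beta>" using g(2) r by (metis scaleR_scaleR)
    then show ?thesis using x(3)[OF r(1)] r by simp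
  qed
  obtain \<epsilon> where e: "0 < \<epsilon>" "\<And>\<gamma>. root \<gamma> \<Longrightarrow> \<gamma> \<bullet> x \<noteq> 0 \<Longrightarrow> sgn (\<gamma> \<bullet> (x + \<epsilon> *\<^sub>R \<beta>)) = sgn (\<gamma> \<bullet> x)"
    using perturbation[OF finite_R, of x \<beta>] by blast
  let ?w = "x + \<epsilon> *\<^sub>R \<beta>"
  have bw: "0 < \<beta> \<bullet> ?w" using x(2) e(1) bb by (simp add: inner_add_right)
  have reg: "regular ?w"
  proof (rule regularI)
    show "?w \<in> W" using x(1) root_W[OF b] subspace_W by (intro subspace_add subspace_scale)
    fix \<gamma> assume g: "root \<gamma>"
    show "\<gamma> \<bullet> ?w \<noteq> 0"
    proof (cases "\<exists>c. \<gamma> = c *\<^sub>R \<beta>")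
      case True
      then obtain c where "\<gamma> = c *\<^sub>R \<beta>" by blast
      then show ?thesis using bw root_nz[OF g] by (cases "c = 0") auto
    next
      case False
      then show ?thesis using e(2)[OF g x3[OF g]] x3[OF g] by (metis sgn_0 sgn_zero_iff)
    qed
  qed
  obtain D where D: "simple ?w D" using regular_simple_ex[OF reg] by blast
  have "\<exists>d\<in>D. \<exists>c>0. \<beta> = c *\<^sub>R d"
  proof (rule wall_criterion[OF D b bw x(1,2)])
    fix \<gamma> assume g: "root \<gamma>" "0 < \<gamma> \<bullet> ?w" "\<nexists>c. \<gamma> = c *\<^sub>R \<beta>"
    show "0 < \<gamma> \<bullet> x" using e(2)[OF g(1) x3[OF g(1,3)]] g(2) by (metis sgn_greater)
  qed
  then show ?thesis using that reg D by blast
qed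

text \<open>Every root is a simple root of some chamber, so by \<open>gallery\<close> it lies in
  \<open>dspan\<close> or in the span of those simple roots of the given chamber that are not
  letters. Letters and remaining simple roots partition a basis of \<open>W\<close>.\<close>

theorem decomposition:
  assumes w: "chamber_word W R F w D e" and nl: "chamber_word.letter D e ` {..<card F - 1} \<noteq> D"
  obtains U' where "subspace U'" "U' \<noteq> {0}" "U' \<subseteq> W" "dspan \<inter> U' = {0}" "span (dspan \<union> U') = W"
    "\<And>\<beta>. root \<beta> \<Longrightarrow> \<beta> \<in> dspan \<or> \<beta> \<in> U'"
proof -
  interpret C: chamber_word W R F w D e by (rule w)
  let ?J = "C.letter ` {..<card F - 1}" 
  let ?T = "{d\<in>D. d \<notin> dspan}"
  note D = simpleD[OF C.simple_w]
  have J: "?J \<subseteq> D" using C.letter(1) by auto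
  have T: "?T = D - ?J" using C.letter_iff_U by blast
  have "?T \<noteq> {}" using nl J T by blast
  then obtain t where t: "t \<in> ?T" by blast
  have t0: "t \<noteq> 0" using root_nz[OF D(4)] t by blast
  have roots: "\<beta> \<in> dspan \<or> \<beta> \<in> span ?T" if b: "root \<beta>" for \<beta>
  proof -
    obtain w' D' d c where d: "regular w'" "simple w' D'" "d \<in> D'" "0 < c" "\<beta> = c *\<^sub>R d" using root_is_wall[OF b] .
    then have "d \<in> dspan \<or> d \<in> span ?T" using gallery[OF C.regular_w C.simple_w d(1,2,3)] by blast
    then show ?thesis unfolding d(5) dspan_def using span_scale by blast
  qed
  have "dspan \<inter> span ?T = {0}"
  proof -
    have "x = 0" if "x \<in> span ?J" "x \<in> span ?T" for x
    proof -
      have fin: "finite ?J" "finite ?T" using D(3) J finite_subset by auto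
      have "x \<bullet> dual_vec D d = 0" if d: "d \<in> D" for d
      proof -
        have *: "x \<bullet> dual_vec D d = 0" if "x \<in> span X" "X \<subseteq> D" "d \<notin> X" for X
        proof -
          have "\<And>y. y \<in> X \<Longrightarrow> orthogonal (dual_vec D d) y"
            using dual_vec(2)[OF D(1), of _ d] that d unfolding orthogonal_def by (auto simp: inner_commute)
          then have "orthogonal (dual_vec D d) x" using orthogonal_to_span[OF that(1)] by blast
          then show ?thesis by (simp add: orthogonal_def inner_commute)
        qed
        show ?thesis using *[OF \<open>x \<in> span ?J\<close> J] *[OF \<open>x \<in> span ?T\<close>] T by blast
      qed
      moreover have "x \<in> W" using that J D(2) span_mono by blast
      ultimately show "x = 0" by (subst simple_expand(1)[OF C.simple_w]) auto
    qed
    then show ?thesis unfolding C.U_letters using span_zero by blast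
  qed
  moreover have "span (dspan \<union> span ?T) = W"
  proof
    have "span ?T \<subseteq> W" using D(2) span_mono[of ?T D] by auto
    then show "span (dspan \<union> span ?T) \<subseteq> W" using dspan_W subspace_W by (intro span_minimal) auto
    have "D \<subseteq> dspan \<union> span ?T" by (auto intro: span_base)
    then show "W \<subseteq> span (dspan \<union> span ?T)" using D(2) span_mono by metis
  qed
  moreover have "span ?T \<noteq> {0}" using t t0 by (metis (no_types, lifting) singletonD span_base)
  moreover have "span ?T \<subseteq> W" using D(2) span_mono[of ?T D] by auto
  ultimately show ?thesis using that[of "span ?T"] roots by simp
qed

end

section \<open>Modular lines\<close>

lemma parallel_of_ker_subset:
  fixes a b :: "'a::euclidean_space"
  assumes V: "subspace V" "a \<in> V" "b \<in> V" "a \<noteq> 0" and k: "\<And>x. x \<in> V \<Longrightarrow> a \<bullet> x = 0 \<Longrightarrow> b \<bullet> x = 0"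
  shows "\<exists>c. b = c *\<^sub>R a"
proof -
  define y where "y = b - ((b \<bullet> a) / (a \<bullet> a)) *\<^sub>R a"
  have "y \<in> V" unfolding y_def using V by (intro subspace_diff subspace_scale)
  moreover have ay: "a \<bullet> y = 0" unfolding y_def using V(4) by (simp add: inner_diff_right inner_commute)
  ultimately have by0: "b \<bullet> y = 0" by (rule k)
  have "y \<bullet> y = b \<bullet> y - ((b \<bullet> a) / (a \<bullet> a)) * (a \<bullet> y)"
    unfolding y_def by (simp add: inner_diff_left)
  then have "y = 0" using ay by0 by simp
  then show ?thesis unfolding y_def by auto
qed

lemma hyperplane_normal:
  assumes V: "subspace V" and H: "hyperplane_of V H"
  obtains n where "n \<in> V" "n \<noteq> 0" "H = {x\<in>V. n \<bullet> x = 0}"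
proof -
  have H': "subspace H" "H \<subseteq> V" "dim H + 1 = dim V" using H unfolding hyperplane_of_def by auto
  have "span H \<subset> span V" using H' V by (metis add_cancel_right_right psubsetI span_eq_iff zero_neq_one)
  then obtain n where n: "n \<noteq> 0" "n \<in> span V" "\<And>y. y \<in> span H \<Longrightarrow> orthogonal n y"
    using orthogonal_to_subspace_exists_gen[of H V] by blast
  let ?K = "{x\<in>V. n \<bullet> x = 0}"
  have K: "subspace ?K" using V by (auto simp: subspace_def inner_add_right)
  have nV: "n \<in> V" using n(2) V by (metis span_eq_iff)
  have HK: "H \<subseteq> ?K" using n(3) H'(2) span_base by (auto simp: orthogonal_def)
  have "?K \<subset> V" using nV n(1) by (metis (mono_tags, lifting) inner_eq_zero_iff mem_Collect_eq psubsetI subsetI)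
  then have "dim ?K < dim V" using K V by (metis dim_psubset span_eq_iff)
  then have "H = ?K" using subspace_dim_equal[OF H'(1) K HK] H'(3) by linarith
  then show ?thesis using that nV n(1) by blast
qed

text \<open>The sign region is convex, hence connected. Conversely, a normal that vanishes nowhere
  on a connected set keeps its sign there.\<close>

lemma sign_region_component:
  fixes V :: "'a::euclidean_space set"
  assumes V: "subspace V" and x: "x \<in> V" "\<And>n. n \<in> N \<Longrightarrow> n \<bullet> x \<noteq> 0"
  shows "connected_component_set (V - \<Union>((\<lambda>n. {x\<in>V. n \<bullet> x = 0}) ` N)) x =
    {y\<in>V. \<forall>n\<in>N. 0 < (n \<bullet> x) * (n \<bullet> y)}" (is "?C = ?K")
proof
  let ?S = "V - \<Union>((\<lambda>n. {x\<in>V. n \<bullet> x = 0}) ` N)"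
  have "convex ?K"
    unfolding convex_def
  proof (intro ballI allI impI)
    fix y z and u v :: real assume yz: "y \<in> ?K" "z \<in> ?K" and uv: "0 \<le> u" "0 \<le> v" "u + v = 1"
    have "0 < (n \<bullet> x) * (n \<bullet> (u *\<^sub>R y + v *\<^sub>R z))" if n: "n \<in> N" for n
    proof -
      have p: "0 < (n \<bullet> x) * (n \<bullet> y)" "0 < (n \<bullet> x) * (n \<bullet> z)" using yz n by auto
      have "(n \<bullet> x) * (n \<bullet> (u *\<^sub>R y + v *\<^sub>R z)) = u * ((n \<bullet> x) * (n \<bullet> y)) + v * ((n \<bullet> x) * (n \<bullet> z))"
        by (simp add: inner_add_right algebra_simps)
      moreover have "0 \<le> u * ((n \<bullet> x) * (n \<bullet> y))" "0 \<le> v * ((n \<bullet> x) * (n \<bullet> z))" using p uv by simp_all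
      moreover have "0 < u \<or> 0 < v" using uv by linarith
      ultimately show ?thesis using p by (metis add_nonneg_pos add_pos_nonneg mult_pos_pos)
    qed
    then show "u *\<^sub>R y + v *\<^sub>R z \<in> ?K" using yz V by (auto intro: subspace_add subspace_scale)
  qed
  moreover have "x \<in> ?K" using x by (auto simp: zero_less_mult_iff linorder_neq_iff)
  moreover have "?K \<subseteq> ?S" by auto
  ultimately show "?K \<subseteq> ?C" by (intro connected_component_maximal convex_connected)
  show "?C \<subseteq> ?K"
  proof
    fix y assume "y \<in> ?C"
    then obtain T where T: "connected T" "T \<subseteq> ?S" "x \<in> T" "y \<in> T"
      unfolding connected_component_def by auto
    have "0 < (n \<bullet> x) * (n \<bullet> y)" if n: "n \<in> N" for n
    proof (rule ccontr)
      assume neg: "\<not> 0 < (n \<bullet> x) * (n \<bullet> y)"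
      have "connected ((\<lambda>z. n \<bullet> z) ` T)" using T(1) by (intro connected_continuous_image continuous_intros)
      then have iv: "is_interval ((\<lambda>z. n \<bullet> z) ` T)" by (simp add: is_interval_connected_1)
      have "n \<bullet> y \<noteq> 0" using T n by auto
      then have "(n \<bullet> x \<le> 0 \<and> 0 \<le> n \<bullet> y) \<or> (n \<bullet> y \<le> 0 \<and> 0 \<le> n \<bullet> x)" using neg x(2)[OF n] 
        by (auto simp: zero_less_mult_iff not_less)
      then have "0 \<in> (\<lambda>z. n \<bullet> z) ` T" using iv T(3,4) unfolding is_interval_1 by blast
      then show False using T(2) n by auto
    qed
    moreover have "y \<in> V" using T by auto
    ultimately show "y \<in> ?K" by simp
  qed
qed

text \<open>The dual basis of the generators of the cone serves as simple system; the work is to see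
  that its members are roots.\<close>

lemma chamber_simple_system:
  fixes V :: "'a::euclidean_space set"
  assumes V: "subspace V" and N: "finite N" "N \<subseteq> V" and x: "x \<in> V" "\<And>n. n \<in> N \<Longrightarrow> n \<bullet> x \<noteq> 0"
    and simp: "simplicial_arr V ((\<lambda>n. {x\<in>V. n \<bullet> x = 0}) ` N)"
  shows "\<exists>D. simple_system V N x D"
proof -
  let ?A = "(\<lambda>n. {x\<in>V. n \<bullet> x = 0}) ` N"
  define K where "K = {y\<in>V. \<forall>n\<in>N. 0 < (n \<bullet> x) * (n \<bullet> y)}"
  have cK: "connected_component_set (V - \<Union>?A) x = K"
    unfolding K_def by (rule sign_region_component[OF V x])
  have "connected_component_set (V - \<Union>?A) x \<in> chambers V ?A"
    unfolding chambers_def by (rule componentsI) (use x in auto)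
  then have "open_simplicial_cone V K"
    using simp unfolding simplicial_arr_def cK by (rule bspec[rotated])
  then obtain B where B: "independent B" "span B = V" "K = {\<Sum>b\<in>B. c b *\<^sub>R b | c. \<forall>b\<in>B. c b > 0}"
    unfolding open_simplicial_cone_def by blast
  have fB: "finite B" using B(1) by (rule finiteI_independent)
  have xK: "x \<in> K" using x unfolding K_def by (auto simp: zero_less_mult_iff linorder_neq_iff)
  have Kroot: "0 < \<beta> \<bullet> y" if r: "root_of N \<beta>" "0 < \<beta> \<bullet> x" and y: "y \<in> K" for \<beta> y
  proof -
    obtain n c where n: "n \<in> N" "\<beta> = c *\<^sub>R n" using r unfolding root_of_def by blast
    have "0 < (n \<bullet> x) * (n \<bullet> y)" using y n unfolding K_def by simp
    then show ?thesis using r(2) unfolding n(2) by (auto simp: zero_less_mult_iff)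
  qed
  have dB: "b' \<bullet> dual_vec B b = (if b' = b then 1 else 0)" if "b' \<in> B" for b b' by (rule dual_vec(2)[OF B(1) that])
  have Kcoef: "y \<in> K \<longleftrightarrow> y \<in> V \<and> (\<forall>b\<in>B. 0 < y \<bullet> dual_vec B b)" for y
  proof
    assume "y \<in> K"
    then obtain c where c: "\<forall>b\<in>B. c b > 0" "y = (\<Sum>b\<in>B. c b *\<^sub>R b)" using B(3) by blast
    have "y \<bullet> dual_vec B b = c b" if "b \<in> B" for b
    proof -
      have "y \<bullet> dual_vec B b = (\<Sum>b'\<in>B. if b' = b then c b else 0)"
        unfolding c(2) inner_sum_left by (intro sum.cong) (auto simp: dB)
      then show ?thesis using fB that by simp
    qed
    then show "y \<in> V \<and> (\<forall>b\<in>B. 0 < y \<bullet> dual_vec B b)" using c \<open>y \<in> K\<close> unfolding K_def by auto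
  next
    assume y: "y \<in> V \<and> (\<forall>b\<in>B. 0 < y \<bullet> dual_vec B b)"
    then have "y = (\<Sum>b\<in>B. (y \<bullet> dual_vec B b) *\<^sub>R b)" using dual_expand(1)[OF B(1), of y] B(2) by simp
    then have "\<exists>c. y = (\<Sum>b\<in>B. c b *\<^sub>R b) \<and> (\<forall>b\<in>B. 0 < c b)" 
      using y by (intro exI[of _ "\<lambda>b. y \<bullet> dual_vec B b"]) simp
    then show "y \<in> K" unfolding B(3) by simp
  qed
  have nn: "0 \<le> \<beta> \<bullet> b" if r: "root_of N \<beta>" "0 < \<beta> \<bullet> x" and b: "b \<in> B" for \<beta> b
  proof (rule ccontr)
    assume neg: "\<not> 0 \<le> \<beta> \<bullet> b"
    \<comment> \<open>With a negative value on the generator \<open>b\<close>, the root would vanish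
      at \<open>x + m b\<close>, which is still inside the open cone.\<close>
    define m where "m = - (\<beta> \<bullet> x) / (\<beta> \<bullet> b)"
    have "0 < m" using neg r(2) unfolding m_def by (simp add: divide_pos_neg)
    have "x + m *\<^sub>R b \<in> K"
      unfolding Kcoef
    proof (intro conjI ballI)
      show "x + m *\<^sub>R b \<in> V" using x(1) b B(2) V by (metis span_base subspace_add subspace_scale)
      fix b' assume "b' \<in> B"
      then have "0 < x \<bullet> dual_vec B b'" using xK Kcoef by blast
      then show "0 < (x + m *\<^sub>R b) \<bullet> dual_vec B b'" using \<open>0 < m\<close> dB[OF b, of b'] by (simp add: inner_add_left)
    qed
    then have "0 < \<beta> \<bullet> (x + m *\<^sub>R b)" by (rule Kroot[OF r])
    moreover have "\<beta> \<bullet> (x + m *\<^sub>R b) = 0" using neg unfolding m_def by (simp add: inner_add_right inner_diff_right)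
    ultimately show False by simp
  qed
  define D where "D = dual_vec B ` B"
  have DV: "D \<subseteq> V" unfolding D_def using dual_vec(1)[OF B(1)] B(2) by auto
  have expD: "y = (\<Sum>b\<in>B. (b \<bullet> y) *\<^sub>R dual_vec B b)" if "y \<in> V" for y
    using dual_expand(2)[OF B(1)] B(2) that by blast
  have inj: "inj_on (dual_vec B) B"
    by (rule inj_onI) (metis dB zero_neq_one)
  have spanD: "V \<subseteq> span D"
  proof
    fix y assume "y \<in> V"
    then have "y = (\<Sum>b\<in>B. (b \<bullet> y) *\<^sub>R dual_vec B b)" by (rule expD)
    also have "\<dots> \<in> span D" unfolding D_def by (intro span_sum span_scale span_base) auto
    finally show "y \<in> span D" .
  qed
  have "card D = dim V" unfolding D_def using B(1,2) by (metis card_image dim_eq_card_independent dim_span inj)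
  then have indD: "independent D" using card_le_dim_spanning[OF DV spanD] fB unfolding D_def by simp
  have "simple_system V N x D"
    unfolding simple_system_def
  proof (intro conjI ballI allI impI)
    show "independent D" by (rule indD)
    show "span D = V" using spanD DV V by (simp add: span_minimal subset_antisym)
  next
    fix d assume "d \<in> D"
    then obtain b where b: "b \<in> B" "d = dual_vec B b" unfolding D_def by blast
    show "0 < d \<bullet> x" using xK Kcoef b by (metis inner_commute)
    \<comment> \<open>A point inside the facet opposite to \<open>b\<close>. It is outside the open
      cone, so some normal fails to be positive there; this normal vanishes on all generators except
      \<open>b\<close> and is therefore a multiple of \<open>d\<close>.\<close>
    let ?y = "\<Sum>b'\<in>B - {b}. b'"
    have yV: "?y \<in> V" using B(2) V by (intro subspace_sum) (auto intro: span_base)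
    have "?y \<bullet> dual_vec B b = (\<Sum>b'\<in>B - {b}. 0)"
      unfolding inner_sum_left by (intro sum.cong) (auto simp: dB)
    then have "\<not> 0 < ?y \<bullet> dual_vec B b" by (simp only: sum.neutral_const less_irrefl not_False_eq_True)
    then have "?y \<notin> K" using Kcoef b(1) by blast
    then obtain n where n: "n \<in> N" "\<not> 0 < (n \<bullet> x) * (n \<bullet> ?y)" using yV unfolding K_def by blast
    define m where "m = sgn (n \<bullet> x) *\<^sub>R n"
    have sg: "sgn (n \<bullet> x) \<noteq> 0" using x(2)[OF n(1)] by (simp add: sgn_zero_iff)
    have rm: "root_of N m" unfolding m_def root_of_def using n(1) sg by blast
    have mx: "0 < m \<bullet> x" unfolding m_def using x(2)[OF n(1)] by (simp add: sgn_if)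
    have my: "m \<bullet> ?y \<le> 0" using n(2) x(2)[OF n(1)] unfolding m_def inner_scaleR_left
      by (cases "0 < n \<bullet> x") (auto simp: zero_less_mult_iff sgn_if mult_le_0_iff not_less)
    have mb: "0 \<le> m \<bullet> b'" if "b' \<in> B" for b' by (rule nn[OF rm mx that])
    have "(\<Sum>b'\<in>B - {b}. m \<bullet> b') = 0"
      using my mb unfolding inner_sum_right by (intro antisym sum_nonneg) auto
    then have z: "m \<bullet> b' = 0" if "b' \<in> B - {b}" for b'
      using mb fB that by (subst (asm) sum_nonneg_eq_0_iff) auto
    have "m \<in> V" unfolding m_def using n(1) N(2) V by (auto intro: subspace_scale)
    then have "m = (\<Sum>b'\<in>B. (b' \<bullet> m) *\<^sub>R dual_vec B b')" by (rule expD)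
    also have "\<dots> = (\<Sum>b'\<in>B. if b' = b then (b \<bullet> m) *\<^sub>R dual_vec B b else 0)"
      using z by (intro sum.cong) (auto simp: inner_commute)
    also have "\<dots> = (b \<bullet> m) *\<^sub>R d" using fB b by (simp only: sum.delta if_True)
    finally have m: "m = (b \<bullet> m) *\<^sub>R d" .
    have "b \<bullet> m \<noteq> 0" using m mx by (metis inner_zero_left less_irrefl scaleR_zero_left)
    have "(1 / (b \<bullet> m)) *\<^sub>R m = (1 / (b \<bullet> m)) *\<^sub>R ((b \<bullet> m) *\<^sub>R d)" using m by (rule arg_cong)
    then have "d = (1 / (b \<bullet> m)) *\<^sub>R m" using \<open>b \<bullet> m \<noteq> 0\<close> by (simp only: scaleR_scaleR) simp
    then show "root_of N d" using root_of_scale[OF rm, of "1 / (b \<bullet> m)"] \<open>b \<bullet> m \<noteq> 0\<close> by simp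
  next
    fix \<beta> assume b: "root_of N \<beta> \<and> 0 < \<beta> \<bullet> x"
    have bV: "\<beta> \<in> V" using b N(2) V unfolding root_of_def by (auto intro: subspace_scale)
    define c where "c d = inv_into B (dual_vec B) d \<bullet> \<beta>" for d
    have "(\<Sum>d\<in>D. c d *\<^sub>R d) = (\<Sum>b\<in>B. (b \<bullet> \<beta>) *\<^sub>R dual_vec B b)"
      unfolding D_def sum.reindex[OF inj] by (intro sum.cong) (auto simp: c_def inv_into_f_f[OF inj])
    moreover have "\<forall>d\<in>D. 0 \<le> c d" 
      unfolding D_def c_def using nn b by (auto simp: inv_into_f_f[OF inj] inner_commute[of _ \<beta>])
    ultimately show "\<exists>c. (\<forall>d\<in>D. 0 \<le> c d) \<and> \<beta> = (\<Sum>d\<in>D. c d *\<^sub>R d)" using expD[OF bV] by metis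
  qed
  then show ?thesis by blast
qed

text \<open>The vector \<open>p\<close> spans the modular line. Normals that are not orthogonal to
  it are scaled to the form \<open>p - f\<close>, so that their hyperplanes meet the line through
  \<open>w\<close> along \<open>p\<close> at the height \<open>f . w\<close>.\<close>

locale modular_fibration =
  fixes V :: "'a::euclidean_space set" and A :: "'a set set" and p :: 'a and W R F N :: "'a set"
  assumes subspace_V: "subspace V" and p_V: "p \<in> V" and p_unit: "p \<bullet> p = 1" and W_def: "W = {x\<in>V. p \<bullet> x = 0}"
    and fin_R: "finite R" and R_sub: "R \<subseteq> W" and R_0: "0 \<notin> R"
    and fin_F: "finite F" and F_sub: "F \<subseteq> W" and F_nonempty: "F \<noteq> {}"
    and N_def: "N = R \<union> (\<lambda>f. p - f) ` F" and A_eq: "A = (\<lambda>n. {x\<in>V. n \<bullet> x = 0}) ` N"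
    and F_difference: "f \<in> F \<Longrightarrow> g \<in> F \<Longrightarrow> f \<noteq> g \<Longrightarrow> root_of R (f - g)"
    and simplicial: "simplicial_arr V A"
begin

lemma sub_W: "subspace W"
  unfolding W_def using subspace_V by (auto simp: subspace_def inner_add_right)

lemma W_V: "W \<subseteq> V" and W_p: "x \<in> W \<Longrightarrow> x \<bullet> p = 0" "x \<in> W \<Longrightarrow> p \<bullet> x = 0"
  unfolding W_def by (auto simp: inner_commute)

lemma pf_nz: "f \<in> F \<Longrightarrow> p - f \<noteq> 0"
  using F_sub W_p(1)[of f] p_unit by auto

lemma N_props: "finite N" "N \<subseteq> V" "0 \<notin> N"
  unfolding N_def using fin_R fin_F R_sub F_sub W_V R_0 pf_nz p_V subspace_V by (auto intro: subspace_diff)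

lemma root_N_iff: "root_of N d \<longleftrightarrow> root_of R d \<or> (\<exists>f\<in>F. \<exists>c. c \<noteq> 0 \<and> d = c *\<^sub>R (p - f))"
  unfolding root_of_def N_def by blast

lemma root_R_N: "root_of R d \<Longrightarrow> root_of N d"
  using root_N_iff by blast

lemma root_R_W: "root_of R d \<Longrightarrow> d \<in> W"
  unfolding root_of_def using R_sub sub_W by (auto intro: subspace_scale)

text \<open>With the fibre \<open>{0}\<close> the conditions on pairs of points are void. This makes
  the facts on simple systems available for the whole arrangement before they are known for
  \<open>W\<close>.\<close>

sublocale total: fibred_arrangement V N "{0}"
proof (unfold_locales, goal_cases)
  case (9 w)
  then show ?case using chamber_simple_system[OF subspace_V N_props(1,2), of w] simplicial unfolding A_eq by blast
qed (use subspace_V N_props in \<open>auto simp: subspace_0\<close>)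

lemma point: "f \<in> F \<Longrightarrow> w \<in> W \<Longrightarrow> (p - f) \<bullet> (w + t *\<^sub>R p) = t - f \<bullet> w"
  using F_sub W_p p_unit by (auto simp: inner_diff_left inner_add_right)

lemma point_R: "d \<in> W \<Longrightarrow> d \<bullet> (w + t *\<^sub>R p) = d \<bullet> w"
  using W_p(1) by (simp add: inner_add_right)

lemma point_V: "w \<in> W \<Longrightarrow> w + t *\<^sub>R p \<in> V"
  using W_V p_V subspace_V by (auto intro: subspace_add subspace_scale)

text \<open>The sign \<open>\<sigma>\<close> selects the walls below or above the given point.\<close>

context
  fixes w t D
  assumes w: "w \<in> W" and wR: "\<forall>r\<in>R. r \<bullet> w \<noteq> 0" and t: "\<And>f. f \<in> F \<Longrightarrow> f \<bullet> w \<noteq> t"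
    and D: "simple_system V N (w + t *\<^sub>R p) D"
begin

lemma wall_cases:
  assumes "d \<in> D"
  obtains "root_of R d" "d \<bullet> p = 0" "0 < d \<bullet> w"
  | f c where "f \<in> F" "c > 0" "d = c *\<^sub>R (p - f)" "f \<bullet> w < t" "d \<bullet> p = c"
  | f c where "f \<in> F" "c > 0" "d = (- c) *\<^sub>R (p - f)" "t < f \<bullet> w" "d \<bullet> p = - c"
proof -
  have pos: "0 < d \<bullet> (w + t *\<^sub>R p)" "root_of N d" using total.simpleD[OF D] assms by auto
  from pos(2) consider "root_of R d" | f c where "f \<in> F" "c \<noteq> 0" "d = c *\<^sub>R (p - f)" using root_N_iff by blast
  then show ?thesis
  proof cases
    case 1
    then show ?thesis using that(1) pos(1) point_R root_R_W W_p(1) by simp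
  next
    case (2 f c)
    have "0 < c * (t - f \<bullet> w)" using pos(1) unfolding 2(3) inner_scaleR_left point[OF 2(1) w] .
    moreover have "d \<bullet> p = c" unfolding 2(3) using F_sub 2(1) W_p p_unit by (auto simp: inner_diff_left)
    ultimately show ?thesis using that(2)[of f c] that(3)[of f "- c"] 2 
      by (cases "c > 0") (auto simp: zero_less_mult_iff)
  qed
qed

lemma wall_signed:
  assumes \<sigma>: "\<sigma> = 1 \<or> \<sigma> = (- 1 :: real)" and d: "d \<in> D" "0 < \<sigma> * (d \<bullet> p)"
  obtains f c where "f \<in> F" "c > 0" "d = (c * \<sigma>) *\<^sub>R (p - f)" "0 < \<sigma> * (t - f \<bullet> w)" "d \<bullet> p = c * \<sigma>"
  using d(1)
proof (cases rule: wall_cases)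
  case 1
  then show ?thesis using d by simp
next
  case (2 f c)
  then show ?thesis using that[of f c] \<sigma> d by auto
next
  case (3 f c)
  then show ?thesis using that[of f c] \<sigma> d by auto
qed

lemma coeff: "e \<in> D \<Longrightarrow> e \<bullet> dual_vec D d = (if e = d then 1 else 0)"
  by (rule dual_vec(2)[OF total.simpleD(1)[OF D]])

text \<open>For two walls on the same side, \<open>\<sigma> (f' - f)\<close> would be a root with
  coefficients of both signs in the simple system.\<close>

lemma signed_unique:
  assumes \<sigma>: "\<sigma> = 1 \<or> \<sigma> = (- 1 :: real)" and d: "d \<in> D" "0 < \<sigma> * (d \<bullet> p)" "d' \<in> D" "0 < \<sigma> * (d' \<bullet> p)"
  shows "d = d'"
proof (rule ccontr)
  assume ne: "d \<noteq> d'"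
  obtain f c where f: "f \<in> F" "c > 0" "d = (c * \<sigma>) *\<^sub>R (p - f)" using wall_signed[OF \<sigma> d(1,2)] .
  obtain f' c' where f': "f' \<in> F" "c' > 0" "d' = (c' * \<sigma>) *\<^sub>R (p - f')" using wall_signed[OF \<sigma> d(3,4)] .
  have ss: "\<sigma> * \<sigma> = 1" using \<sigma> by auto
  have eq: "\<sigma> *\<^sub>R (f' - f) = (1/c) *\<^sub>R d - (1/c') *\<^sub>R d'"
    using f(2) f'(2) unfolding f(3) f'(3) by (simp add: scaleR_diff_right)
  have c1: "(\<sigma> *\<^sub>R (f' - f)) \<bullet> dual_vec D d = 1/c" "(\<sigma> *\<^sub>R (f' - f)) \<bullet> dual_vec D d' = - (1/c')"
    unfolding eq using coeff[OF d(1)] coeff[OF d(3)] ne by (auto simp: inner_diff_left)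
  have "f \<noteq> f'" using c1(1) f(2) by auto
  then have "root_of N (f' - f)" using F_difference f'(1) f(1) root_R_N by auto
  then have r: "root_of N (\<sigma> *\<^sub>R (f' - f))" using root_of_scale[of N "f' - f" \<sigma>] \<sigma> by auto
  have "(\<sigma> *\<^sub>R (f' - f)) \<bullet> (w + t *\<^sub>R p) \<noteq> 0" 
  proof
    assume "(\<sigma> *\<^sub>R (f' - f)) \<bullet> (w + t *\<^sub>R p) = 0"
    then have "(f' - f) \<bullet> (w + t *\<^sub>R p) = 0" using \<sigma> by auto
    moreover have rr: "root_of R (f' - f)" using F_difference f'(1) f(1) \<open>f \<noteq> f'\<close> by auto
    ultimately have "(f' - f) \<bullet> w = 0" using point_R root_R_W by metis
    then show False using rr wR unfolding root_of_def by auto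
  qed
  then consider "0 < (\<sigma> *\<^sub>R (f' - f)) \<bullet> (w + t *\<^sub>R p)" | "0 < (- (\<sigma> *\<^sub>R (f' - f))) \<bullet> (w + t *\<^sub>R p)"
    by (metis inner_minus_left linorder_neqE_linordered_idom neg_0_less_iff_less)
  then show False
  proof cases
    case 1
    then have "0 \<le> (\<sigma> *\<^sub>R (f' - f)) \<bullet> dual_vec D d'" by (rule total.simple_coeff_nonneg[OF D r _ d(3)])
    then show False using c1(2) f'(2) by simp
  next
    case 2
    then have "0 \<le> (- (\<sigma> *\<^sub>R (f' - f))) \<bullet> dual_vec D d"
      using total.simple_coeff_nonneg[OF D _ _ d(1), of "- (\<sigma> *\<^sub>R (f' - f))"] r root_of_minus by blast
    then show False using c1(1) f(2) by simp
  qed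
qed

text \<open>Comparing components along \<open>p\<close>, the expansion of
  \<open>\<sigma> (p - f)\<close> uses the only wall on its side, with coefficient at least
  \<open>1 / c\<close>. If this wall came from another \<open>f'\<close>, then
  \<open>\<sigma> (f' - f)\<close> would be a nonnegative combination of the walls, and the height
  of \<open>f'\<close> would be closer to \<open>t\<close> than that of \<open>f\<close>.\<close>

lemma signed_wall:
  assumes \<sigma>: "\<sigma> = 1 \<or> \<sigma> = (- 1 :: real)" and f: "f \<in> F" "0 < \<sigma> * (t - f \<bullet> w)"
    and ext: "\<And>h. h \<in> F \<Longrightarrow> 0 < \<sigma> * (t - h \<bullet> w) \<Longrightarrow> \<sigma> * (h \<bullet> w) \<le> \<sigma> * (f \<bullet> w)"
  obtains c where "c > 0" "(c * \<sigma>) *\<^sub>R (p - f) \<in> D" "((c * \<sigma>) *\<^sub>R (p - f)) \<bullet> p = c * \<sigma>"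
proof -
  have ss: "\<sigma> * \<sigma> = 1" "\<sigma> \<noteq> 0" using \<sigma> by auto
  let ?x = "w + t *\<^sub>R p" and ?\<beta> = "\<sigma> *\<^sub>R (p - f)"
  note fD = total.simpleD(3)[OF D]
  have r: "root_of N ?\<beta>" using root_N_iff f(1) ss by blast
  have "?\<beta> \<bullet> ?x = \<sigma> * (t - f \<bullet> w)" unfolding inner_scaleR_left point[OF f(1) w] ..
  then have pos: "0 < ?\<beta> \<bullet> ?x" using f(2) by (simp only:)
  define cf where "cf d = ?\<beta> \<bullet> dual_vec D d" for d
  have nn: "0 \<le> cf d" if "d \<in> D" for d unfolding cf_def by (rule total.simple_coeff_nonneg[OF D r pos that])
  have ex: "?\<beta> = (\<Sum>d\<in>D. cf d *\<^sub>R d)" unfolding cf_def by (rule total.simple_expand(1)[OF D total.root_W[OF r]])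
  have bp: "\<sigma> * (?\<beta> \<bullet> p) = 1" using ss F_sub f(1) W_p p_unit by (auto simp: inner_diff_left)
  then have s1: "(\<Sum>d\<in>D. cf d * (\<sigma> * (d \<bullet> p))) = 1"
    by (subst (asm) ex) (simp add: inner_sum_left sum_distrib_left mult.left_commute)
  have "\<exists>d\<in>D. 0 < \<sigma> * (d \<bullet> p)"
  proof (rule ccontr)
    assume "\<not> ?thesis"
    then have "(\<Sum>d\<in>D. cf d * (\<sigma> * (d \<bullet> p))) \<le> 0" using nn by (intro sum_nonpos) (auto simp: mult_le_0_iff not_less)
    then show False using s1 by simp
  qed
  then obtain d where d: "d \<in> D" "0 < \<sigma> * (d \<bullet> p)" by blast
  obtain f' c where f': "f' \<in> F" "c > 0" "d = (c * \<sigma>) *\<^sub>R (p - f')" "0 < \<sigma> * (t - f' \<bullet> w)" "d \<bullet> p = c * \<sigma>"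
    using wall_signed[OF \<sigma> d] .
  have dp: "\<sigma> * (d \<bullet> p) = c" using f'(5) ss by (metis mult.commute mult.left_commute mult.right_neutral)
  have "(\<Sum>e\<in>D. cf e * (\<sigma> * (e \<bullet> p))) = cf d * c + (\<Sum>e\<in>D - {d}. cf e * (\<sigma> * (e \<bullet> p)))"
    using fD d(1) dp by (simp add: sum.remove)
  moreover have "(\<Sum>e\<in>D - {d}. cf e * (\<sigma> * (e \<bullet> p))) \<le> 0"
  proof (rule sum_nonpos)
    fix e assume e: "e \<in> D - {d}"
    then have "\<not> 0 < \<sigma> * (e \<bullet> p)" using signed_unique[OF \<sigma> _ _ d] by blast
    then show "cf e * (\<sigma> * (e \<bullet> p)) \<le> 0" using nn e by (simp add: mult_nonneg_nonpos)
  qed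
  ultimately have "1 \<le> cf d * c" using s1 by simp
  then have cd: "1/c \<le> cf d" using f'(2) by (simp add: divide_le_eq)
  have "f' = f"
  proof (rule ccontr)
    assume ne: "f' \<noteq> f"
    have eq: "\<sigma> *\<^sub>R (f' - f) = ?\<beta> - (1/c) *\<^sub>R d" using f'(2) unfolding f'(3) by (simp add: scaleR_diff_right)
    have co: "0 \<le> (\<sigma> *\<^sub>R (f' - f)) \<bullet> dual_vec D e" if "e \<in> D" for e
      unfolding eq using coeff[OF d(1), of e] nn[OF that] cd unfolding cf_def by (auto simp: inner_diff_left)
    have rr: "root_of R (\<sigma> *\<^sub>R (f' - f))" using root_of_scale[OF F_difference[OF f'(1) f(1) ne] ss(2)] .
    have "\<sigma> * (f' \<bullet> w) \<le> \<sigma> * (f \<bullet> w)" using ext f' by blast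
    then have "(\<sigma> *\<^sub>R (f' - f)) \<bullet> w \<le> 0" by (simp add: inner_diff_left right_diff_distrib)
    moreover have "(\<sigma> *\<^sub>R (f' - f)) \<bullet> ?x = (\<sigma> *\<^sub>R (f' - f)) \<bullet> w" by (rule point_R[OF root_R_W[OF rr]])
    moreover have "0 \<le> (\<sigma> *\<^sub>R (f' - f)) \<bullet> ?x"
    proof -
      have "(\<sigma> *\<^sub>R (f' - f)) \<bullet> ?x = (\<Sum>e\<in>D. ((\<sigma> *\<^sub>R (f' - f)) \<bullet> dual_vec D e) * (e \<bullet> ?x))"
        by (subst total.simple_expand(1)[OF D total.root_W[OF root_R_N[OF rr]]]) (simp only: inner_sum_left inner_scaleR_left)
      also have "\<dots> \<ge> 0" using co total.simpleD(5)[OF D] by (intro sum_nonneg mult_nonneg_nonneg) (auto intro: less_imp_le)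
      finally show ?thesis .
    qed
    ultimately have z: "(\<sigma> *\<^sub>R (f' - f)) \<bullet> w = 0" by (simp only:)
    obtain r c where "r \<in> R" "c \<noteq> 0" "\<sigma> *\<^sub>R (f' - f) = c *\<^sub>R r" using rr unfolding root_of_def by blast
    then show False using z wR by (metis inner_scaleR_left mult_eq_0_iff)
  qed
  then show ?thesis using that f' d by metis
qed

text \<open>Elements of \<open>W\<close> have no component along \<open>p\<close>, so the only wall
  not containing \<open>p\<close> has coefficient zero in their expansions.\<close>

lemma simple_of_one:
  assumes d: "d \<in> D" "d \<bullet> p \<noteq> 0" and oth: "\<And>e. e \<in> D \<Longrightarrow> e \<bullet> p \<noteq> 0 \<Longrightarrow> e = d"
  shows "simple_system W R w {e\<in>D. e \<bullet> p = 0}"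
proof -
  let ?D = "{e\<in>D. e \<bullet> p = 0}"
  note fD = total.simpleD(3)[OF D]
  have DD: "?D = D - {d}" using d oth by blast
  have oth': "e \<bullet> p = 0" if "e \<in> D - {d}" for e using oth that by blast
  have coef0: "y \<bullet> dual_vec D d = 0" if "y \<in> W" for y
  proof -
    define cf where "cf e = y \<bullet> dual_vec D e" for e
    have "y = (\<Sum>e\<in>D. cf e *\<^sub>R e)" unfolding cf_def using that W_V by (intro total.simple_expand(1)[OF D]) auto
    then have "y \<bullet> p = (\<Sum>e\<in>D. cf e * (e \<bullet> p))" by (simp add: inner_sum_left)
    also have "\<dots> = (\<Sum>e\<in>{d}. cf e * (e \<bullet> p))" using fD d(1) oth' by (intro sum.mono_neutral_right) simp_all
    finally have "y \<bullet> p = cf d * (d \<bullet> p)" by simp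
    then show ?thesis using W_p(1)[OF that] d(2) unfolding cf_def by simp
  qed
  have exp: "y = (\<Sum>e\<in>?D. (y \<bullet> dual_vec D e) *\<^sub>R e)" if "y \<in> W" for y
  proof -
    have "y = (\<Sum>e\<in>D. (y \<bullet> dual_vec D e) *\<^sub>R e)" using that W_V by (intro total.simple_expand(1)[OF D]) auto
    also have "\<dots> = (\<Sum>e\<in>?D. (y \<bullet> dual_vec D e) *\<^sub>R e)" 
      unfolding DD using fD coef0[OF that] by (intro sum.mono_neutral_right) auto
    finally show ?thesis .
  qed
  have rt: "root_of R e \<and> 0 < e \<bullet> w" if "e \<in> ?D" for e
    using that by (auto elim: wall_cases)
  show ?thesis
    unfolding simple_system_def
  proof (intro conjI ballI allI impI)
    show "independent ?D" by (rule independent_mono[OF total.simpleD(1)[OF D]]) auto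
    show "span ?D = W"
    proof
      show "span ?D \<subseteq> W" using rt root_R_W by (intro span_minimal sub_W) blast
      show "W \<subseteq> span ?D"
      proof
        fix y assume "y \<in> W"
        then have "y = (\<Sum>e\<in>?D. (y \<bullet> dual_vec D e) *\<^sub>R e)" by (rule exp)
        also have "\<dots> \<in> span ?D" by (intro span_sum span_scale span_base)
        finally show "y \<in> span ?D" .
      qed
    qed
  next
    fix \<beta> assume b: "root_of R \<beta> \<and> 0 < \<beta> \<bullet> w"
    then have bW: "\<beta> \<in> W" using root_R_W by blast
    have "0 < \<beta> \<bullet> (w + t *\<^sub>R p)" using point_R[OF bW] b by simp
    then have "0 \<le> \<beta> \<bullet> dual_vec D e" if "e \<in> D" for e using total.simple_coeff_nonneg[OF D root_R_N _ that] b by blast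
    then show "\<exists>c. (\<forall>d\<in>?D. 0 \<le> c d) \<and> \<beta> = (\<Sum>d\<in>?D. c d *\<^sub>R d)" 
      using exp[OF bW] by (intro exI[of _ "\<lambda>e. \<beta> \<bullet> dual_vec D e"]) auto
  qed (use rt in auto)
qed

text \<open>In the expansion of an element of \<open>W\<close> the two walls not containing
  \<open>p\<close> must cancel along \<open>p\<close>, and together they contribute a multiple of
  \<open>g - f\<close>. Independence follows by counting against the dimension of
  \<open>W\<close>.\<close>

lemma simple_of_two:
  assumes f: "f \<in> F" "c > 0" "c *\<^sub>R (p - f) \<in> D" and g: "g \<in> F" "c' > 0" "(- c') *\<^sub>R (p - g) \<in> D"
    and fg: "f \<bullet> w < g \<bullet> w"
  shows "simple_system W R w (insert (g - f) {e\<in>D. e \<bullet> p = 0})"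
proof -
  let ?D = "{e\<in>D. e \<bullet> p = 0}"
  define d1 d2 where d12: "d1 = c *\<^sub>R (p - f)" "d2 = (- c') *\<^sub>R (p - g)"
  have inD: "d1 \<in> D" "d2 \<in> D" using f(3) g(3) unfolding d12 by auto
  note fD = total.simpleD(3)[OF D]
  have dp: "d1 \<bullet> p = c" "d2 \<bullet> p = - c'" unfolding d12 using F_sub f(1) g(1) W_p p_unit by (auto simp: inner_diff_left)
  have oth: "e = d1 \<or> e = d2" if "e \<in> D" "e \<bullet> p \<noteq> 0" for e
  proof (cases "0 < e \<bullet> p")
    case True
    then show ?thesis using signed_unique[of 1 e d1] that inD(1) f(2) dp by auto
  next
    case False
    then show ?thesis using signed_unique[of "- 1" e d2] that inD(2) g(2) dp by auto
  qed
  have ne: "d1 \<noteq> d2" using dp f(2) g(2) by (metis less_trans neg_less_0_iff_less less_irrefl)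
  have Ddec: "D = insert d1 (insert d2 ?D)" using oth inD by auto
  have nin: "d1 \<notin> insert d2 ?D" "d2 \<notin> ?D" using ne dp f(2) g(2) by auto
  have gf: "g \<noteq> f" using fg by auto
  have rgf: "root_of R (g - f)" by (rule F_difference[OF g(1) f(1) gf])
  have gf_eq: "g - f = (1/c) *\<^sub>R d1 + (1/c') *\<^sub>R d2" using f(2) g(2) unfolding d12 by (simp add: scaleR_diff_right)
  have "(g - f) \<bullet> dual_vec D d1 = 1/c"
    unfolding gf_eq inner_add_left inner_scaleR_left coeff[OF inD(1)] coeff[OF inD(2)] using ne by simp
  moreover have "e \<bullet> dual_vec D d1 = 0" if "e \<in> ?D" for e using coeff[of e d1] that nin(1) by auto
  ultimately have gfn: "g - f \<notin> ?D" using f(2) by force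
  have exp: "y = (y \<bullet> dual_vec D d1 * c) *\<^sub>R (g - f) + (\<Sum>e\<in>?D. (y \<bullet> dual_vec D e) *\<^sub>R e)" if "y \<in> W" for y
  proof -
    define cf where "cf e = y \<bullet> dual_vec D e" for e
    have "y = (\<Sum>e\<in>D. cf e *\<^sub>R e)" unfolding cf_def using that W_V by (intro total.simple_expand(1)[OF D]) auto
    also have "\<dots> = cf d1 *\<^sub>R d1 + (cf d2 *\<^sub>R d2 + (\<Sum>e\<in>?D. cf e *\<^sub>R e))"
      using fD nin by (subst Ddec) (simp add: sum.insert)
    finally have y: "y = cf d1 *\<^sub>R d1 + (cf d2 *\<^sub>R d2 + (\<Sum>e\<in>?D. cf e *\<^sub>R e))" .
    have "(\<Sum>e\<in>?D. cf e *\<^sub>R e) \<bullet> p = 0" by (simp add: inner_sum_left)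
    moreover have "y \<bullet> p = cf d1 * (d1 \<bullet> p) + (cf d2 * (d2 \<bullet> p) + (\<Sum>e\<in>?D. cf e *\<^sub>R e) \<bullet> p)"
      by (subst y) (simp only: inner_add_left inner_scaleR_left)
    ultimately have "y \<bullet> p = cf d1 * c - cf d2 * c'" using dp by simp
    then have "cf d1 * c = cf d2 * c'" using W_p(1)[OF that] by simp
    then have eq: "cf d1 *\<^sub>R d1 + cf d2 *\<^sub>R d2 = (cf d1 * c) *\<^sub>R (g - f)" unfolding d12 by (simp add: scaleR_diff_right)
    have "y = (cf d1 *\<^sub>R d1 + cf d2 *\<^sub>R d2) + (\<Sum>e\<in>?D. cf e *\<^sub>R e)" unfolding add.assoc by (rule y)
    then show ?thesis unfolding eq unfolding cf_def .
  qed
  have rt: "root_of R e \<and> 0 < e \<bullet> w" if "e \<in> insert (g - f) ?D" for e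
  proof (cases "e = g - f")
    case False
    then have "e \<in> D" "e \<bullet> p = 0" using that by auto
    then show ?thesis by (cases rule: wall_cases) auto
  qed (use fg rgf in \<open>auto simp: inner_diff_left\<close>)
  let ?E = "insert (g - f) ?D"
  have EW: "?E \<subseteq> W" using rt root_R_W by blast
  have Wspan: "W \<subseteq> span ?E"
  proof
    fix y assume "y \<in> W"
    then have "y = (y \<bullet> dual_vec D d1 * c) *\<^sub>R (g - f) + (\<Sum>e\<in>?D. (y \<bullet> dual_vec D e) *\<^sub>R e)" by (rule exp)
    also have "\<dots> \<in> span ?E" by (intro span_add span_sum span_scale span_base) auto
    finally show "y \<in> span ?E" .
  qed
  show ?thesis
    unfolding simple_system_def
  proof (intro conjI ballI allI impI)
    show "span ?E = W" using Wspan EW sub_W by (simp add: span_minimal subset_antisym)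
    have "card D = Suc (Suc (card ?D))" using fD nin by (subst Ddec) simp
    moreover have "card D = dim V" using total.simpleD(1,2)[OF D] by (metis dim_eq_card_independent dim_span)
    ultimately have cE: "Suc (card ?E) = dim V" using gfn fD by simp
    have "dim V \<le> Suc (dim W)"
    proof -
      have "V \<subseteq> span (insert p W)"
      proof
        fix x assume x: "x \<in> V"
        have "x - (p \<bullet> x) *\<^sub>R p \<in> W" unfolding W_def using x p_V subspace_V p_unit
          by (auto intro!: subspace_diff subspace_scale simp: inner_diff_right)
        then have "(x - (p \<bullet> x) *\<^sub>R p) + (p \<bullet> x) *\<^sub>R p \<in> span (insert p W)" by (intro span_add span_scale span_base) auto
        then show "x \<in> span (insert p W)" by simp
      qed
      then have "dim V \<le> dim (insert p W)" by (metis dim_mono)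
      also have "\<dots> \<le> Suc (dim W)" by (simp add: dim_insert)
      finally show ?thesis .
    qed
    then have "card ?E \<le> dim W" using cE by simp
    then show "independent ?E" using card_le_dim_spanning[OF EW Wspan] fD by simp
  next
    fix \<beta> assume b: "root_of R \<beta> \<and> 0 < \<beta> \<bullet> w"
    then have bW: "\<beta> \<in> W" using root_R_W by blast
    have "0 < \<beta> \<bullet> (w + t *\<^sub>R p)" using point_R[OF bW] b by simp
    then have nn: "0 \<le> \<beta> \<bullet> dual_vec D e" if "e \<in> D" for e using total.simple_coeff_nonneg[OF D root_R_N _ that] b by blast
    define c1 where "c1 e = (if e = g - f then \<beta> \<bullet> dual_vec D d1 * c else \<beta> \<bullet> dual_vec D e)" for e
    have "(\<Sum>e\<in>?E. c1 e *\<^sub>R e) = (\<beta> \<bullet> dual_vec D d1 * c) *\<^sub>R (g - f) + (\<Sum>e\<in>?D. (\<beta> \<bullet> dual_vec D e) *\<^sub>R e)"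
      using gfn fD by (simp add: c1_def) (intro sum.cong, auto)
    then have "\<beta> = (\<Sum>e\<in>?E. c1 e *\<^sub>R e)" using exp[OF bW] by metis
    moreover have "0 \<le> c1 e" if "e \<in> ?E" for e
      using that nn[of e] mult_nonneg_nonneg[OF nn[OF inD(1)] less_imp_le[OF f(2)]] unfolding c1_def by auto
    ultimately show "\<exists>c. (\<forall>d\<in>?E. 0 \<le> c d) \<and> \<beta> = (\<Sum>d\<in>?E. c d *\<^sub>R d)" by blast
  qed (use rt in auto)
qed

end

lemma fibre_simple_ex:
  assumes w: "w \<in> W" "\<forall>r\<in>R. r \<bullet> w \<noteq> 0"
  shows "\<exists>D. simple_system W R w D"
proof -
  \<comment> \<open>Above all heights of the fibre, so no hyperplane of some \<open>p - f\<close>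
    bounds the chamber from above.\<close>
  define t where "t = Max ((\<lambda>f. f \<bullet> w) ` F) + 1"
  have lt: "f \<bullet> w < t" if "f \<in> F" for f
  proof -
    have "f \<bullet> w \<le> Max ((\<lambda>f. f \<bullet> w) ` F)" using fin_F that by (intro Max_ge) auto
    then show ?thesis unfolding t_def by linarith
  qed
  let ?x = "w + t *\<^sub>R p"
  have "n \<bullet> ?x \<noteq> 0" if "n \<in> N" for n
    using that lt w point[OF _ w(1)] point_R R_sub unfolding N_def by force
  then obtain D where D: "simple_system V N ?x D" using total.simple_ex[OF point_V[OF w(1)]] by blast
  have t: "\<And>f. f \<in> F \<Longrightarrow> f \<bullet> w \<noteq> t" using lt by force
  have "\<exists>d\<in>D. d \<bullet> p \<noteq> 0"
  proof (rule ccontr)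
    assume n: "\<not> ?thesis"
    have "orthogonal p p"
    proof (rule orthogonal_to_span)
      show "p \<in> span D" using total.simpleD(2)[OF D] p_V by simp
    qed (use n in \<open>auto simp: orthogonal_def inner_commute\<close>)
    then show False using p_unit by (simp add: orthogonal_def)
  qed
  then obtain d where d: "d \<in> D" "d \<bullet> p \<noteq> 0" by blast
  have pos: "0 < 1 * (e \<bullet> p)" if "e \<in> D" "e \<bullet> p \<noteq> 0" for e
  proof -
    have "e \<bullet> p = 0 \<or> 0 < e \<bullet> p \<or> (\<exists>f\<in>F. t < f \<bullet> w)"
      by (rule wall_cases[OF w t D that(1)]) auto
    then show ?thesis using lt that(2) by force
  qed
  have "simple_system W R w {e\<in>D. e \<bullet> p = 0}"
  proof (rule simple_of_one[OF w t D d])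
    fix e assume "e \<in> D" "e \<bullet> p \<noteq> 0"
    then show "e = d" using signed_unique[OF w t D, of 1 e d] pos d by auto
  qed
  then show ?thesis by blast
qed

text \<open>Provides \<open>simple_unique\<close> for \<open>W\<close> and \<open>R\<close>, which
  is used in proving \<open>F_consec\<close> for the true fibre \<open>F\<close>.\<close>

sublocale base: fibred_arrangement W R "{0}"
  by unfold_locales (use sub_W fin_R R_sub R_0 fibre_simple_ex in \<open>auto simp: subspace_0\<close>)

lemma consecutive_walls:
  assumes w: "w \<in> W" "\<forall>r\<in>R. r \<bullet> w \<noteq> 0" and fg: "f \<in> F" "g \<in> F" "f \<bullet> w < t" "t < g \<bullet> w"
    and cons: "\<forall>h\<in>F. \<not> (f \<bullet> w < h \<bullet> w \<and> h \<bullet> w < g \<bullet> w)" and D: "simple_system V N (w + t *\<^sub>R p) D"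
  obtains c c' where "c > 0" "c' > 0" "c *\<^sub>R (p - f) \<in> D" "(- c') *\<^sub>R (p - g) \<in> D"
    "simple_system W R w (insert (g - f) {e\<in>D. e \<bullet> p = 0})"
proof -
  have dich: "h \<bullet> w \<le> f \<bullet> w \<or> g \<bullet> w \<le> h \<bullet> w" if "h \<in> F" for h using cons that by force
  then have t: "\<And>h. h \<in> F \<Longrightarrow> h \<bullet> w \<noteq> t" using fg by force
  obtain c where c: "c > 0" "(c * 1) *\<^sub>R (p - f) \<in> D"
    by (rule signed_wall[OF w t D, of 1 f]) (use fg dich in force)+
  obtain c' where c': "c' > 0" "(c' * -1) *\<^sub>R (p - g) \<in> D"
    by (rule signed_wall[OF w t D, of "-1" g]) (use fg dich in force)+
  have c1: "c *\<^sub>R (p - f) \<in> D" "(- c') *\<^sub>R (p - g) \<in> D" using c c' by auto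
  have "f \<bullet> w < g \<bullet> w" using fg by simp
  then show ?thesis using that[OF c(1) c'(1) c1] simple_of_two[OF w t D fg(1) c(1) c1(1) fg(2) c'(1) c1(2)] by blast
qed

sublocale fibred_arrangement W R F
proof (unfold_locales, goal_cases)
  case (10 w D f g)
  \<comment> \<open>Halfway between consecutive heights, where the hyperplanes of \<open>f\<close>
    and \<open>g\<close> are the lower and upper walls of the chamber.\<close>
  define t where "t = (f \<bullet> w + g \<bullet> w) / 2"
  have t: "f \<bullet> w < t" "t < g \<bullet> w" using 10 unfolding t_def by auto
  let ?x = "w + t *\<^sub>R p"
  have "n \<bullet> ?x \<noteq> 0" if "n \<in> N" for n
    using that
    unfolding N_def
  proof
    assume "n \<in> (\<lambda>f. p - f) ` F"
    then obtain h where h: "h \<in> F" "n = p - h" by blast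
    have "h \<bullet> w \<noteq> t" using 10 h t by force
    then show ?thesis unfolding h(2) point[OF h(1) 10(1)] by simp
  qed (use 10 point_R R_sub in force)
  then obtain D' where D': "simple_system V N ?x D'" using total.simple_ex[OF point_V[OF 10(1)]] by blast
  have "simple_system W R w (insert (g - f) {e\<in>D'. e \<bullet> p = 0})"
    using consecutive_walls[OF 10(1,2,4,5) t 10(7) D'] by blast
  then show ?case using base.simple_unique[OF _ 10(3), of _ "g - f"] by blast
qed (use sub_W fin_R R_sub R_0 fin_F F_sub F_nonempty F_difference fibre_simple_ex in auto)

end

section \<open>From a chain of modular elements to a fibration\<close>

lemma subspace_lattice:
  assumes "arrangement V A" "X \<in> int_lattice V A" shows "subspace X" "X \<subseteq> V"
proof -
  obtain B where B: "B \<subseteq> A" "X = V \<inter> \<Inter>B" using assms(2) unfolding int_lattice_def by blast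
  have V: "subspace V" "\<forall>H\<in>A. subspace H" using assms(1) unfolding arrangement_def hyperplane_of_def by auto
  show "subspace X" unfolding B(2) using V B(1) by (intro subspace_inter subspace_Inter) auto
  show "X \<subseteq> V" using B by auto
qed

text \<open>Dimensions fall strictly along a chain of \<open>dim V\<close> steps, so the last but
  one member has dimension at most one; it is not zero because it properly contains the
  center.\<close>

lemma modular_line:
  assumes arr: "arrangement V A" and pos: "0 < dim V" and sup: "supersolvable_arr V A"
  obtains p where "p \<in> V" "p \<bullet> p = 1" "modular_element V A (span {p})" "arr_center V A = {0}"
proof -
  obtain X where X: "X 0 = V" "X (dim V) = arr_center V A" "\<And>i. i < dim V \<Longrightarrow> X (Suc i) \<subset> X i"
      "\<And>i. i \<le> dim V \<Longrightarrow> modular_element V A (X i)" and rk: "arr_rank V A = dim V"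
    using sup unfolding supersolvable_arr_def by blast
  have sub: "subspace (X i)" "X i \<subseteq> V" if "i \<le> dim V" for i
    using subspace_lattice[OF arr] X(4)[OF that] unfolding modular_element_def by auto
  have d: "dim (X i) + i \<le> dim V" if "i \<le> dim V" for i
    using that
  proof (induction i)
    case 0 then show ?case by (simp add: X(1))
  next
    case (Suc i)
    have "span (X (Suc i)) \<subset> span (X i)" using X(3)[of i] sub[of i] sub[of "Suc i"] Suc.prems by (metis Suc_leD Suc_le_lessD span_eq_iff)
    then have "dim (X (Suc i)) < dim (X i)" by (rule dim_psubset)
    then show ?case using Suc by auto
  qed
  let ?m = "dim V - 1"
  have m: "?m < dim V" "Suc ?m = dim V" using pos by auto
  have d1: "dim (X ?m) \<le> 1" using d[of ?m] m by auto
  have "arr_center V A \<subset> X ?m" using X(2,3) m by metis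
  moreover have "0 \<in> arr_center V A" using sub[of "dim V"] X(2) subspace_0 by auto
  ultimately obtain x where x: "x \<in> X ?m" "x \<noteq> 0" by blast
  define p where "p = (1 / norm x) *\<^sub>R x"
  have p: "p \<in> X ?m" "p \<bullet> p = 1" unfolding p_def using x sub[of ?m] m
    by (auto intro: subspace_scale simp: dot_square_norm power2_eq_square)
  have "span {p} = X ?m"
  proof (rule subspace_dim_equal)
    show "span {p} \<subseteq> X ?m" using p sub[of ?m] m by (intro span_minimal) auto
    have "independent {p}" using p(2) by auto
    then have "dim (span {p}) = 1" by (simp add: dim_eq_card_independent)
    then show "dim (X ?m) \<le> dim (span {p})" using d1 by simp
  qed (use sub[of ?m] m in auto)
  then have "modular_element V A (span {p})" using X(4)[of ?m] m by simp
  moreover have "arr_center V A = {0}"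
  proof -
    have "dim (arr_center V A) = 0" using d[of "dim V"] X(2) by simp
    then show ?thesis using \<open>0 \<in> arr_center V A\<close> by auto
  qed
  ultimately show ?thesis using that p sub[of ?m] m by auto
qed

text \<open>For two hyperplanes off the modular line with intersection \<open>Y\<close>, modularity
  puts \<open>span {p} + Y\<close> into the lattice. It does not contain \<open>f - g\<close>, so
  some hyperplane of \<open>A\<close> contains \<open>p\<close> and \<open>Y\<close> but not
  \<open>f - g\<close>, and its normal is a multiple of \<open>f - g\<close>.\<close>

theorem ex_modular_fibration:
  fixes V :: "'a::euclidean_space set"
  assumes arr: "arrangement V A" and pos: "0 < dim V" and sup: "supersolvable_arr V A" and simp: "simplicial_arr V A"
  shows "\<exists>p W R F N. modular_fibration V A p W R F N"
proof -
  have V: "subspace V" "finite A" "\<And>H. H \<in> A \<Longrightarrow> hyperplane_of V H" using arr unfolding arrangement_def by auto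
  obtain p where p: "p \<in> V" "p \<bullet> p = 1" "modular_element V A (span {p})" "arr_center V A = {0}"
    using modular_line[OF arr pos sup] .
  have "\<exists>n. n \<in> V \<and> n \<noteq> 0 \<and> H = {x\<in>V. n \<bullet> x = 0} \<and> (n \<bullet> p = 0 \<or> n \<bullet> p = 1)" if HA: "H \<in> A" for H
  proof -
    obtain n where n: "n \<in> V" "n \<noteq> 0" "H = {x\<in>V. n \<bullet> x = 0}" using hyperplane_normal[OF V(1) V(3)[OF HA]] .
    show ?thesis
    proof (cases "n \<bullet> p = 0")
      case False
      define m where "m = (1 / (n \<bullet> p)) *\<^sub>R n"
      have "m \<in> V" "m \<noteq> 0" "m \<bullet> p = 1" unfolding m_def using n False V(1) by (auto intro: subspace_scale)
      moreover have "H = {x\<in>V. m \<bullet> x = 0}" unfolding n(3) m_def using False by auto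
      ultimately show ?thesis by blast
    qed (use n in blast)
  qed
  then obtain nor where nor: "\<And>H. H \<in> A \<Longrightarrow> nor H \<in> V \<and> nor H \<noteq> 0 \<and> H = {x\<in>V. nor H \<bullet> x = 0} \<and> (nor H \<bullet> p = 0 \<or> nor H \<bullet> p = 1)"
    by metis
  define N0 where "N0 = nor ` A"
  define W where "W = {x\<in>V. p \<bullet> x = 0}"
  define R where "R = {n\<in>N0. n \<bullet> p = 0}"
  define F where "F = (\<lambda>n. p - n) ` {n\<in>N0. n \<bullet> p = 1}"
  have N0: "finite N0" "N0 \<subseteq> V" "0 \<notin> N0" "\<And>n. n \<in> N0 \<Longrightarrow> n \<bullet> p = 0 \<or> n \<bullet> p = 1"
    unfolding N0_def using nor V(2) by force+
  have A: "A = (\<lambda>n. {x\<in>V. n \<bullet> x = 0}) ` N0" unfolding N0_def image_image using nor by force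
  have NN: "R \<union> (\<lambda>f. p - f) ` F = N0"
  proof -
    have "(\<lambda>f. p - f) ` F = {n\<in>N0. n \<bullet> p = 1}" unfolding F_def image_image by simp
    then show ?thesis unfolding R_def using N0(4) by blast
  qed
  have subW: "subspace W" unfolding W_def using V(1) by (auto simp: subspace_def inner_add_right)
  have FW: "F \<subseteq> W" unfolding F_def W_def using N0(2) p V(1) 
    by (auto intro: subspace_diff simp: inner_diff_right inner_commute)
  have "modular_fibration V A p W R F N0"
  proof
    show "R \<subseteq> W" unfolding R_def W_def using N0(2) by (auto simp: inner_commute)
    show "F \<noteq> {}"
    proof
      assume "F = {}"
      then have "\<forall>n\<in>N0. n \<bullet> p = 0" using N0(4) unfolding F_def by auto
      then have "p \<in> arr_center V A" unfolding arr_center_def A using p(1) by auto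
      then show False using p(2,4) by auto
    qed
    fix f g assume fg: "f \<in> F" "g \<in> F" "f \<noteq> g"
    let ?H = "\<lambda>n. {x\<in>V. n \<bullet> x = 0}"
    have fgN: "p - f \<in> N0" "p - g \<in> N0" using fg(1,2) NN by auto
    define Y where "Y = V \<inter> \<Inter>{?H (p - f), ?H (p - g)}"
    have "Y \<in> int_lattice V A" unfolding int_lattice_def Y_def A using fgN by blast
    then have "span {p} + Y \<in> int_lattice V A" using p(3) unfolding modular_element_def by blast
    then obtain B where B: "B \<subseteq> A" "span {p} + Y = V \<inter> \<Inter>B" unfolding int_lattice_def by blast
    have fgW: "f \<in> W" "g \<in> W" "f - g \<in> W" using FW fg subW by (auto intro: subspace_diff)
    have pW: "p \<bullet> y = 0" "y \<bullet> p = 0" if "y \<in> W" for y using that unfolding W_def by (auto simp: inner_commute)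
    have "f - g \<notin> span {p} + Y"
    proof
      assume "f - g \<in> span {p} + Y"
      then obtain k y where ky: "f - g = k *\<^sub>R p + y" "y \<in> Y" by (auto simp: set_plus_def span_singleton)
      have "(p - f) \<bullet> y = 0" "(p - g) \<bullet> y = 0" using ky(2) unfolding Y_def by auto
      then have "(f - g) \<bullet> y = 0" by (simp add: inner_diff_left)
      moreover have "(f - g) \<bullet> p = 0" using pW fgW by blast
      ultimately have "(f - g) \<bullet> (f - g) = 0" by (subst (2) ky(1)) (simp add: inner_add_right)
      then show False using fg(3) by simp
    qed
    moreover have "f - g \<in> V" using fgW unfolding W_def by auto
    ultimately obtain H where H: "H \<in> B" "span {p} + Y \<subseteq> H" using B(2) by blast
    then obtain n where n: "n \<in> N0" "H = ?H n" using B(1) unfolding A by blast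
    have "0 \<in> Y" unfolding Y_def using V(1) subspace_0 by auto
    then have "p + 0 \<in> span {p} + Y" by (intro set_plus_intro) (auto intro: span_base)
    then have np: "n \<bullet> p = 0" using H(2) n(2) by auto
    then have nR: "n \<in> R" "n \<in> W" using n(1) N0(2) unfolding R_def W_def by (auto simp: inner_commute)
    have "\<exists>c. n = c *\<^sub>R (f - g)"
    proof (rule parallel_of_ker_subset[OF subW fgW(3) nR(2)])
      fix y assume y: "y \<in> W" "(f - g) \<bullet> y = 0"
      \<comment> \<open>The point above \<open>y\<close>, in the direction of \<open>p\<close>, at
        which both hyperplanes are met.\<close>
      define z where "z = y + (f \<bullet> y) *\<^sub>R p"
      have "z \<in> V" unfolding z_def using y(1) p(1) V(1) unfolding W_def by (auto intro: subspace_add subspace_scale)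
      moreover have "(p - f) \<bullet> z = 0" "(p - g) \<bullet> z = 0"
        unfolding z_def using y fgW pW p(2) by (auto simp: inner_diff_left inner_add_right)
      ultimately have "z \<in> Y" unfolding Y_def by auto
      then have "0 + z \<in> span {p} + Y" by (intro set_plus_intro) (auto intro: span_zero)
      then have "n \<bullet> z = 0" using H(2) n(2) by auto
      then show "n \<bullet> y = 0" unfolding z_def using np by (simp add: inner_add_right)
    qed (use fg in auto)
    then obtain c where c: "n = c *\<^sub>R (f - g)" by blast
    have "c \<noteq> 0" using c n(1) N0(3) by auto
    then have "f - g = (1/c) *\<^sub>R n" using c by simp
    then show "root_of R (f - g)" unfolding root_of_def using nR(1) \<open>c \<noteq> 0\<close> by (intro bexI[of _ n] exI[of _ "1/c"]) auto
  qed (use V p W_def N0 A NN FW simp in \<open>auto simp: R_def F_def\<close>)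
  then show ?thesis by blast
qed

section \<open>Irreducibility makes every simple root a letter\<close>

lemma dim_ker_Suc:
  fixes n :: "'a::euclidean_space"
  assumes S: "subspace S" and x: "x \<in> S" "n \<bullet> x \<noteq> 0"
  shows "dim {y\<in>S. n \<bullet> y = 0} + 1 = dim S"
proof -
  let ?K = "{y\<in>S. n \<bullet> y = 0}"
  have K: "subspace ?K" using S by (auto simp: subspace_def inner_add_right)
  have "x \<notin> span ?K" using K x by (metis (mono_tags, lifting) mem_Collect_eq span_eq_iff)
  then have 1: "dim (insert x ?K) = dim ?K + 1" by (simp add: dim_insert)
  have "S \<subseteq> span (insert x ?K)"
  proof
    fix y assume y: "y \<in> S"
    have "y - ((n \<bullet> y) / (n \<bullet> x)) *\<^sub>R x \<in> ?K" using y x S by (auto intro!: subspace_diff subspace_scale simp: inner_diff_right)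
    then have "(y - ((n \<bullet> y) / (n \<bullet> x)) *\<^sub>R x) + ((n \<bullet> y) / (n \<bullet> x)) *\<^sub>R x \<in> span (insert x ?K)"
      by (intro span_add span_scale span_base) auto
    then show "y \<in> span (insert x ?K)" by simp
  qed
  then have "dim S \<le> dim (insert x ?K)" by (metis dim_mono)
  moreover have "dim (insert x ?K) \<le> dim S" by (rule dim_subset) (use x in auto)
  ultimately show ?thesis using 1 by simp
qed

text \<open>The factors are orthogonal complements with exchanged roles: a normal in
  \<open>M\<close> vanishes on the complement of \<open>M\<close>, which is therefore the factor
  contained in its hyperplane.\<close>

lemma reducible_of_normals:
  fixes V :: "'a::euclidean_space set"
  assumes V: "subspace V" and M: "subspace M" "M \<subseteq> V" "M \<noteq> {0}" "subspace M'" "M' \<subseteq> V" "M' \<noteq> {0}"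
    and sum: "M \<inter> M' = {0}" "span (M \<union> M') = V"
    and N: "\<And>n. n \<in> N \<Longrightarrow> n \<noteq> 0 \<and> (n \<in> M \<or> n \<in> M')"
  shows "\<not> irreducible_arr V ((\<lambda>n. {x\<in>V. n \<bullet> x = 0}) ` N)"
proof -
  define pp where "pp M = {y\<in>V. \<forall>x\<in>M. orthogonal x y}" for M
  have sub: "subspace (pp M)" for M
    unfolding pp_def using V by (auto simp: subspace_def orthogonal_def inner_add_right)
  have dimpp: "dim (pp M) + dim M = dim V" if "subspace M" "M \<subseteq> V" for M
    unfolding pp_def by (rule dim_subspace_orthogonal_to_vectors[OF that(1) V that(2)])
  have sp: "{x + y |x y. x \<in> M \<and> y \<in> M'} = V"
  proof -
    have s: "span M = M" "span M' = M'" using M(1,4) by (simp_all add: span_eq_iff)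
    show ?thesis using sum(2) unfolding span_Un s .
  qed
  have dM: "dim M + dim M' = dim V" using dim_sums_Int[OF M(1,4)] sp sum(1) by simp
  have zero: "x = 0" if xx: "x \<in> V" "\<And>m. m \<in> M \<Longrightarrow> m \<bullet> x = 0" "\<And>m. m \<in> M' \<Longrightarrow> m \<bullet> x = 0" for x
  proof -
    obtain a b where ab: "x = a + b" "a \<in> M" "b \<in> M'" using sp xx(1) by blast
    have "x \<bullet> x = a \<bullet> x + b \<bullet> x" by (subst (1) ab(1)) (simp add: inner_add_left)
    then show ?thesis using xx(2)[OF ab(2)] xx(3)[OF ab(3)] by simp
  qed
  let ?V1 = "pp M'" and ?V2 = "pp M"
  have V12: "?V1 \<inter> ?V2 = {0}"
  proof -
    have "x = 0" if "x \<in> ?V1" "x \<in> ?V2" for x using that zero[of x] unfolding pp_def orthogonal_def by auto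
    then show ?thesis using sub subspace_0 by blast
  qed
  have plus: "?V1 + ?V2 = {x + y |x y. x \<in> ?V1 \<and> y \<in> ?V2}" unfolding set_plus_def by blast
  have "dim (?V1 + ?V2) = dim V" using dim_sums_Int[OF sub sub, of M' M] V12 dimpp[OF M(1,2)] dimpp[OF M(4,5)] dM unfolding plus by simp
  moreover have "?V1 + ?V2 \<subseteq> V"
  proof -
    have "pp M \<subseteq> V" for M unfolding pp_def by auto
    then show ?thesis using subspace_add[OF V] unfolding plus by blast
  qed
  moreover have "subspace (?V1 + ?V2)" unfolding plus by (rule subspace_sums[OF sub sub])
  ultimately have VV: "?V1 + ?V2 = V" using subspace_dim_equal[OF _ V] by simp
  have nz: "?V1 \<noteq> {0}" "?V2 \<noteq> {0}"
  proof -
    have "\<not> M \<subseteq> {0}" "\<not> M' \<subseteq> {0}" using M(3,6) subspace_0[OF M(1)] subspace_0[OF M(4)] by blast+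
    then have "dim M \<noteq> 0" "dim M' \<noteq> 0" unfolding dim_eq_0 .
    then have "dim ?V1 \<noteq> 0" "dim ?V2 \<noteq> 0" using dimpp[OF M(1,2)] dimpp[OF M(4,5)] dM by linarith+
    then show "?V1 \<noteq> {0}" "?V2 \<noteq> {0}" unfolding dim_eq_0 by blast+
  qed
  have hyp: "hyperplane_of V1 {x\<in>V1. n \<bullet> x = 0} \<and> {x\<in>V. n \<bullet> x = 0} = {x\<in>V1. n \<bullet> x = 0} + V2"
    if V12: "subspace V1" "subspace V2" "V1 + V2 = V" "V1 \<subseteq> V" and n: "n \<noteq> 0" "n \<in> V" "\<And>y. y \<in> V2 \<Longrightarrow> n \<bullet> y = 0" for V1 V2 n
  proof -
    have dec: "\<exists>a\<in>V1. \<exists>b\<in>V2. x = a + b" if "x \<in> V" for x using that V12(3) by (auto simp: set_plus_def)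
    have "\<exists>x\<in>V1. n \<bullet> x \<noteq> 0"
    proof (rule ccontr)
      assume z: "\<not> ?thesis"
      obtain a b where "a \<in> V1" "b \<in> V2" "n = a + b" using dec[OF n(2)] by blast
      then have "n \<bullet> n = 0" using z n(3) by (metis add.right_neutral inner_add_right)
      then show False using n(1) by simp
    qed
    then obtain x where x: "x \<in> V1" "n \<bullet> x \<noteq> 0" by blast
    have "hyperplane_of V1 {x\<in>V1. n \<bullet> x = 0}"
      unfolding hyperplane_of_def using dim_ker_Suc[OF V12(1) x] V12(1) by (auto simp: subspace_def inner_add_right)
    moreover have "{x\<in>V. n \<bullet> x = 0} = {x\<in>V1. n \<bullet> x = 0} + V2"
    proof
      show "{x\<in>V. n \<bullet> x = 0} \<subseteq> {x\<in>V1. n \<bullet> x = 0} + V2"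
      proof
        fix x assume x: "x \<in> {x\<in>V. n \<bullet> x = 0}"
        then obtain a b where ab: "a \<in> V1" "b \<in> V2" "x = a + b" using dec by blast
        then have "n \<bullet> a = 0" using x n(3) by (auto simp: inner_add_right)
        then show "x \<in> {x\<in>V1. n \<bullet> x = 0} + V2" unfolding ab(3) using ab by (intro set_plus_intro) auto
      qed
      show "{x\<in>V1. n \<bullet> x = 0} + V2 \<subseteq> {x\<in>V. n \<bullet> x = 0}"
      proof
        fix x assume "x \<in> {x\<in>V1. n \<bullet> x = 0} + V2"
        then obtain a b where ab: "a \<in> V1" "n \<bullet> a = 0" "b \<in> V2" "x = a + b" by (auto simp: set_plus_def)
        then have "x \<in> V" using V12(3) by (metis set_plus_intro)
        then show "x \<in> {x\<in>V. n \<bullet> x = 0}" using ab n(3) by (auto simp: inner_add_right)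
      qed
    qed
    ultimately show ?thesis by blast
  qed
  have VV': "?V2 + ?V1 = V" using VV by (simp add: add.commute)
  have "(\<exists>H1. hyperplane_of ?V1 H1 \<and> H = H1 + ?V2) \<or> (\<exists>H2. hyperplane_of ?V2 H2 \<and> H = ?V1 + H2)"
    if HN: "H \<in> (\<lambda>n. {x\<in>V. n \<bullet> x = 0}) ` N" for H
  proof -
    obtain n where n: "n \<in> N" "H = {x\<in>V. n \<bullet> x = 0}" using HN by blast
    from N[OF n(1)] consider "n \<in> M" | "n \<in> M'" by blast
    then show ?thesis
    proof cases
      case 1
      then have "n \<bullet> y = 0" if "y \<in> ?V2" for y using that unfolding pp_def orthogonal_def by blast
      then show ?thesis using hyp[OF sub sub VV, of n] N[OF n(1)] 1 M(2) n(2) unfolding pp_def by blast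
    next
      case 2
      then have "n \<bullet> y = 0" if "y \<in> ?V1" for y using that unfolding pp_def orthogonal_def by blast
      then have "hyperplane_of ?V2 {x\<in>?V2. n \<bullet> x = 0} \<and> {x\<in>V. n \<bullet> x = 0} = {x\<in>?V2. n \<bullet> x = 0} + ?V1" 
        using hyp[OF sub sub VV', of n] N[OF n(1)] 2 M(5) unfolding pp_def by blast
      then show ?thesis using n(2) by (metis add.commute)
    qed
  qed
  then have "\<forall>H\<in>(\<lambda>n. {x\<in>V. n \<bullet> x = 0}) ` N. (\<exists>H1. hyperplane_of ?V1 H1 \<and> H = H1 + ?V2) \<or>
      (\<exists>H2. hyperplane_of ?V2 H2 \<and> H = ?V1 + H2)" by (rule ballI)
  then show ?thesis
    unfolding irreducible_arr_def not_not
    by (intro exI[of _ ?V1] exI[of _ ?V2] conjI sub VV V12 nz)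
qed

context modular_fibration
begin

text \<open>Otherwise the space \<open>U'\<close> of \<open>decomposition\<close> and the span of
  \<open>dspan\<close> with one normal \<open>p - f0\<close> would split \<open>V\<close>; all other
  \<open>p - f\<close> differ from \<open>p - f0\<close> by elements of
  \<open>dspan\<close>.\<close>

theorem all_letters:
  assumes irr: "irreducible_arr V A" and w: "chamber_word W R F w D e"
  shows "chamber_word.letter D e ` {..<card F - 1} = D"
proof (rule ccontr)
  assume "chamber_word.letter D e ` {..<card F - 1} \<noteq> D"
  then obtain U' where U': "subspace U'" "U' \<noteq> {0}" "U' \<subseteq> W" "dspan \<inter> U' = {0}" "span (dspan \<union> U') = W"
    "\<And>\<beta>. root \<beta> \<Longrightarrow> \<beta> \<in> dspan \<or> \<beta> \<in> U'" using decomposition[OF w] by blast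
  obtain f0 where f0: "f0 \<in> F" using F_nonempty by blast
  define M where "M = span (insert (p - f0) dspan)"
  have sd: "span dspan = dspan" unfolding dspan_def by simp
  have pf: "p - f0 \<in> V" using f0 F_sub W_V p_V subspace_V by (auto intro: subspace_diff)
  have pfp: "(p - f0) \<bullet> p = 1" using f0 F_sub W_p p_unit by (auto simp: inner_diff_left)
  have "M \<subseteq> V" unfolding M_def using pf dspan_W W_V subspace_V by (intro span_minimal) auto
  have 1: "M \<noteq> {0}"
  proof -
    have "p - f0 \<in> M" unfolding M_def by (intro span_base) auto
    then show ?thesis using pf_nz[OF f0] by blast
  qed
  have 2: "M \<inter> U' = {0}"
  proof -
    have "x = 0" if x: "x \<in> M" "x \<in> U'" for x
    proof -
      obtain k where k: "x - k *\<^sub>R (p - f0) \<in> dspan" using x(1) unfolding M_def span_insert sd by blast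
      have "(x - k *\<^sub>R (p - f0)) \<bullet> p = 0" using k dspan_W W_p by blast
      moreover have "x \<bullet> p = 0" using x(2) U'(3) W_p by blast
      ultimately have "k = 0" using pfp by (simp add: inner_diff_left)
      then show ?thesis using k x(2) U'(4) by auto
    qed
    moreover have "0 \<in> M" "0 \<in> U'" using U'(1) subspace_0 unfolding M_def by (auto intro: span_zero)
    ultimately show ?thesis by blast
  qed
  have 3: "span (M \<union> U') = V"
  proof
    show "span (M \<union> U') \<subseteq> V" using \<open>M \<subseteq> V\<close> U'(3) W_V subspace_V by (intro span_minimal) auto
    have dM: "dspan \<subseteq> M" unfolding M_def by (auto intro: span_base)
    have "W \<subseteq> span (M \<union> U')" unfolding U'(5)[symmetric] using dM by (intro span_mono) auto
    moreover have "p \<in> span (M \<union> U')"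
    proof -
      have "p - f0 \<in> span (M \<union> U')" unfolding M_def by (intro span_base UnI1) auto
      moreover have "f0 \<in> span (M \<union> U')" using \<open>W \<subseteq> span (M \<union> U')\<close> f0 F_sub by auto
      ultimately have "(p - f0) + f0 \<in> span (M \<union> U')" by (rule span_add)
      then show ?thesis by simp
    qed
    ultimately show "V \<subseteq> span (M \<union> U')"
    proof -
      assume W: "W \<subseteq> span (M \<union> U')" and p: "p \<in> span (M \<union> U')"
      show ?thesis
      proof
        fix x assume x: "x \<in> V"
        have "x - (p \<bullet> x) *\<^sub>R p \<in> W" unfolding W_def using x p_V subspace_V p_unit
          by (auto intro!: subspace_diff subspace_scale simp: inner_diff_right)
        then have "(x - (p \<bullet> x) *\<^sub>R p) + (p \<bullet> x) *\<^sub>R p \<in> span (M \<union> U')" using W p by (intro span_add span_scale) auto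
        then show "x \<in> span (M \<union> U')" by simp
      qed
    qed
  qed
  have "\<not> irreducible_arr V ((\<lambda>n. {x\<in>V. n \<bullet> x = 0}) ` N)"
  proof (rule reducible_of_normals[OF subspace_V _ \<open>M \<subseteq> V\<close> 1 U'(1) _ U'(2) 2 3])
    show "subspace M" unfolding M_def by simp
    show "U' \<subseteq> V" using U'(3) W_V by blast
    fix n assume n: "n \<in> N"
    then consider "n \<in> R" | f where "f \<in> F" "n = p - f" unfolding N_def by blast
    then show "n \<noteq> 0 \<and> (n \<in> M \<or> n \<in> U')"
    proof cases
      case 1
      have "n \<in> dspan \<Longrightarrow> n \<in> M" unfolding M_def by (intro span_base) auto
      then show ?thesis using U'(6)[OF root_of_base[OF 1]] n N_props(3) by blast
    next
      case 2
      have "f - f0 \<in> dspan" unfolding dspan_def using 2(1) f0 by (intro span_base) blast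
      then have "(p - f0) - (f - f0) \<in> M" unfolding M_def by (intro span_diff span_base) auto
      then show ?thesis using 2 n N_props(3) by auto
    qed
  qed
  then show False using irr unfolding A_eq by blast
qed

end

section \<open>Crystallographic root systems and reflection arrangements\<close>

definition zspan :: "'a::real_vector set \<Rightarrow> 'a set" where
  "zspan M = {\<Sum>x\<in>M. of_int (k x) *\<^sub>R x | k :: 'a \<Rightarrow> int. True}"

lemma zspan_base: "finite M \<Longrightarrow> x \<in> M \<Longrightarrow> x \<in> zspan M"
proof -
  assume M: "finite M" "x \<in> M"
  have "(\<Sum>y\<in>M. of_int (if y = x then 1 else 0) *\<^sub>R y) = (\<Sum>y\<in>M. if y = x then x else 0)"
    by (intro sum.cong) auto
  also have "\<dots> = x" using M by simp
  finally have "x = (\<Sum>y\<in>M. of_int (if y = x then 1 else 0) *\<^sub>R y)" by (rule sym)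
  then have "\<exists>k :: 'a \<Rightarrow> int. x = (\<Sum>y\<in>M. of_int (k y) *\<^sub>R y)" by (rule exI[of _ "\<lambda>y. if y = x then 1 else 0"])
  then show ?thesis unfolding zspan_def by simp
qed

lemma zspan_add: "x \<in> zspan M \<Longrightarrow> y \<in> zspan M \<Longrightarrow> x + y \<in> zspan M"
proof -
  assume "x \<in> zspan M" "y \<in> zspan M"
  then obtain k l :: "'a \<Rightarrow> int" where "x = (\<Sum>x\<in>M. of_int (k x) *\<^sub>R x)" "y = (\<Sum>x\<in>M. of_int (l x) *\<^sub>R x)"
    unfolding zspan_def by auto
  then have "x + y = (\<Sum>x\<in>M. of_int (k x + l x) *\<^sub>R x)" by (simp add: sum.distrib scaleR_left_distrib)
  then show ?thesis unfolding zspan_def by (auto intro!: exI[of _ "\<lambda>x. k x + l x"])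
qed

lemma zspan_minus: "x \<in> zspan M \<Longrightarrow> - x \<in> zspan M"
proof -
  assume "x \<in> zspan M"
  then obtain k :: "'a \<Rightarrow> int" where "x = (\<Sum>x\<in>M. of_int (k x) *\<^sub>R x)" unfolding zspan_def by auto
  then have "- x = (\<Sum>x\<in>M. of_int (- k x) *\<^sub>R x)" by (simp add: sum_negf)
  then show ?thesis unfolding zspan_def by (auto intro!: exI[of _ "\<lambda>x. - k x"])
qed

text \<open>The classical induction on height: a positive root that is not simple has positive inner
  product with some simple root and remains a positive root when this is subtracted. Inner products
  are those of the coordinates in \<open>\<Phi>\<close>, while signs and coefficients are taken
  after \<open>lc\<close>, which need not be an isometry. The height is the value at
  \<open>x\<close>.\<close>

lemma simple_system_integral:
  fixes lc :: "'b::euclidean_space \<Rightarrow> 'a::euclidean_space"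
  assumes lin: "linear lc" and inj: "inj_on lc (span \<Phi>)" and fin: "finite \<Phi>" 
    and neg: "\<And>a. a \<in> \<Phi> \<Longrightarrow> - a \<in> \<Phi>"
    and str: "\<And>a b. a \<in> \<Phi> \<Longrightarrow> b \<in> \<Phi> \<Longrightarrow> a \<noteq> b \<Longrightarrow> 0 < a \<bullet> b \<Longrightarrow> a - b \<in> \<Phi>"
    and V: "subspace V" "lc ` \<Phi> \<subseteq> V" and nz: "0 \<notin> lc ` \<Phi>"
    and reg: "\<And>n. n \<in> lc ` \<Phi> \<Longrightarrow> n \<bullet> x \<noteq> 0"
    and D: "simple_system V (lc ` \<Phi>) x D" and a: "a \<in> \<Phi>"
  shows "lc a \<in> zspan {n \<in> lc ` \<Phi>. \<exists>d\<in>D. \<exists>c>0. n = c *\<^sub>R d}"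
proof -
  let ?M = "{n \<in> lc ` \<Phi>. \<exists>d\<in>D. \<exists>c>0. n = c *\<^sub>R d}"
  have fM: "finite ?M" using fin by simp
  have lcneg: "lc (- b) = - lc b" for b using lin by (simp add: linear_neg)
  have iD: "independent D" "span D = V" "finite D" "\<And>d. d \<in> D \<Longrightarrow> root_of (lc ` \<Phi>) d \<and> 0 < d \<bullet> x"
    using D unfolding simple_system_def by (auto intro: finiteI_independent)
  have nn: "0 \<le> lc b \<bullet> dual_vec D d" if b: "b \<in> \<Phi>" "0 < lc b \<bullet> x" "d \<in> D" for b d
  proof -
    have "root_of (lc ` \<Phi>) (lc b)" using b(1) by (intro root_of_base) auto
    then obtain c where c: "\<forall>d\<in>D. 0 \<le> c d" "lc b = (\<Sum>d\<in>D. c d *\<^sub>R d)"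
      using D b(2) unfolding simple_system_def by blast
    have "lc b \<bullet> dual_vec D d = (\<Sum>e\<in>D. c e * (e \<bullet> dual_vec D d))" unfolding c(2) by (simp add: inner_sum_left)
    also have "\<dots> \<ge> 0" using c(1) dual_vec(2)[OF iD(1)] by (intro sum_nonneg) auto
    finally show ?thesis .
  qed
  have "\<exists>b k. b \<in> \<Phi> \<and> 0 < k \<and> lc b = k *\<^sub>R d" if dD: "d \<in> D" for d
  proof -
    obtain b c where bc: "b \<in> \<Phi>" "c \<noteq> 0" "d = c *\<^sub>R lc b" using iD(4)[OF dD] unfolding root_of_def by blast
    show ?thesis
    proof (cases "0 < c")
      case True
      then show ?thesis using bc by (intro exI[of _ b] exI[of _ "1/c"]) auto
    next
      case False
      then have "0 < - (1/c)" "lc (- b) = (- (1/c)) *\<^sub>R d" using bc lcneg by auto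
      then show ?thesis using neg[OF bc(1)] by blast
    qed
  qed
  then obtain m k where mk: "\<And>d. d \<in> D \<Longrightarrow> m d \<in> \<Phi> \<and> 0 < k d \<and> lc (m d) = k d *\<^sub>R d" by metis
  have mM: "lc (m d) \<in> ?M" if "d \<in> D" for d using mk[OF that] that by blast
  have pos: "lc b \<in> zspan ?M" if "b \<in> \<Phi>" "0 < lc b \<bullet> x" for b
    using that
  proof (induction "card {a\<in>\<Phi>. 0 < lc a \<bullet> x \<and> lc a \<bullet> x < lc b \<bullet> x}" arbitrary: b rule: less_induct)
    case less
    show ?case
    proof (cases "lc b \<in> ?M")
      case True
      then show ?thesis by (rule zspan_base[OF fM])
    next
      case False
      define cf where "cf d = lc b \<bullet> dual_vec D d" for d
      have cnn: "0 \<le> cf d" if "d \<in> D" for d unfolding cf_def by (rule nn[OF less.prems that])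
      have bV: "lc b \<in> span D" using V(2) less.prems(1) iD(2) by auto
      have ex: "lc b = (\<Sum>d\<in>D. cf d *\<^sub>R d)" unfolding cf_def by (rule dual_expand(1)[OF iD(1) bV])
      have "lc b = lc (\<Sum>d\<in>D. (cf d / k d) *\<^sub>R m d)"
      proof -
        have "lc (\<Sum>d\<in>D. (cf d / k d) *\<^sub>R m d) = (\<Sum>d\<in>D. (cf d / k d) *\<^sub>R lc (m d))"
          using lin by (simp add: linear_sum linear_scale)
        also have "\<dots> = (\<Sum>d\<in>D. cf d *\<^sub>R d)" using mk by (intro sum.cong) (auto simp: less_imp_neq[THEN not_sym])
        finally show ?thesis using ex by simp
      qed
      then have b: "b = (\<Sum>d\<in>D. (cf d / k d) *\<^sub>R m d)"
        by (rule inj_onD[OF inj]) (use less.prems(1) mk in \<open>auto intro!: span_base span_sum span_scale\<close>)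
      have "b \<noteq> 0" using less.prems(2) lin by (auto simp: linear_0)
      then have "0 < b \<bullet> b" by simp
      also have "b \<bullet> b = (\<Sum>d\<in>D. (cf d / k d) * (b \<bullet> m d))" by (subst (2) b) (simp add: inner_sum_right)
      finally have "\<exists>d\<in>D. 0 < (cf d / k d) * (b \<bullet> m d)" by (metis (no_types, lifting) not_le sum_nonpos)
      then obtain d where d: "d \<in> D" "0 < (cf d / k d) * (b \<bullet> m d)" by blast
      have kd: "0 < k d" "m d \<in> \<Phi>" "lc (m d) = k d *\<^sub>R d" using mk[OF d(1)] by auto
      have "0 \<le> cf d / k d" using cnn[OF d(1)] kd by simp
      then have bm: "0 < b \<bullet> m d" using d(2) by (meson mult_nonneg_nonpos not_le)
      have "b \<noteq> m d" using False mM[OF d(1)] by auto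
      then have bd: "b - m d \<in> \<Phi>" using str[OF less.prems(1) kd(2) _ bm] by blast
      have lbd: "lc (b - m d) = lc b - k d *\<^sub>R d" using lin kd(3) by (simp add: linear_diff)
      \<comment> \<open>A second positive coefficient is untouched by the subtraction and excludes
        that the difference is a negative root.\<close>
      have "\<exists>d'\<in>D. d' \<noteq> d \<and> 0 < cf d'"
      proof (rule ccontr)
        assume n: "\<not> ?thesis"
        then have z: "cf d' = 0" if "d' \<in> D - {d}" for d' using cnn[of d'] that by force
        have "lc b = (\<Sum>d'\<in>{d}. cf d' *\<^sub>R d')"
          unfolding ex using iD(3) d(1) z by (intro sum.mono_neutral_right) auto
        then have lb: "lc b = cf d *\<^sub>R d" by simp
        then have "cf d \<noteq> 0" using less.prems(2) by auto
        then have "0 < cf d" using cnn[OF d(1)] by simp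
        then have "lc b \<in> ?M" using lb d(1) less.prems(1) by blast
        then show False using False by simp
      qed
      then obtain d' where d': "d' \<in> D" "d' \<noteq> d" "0 < cf d'" by blast
      have cd': "lc (b - m d) \<bullet> dual_vec D d' = cf d'"
        unfolding lbd using dual_vec(2)[OF iD(1) d(1), of d'] d'(2) by (simp add: inner_diff_left cf_def)
      have "0 < lc (b - m d) \<bullet> x"
      proof (rule ccontr)
        assume "\<not> ?thesis"
        then have "0 < lc (- (b - m d)) \<bullet> x" using reg[of "lc (b - m d)"] bd unfolding lcneg by (simp add: order_less_le)
        then have "0 \<le> lc (- (b - m d)) \<bullet> dual_vec D d'" using nn[OF neg[OF bd] _ d'(1)] by blast
        then show False using cd' d'(3) unfolding lcneg by simp
      qed
      moreover have "lc (b - m d) \<bullet> x < lc b \<bullet> x" unfolding lbd using iD(4)[OF d(1)] kd(1) by (simp add: inner_diff_left)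
      ultimately have p: "0 < lc (b - m d) \<bullet> x" "lc (b - m d) \<bullet> x < lc b \<bullet> x" by auto
      have "{a\<in>\<Phi>. 0 < lc a \<bullet> x \<and> lc a \<bullet> x < lc (b - m d) \<bullet> x} \<subset> {a\<in>\<Phi>. 0 < lc a \<bullet> x \<and> lc a \<bullet> x < lc b \<bullet> x}"
      proof
        show "{a\<in>\<Phi>. 0 < lc a \<bullet> x \<and> lc a \<bullet> x < lc (b - m d) \<bullet> x} \<noteq> {a\<in>\<Phi>. 0 < lc a \<bullet> x \<and> lc a \<bullet> x < lc b \<bullet> x}"
          using p bd by blast
      qed (use p in auto)
      then have "card {a\<in>\<Phi>. 0 < lc a \<bullet> x \<and> lc a \<bullet> x < lc (b - m d) \<bullet> x} < card {a\<in>\<Phi>. 0 < lc a \<bullet> x \<and> lc a \<bullet> x < lc b \<bullet> x}"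
        using fin by (intro psubset_card_mono) auto
      then have "lc (b - m d) \<in> zspan ?M" using less.hyps[OF _ bd p(1)] by blast
      then have "lc (b - m d) + lc (m d) \<in> zspan ?M" using zspan_base[OF fM mM[OF d(1)]] by (rule zspan_add)
      then show ?thesis unfolding lbd kd(3) by simp
    qed
  qed
  show ?thesis
  proof (cases "0 < lc a \<bullet> x")
    case True then show ?thesis using pos a by blast
  next
    case False
    then have "0 < lc (- a) \<bullet> x" using reg[of "lc a"] a unfolding lcneg by (simp add: order_less_le)
    then have "lc (- a) \<in> zspan ?M" using pos neg[OF a] by blast
    then have "- lc (- a) \<in> zspan ?M" by (rule zspan_minus)
    then show ?thesis unfolding lcneg by simp
  qed
qed

text \<open>The facet contains the dual vectors of all other simple roots, each a limit of points
  \<open>dual_vec D e + t x\<close> of the chamber as \<open>t\<close> tends to zero.\<close>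

lemma simple_wall_dim:
  fixes V :: "'a::euclidean_space set"
  assumes V: "subspace V" and N: "N \<subseteq> V" "0 \<notin> N" and x: "x \<in> V" "\<And>n. n \<in> N \<Longrightarrow> n \<bullet> x \<noteq> 0"
    and D: "simple_system V N x D" and d: "d \<in> D" and K: "K = {y\<in>V. \<forall>n\<in>N. 0 < (n \<bullet> x) * (n \<bullet> y)}"
  shows "dim ({y\<in>V. d \<bullet> y = 0} \<inter> closure K) + 1 = dim V"
proof -
  have iD: "independent D" "span D = V" "finite D" "\<And>d. d \<in> D \<Longrightarrow> root_of N d \<and> 0 < d \<bullet> x"
    using D unfolding simple_system_def by (auto intro: finiteI_independent)
  have dV: "d \<in> V" using d iD(2) by (auto intro: span_base)
  have d0: "d \<noteq> 0" using iD(4)[OF d] by auto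
  have H: "dim {y\<in>V. d \<bullet> y = 0} + 1 = dim V"
    by (rule dim_ker_Suc[OF V dV]) (use d0 in auto)
  let ?B = "dual_vec D ` (D - {d})"
  have inK: "dual_vec D e \<in> {y\<in>V. d \<bullet> y = 0} \<inter> closure K" if e: "e \<in> D - {d}" for e
  proof
    have eV: "dual_vec D e \<in> V" using dual_vec(1)[OF iD(1)] iD(2) by blast
    then show "dual_vec D e \<in> {y\<in>V. d \<bullet> y = 0}" using dual_vec(2)[OF iD(1) d, of e] e by auto
    have pt: "dual_vec D e + t *\<^sub>R x \<in> K" if t: "0 < t" for t
    proof -
      have yV: "dual_vec D e + t *\<^sub>R x \<in> V" using eV x(1) V by (intro subspace_add subspace_scale)
      have pos: "0 < \<beta> \<bullet> (dual_vec D e + t *\<^sub>R x)" if b: "root_of N \<beta>" "0 < \<beta> \<bullet> x" for \<beta>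
      proof -
        obtain c where c: "\<forall>d\<in>D. 0 \<le> c d" "\<beta> = (\<Sum>d\<in>D. c d *\<^sub>R d)"
          using D b unfolding simple_system_def by blast
        have "\<beta> \<bullet> dual_vec D e = (\<Sum>d'\<in>D. c d' * (d' \<bullet> dual_vec D e))" unfolding c(2) by (simp add: inner_sum_left)
        also have "\<dots> \<ge> 0" using c(1) dual_vec(2)[OF iD(1)] by (intro sum_nonneg) auto
        finally show ?thesis using b(2) t by (simp add: inner_add_right add_nonneg_pos)
      qed
      have "0 < (n \<bullet> x) * (n \<bullet> (dual_vec D e + t *\<^sub>R x))" if n: "n \<in> N" for n
      proof (cases "0 < n \<bullet> x")
        case True
        then show ?thesis using pos[OF root_of_base[OF n]] by simp
      next
        case False
        then have "0 < (- n) \<bullet> x" using x(2)[OF n] by (simp add: order_less_le)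
        then have "0 < (- n) \<bullet> (dual_vec D e + t *\<^sub>R x)" using pos[of "- n"] root_of_base[OF n] root_of_minus by blast
        then show ?thesis using \<open>0 < (- n) \<bullet> x\<close> by (metis inner_minus_left minus_mult_minus mult_pos_pos)
      qed
      then show ?thesis unfolding K using yV by blast
    qed
    show "dual_vec D e \<in> closure K"
      unfolding closure_approachable
    proof (intro allI impI)
      fix \<epsilon> :: real assume e0: "0 < \<epsilon>"
      have nx: "0 < norm x" using iD(4)[OF d] by auto
      define t where "t = \<epsilon> / (2 * norm x)"
      have "0 < t" using e0 nx unfolding t_def by simp
      moreover have "dist (dual_vec D e + t *\<^sub>R x) (dual_vec D e) < \<epsilon>"
        using e0 nx \<open>0 < t\<close> by (simp add: dist_norm t_def)
      ultimately show "\<exists>y\<in>K. dist y (dual_vec D e) < \<epsilon>" using pt by blast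
    qed
  qed
  have injd: "inj_on (dual_vec D) D"
    by (rule inj_onI) (metis dual_vec(2)[OF iD(1)] zero_neq_one)
  have "V \<subseteq> span (dual_vec D ` D)"
  proof
    fix y assume "y \<in> V"
    then have "y = (\<Sum>b\<in>D. (b \<bullet> y) *\<^sub>R dual_vec D b)" using dual_expand(2)[OF iD(1)] iD(2) by blast
    also have "\<dots> \<in> span (dual_vec D ` D)" by (intro span_sum span_scale span_base) auto
    finally show "y \<in> span (dual_vec D ` D)" .
  qed
  moreover have "dual_vec D ` D \<subseteq> V" using dual_vec(1)[OF iD(1)] iD(2) by auto
  moreover have "card (dual_vec D ` D) = dim V" using iD(1,2) injd by (metis card_image dim_eq_card_independent dim_span)
  ultimately have "independent (dual_vec D ` D)" using card_le_dim_spanning[of "dual_vec D ` D" V] iD(3) by simp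
  then have iB: "independent ?B" by (rule independent_mono) auto
  have cB: "card ?B + 1 = dim V"
  proof -
    have "card ?B = card D - 1" using injd d iD(3) by (simp add: card_image inj_on_diff card_Diff_singleton)
    moreover have "0 < card D" using d iD(3) by (auto simp: card_gt_0_iff)
    moreover have "card D = dim V" using iD(1,2) by (metis dim_eq_card_independent dim_span)
    ultimately show ?thesis by simp
  qed
  have "card ?B \<le> dim ({y\<in>V. d \<bullet> y = 0} \<inter> closure K)"
    using independent_card_le_dim[OF _ iB] inK by blast
  moreover have "dim ({y\<in>V. d \<bullet> y = 0} \<inter> closure K) \<le> dim {y\<in>V. d \<bullet> y = 0}" by (intro dim_subset) auto
  ultimately show ?thesis using cB H by linarith
qed

theorem crystallographic_of_roots:
  fixes lc :: "'b::euclidean_space \<Rightarrow> 'a::euclidean_space"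
  assumes lin: "linear lc" and inj: "inj_on lc (span \<Phi>)" and fin: "finite \<Phi>" and nz: "0 \<notin> \<Phi>"
    and neg: "\<And>a. a \<in> \<Phi> \<Longrightarrow> - a \<in> \<Phi>"
    and red: "\<And>a c. a \<in> \<Phi> \<Longrightarrow> c *\<^sub>R a \<in> \<Phi> \<Longrightarrow> c = 1 \<or> c = - 1"
    and str: "\<And>a b. a \<in> \<Phi> \<Longrightarrow> b \<in> \<Phi> \<Longrightarrow> a \<noteq> b \<Longrightarrow> 0 < a \<bullet> b \<Longrightarrow> a - b \<in> \<Phi>"
    and V: "subspace V" "lc ` \<Phi> \<subseteq> V" and A: "A = (\<lambda>n. {x\<in>V. n \<bullet> x = 0}) ` (lc ` \<Phi>)"
    and simp: "simplicial_arr V A"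
  shows "crystallographic_arr V A"
proof -
  \<comment> \<open>Members of \<open>dual_space V\<close> have to vanish outside
    \<open>V\<close>.\<close>
  define fm where "fm n x = (if x \<in> V then n \<bullet> x else 0)" for n x :: 'a
  let ?N = "lc ` \<Phi>"
  define R where "R = fm ` ?N"
  have nzN: "0 \<notin> ?N"
  proof
    assume "0 \<in> ?N"
    then obtain a where a: "a \<in> \<Phi>" "lc a = 0" by auto
    then have "a = 0" using inj_onD[OF inj, of a 0] lin by (auto simp: linear_0 intro: span_base span_zero)
    then show False using a nz by simp
  qed
  have fm_inj: "n = n'" if "fm n = fm n'" "n \<in> V" "n' \<in> V" for n n'
  proof -
    have "n - n' \<in> V" using that V(1) by (auto intro: subspace_diff)
    then have "n \<bullet> (n - n') = n' \<bullet> (n - n')" using fun_cong[OF that(1), of "n - n'"] unfolding fm_def by simp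
    then have "(n - n') \<bullet> (n - n') = 0" by (simp add: inner_diff_left)
    then show ?thesis by simp
  qed
  have ker: "form_ker V (fm n) = {x\<in>V. n \<bullet> x = 0}" for n unfolding form_ker_def fm_def by auto
  have fms: "(\<lambda>x. c * fm n x) = fm (c *\<^sub>R n)" for c n unfolding fm_def by auto
  have root: "root_system_for V A R"
    unfolding root_system_for_def
  proof (intro conjI ballI)
    show "finite R" unfolding R_def using fin by simp
    show "R \<subseteq> dual_space V"
      unfolding R_def dual_space_def fm_def using V(1) by (auto simp: inner_add_right subspace_add subspace_scale)
    show "A = form_ker V ` R" unfolding R_def A image_image ker ..
    fix \<alpha> assume "\<alpha> \<in> R"
    then obtain a where a: "a \<in> \<Phi>" "\<alpha> = fm (lc a)" unfolding R_def by auto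
    have m: "(\<lambda>x. - \<alpha> x) = fm (lc (- a))" using fms[of "-1" "lc a"] lin unfolding a(2) by (simp add: linear_neg)
    show "{\<lambda>x. c * \<alpha> x |c. True} \<inter> R = {\<alpha>, \<lambda>x. - \<alpha> x}"
    proof
      show "{\<alpha>, \<lambda>x. - \<alpha> x} \<subseteq> {\<lambda>x. c * \<alpha> x |c. True} \<inter> R"
      proof -
        have "\<alpha> = (\<lambda>x. 1 * \<alpha> x)" "(\<lambda>x. - \<alpha> x) = (\<lambda>x. (-1) * \<alpha> x)" by auto
        moreover have "(\<lambda>x. - \<alpha> x) \<in> R" "\<alpha> \<in> R" unfolding m unfolding R_def a(2) using neg a(1) by auto
        ultimately show ?thesis by blast
      qed
      show "{\<lambda>x. c * \<alpha> x |c. True} \<inter> R \<subseteq> {\<alpha>, \<lambda>x. - \<alpha> x}"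
      proof
        fix g assume "g \<in> {\<lambda>x. c * \<alpha> x |c. True} \<inter> R"
        then obtain c b where cb: "g = (\<lambda>x. c * \<alpha> x)" "b \<in> \<Phi>" "g = fm (lc b)" unfolding R_def by auto
        have "fm (c *\<^sub>R lc a) = fm (lc b)" using cb fms a(2) by metis
        then have "c *\<^sub>R lc a = lc b" by (rule fm_inj) (use a(1) cb(2) V in \<open>auto intro: subspace_scale\<close>)
        then have "lc (c *\<^sub>R a) = lc b" using lin by (simp add: linear_scale)
        then have "c *\<^sub>R a = b" by (rule inj_onD[OF inj]) (use a(1) cb(2) in \<open>auto intro: span_base span_scale\<close>)
        then have "c = 1 \<or> c = - 1" using red a(1) cb(2) by blast
        then show "g \<in> {\<alpha>, \<lambda>x. - \<alpha> x}" using cb(1) by auto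
      qed
    qed
  qed
  have "R \<subseteq> {(\<lambda>x. \<Sum>\<beta>\<in>chamber_basis V A R K. of_int (k \<beta>) * \<beta> x) | k :: ('a \<Rightarrow> real) \<Rightarrow> int. True}"
    if Kc: "K \<in> chambers V A" for K
  proof -
    obtain x where x: "x \<in> V - \<Union>A" "K = connected_component_set (V - \<Union>A) x"
      using Kc unfolding chambers_def components_def by auto
    have xV: "x \<in> V" using x by simp
    have reg: "n \<bullet> x \<noteq> 0" if "n \<in> ?N" for n using x(1) that unfolding A by auto
    have K: "K = {y\<in>V. \<forall>n\<in>?N. 0 < (n \<bullet> x) * (n \<bullet> y)}"
      unfolding x(2) A by (rule sign_region_component[OF V(1) xV reg])
    have "\<exists>D. simple_system V ?N x D"
      by (rule chamber_simple_system[OF V(1) _ V(2) xV reg]) (use fin simp A in auto)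
    then obtain D where D: "simple_system V ?N x D" by blast
    define M where "M = {n \<in> ?N. \<exists>d\<in>D. \<exists>c>0. n = c *\<^sub>R d}"
    have fM: "finite M" "M \<subseteq> V" unfolding M_def using fin V(2) by auto
    have cb: "fm ` M \<subseteq> chamber_basis V A R K"
    proof
      fix \<beta> assume "\<beta> \<in> fm ` M"
      then obtain n d c where n: "\<beta> = fm n" "n \<in> ?N" "d \<in> D" "c > 0" "n = c *\<^sub>R d" unfolding M_def by blast
      have dx: "0 < d \<bullet> x" using D n(3) unfolding simple_system_def by blast
      have nx: "0 < n \<bullet> x" unfolding n(5) using dx n(4) by simp
      have kn: "{y\<in>V. n \<bullet> y = 0} = {y\<in>V. d \<bullet> y = 0}" unfolding n(5) using n(4) by auto
      have "dim ({y\<in>V. d \<bullet> y = 0} \<inter> closure K) + 1 = dim V"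
        by (rule simple_wall_dim[OF V nzN xV reg D n(3) K])
      then have "form_ker V \<beta> \<in> walls V A K" unfolding walls_def n(1) ker kn[symmetric] A using n(2) by auto
      moreover have "\<beta> y > 0" if "y \<in> K" for y
      proof -
        have "y \<in> V" "0 < (n \<bullet> x) * (n \<bullet> y)" using that n(2) unfolding K by auto
        then show ?thesis unfolding n(1) fm_def using nx by (simp add: zero_less_mult_iff)
      qed
      moreover have "\<beta> \<in> R" unfolding R_def n(1) using n(2) by blast
      ultimately show "\<beta> \<in> chamber_basis V A R K" unfolding chamber_basis_def by blast
    qed
    have fcb: "finite (chamber_basis V A R K)" unfolding chamber_basis_def R_def using fin by simp
    have fmi: "inj_on fm M" using fm_inj fM(2) by (meson inj_onI subsetD)
    show ?thesis
    proof
      fix \<alpha> assume "\<alpha> \<in> R"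
      then obtain a where a: "a \<in> \<Phi>" "\<alpha> = fm (lc a)" unfolding R_def by auto
      have "lc a \<in> zspan M" unfolding M_def
        by (rule simple_system_integral[OF lin inj fin neg str V nzN reg D a(1)])
      then obtain k :: "'a \<Rightarrow> int" where k: "lc a = (\<Sum>n\<in>M. of_int (k n) *\<^sub>R n)" unfolding zspan_def by auto
      \<comment> \<open>Members of \<open>chamber_basis\<close> outside the image of
        \<open>M\<close>, if any, get coefficient zero.\<close>
      define l where "l \<beta> = (if \<beta> \<in> fm ` M then k (inv_into M fm \<beta>) else 0)" for \<beta>
      have "\<alpha> y = (\<Sum>\<beta>\<in>chamber_basis V A R K. of_int (l \<beta>) * \<beta> y)" for y
      proof -
        have "(\<Sum>\<beta>\<in>chamber_basis V A R K. of_int (l \<beta>) * \<beta> y) = (\<Sum>\<beta>\<in>fm ` M. of_int (l \<beta>) * \<beta> y)"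
          using fcb cb by (intro sum.mono_neutral_right) (auto simp: l_def)
        also have "\<dots> = (\<Sum>n\<in>M. of_int (k n) * fm n y)"
          unfolding sum.reindex[OF fmi] by (intro sum.cong) (auto simp: l_def inv_into_f_f[OF fmi])
        also have "\<dots> = fm (lc a) y"
          unfolding fm_def k by (auto simp: inner_sum_left)
        finally show ?thesis unfolding a(2) by simp
      qed
      then have "\<alpha> = (\<lambda>y. \<Sum>\<beta>\<in>chamber_basis V A R K. of_int (l \<beta>) * \<beta> y)" by (rule ext)
      then show "\<alpha> \<in> {(\<lambda>x. \<Sum>\<beta>\<in>chamber_basis V A R K. of_int (k \<beta>) * \<beta> x) | k :: ('a \<Rightarrow> real) \<Rightarrow> int. True}" by blast
    qed
  qed
  then show ?thesis unfolding crystallographic_arr_def using simp root by blast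
qed

section \<open>Model root systems of the three reflection types\<close>

definition PhiA :: "(real ^ 'm) set" where
  "PhiA = {axis i 1 - axis j 1 | i j. i \<noteq> j}"

text \<open>For \<open>i = j\<close> the element is twice a signed unit vector, a long root of type
  C. The predicate \<open>P\<close> selects the coordinates with long roots, so both
  \<open>coxeter_C\<close> and \<open>coxeter_C_minus\<close> are covered.\<close>

definition PhiC :: "('n \<Rightarrow> bool) \<Rightarrow> (real ^ 'n) set" where
  "PhiC P = {s *\<^sub>R axis i 1 + t *\<^sub>R axis j 1 | i j s t.
     (s = 1 \<or> s = - 1) \<and> (t = 1 \<or> t = - 1) \<and> (i = j \<longrightarrow> s = t \<and> P i)}"

lemma PhiC_I: "s = 1 \<or> s = - 1 \<Longrightarrow> t = 1 \<or> t = - 1 \<Longrightarrow> (i = j \<Longrightarrow> s = t \<and> P i) \<Longrightarrow>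
    s *\<^sub>R axis i 1 + t *\<^sub>R axis j 1 \<in> PhiC P"
  unfolding PhiC_def by blast

lemma finite_PhiA: "finite (PhiA :: (real ^ 'm) set)"
proof -
  have "(PhiA :: (real ^ 'm) set) \<subseteq> (\<lambda>(i, j). axis i 1 - axis j 1) ` UNIV" unfolding PhiA_def by auto
  then show ?thesis by (rule finite_subset) simp
qed

lemma finite_PhiC: "finite (PhiC P :: (real ^ 'n) set)"
proof -
  have "(PhiC P :: (real ^ 'n) set) \<subseteq> (\<lambda>(i, j, s, t). s *\<^sub>R axis i 1 + t *\<^sub>R axis j 1) ` (UNIV \<times> UNIV \<times> {1, - 1} \<times> {1, - 1})"
    unfolding PhiC_def by (auto simp: image_iff) blast+
  then show ?thesis by (rule finite_subset) auto
qed

lemma neg_PhiA: "a \<in> PhiA \<Longrightarrow> - a \<in> PhiA"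
proof -
  assume "a \<in> PhiA"
  then obtain i j where "a = axis i 1 - axis j 1" "i \<noteq> j" unfolding PhiA_def by blast
  then have "- a = axis j 1 - axis i 1" "j \<noteq> i" by auto
  then show ?thesis unfolding PhiA_def by blast
qed

lemma neg_PhiC: "a \<in> PhiC P \<Longrightarrow> - a \<in> PhiC P"
proof -
  assume "a \<in> PhiC P"
  then obtain i j s t where a: "a = s *\<^sub>R axis i 1 + t *\<^sub>R axis j 1" "s = 1 \<or> s = - 1" "t = 1 \<or> t = - 1" "i = j \<longrightarrow> s = t \<and> P i"
    unfolding PhiC_def by blast
  have "- a = (- s) *\<^sub>R axis i 1 + (- t) *\<^sub>R axis j 1" unfolding a(1) by simp
  also have "\<dots> \<in> PhiC P" by (rule PhiC_I) (use a in auto)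
  finally show ?thesis .
qed

text \<open>All model roots have the same norm in this sense, so a multiple of one that is again a
  root has factor \<open>1\<close> or \<open>- 1\<close>.\<close>

definition l1 :: "real ^ 'n \<Rightarrow> real" where "l1 x = (\<Sum>i\<in>UNIV. \<bar>x $ i\<bar>)"

lemma l1_scale: "l1 (c *\<^sub>R x) = \<bar>c\<bar> * l1 x"
  unfolding l1_def by (simp add: abs_mult sum_distrib_left)

lemma l1_two:
  assumes "\<bar>s\<bar> = 1" "\<bar>t\<bar> = 1" "i = j \<Longrightarrow> s = t"
  shows "l1 (s *\<^sub>R axis i 1 + t *\<^sub>R axis j 1 :: real ^ 'n) = 2"
proof -
  have "\<bar>(s *\<^sub>R axis i 1 + t *\<^sub>R axis j 1 :: real ^ 'n) $ m\<bar> = (if m = i then 1 else 0) + (if m = j then 1 else 0)" for m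
    using assms by (auto simp: axis_def)
  then show ?thesis unfolding l1_def by (simp add: sum.distrib)
qed

lemma l1_PhiC: "a \<in> PhiC P \<Longrightarrow> l1 a = 2"
proof -
  assume "a \<in> PhiC P"
  then obtain i j s t where a: "a = s *\<^sub>R axis i 1 + t *\<^sub>R axis j 1" "s = 1 \<or> s = - 1" "t = 1 \<or> t = - 1" "i = j \<longrightarrow> s = t \<and> P i"
    unfolding PhiC_def by blast
  show ?thesis unfolding a(1) by (rule l1_two) (use a in auto)
qed

lemma l1_PhiA: "a \<in> PhiA \<Longrightarrow> l1 a = 2"
proof -
  assume "a \<in> PhiA"
  then obtain i j where "a = axis i 1 - axis j 1" "i \<noteq> j" unfolding PhiA_def by blast
  then have "a = 1 *\<^sub>R axis i 1 + (- 1) *\<^sub>R axis j 1" "i \<noteq> j" by auto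
  then show ?thesis using l1_two[of 1 "- 1" i j] by auto
qed

lemma red_of_l1: "l1 a = 2 \<Longrightarrow> l1 (c *\<^sub>R a) = 2 \<Longrightarrow> c = 1 \<or> c = - 1"
  unfolding l1_scale by auto

lemma l1_nz: "l1 a = 2 \<Longrightarrow> a \<noteq> 0"
  unfolding l1_def by auto

lemma inner_axis1: "(axis i 1 :: real ^ 'n) \<bullet> x = x $ i" "x \<bullet> (axis i 1 :: real ^ 'n) = x $ i"
  by (simp_all add: inner_axis inner_axis')

lemma str_PhiA:
  assumes "a \<in> PhiA" "b \<in> PhiA" "a \<noteq> b" "0 < a \<bullet> (b :: real ^ 'm)"
  shows "a - b \<in> PhiA"
proof -
  obtain i j k l where ab: "a = axis i 1 - axis j 1" "i \<noteq> j" "b = axis k 1 - axis l 1" "k \<noteq> l"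
    using assms(1,2) unfolding PhiA_def by blast
  have "a \<bullet> b = (if i = k then 1 else 0) - (if i = l then 1 else 0) - (if j = k then 1 else 0) + (if j = l then 1 else 0)"
    unfolding ab inner_diff_left inner_diff_right inner_axis1 by (auto simp: axis_def)
  then have "i = k \<or> j = l" using assms(4) by (auto split: if_splits)
  then show ?thesis
  proof
    assume "i = k"
    then have "a - b = axis l 1 - axis j 1" "l \<noteq> j" using ab assms(3) by auto
    then show ?thesis unfolding PhiA_def by blast
  next
    assume "j = l"
    then have "a - b = axis i 1 - axis k 1" "i \<noteq> k" using ab assms(3) by auto
    then show ?thesis unfolding PhiA_def by blast
  qed
qed

text \<open>A difference that is a long root at \<open>j\<close> can only come from two short roots
  that agree at another coordinate and have opposite signs at \<open>j\<close>. These are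
  orthogonal, so the closure property survives when \<open>P\<close> removes long roots.\<close>

lemma str_PhiC:
  assumes "a \<in> PhiC P" "b \<in> PhiC P" "a \<noteq> b" "0 < a \<bullet> (b :: real ^ 'n)"
  shows "a - b \<in> PhiC P"
proof -
  let ?r = "\<lambda>i j s t. (s = 1 \<or> s = - 1) \<and> (t = 1 \<or> t = - 1) \<and> (i = j \<longrightarrow> s = t \<and> P i)"
  let ?v = "\<lambda>i j s t. s *\<^sub>R axis i 1 + t *\<^sub>R axis j 1 :: real ^ 'n"
  have in1: "?v i j s t \<bullet> ?v k l s' t' = s * s' * (if i = k then 1 else 0) + s * t' * (if i = l then 1 else 0)
      + t * s' * (if j = k then 1 else 0) + t * t' * (if j = l then 1 else 0)" for i j k l s t s' t'
    unfolding inner_add_left inner_add_right inner_scaleR_left inner_scaleR_right inner_axis1 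
    by (auto simp: axis_def algebra_simps)
  have key: "a - b \<in> PhiC P"
    if a: "a = ?v i j s t" "?r i j s t" and b: "b = ?v i l s t'" "?r i l s t'" and ne: "a \<noteq> b" and pos: "0 < a \<bullet> b"
    for a b i j l s t t'
  proof -
    have "a - b = t *\<^sub>R axis j 1 + (- t') *\<^sub>R axis l 1" using a b by simp
    also have "\<dots> \<in> PhiC P"
    proof (rule PhiC_I)
      assume jl: "j = l"
      then have "t \<noteq> t'" using ne a b by auto
      then have t: "t = - t'" using a b by auto
      show "t = - t' \<and> P j"
      proof (cases "i = j")
        case True
        then show ?thesis using a b t jl by auto
      next
        case False
        then show ?thesis using pos jl t a(2) b(2) unfolding a(1) b(1) in1 by auto
      qed
    qed (use a b in auto)
    finally show ?thesis .
  qed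
  have swap: "?v i j s t = ?v j i t s" for i j s t by (rule add.commute)
  obtain i j s t where a: "a = ?v i j s t" "?r i j s t" using assms(1) unfolding PhiC_def by blast
  obtain k l s' t' where b: "b = ?v k l s' t'" "?r k l s' t'" using assms(2) unfolding PhiC_def by blast
  have a': "a = ?v j i t s" "?r j i t s" using a swap by auto
  have b': "b = ?v l k t' s'" "?r l k t' s'" using b swap by auto
  have "(i = k \<and> s = s') \<or> (i = l \<and> s = t') \<or> (j = k \<and> t = s') \<or> (j = l \<and> t = t')"
  proof (rule ccontr)
    assume n: "\<not> ?thesis"
    have "s * s' * (if i = k then 1 else 0) \<le> 0" "s * t' * (if i = l then 1 else 0) \<le> 0"
      "t * s' * (if j = k then 1 else 0) \<le> 0" "t * t' * (if j = l then 1 else 0) \<le> 0"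
      using n a(2) b(2) by auto
    then show False using assms(4) unfolding a(1) b(1) in1 by linarith
  qed
  then consider "i = k" "s = s'" | "i = l" "s = t'" | "j = k" "t = s'" | "j = l" "t = t'" by blast
  then show ?thesis
  proof cases
    case 1
    show ?thesis by (rule key[OF a b[folded 1] assms(3,4)])
  next
    case 2
    show ?thesis by (rule key[OF a b'[folded 2] assms(3,4)])
  next
    case 3
    show ?thesis by (rule key[OF a' b[folded 3] assms(3,4)])
  next
    case 4
    show ?thesis by (rule key[OF a' b'[folded 4] assms(3,4)])
  qed
qed

lemma coxeter_A_eq: "coxeter_A = (\<lambda>y. {z \<in> coxeter_A_space. y \<bullet> z = 0}) ` PhiA"
proof -
  have 1: "{z \<in> coxeter_A_space. z $ i - z $ j = 0} = {z \<in> coxeter_A_space. (axis i 1 - axis j 1) \<bullet> z = 0}" for i j :: "'a option"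
    by (simp add: inner_diff_left inner_axis1)
  show ?thesis unfolding coxeter_A_def PhiA_def 1 by blast
qed

lemma PhiC_ker: "{z. (s *\<^sub>R axis i 1 + t *\<^sub>R axis j 1 :: real ^ 'n) \<bullet> z = 0} = {z. s * z $ i + t * z $ j = 0}"
  by (simp add: inner_add_left inner_axis1)

lemma coxeter_C_eq: "coxeter_C = (\<lambda>y. {z. y \<bullet> z = 0}) ` PhiC (\<lambda>_. True)" (is "?L = ?R")
proof
  show "?L \<subseteq> ?R"
  proof
    fix H assume "H \<in> ?L"
    then have "(\<exists>i j. H = {x. x $ i + x $ j = 0} \<and> i \<noteq> j) \<or> (\<exists>i j. H = {x. x $ i - x $ j = 0} \<and> i \<noteq> j) \<or> (\<exists>i. H = {x. x $ i = 0})"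
      unfolding coxeter_C_def Un_iff mem_Collect_eq by simp
    then show "H \<in> ?R"
    proof (elim disjE exE conjE, goal_cases)
      case (1 i j)
      have "H = {z. (1 *\<^sub>R axis i 1 + 1 *\<^sub>R axis j 1) \<bullet> z = 0}" unfolding PhiC_ker 1 by simp
      then show ?thesis using PhiC_I[of 1 1 i j "\<lambda>_. True"] by blast
    next
      case (2 i j)
      have "H = {z. (1 *\<^sub>R axis i 1 + (- 1) *\<^sub>R axis j 1) \<bullet> z = 0}" unfolding PhiC_ker 2 by simp
      then show ?thesis using PhiC_I[of 1 "- 1" i j "\<lambda>_. True"] 2(2) by blast
    next
      case (3 i)
      have "H = {z. (1 *\<^sub>R axis i 1 + 1 *\<^sub>R axis i 1) \<bullet> z = 0}" unfolding PhiC_ker 3 by simp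
      then show ?thesis using PhiC_I[of 1 1 i i "\<lambda>_. True"] by blast
    qed
  qed
  show "?R \<subseteq> ?L"
  proof
    fix H assume "H \<in> ?R"
    then obtain i j s t where r: "s = 1 \<or> s = - 1" "t = 1 \<or> t = - 1" "i = j \<longrightarrow> s = t"
      and H: "H = {z. (s *\<^sub>R axis i 1 + t *\<^sub>R axis j 1 :: real ^ 'a) \<bullet> z = 0}" unfolding PhiC_def by auto
    show "H \<in> ?L"
    proof (cases "i = j")
      case True
      then have "H = {x. x $ i = 0}" unfolding H PhiC_ker using r by auto
      then show ?thesis unfolding coxeter_C_def by blast
    next
      case False
      have "H = {x. x $ i + x $ j = 0} \<or> H = {x. x $ i - x $ j = 0}" unfolding H PhiC_ker using r(1,2) by auto
      then show ?thesis unfolding coxeter_C_def using False by blast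
    qed
  qed
qed

lemma coxeter_C_minus_eq: "coxeter_C_minus p = (\<lambda>y. {z. y \<bullet> z = 0}) ` PhiC (\<lambda>i. i \<noteq> p)" (is "?L = ?R")
proof
  show "?L \<subseteq> ?R"
  proof
    fix H assume "H \<in> ?L"
    then have np: "H \<noteq> {x. x $ p = 0}" and "H \<in> coxeter_C" unfolding coxeter_C_minus_def by auto
    then obtain y where y: "y \<in> PhiC (\<lambda>_. True)" "H = {z. y \<bullet> z = 0}" unfolding coxeter_C_eq by blast
    then obtain i j s t where r: "s = 1 \<or> s = - 1" "t = 1 \<or> t = - 1" "i = j \<longrightarrow> s = t"
      and "y = s *\<^sub>R axis i 1 + t *\<^sub>R axis j 1" unfolding PhiC_def by blast
    then have H: "H = {z. (s *\<^sub>R axis i 1 + t *\<^sub>R axis j 1 :: real ^ 'a) \<bullet> z = 0}" using y by simp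
    have "i \<noteq> p" if "i = j"
    proof
      assume "i = p"
      then have "H = {x. x $ p = 0}" unfolding H PhiC_ker using r that by auto
      then show False using np by simp
    qed
    then show "H \<in> ?R" unfolding H using PhiC_I[OF r(1,2), of i j "\<lambda>i. i \<noteq> p"] r(3) by blast
  qed
  show "?R \<subseteq> ?L"
  proof
    fix H assume "H \<in> ?R"
    then obtain i j s t where r: "s = 1 \<or> s = - 1" "t = 1 \<or> t = - 1" "i = j \<longrightarrow> s = t \<and> i \<noteq> p"
      and H: "H = {z. (s *\<^sub>R axis i 1 + t *\<^sub>R axis j 1 :: real ^ 'a) \<bullet> z = 0}" unfolding PhiC_def by auto
    have HC: "H \<in> coxeter_C" unfolding coxeter_C_eq H using PhiC_I[OF r(1,2), of i j "\<lambda>_. True"] r(3) by blast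
    have "\<exists>z\<in>H. z $ p \<noteq> 0"
    proof -
      consider "i \<noteq> p" "j \<noteq> p" | "i = p" "j \<noteq> p" | "i \<noteq> p" "j = p" using r(3) by blast
      then show ?thesis
      proof cases
        case 1
        then show ?thesis unfolding H PhiC_ker by (intro bexI[of _ "axis p 1"]) (auto simp: axis_def)
      next
        case 2
        then show ?thesis unfolding H PhiC_ker using r
          by (intro bexI[of _ "axis p 1 - (s / t) *\<^sub>R axis j 1"]) (auto simp: axis_def)
      next
        case 3
        then show ?thesis unfolding H PhiC_ker using r
          by (intro bexI[of _ "axis p 1 - (t / s) *\<^sub>R axis i 1"]) (auto simp: axis_def)
      qed
    qed
    then have "H \<noteq> {x. x $ p = 0}" by auto
    then show "H \<in> ?L" unfolding coxeter_C_minus_def using HC by blast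
  qed
qed

lemma linearly_isomorphic_of_forms:
  assumes "linear \<phi>" "bij_betw \<phi> V T" and f: "\<And>y x. y \<in> \<Phi> \<Longrightarrow> x \<in> V \<Longrightarrow> y \<bullet> \<phi> x = lc y \<bullet> x"
  shows "linearly_isomorphic V ((\<lambda>n. {x\<in>V. n \<bullet> x = 0}) ` (lc ` \<Phi>)) T ((\<lambda>y. {z\<in>T. y \<bullet> z = 0}) ` \<Phi>)"
proof -
  have img: "\<phi> ` {x\<in>V. lc y \<bullet> x = 0} = {z\<in>T. y \<bullet> z = 0}" if "y \<in> \<Phi>" for y
    using f[OF that] assms(2) unfolding bij_betw_def by force
  have "(\<lambda>y. {z\<in>T. y \<bullet> z = 0}) ` \<Phi> = (\<lambda>H. \<phi> ` H) ` ((\<lambda>n. {x\<in>V. n \<bullet> x = 0}) ` (lc ` \<Phi>))"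
    unfolding image_image by (intro image_cong refl) (simp add: img)
  then show ?thesis unfolding linearly_isomorphic_def using assms(1,2) by blast
qed

lemma coordinates_bij:
  fixes V :: "'a::euclidean_space set" and v :: "'n::finite \<Rightarrow> 'a"
  assumes V: "subspace V" and sp: "span (range v) = V" and dim: "dim V = CARD('n)"
  shows "linear (\<lambda>x. \<chi> i. v i \<bullet> x)" "bij_betw (\<lambda>x. \<chi> i. v i \<bullet> x) V UNIV"
proof -
  let ?f = "\<lambda>x. \<chi> i. v i \<bullet> x"
  show lin: "linear ?f" by (intro linearI) (auto simp: vec_eq_iff inner_add_right)
  have inj: "inj_on ?f V"
  proof (rule inj_onI)
    fix x y assume xy: "x \<in> V" "y \<in> V" "?f x = ?f y"
    then have "v i \<bullet> (x - y) = 0" for i by (simp add: vec_eq_iff inner_diff_right)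
    moreover have "x - y \<in> span (range v)" using sp V xy by (auto intro: subspace_diff)
    ultimately have "x - y = 0" by (intro orthogonal_span_eq_0[of _ "range v"]) auto
    then show "x = y" by simp
  qed
  have "dim (?f ` V) = dim V" by (rule dim_image_eq[OF lin]) (use inj V in \<open>simp add: span_eq_iff[THEN iffD2]\<close>)
  then have "dim (?f ` V) = DIM(real ^ 'n)" using dim by simp
  then have "span (?f ` V) = UNIV" by (simp only: dim_eq_full)
  moreover have "subspace (?f ` V)" by (rule linear_subspace_image[OF lin V])
  ultimately have "?f ` V = UNIV" by (simp add: span_eq_iff[THEN iffD2])
  then show "bij_betw ?f V UNIV" using inj unfolding bij_betw_def by simp
qed

theorem type_C:
  fixes V :: "'a::euclidean_space set" and v :: "'n::finite \<Rightarrow> 'a"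
  assumes V: "subspace V" and sp: "span (range v) = V" and dim: "dim V = CARD('n)"
    and A: "A = (\<lambda>n. {x\<in>V. n \<bullet> x = 0}) ` ((\<lambda>y. \<Sum>i\<in>UNIV. y $ i *\<^sub>R v i) ` PhiC P)" and simp: "simplicial_arr V A"
  shows "linearly_isomorphic V A UNIV ((\<lambda>y. {z. y \<bullet> z = 0}) ` PhiC P)" "crystallographic_arr V A"
proof -
  let ?f = "\<lambda>x. \<chi> i. v i \<bullet> x" and ?lc = "\<lambda>y. \<Sum>i\<in>UNIV. y $ i *\<^sub>R v i"
  note f = coordinates_bij[OF V sp dim]
  have adj: "y \<bullet> ?f x = ?lc y \<bullet> x" for y x
    by (simp add: inner_vec_def inner_sum_left)
  have "linearly_isomorphic V ((\<lambda>n. {x\<in>V. n \<bullet> x = 0}) ` (?lc ` PhiC P)) UNIV ((\<lambda>y. {z\<in>UNIV. y \<bullet> z = 0}) ` PhiC P)"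
    by (rule linearly_isomorphic_of_forms[OF f]) (rule adj)
  then show "linearly_isomorphic V A UNIV ((\<lambda>y. {z. y \<bullet> z = 0}) ` PhiC P)" unfolding A by simp
  have lin: "linear ?lc" by (intro linearI) (auto simp: scaleR_add_left sum.distrib scaleR_sum_right)
  have vV: "v i \<in> V" for i unfolding sp[symmetric] by (rule span_base) simp
  have inj: "inj_on ?lc (span (PhiC P))"
  proof (rule inj_onI)
    fix y z assume "?lc y = ?lc z"
    then have "(y - z) \<bullet> ?f x = 0" for x using adj[of y x] adj[of z x] by (simp add: inner_diff_left)
    moreover have "y - z \<in> ?f ` V" using bij_betw_imp_surj_on[OF f(2)] by simp
    ultimately have "(y - z) \<bullet> (y - z) = 0" by (elim imageE) (simp only:)
    then show "y = z" by simp
  qed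
  show "crystallographic_arr V A"
  proof (rule crystallographic_of_roots[OF lin inj finite_PhiC _ _ _ _ V _ A simp])
    show "0 \<notin> PhiC P" using l1_PhiC l1_nz by blast
    show "\<And>a c. a \<in> PhiC P \<Longrightarrow> c *\<^sub>R a \<in> PhiC P \<Longrightarrow> c = 1 \<or> c = - 1" using l1_PhiC red_of_l1 by blast
    show "?lc ` PhiC P \<subseteq> V" using vV V by (auto intro!: subspace_sum subspace_scale)
  qed (use neg_PhiC str_PhiC in blast)+
qed

lemma sum_option:
  fixes g :: "'n::finite option \<Rightarrow> 'c::comm_monoid_add"
  shows "(\<Sum>q\<in>UNIV. g q) = g None + (\<Sum>i\<in>UNIV. g (Some i))"
  unfolding UNIV_option_conv by (simp add: sum.reindex)

theorem type_A:
  fixes V :: "'a::euclidean_space set" and v :: "'n::finite \<Rightarrow> 'a"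
  assumes V: "subspace V" and sp: "span (range v) = V" and dim: "dim V = CARD('n)"
    and A: "A = (\<lambda>n. {x\<in>V. n \<bullet> x = 0}) ` ((\<lambda>y. \<Sum>i\<in>UNIV. y $ (Some i) *\<^sub>R v i) ` PhiA)" and simp: "simplicial_arr V A"
  shows "linearly_isomorphic V A coxeter_A_space (coxeter_A :: (real ^ 'n option) set set)" "crystallographic_arr V A"
proof -
  let ?f = "\<lambda>x. \<chi> i. v i \<bullet> x" and ?lc = "\<lambda>y. \<Sum>i\<in>UNIV. y $ (Some i) *\<^sub>R v i"
  note f = coordinates_bij[OF V sp dim]
  \<comment> \<open>Shifts the coordinates, \<open>0\<close> at \<open>None\<close> and
    \<open>v i . x\<close> at \<open>Some i\<close>, to sum zero; differences of coordinates are
    unaffected.\<close>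
  define m where "m x = - (\<Sum>i\<in>UNIV. v i \<bullet> x) / (real CARD('n) + 1)" for x
  define h :: "'a \<Rightarrow> real ^ 'n option" where "h x = (\<chi> q. (case q of None \<Rightarrow> 0 | Some i \<Rightarrow> v i \<bullet> x) + m x)" for x
  have m_lin: "m (x + y) = m x + m y" "m (c *\<^sub>R x) = c * m x" for x y c
    unfolding m_def by (simp_all add: inner_add_right sum.distrib add_divide_distrib diff_divide_distrib sum_distrib_left)
  have lin_h: "linear h"
    by (intro linearI) (auto simp: h_def vec_eq_iff m_lin inner_add_right algebra_simps split: option.split)
  have hS: "h x $ Some i = v i \<bullet> x + m x" "h x $ None = m x" for x i unfolding h_def by simp_all
  have space: "h x \<in> coxeter_A_space" for x
  proof -
    have n: "real CARD('n) + 1 \<noteq> 0" by (metis add.commute add_cancel_right_right of_nat_Suc of_nat_eq_0_iff Zero_not_Suc Suc_eq_plus1)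
    have "(\<Sum>q\<in>UNIV. h x $ q) = (\<Sum>i\<in>UNIV. v i \<bullet> x) + (real CARD('n) + 1) * m x"
      unfolding sum_option hS by (simp add: sum.distrib algebra_simps)
    also have "\<dots> = 0" unfolding m_def using n by simp
    finally show ?thesis unfolding coxeter_A_space_def by simp
  qed
  have adj: "y \<bullet> h x = ?lc y \<bullet> x" if "(\<Sum>q\<in>UNIV. y $ q) = 0" for y x
  proof -
    have "y \<bullet> h x = y $ None * m x + (\<Sum>i\<in>UNIV. y $ Some i * (v i \<bullet> x + m x))"
      unfolding inner_vec_def sum_option hS by simp
    also have "\<dots> = (\<Sum>q\<in>UNIV. y $ q) * m x + (\<Sum>i\<in>UNIV. y $ Some i * (v i \<bullet> x))"
      unfolding sum_option by (simp add: algebra_simps sum.distrib sum_distrib_left)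
    finally show ?thesis using that by (simp add: inner_sum_left)
  qed
  have bij: "bij_betw h V coxeter_A_space"
    unfolding bij_betw_def
  proof
    show "inj_on h V"
    proof (rule inj_onI)
      fix x y assume xy: "x \<in> V" "y \<in> V" "h x = h y"
      have "v i \<bullet> x = v i \<bullet> y" for i using hS(1)[of x i] hS(1)[of y i] hS(2)[of x] hS(2)[of y] xy(3) by simp
      then have "?f x = ?f y" by simp
      then show "x = y" using f(2) xy unfolding bij_betw_def inj_on_def by blast
    qed
    show "h ` V = coxeter_A_space"
    proof
      show "h ` V \<subseteq> coxeter_A_space" using space by blast
      show "coxeter_A_space \<subseteq> h ` V"
      proof
        fix z :: "real ^ 'n option" assume z: "z \<in> coxeter_A_space"
        have "(\<chi> i. z $ Some i - z $ None) \<in> ?f ` V" using bij_betw_imp_surj_on[OF f(2)] by simp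
        then obtain x where x: "(\<chi> i. z $ Some i - z $ None) = ?f x" "x \<in> V" by (rule imageE)
        have vx: "v i \<bullet> x = z $ Some i - z $ None" for i using arg_cong[OF x(1), of "\<lambda>u. u $ i"] by simp
        have zs: "z $ None + (\<Sum>i\<in>UNIV. z $ Some i) = 0" using z unfolding coxeter_A_space_def sum_option by simp
        have "(\<Sum>i\<in>UNIV. v i \<bullet> x) = - ((real CARD('n) + 1) * z $ None)"
          unfolding vx using zs by (simp add: sum_subtractf algebra_simps)
        moreover have "real CARD('n) + 1 > 0" by (simp add: add_nonneg_pos)
        ultimately have "m x = z $ None" unfolding m_def by (simp only: minus_minus) (simp add: field_simps)
        then have "h x = z" unfolding vec_eq_iff h_def using vx by (auto split: option.split)
        then show "z \<in> h ` V" using x(2) by blast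
      qed
    qed
  qed
  have sum0: "(\<Sum>q\<in>UNIV. y $ q) = 0" if "y \<in> PhiA" for y :: "real ^ 'n option"
    using that unfolding PhiA_def by (auto simp: sum_subtractf axis_def)
  have "linearly_isomorphic V ((\<lambda>n. {x\<in>V. n \<bullet> x = 0}) ` (?lc ` PhiA)) coxeter_A_space ((\<lambda>y. {z\<in>coxeter_A_space. y \<bullet> z = 0}) ` (PhiA :: (real ^ 'n option) set))"
    by (rule linearly_isomorphic_of_forms[OF lin_h bij]) (rule adj[OF sum0])
  then show "linearly_isomorphic V A coxeter_A_space (coxeter_A :: (real ^ 'n option) set set)" unfolding A coxeter_A_eq .
  have lin: "linear ?lc" by (intro linearI) (auto simp: scaleR_add_left sum.distrib scaleR_sum_right)
  have vV: "v i \<in> V" for i unfolding sp[symmetric] by (rule span_base) simp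
  have subA: "subspace (coxeter_A_space :: (real ^ 'n option) set)"
    unfolding coxeter_A_space_def by (auto simp: subspace_def sum.distrib sum_distrib_left[symmetric])
  have spA: "span PhiA \<subseteq> (coxeter_A_space :: (real ^ 'n option) set)"
    by (intro span_minimal subA) (use sum0 in \<open>auto simp: coxeter_A_space_def\<close>)
  have inj: "inj_on ?lc (span PhiA)"
  proof (rule inj_onI)
    fix y z assume yz: "y \<in> span PhiA" "z \<in> span (PhiA :: (real ^ 'n option) set)" "?lc y = ?lc z"
    have d: "y - z \<in> coxeter_A_space" using yz spA subA by (auto intro: subspace_diff)
    then have "y - z \<in> h ` V" using bij_betw_imp_surj_on[OF bij] by simp
    then obtain x where x: "y - z = h x" by (rule imageE)
    have "?lc (y - z) = 0" using yz(3) by (simp add: scaleR_left_diff_distrib sum_subtractf)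
    then have "(y - z) \<bullet> h x = 0" using adj[of "y - z" x] d unfolding coxeter_A_space_def by simp
    then have "h x \<bullet> h x = 0" unfolding x .
    then show "y = z" using x by simp
  qed
  show "crystallographic_arr V A"
  proof (rule crystallographic_of_roots[OF lin inj finite_PhiA _ _ _ _ V _ A simp])
    show "0 \<notin> (PhiA :: (real ^ 'n option) set)" using l1_PhiA l1_nz by blast
    show "\<And>a c. a \<in> (PhiA :: (real ^ 'n option) set) \<Longrightarrow> c *\<^sub>R a \<in> PhiA \<Longrightarrow> c = 1 \<or> c = - 1" using l1_PhiA red_of_l1 by blast
    show "?lc ` PhiA \<subseteq> V" using vV V by (auto intro!: subspace_sum subspace_scale)
  qed (use neg_PhiA str_PhiA in blast)+
qed

section \<open>Numbers of hyperplanes tell the three models apart\<close>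

lemma linearly_isomorphic_card:
  assumes "linearly_isomorphic V A T B" "\<And>H. H \<in> A \<Longrightarrow> H \<subseteq> V"
  shows "card A = card B"
proof -
  obtain f where f: "bij_betw f V T" "B = (\<lambda>H. f ` H) ` A" using assms(1) unfolding linearly_isomorphic_def by blast
  have "inj_on (\<lambda>H. f ` H) A"
    using f(1) assms(2) unfolding bij_betw_def by (meson inj_onI inj_on_image_eq_iff)
  then show ?thesis unfolding f(2) by (simp add: card_image)
qed

lemma card_coxeter_A_le: "card (coxeter_A :: (real ^ 'n::finite option) set set) \<le> Suc CARD('n) choose 2"
proof -
  let ?S = "{B :: 'n option set. B \<subseteq> UNIV \<and> card B = 2}"
  define g where "g B = {x :: real ^ 'n option. x \<in> coxeter_A_space \<and> (\<forall>i\<in>B. \<forall>j\<in>B. x $ i = x $ j)}" for B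
  have "coxeter_A \<subseteq> g ` ?S"
  proof
    fix H assume "H \<in> (coxeter_A :: (real ^ 'n option) set set)"
    then obtain i j where ij: "i \<noteq> j" "H = {x \<in> coxeter_A_space. x $ i - x $ j = 0}" unfolding coxeter_A_def by blast
    then have "H = g {i, j}" unfolding g_def by auto
    then show "H \<in> g ` ?S" using ij(1) by auto
  qed
  then have "card (coxeter_A :: (real ^ 'n option) set set) \<le> card (g ` ?S)" by (intro card_mono) auto
  also have "\<dots> \<le> card ?S" by (rule card_image_le) simp
  also have "\<dots> = CARD('n option) choose 2" by (rule n_subsets) simp
  finally show ?thesis by (simp add: card_UNIV_option)
qed

lemma card_coxeter_C_minus_ge: "2 * (CARD('n) choose 2) \<le> card (coxeter_C_minus (p :: 'n::finite))"
proof -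
  let ?S = "{B :: 'n set. B \<subseteq> UNIV \<and> card B = 2}"
  define g where "g B b = (if b then {x :: real ^ 'n. \<forall>i\<in>B. \<forall>j\<in>B. x $ i = x $ j} else {x. (\<Sum>i\<in>B. x $ i) = 0})" for B b
  have gS: "\<exists>i j. i \<noteq> j \<and> B = {i, j} \<and> g B True = {x. x $ i - x $ j = 0} \<and> g B False = {x. x $ i + x $ j = 0}" if BS: "B \<in> ?S" for B
  proof -
    obtain i j where ij: "i \<noteq> j" "B = {i, j}" using BS by (auto simp: card_2_iff)
    have "g B True = {x. x $ i - x $ j = 0}" unfolding g_def ij(2) by auto
    moreover have "g B False = {x. x $ i + x $ j = 0}" unfolding g_def ij(2) using ij(1) by simp
    ultimately show ?thesis using ij by blast
  qed
  \<comment> \<open>Both arguments of \<open>g\<close> can be read off from the hyperplane: the unit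
    vectors outside it give \<open>B\<close>, and the vector with all entries \<open>1\<close> gives
    \<open>b\<close>.\<close>
  have rec: "i \<in> B \<longleftrightarrow> axis i 1 \<notin> g B b" if "B \<in> ?S" for B b i
    using gS[OF that] by (cases b) (auto simp: axis_def)
  have recb: "b \<longleftrightarrow> (\<chi> i. 1) \<in> g B b" if "B \<in> ?S" for B b
    using gS[OF that] by (cases b) auto
  have inj: "inj_on (\<lambda>(B, b). g B b) (?S \<times> UNIV)"
  proof (rule inj_onI, clarify)
    fix B b B' b' assume B: "card B = 2" "card B' = 2" "g B b = g B' b'"
    have "B \<in> ?S" "B' \<in> ?S" using B by auto
    then show "B = B' \<and> b = b'" using rec[of B] rec[of B'] recb[of B b] recb[of B' b'] B(3) by blast
  qed
  have sub: "(\<lambda>(B, b). g B b) ` (?S \<times> UNIV) \<subseteq> coxeter_C_minus p"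
  proof clarify
    fix B b assume "card (B :: 'n set) = 2"
    then have BS: "B \<in> ?S" by simp
    obtain i j where ij: "i \<noteq> j" "B = {i, j}" "g B True = {x. x $ i - x $ j = 0}" "g B False = {x. x $ i + x $ j = 0}" using gS[OF BS] by blast
    have "\<exists>s t. (s = 1 \<or> s = - 1) \<and> (t = 1 \<or> t = - 1) \<and> g B b = {z. (s *\<^sub>R axis i 1 + t *\<^sub>R axis j 1 :: real ^ 'n) \<bullet> z = 0}"
      unfolding PhiC_ker using ij(3,4)
      by (intro exI[of _ 1] exI[of _ "if b then - 1 else 1"]) (cases b; simp)
    then have "g B b \<in> coxeter_C" unfolding coxeter_C_eq using PhiC_I[of _ _ i j "\<lambda>_. True"] ij(1) by blast
    moreover have "g B b \<noteq> {x. x $ p = 0}"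
    proof
      assume g: "g B b = {x. x $ p = 0}"
      have "i \<in> B" "j \<in> B" using ij by auto
      then have "axis i 1 \<notin> g B b" "axis j 1 \<notin> g B b" using rec[OF BS] by blast+
      then show False unfolding g using ij(1) by (auto simp: axis_def split: if_splits)
    qed
    ultimately show "g B b \<in> coxeter_C_minus p" unfolding coxeter_C_minus_def by blast
  qed
  have "2 * (CARD('n) choose 2) = card (?S \<times> (UNIV :: bool set))"
    using n_subsets[of "UNIV :: 'n set" 2] by (simp add: card_cartesian_product)
  also have "\<dots> = card ((\<lambda>(B, b). g B b) ` (?S \<times> UNIV))" by (rule card_image[OF inj, symmetric])
  also have "\<dots> \<le> card (coxeter_C_minus p)"
    by (rule card_mono[OF _ sub]) (unfold coxeter_C_minus_eq, intro finite_imageI finite_PhiC)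
  finally show ?thesis .
qed

text \<open>The bounds \<open>l (l + 1) / 2\<close> and \<open>l (l - 1)\<close> agree for
  \<open>l = 3\<close>, so the first comparison starts at \<open>l = 4\<close>.\<close>

lemma card_coxeter:
  assumes "4 \<le> CARD('n)"
  shows "card (coxeter_A :: (real ^ 'n::finite option) set set) < card (coxeter_C_minus (p :: 'n))"
    "card (coxeter_C_minus p) < card (coxeter_C :: (real ^ 'n) set set)"
proof -
  let ?l = "CARD('n)"
  have "Suc ?l choose 2 < 2 * (?l choose 2)"
  proof -
    have "Suc ?l choose 2 = ?l + (?l choose 2)" by (simp add: numeral_2_eq_2)
    moreover have "?l < ?l choose 2"
    proof -
      have "2 * ?l < ?l * (?l - 1)" using assms by (simp add: mult.commute)
      moreover have "?l * (?l - 1) = 2 * (?l choose 2)" by (simp add: choose_two)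
      ultimately show ?thesis by linarith
    qed
    ultimately show ?thesis by simp
  qed
  then show "card (coxeter_A :: (real ^ 'n option) set set) < card (coxeter_C_minus (p :: 'n))"
    using card_coxeter_A_le[where 'n = 'n] card_coxeter_C_minus_ge[of p] by linarith
  have "{x. x $ p = 0} \<in> (coxeter_C :: (real ^ 'n) set set)" unfolding coxeter_C_def by blast
  moreover have "finite (coxeter_C :: (real ^ 'n) set set)" unfolding coxeter_C_eq by (intro finite_imageI finite_PhiC)
  ultimately show "card (coxeter_C_minus p) < card (coxeter_C :: (real ^ 'n) set set)"
    unfolding coxeter_C_minus_def by (intro psubset_card_mono) auto
qed

lemma exactly_one_coxeter:
  fixes p :: "'n::finite"
  assumes l: "4 \<le> CARD('n)" and A: "\<And>H. H \<in> A \<Longrightarrow> H \<subseteq> V"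
    and ex: "linearly_isomorphic V A coxeter_A_space (coxeter_A :: (real ^ 'n option) set set) \<or>
      linearly_isomorphic V A UNIV (coxeter_C :: (real ^ 'n) set set) \<or> linearly_isomorphic V A UNIV (coxeter_C_minus p)"
  shows "exactly_one [linearly_isomorphic V A coxeter_A_space (coxeter_A :: (real ^ 'n option) set set),
      linearly_isomorphic V A UNIV (coxeter_C :: (real ^ 'n) set set), linearly_isomorphic V A UNIV (coxeter_C_minus p)]"
proof -
  show ?thesis
    unfolding exactly_one_def using ex card_coxeter[OF l, of p] 
      linearly_isomorphic_card[of V A coxeter_A_space "coxeter_A :: (real ^ 'n option) set set", OF _ A] 
      linearly_isomorphic_card[of V A UNIV "coxeter_C :: (real ^ 'n) set set", OF _ A]
      linearly_isomorphic_card[of V A UNIV "coxeter_C_minus p", OF _ A]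
    by (auto split: if_splits)
qed

section \<open>Rank at least four\<close>

lemma hyperplanes_eq:
  assumes "\<And>n. n \<in> X \<Longrightarrow> \<exists>m\<in>Y. \<exists>c. c \<noteq> 0 \<and> n = c *\<^sub>R m" "\<And>m. m \<in> Y \<Longrightarrow> \<exists>n\<in>X. \<exists>c. c \<noteq> 0 \<and> m = c *\<^sub>R n"
  shows "(\<lambda>n. {x\<in>V. n \<bullet> x = 0}) ` X = (\<lambda>n. {x\<in>V. n \<bullet> x = (0::real)}) ` Y"
proof -
  have sc: "{x\<in>V. (c *\<^sub>R n) \<bullet> x = 0} = {x\<in>V. n \<bullet> x = 0}" if "c \<noteq> 0" for c n using that by simp
  show ?thesis
  proof
    show "(\<lambda>n. {x\<in>V. n \<bullet> x = 0}) ` X \<subseteq> (\<lambda>n. {x\<in>V. n \<bullet> x = 0}) ` Y"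
    proof
      fix H assume "H \<in> (\<lambda>n. {x\<in>V. n \<bullet> x = 0}) ` X"
      then obtain n where n: "n \<in> X" "H = {x\<in>V. n \<bullet> x = 0}" by blast
      obtain m c where m: "m \<in> Y" "c \<noteq> 0" "n = c *\<^sub>R m" using assms(1)[OF n(1)] by blast
      have "H = {x\<in>V. m \<bullet> x = 0}" unfolding n(2) m(3) sc[OF m(2)] ..
      then show "H \<in> (\<lambda>n. {x\<in>V. n \<bullet> x = 0}) ` Y" using m(1) by blast
    qed
    show "(\<lambda>n. {x\<in>V. n \<bullet> x = 0}) ` Y \<subseteq> (\<lambda>n. {x\<in>V. n \<bullet> x = 0}) ` X"
    proof
      fix H assume "H \<in> (\<lambda>n. {x\<in>V. n \<bullet> x = 0}) ` Y"
      then obtain n where n: "n \<in> Y" "H = {x\<in>V. n \<bullet> x = 0}" by blast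
      obtain m c where m: "m \<in> X" "c \<noteq> 0" "n = c *\<^sub>R m" using assms(2)[OF n(1)] by blast
      have "H = {x\<in>V. m \<bullet> x = 0}" unfolding n(2) m(3) sc[OF m(2)] ..
      then show "H \<in> (\<lambda>n. {x\<in>V. n \<bullet> x = 0}) ` X" using m(1) by blast
    qed
  qed
qed

lemma pigeonhole_two: "card I = 2 \<Longrightarrow> x \<in> I \<Longrightarrow> y \<in> I \<Longrightarrow> z \<in> I \<Longrightarrow> x = y \<or> y = z \<or> x = z"
  by (auto simp: card_2_iff)

text \<open>The parameter at which the ray of \<open>a s + b t\<close> meets the segment from
  \<open>s\<close> to \<open>t\<close>.\<close>

definition slope :: "real \<Rightarrow> real \<Rightarrow> real" where "slope a b = b / (a + b)"

lemma slope_eq: "0 < a \<Longrightarrow> 0 < b \<Longrightarrow> 0 < a' \<Longrightarrow> 0 < b' \<Longrightarrow> slope a b = slope a' b' \<longleftrightarrow> a * b' = a' * b"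
proof -
  assume "0 < a" "0 < b" "0 < a'" "0 < b'"
  then have "slope a b = slope a' b' \<longleftrightarrow> b * (a' + b') = b' * (a + b)" unfolding slope_def by (simp add: frac_eq_eq)
  then show ?thesis by (auto simp: algebra_simps)
qed

context fibred_arrangement
begin

definition slopes :: "'a \<Rightarrow> 'a \<Rightarrow> real set" where
  "slopes s t = {\<tau>. 0 < \<tau> \<and> \<tau> < 1 \<and> root ((1 - \<tau>) *\<^sub>R s + \<tau> *\<^sub>R t)}"

text \<open>The ends \<open>s\<close> and \<open>t\<close> of the segment account for the summand
  \<open>2\<close>.\<close>

lemma card_slopes:
  assumes "regular w" "simple w D" "s \<in> D" "t \<in> D" "s \<noteq> t"
  shows "card (slopes s t) + 2 = order2 s t"
proof -
  interpret V: rank_two_view W R F w D s t by unfold_locales (use assms in auto)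
  have T: "V.T = insert 0 (insert 1 (slopes s t))"
    using V.T_01 unfolding V.T_def slopes_def V.ray_def by (auto simp: order_less_le)
  have "finite (slopes s t)" using V.finite_T unfolding T by simp
  then have "card V.T = card (slopes s t) + 2" unfolding T slopes_def by (subst card_insert_disjoint) auto
  moreover have "card V.T = order2 s t" unfolding order2_def V.T_def V.ray_def ..
  ultimately show ?thesis by simp
qed

lemma slope_mem: "0 < a \<Longrightarrow> 0 < b \<Longrightarrow> root (a *\<^sub>R s + b *\<^sub>R t) \<Longrightarrow> slope a b \<in> slopes s t"
proof -
  assume ab: "0 < a" "0 < b" and r: "root (a *\<^sub>R s + b *\<^sub>R t)"
  have 1: "1 - slope a b = a / (a + b)" using ab unfolding slope_def by (simp add: field_simps)
  have "(1 - slope a b) *\<^sub>R s + slope a b *\<^sub>R t = (1 / (a + b)) *\<^sub>R (a *\<^sub>R s + b *\<^sub>R t)"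
    unfolding 1 unfolding slope_def by (simp add: scaleR_add_right)
  moreover have "root ((1 / (a + b)) *\<^sub>R (a *\<^sub>R s + b *\<^sub>R t))" using root_of_scale[OF r, of "1 / (a + b)"] ab by simp
  moreover have "0 < slope a b" "slope a b < 1" using ab unfolding slope_def by auto
  ultimately show ?thesis unfolding slopes_def by simp
qed

end

context chamber_word
begin

definition len :: "nat \<Rightarrow> real" where "len i = (SOME c. 0 < c \<and> e (Suc i) - e i = c *\<^sub>R letter i)"

lemma len: "Suc i < card F \<Longrightarrow> 0 < len i" "Suc i < card F \<Longrightarrow> e (Suc i) - e i = len i *\<^sub>R letter i"
proof -
  have "0 < len i \<and> e (Suc i) - e i = len i *\<^sub>R letter i" if "Suc i < card F"
    unfolding len_def by (rule someI_ex) (use letter(2)[OF that] in blast)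
  then show "Suc i < card F \<Longrightarrow> 0 < len i" "Suc i < card F \<Longrightarrow> e (Suc i) - e i = len i *\<^sub>R letter i" by auto
qed

lemma root_diff: "i < j \<Longrightarrow> j < card F \<Longrightarrow> root (e j - e i)"
  using F_diff[OF e_F e_F, of j i] e_less[of i j] by (metis less_irrefl less_trans)

lemma slope_two: 
  assumes "i + 2 < card F"
  shows "slope (len i) (len (i + 1)) \<in> slopes (letter i) (letter (i + 1))"
    "slope (len (i + 1)) (len i) \<in> slopes (letter (i + 1)) (letter i)"
proof -
  have "e (i + 2) - e i = (e (Suc i) - e i) + (e (Suc (Suc i)) - e (Suc i))" by simp
  also have "\<dots> = len i *\<^sub>R letter i + len (i + 1) *\<^sub>R letter (i + 1)"
    using len(2)[of i] len(2)[of "Suc i"] assms by simp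
  finally have eq: "e (i + 2) - e i = len i *\<^sub>R letter i + len (i + 1) *\<^sub>R letter (i + 1)" .
  have r: "root (e (i + 2) - e i)" using root_diff[of i "i + 2"] assms by simp
  show "slope (len i) (len (i + 1)) \<in> slopes (letter i) (letter (i + 1))"
    by (rule slope_mem) (use len(1) assms r eq in auto)
  show "slope (len (i + 1)) (len i) \<in> slopes (letter (i + 1)) (letter i)"
    by (rule slope_mem) (use len(1) assms r eq in \<open>auto simp: add.commute\<close>)
qed

text \<open>There are so few intermediate slopes that those of different differences coincide. At
  the turn, order four leaves two slopes for the three or four differences considered. Away from it,
  order three leaves one, so the ratio of neighbouring lengths is the same on both arms.\<close>

lemma palindrome_len:
  assumes n: "3 \<le> n" and N: "card F = Suc N" "N = 2 * n - 1 \<or> N = 2 * n"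
    and pal: "\<And>i. i < N \<Longrightarrow> letter (N - 1 - i) = letter i" and inj: "inj_on letter {..<n}"
    and o3: "\<And>i. i + 2 < n \<Longrightarrow> order2 (letter i) (letter (i + 1)) = 3"
    and o4: "order2 (letter (n - 2)) (letter (n - 1)) = 4"
    and i: "i < n"
  shows "len (N - 1 - i) = len i"
proof -
  have pos: "0 < len j" if "j < N" for j using len(1) N(1) that by simp
  have cs: "card (slopes (letter j) (letter k)) + 2 = order2 (letter j) (letter k)" if "j < n" "k < n" "j \<noteq> k" for j k
  proof -
    have "letter j \<in> D" "letter k \<in> D" using letter(1) N that n by auto
    moreover have "letter j \<noteq> letter k" using inj that by (auto dest: inj_onD)
    ultimately show ?thesis using card_slopes[OF regular_w simple_w] by blast
  qed
  define m where "m = n - 2"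
  have nm: "n = m + 2" "n - 2 = m" "n - 1 = m + 1" using n unfolding m_def by auto
  define s t where "s = letter m" and "t = letter (m + 1)"
  have c2: "card (slopes s t) = 2" using cs[of m "m + 1"] o4 nm unfolding s_def t_def by simp
  have step: "e (Suc j) = e j + len j *\<^sub>R letter j" if "j < N" for j using len(2)[of j] N(1) that by (simp add: algebra_simps)
  have base: "len (N - 1 - m) = len m \<and> len (N - 1 - (m + 1)) = len (m + 1)"
    using N(2)
  proof
    \<comment> \<open>Steps \<open>a s\<close>, \<open>b t\<close>, \<open>c s\<close>: the slope of
      the whole differs from that of the first two and from that of the last two steps, so these
      agree and \<open>a = c\<close>.\<close>
    assume b: "N = 2 * n - 1"
    have l2: "letter (m + 2) = s" using pal[of m] b nm unfolding s_def by (simp add: numeral_eq_Suc)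
    let ?a = "len m" and ?b = "len (m + 1)" and ?c = "len (m + 2)"
    have p: "0 < ?a" "0 < ?b" "0 < ?c" using pos b nm by auto
    have e1: "e (m + 1) = e m + ?a *\<^sub>R s" "e (m + 2) = e (m + 1) + ?b *\<^sub>R t" "e (m + 3) = e (m + 2) + ?c *\<^sub>R s"
      using step[of m] step[of "m + 1"] step[of "m + 2"] l2 b nm unfolding s_def t_def by (simp_all add: numeral_eq_Suc)
    have r: "root (e (m + 2) - e m)" "root (e (m + 3) - e (m + 1))" "root (e (m + 3) - e m)"
      by (rule root_diff; use N b nm in simp)+
    have "e (m + 2) - e m = ?a *\<^sub>R s + ?b *\<^sub>R t" "e (m + 3) - e (m + 1) = ?c *\<^sub>R s + ?b *\<^sub>R t"
      "e (m + 3) - e m = (?a + ?c) *\<^sub>R s + ?b *\<^sub>R t"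
      unfolding e1 by (simp_all add: algebra_simps)
    then have mem: "slope ?a ?b \<in> slopes s t" "slope ?c ?b \<in> slopes s t" "slope (?a + ?c) ?b \<in> slopes s t"
      using slope_mem[OF p(1,2)] slope_mem[OF p(3,2)] slope_mem[of "?a + ?c" ?b s t] p r by auto
    have "?a = ?c"
      using pigeonhole_two[OF c2 mem] p by (auto simp: slope_eq)
    then show ?thesis using b nm by (simp add: numeral_eq_Suc)
  next
    \<comment> \<open>Steps \<open>a s\<close>, \<open>b t\<close>, \<open>b' t\<close>,
      \<open>a' s\<close>: first \<open>a = a'\<close> as in the odd case, with the two middle steps
      merged; then the slope of the first two steps must be that of the whole, which gives
      \<open>b = b'\<close>.\<close>
    assume b: "N = 2 * n"
    have l2: "letter (m + 2) = t" "letter (m + 3) = s" using pal[of m] pal[of "m + 1"] b nm unfolding s_def t_def by (simp_all add: numeral_eq_Suc)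
    let ?a = "len m" and ?b = "len (m + 1)" and ?b' = "len (m + 2)" and ?a' = "len (m + 3)"
    have p: "0 < ?a" "0 < ?b" "0 < ?b'" "0 < ?a'" using pos b nm by auto
    have e1: "e (m + 1) = e m + ?a *\<^sub>R s" "e (m + 2) = e (m + 1) + ?b *\<^sub>R t" "e (m + 3) = e (m + 2) + ?b' *\<^sub>R t"
      "e (m + 4) = e (m + 3) + ?a' *\<^sub>R s"
      using step[of m] step[of "m + 1"] step[of "m + 2"] step[of "m + 3"] l2 b nm unfolding s_def t_def by (simp_all add: numeral_eq_Suc)
    have r: "root (e (m + 2) - e m)" "root (e (m + 3) - e m)" "root (e (m + 4) - e (m + 1))" "root (e (m + 4) - e m)"
      by (rule root_diff; use N b nm in simp)+
    have "e (m + 2) - e m = ?a *\<^sub>R s + ?b *\<^sub>R t" "e (m + 3) - e m = ?a *\<^sub>R s + (?b + ?b') *\<^sub>R t"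
      "e (m + 4) - e (m + 1) = ?a' *\<^sub>R s + (?b + ?b') *\<^sub>R t" "e (m + 4) - e m = (?a + ?a') *\<^sub>R s + (?b + ?b') *\<^sub>R t"
      unfolding e1 by (simp_all add: algebra_simps)
    then have mem: "slope ?a ?b \<in> slopes s t" "slope ?a (?b + ?b') \<in> slopes s t" "slope ?a' (?b + ?b') \<in> slopes s t"
        "slope (?a + ?a') (?b + ?b') \<in> slopes s t"
      using slope_mem[of ?a ?b s t] slope_mem[of ?a "?b + ?b'" s t] slope_mem[of ?a' "?b + ?b'" s t]
        slope_mem[of "?a + ?a'" "?b + ?b'" s t] p r by auto
    have n12: "slope ?a ?b \<noteq> slope ?a (?b + ?b')" using p by (simp add: slope_eq)
    have n25: "slope ?a (?b + ?b') \<noteq> slope (?a + ?a') (?b + ?b')" using p by (simp add: slope_eq)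
    have n45: "slope ?a' (?b + ?b') \<noteq> slope (?a + ?a') (?b + ?b')" using p by (simp add: slope_eq)
    have "slope ?a' (?b + ?b') = slope ?a (?b + ?b')"
      using pigeonhole_two[OF c2 mem(2,3,4)] n25 n45 by auto
    then have aa: "?a = ?a'" using p by (simp add: slope_eq)
    have "slope ?a ?b = slope (?a + ?a') (?b + ?b')"
      using pigeonhole_two[OF c2 mem(1,2,4)] n12 n25 by auto
    then have "?a * (?b + ?b') = (?a + ?a') * ?b" using p by (simp add: slope_eq)
    then have "?a * (?b' - ?b) = 0" unfolding aa[symmetric] by (simp add: algebra_simps)
    then have "?b = ?b'" using p by simp
    then show ?thesis using aa b nm by (simp add: numeral_eq_Suc)
  qed
  have "len (N - 1 - (m - j)) = len (m - j)" if "j \<le> m" for j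
    using that
  proof (induction j)
    case 0 then show ?case using base by simp
  next
    case (Suc j)
    define k where "k = m - Suc j"
    have k: "m - j = k + 1" "k + 2 < n" using Suc.prems nm unfolding k_def by auto
    have IH: "len (N - 1 - (k + 1)) = len (k + 1)" using Suc k by simp
    define q where "q = N - 1 - (k + 1)"
    have q: "q + 1 = N - 1 - k" "q + 2 \<le> N" "q + 1 < N" "k + 2 \<le> N" "k + 1 < N" "k < N" using k N(2) nm unfolding q_def by auto
    have lq: "letter (q + 1) = letter k" "letter q = letter (k + 1)" using pal[of k] pal[of "k + 1"] q unfolding q_def by auto
    have c1: "card (slopes (letter k) (letter (k + 1))) = 1" using cs[of k "k + 1"] o3[of k] k by simp
    have m1: "slope (len k) (len (k + 1)) \<in> slopes (letter k) (letter (k + 1))" using slope_two(1)[of k] N(1) q by simp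
    have m2: "slope (len (q + 1)) (len q) \<in> slopes (letter k) (letter (k + 1))" using slope_two(2)[of q] N(1) q lq by simp
    have "slope (len k) (len (k + 1)) = slope (len (q + 1)) (len q)"
      using c1 m1 m2 by (auto simp: card_1_singleton_iff)
    then have "len k * len q = len (q + 1) * len (k + 1)" using pos q by (simp add: slope_eq)
    moreover have "len q = len (k + 1)" using IH unfolding q_def .
    ultimately have "len k = len (q + 1)" using pos[of "k + 1"] q by simp
    then show ?case using q k_def by simp
  qed
  from this[of "m - i"] base show ?thesis using i nm by (cases "i = m + 1") auto
qed

end

section \<open>Recognising the models from the points of the fibre\<close>

context modular_fibration
begin

lemma dim_W: "dim W + 1 = dim V"
  unfolding W_def by (rule dim_ker_Suc[OF subspace_V p_V]) (simp add: p_unit)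

lemma W_p_span: "W \<subseteq> S \<Longrightarrow> p \<in> S \<Longrightarrow> subspace S \<Longrightarrow> V \<subseteq> S"
proof
  fix x assume S: "W \<subseteq> S" "p \<in> S" "subspace S" and x: "x \<in> V"
  have "x - (p \<bullet> x) *\<^sub>R p \<in> W" unfolding W_def using x p_V subspace_V p_unit
    by (auto intro!: subspace_diff subspace_scale simp: inner_diff_right)
  then have "(x - (p \<bullet> x) *\<^sub>R p) + (p \<bullet> x) *\<^sub>R p \<in> S" using S by (intro subspace_add subspace_scale) auto
  then show "x \<in> S" by simp
qed

text \<open>Every root is a wall of some chamber and there a letter by \<open>all_letters\<close>,
  hence parallel to a difference of points. So \<open>p\<close> and \<open>F\<close> determine the
  arrangement.\<close>

lemma A_differences:
  assumes irr: "irreducible_arr V A"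
  shows "A = (\<lambda>n. {x\<in>V. n \<bullet> x = 0}) ` ({f - g | f g. f \<in> F \<and> g \<in> F \<and> f \<noteq> g} \<union> (\<lambda>f. p - f) ` F)"
  unfolding A_eq
proof (rule hyperplanes_eq)
  fix m assume "m \<in> N"
  then consider "m \<in> R" | "m \<in> (\<lambda>f. p - f) ` F" unfolding N_def by blast
  then show "\<exists>n\<in>{f - g | f g. f \<in> F \<and> g \<in> F \<and> f \<noteq> g} \<union> (\<lambda>f. p - f) ` F. \<exists>c. c \<noteq> 0 \<and> m = c *\<^sub>R n"
  proof cases
    case 1
    obtain w D d c where w: "regular w" "simple w D" "d \<in> D" "0 < c" "m = c *\<^sub>R d"
      using root_is_wall[OF root_of_base[OF 1]] .
    obtain e where e: "chamber_word W R F w D e" using ex_chamber_word[OF w(1,2)] by blast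
    interpret C: chamber_word W R F w D e by (rule e)
    obtain i where i: "i < card F - 1" "d = C.letter i" using all_letters[OF irr e] w(3) by blast
    have i': "Suc i < card F" using i by simp
    obtain c' where c': "c' > 0" "e (Suc i) - e i = c' *\<^sub>R C.letter i" using C.letter(2)[OF i'] by blast
    have "m = (c / c') *\<^sub>R (e (Suc i) - e i)" unfolding c'(2) w(5) i(2) using c'(1) by simp
    moreover have "e (Suc i) \<in> F" "e i \<in> F" "e (Suc i) \<noteq> e i" using C.e_F i' C.e_less[of i "Suc i"] by auto
    moreover have "c / c' \<noteq> 0" using w(4) c'(1) by simp
    ultimately show ?thesis by blast
  next
    case 2
    then show ?thesis by (intro bexI[of _ m] exI[of _ 1]) auto
  qed
next
  fix m assume m: "m \<in> {f - g | f g. f \<in> F \<and> g \<in> F \<and> f \<noteq> g} \<union> (\<lambda>f. p - f) ` F"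
  show "\<exists>n\<in>N. \<exists>c. c \<noteq> 0 \<and> m = c *\<^sub>R n"
  proof (cases "m \<in> (\<lambda>f. p - f) ` F")
    case True
    then show ?thesis unfolding N_def by (intro bexI[of _ m] exI[of _ 1]) auto
  next
    case False
    then have "root_of R m" using m F_difference by auto
    then show ?thesis unfolding root_of_def N_def by blast
  qed
qed

text \<open>The normals \<open>p - e i\<close> form a basis and the other normals are parallel to
  their differences. With zero assigned to \<open>None\<close> this is the pattern of
  \<open>PhiA\<close>.\<close>

lemma type_A_of_simplex:
  fixes e :: "nat \<Rightarrow> 'a"
  assumes irr: "irreducible_arr V A" and card: "CARD('n::finite) = Suc n"
    and F: "F = e ` {..n}" and inj: "inj_on e {..n}" and sp: "W \<subseteq> span ((\<lambda>i. e (Suc i) - e i) ` {..<n})" and dimV: "dim V = Suc n"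
  shows "linearly_isomorphic V A coxeter_A_space (coxeter_A :: (real ^ 'n option) set set)" "crystallographic_arr V A"
proof -
  obtain \<tau> :: "'n \<Rightarrow> nat" where \<tau>: "bij_betw \<tau> UNIV {..n}"
    using finite_same_card_bij[of "UNIV :: 'n set" "{..n}"] card by auto
  define v where "v j = p - e (\<tau> j)" for j
  have \<tau>n: "\<tau> j \<le> n" for j using \<tau> unfolding bij_betw_def by auto
  have eF: "e i \<in> F" if "i \<le> n" for i using F that by auto
  have ev: "\<exists>j. e i = p - v j" if "i \<le> n" for i
  proof -
    have "i \<in> range \<tau>" using \<tau> that unfolding bij_betw_def by auto
    then show ?thesis unfolding v_def by auto
  qed
  have vV: "range v \<subseteq> V" unfolding v_def using p_V eF \<tau>n F_sub W_V subspace_V by (auto intro!: subspace_diff)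
  have dv: "e i - e k \<in> span (range v)" if ik: "i \<le> n" "k \<le> n" for i k
  proof -
    obtain a b where "e i = p - v a" "e k = p - v b" using ev[OF ik(1)] ev[OF ik(2)] by blast
    then have "e i - e k = v b - v a" by simp
    then show ?thesis by (auto intro: span_diff span_base)
  qed
  have Wv: "W \<subseteq> span (range v)"
    using sp by (rule order_trans) (intro span_minimal, use dv in auto)
  have "p \<in> span (range v)"
  proof -
    obtain j where j: "e 0 = p - v j" using ev by blast
    have "e 0 \<in> span (range v)" using Wv F_sub eF[of 0] by auto
    then have "e 0 + v j \<in> span (range v)" by (auto intro: span_add span_base)
    then show ?thesis using j by simp
  qed
  then have spv: "span (range v) = V" using W_p_span[OF Wv] vV subspace_V by (simp add: span_minimal subset_antisym)
  define lc where lc_eq: "lc = (\<lambda>y :: real ^ 'n option. \<Sum>i\<in>UNIV. y $ (Some i) *\<^sub>R v i)"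
  have lcS: "lc (axis (Some i) 1) = v i" for i
  proof -
    have "lc (axis (Some i) 1) = (\<Sum>j\<in>UNIV. if j = i then v i else 0)" unfolding lc_eq by (intro sum.cong) (auto simp: axis_def)
    then show ?thesis by simp
  qed
  have lcN: "lc (axis None 1) = 0" unfolding lc_eq by (intro sum.neutral) (auto simp: axis_def)
  have lcd: "lc (y - z) = lc y - lc z" for y z unfolding lc_eq by (simp add: scaleR_left_diff_distrib sum_subtractf)
  have vd: "v i - v j = e (\<tau> j) - e (\<tau> i)" for i j unfolding v_def by simp
  have \<tau>i: "\<tau> i = \<tau> j \<longleftrightarrow> i = j" for i j using \<tau> unfolding bij_betw_def by (auto dest: injD)
  let ?X = "{f - g | f g. f \<in> F \<and> g \<in> F \<and> f \<noteq> g} \<union> (\<lambda>f. p - f) ` F"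
  have A: "A = (\<lambda>n. {x\<in>V. n \<bullet> x = 0}) ` (lc ` PhiA)"
    unfolding A_differences[OF irr]
  proof (rule hyperplanes_eq)
    fix m assume "m \<in> ?X"
    then consider f g where "f \<in> F" "g \<in> F" "f \<noteq> g" "m = f - g" | f where "f \<in> F" "m = p - f" by blast
    then show "\<exists>y\<in>lc ` PhiA. \<exists>c. c \<noteq> 0 \<and> m = c *\<^sub>R y"
    proof cases
      case (1 f g)
      obtain a where a: "f = p - v a" using 1(1) F ev by auto
      obtain b where b: "g = p - v b" using 1(2) F ev by auto
      have "m = lc (axis (Some b) 1 - axis (Some a) 1)" unfolding lcd lcS 1(4) a b by simp
      moreover have "axis (Some b) 1 - axis (Some a) 1 \<in> (PhiA :: (real ^ 'n option) set)" unfolding PhiA_def using 1(3) a b by auto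
      ultimately show ?thesis by (intro bexI[of _ m] exI[of _ 1]) auto
    next
      case (2 f)
      obtain a where a: "f = p - v a" using 2(1) F ev by auto
      have "m = lc (axis (Some a) 1 - axis None 1)" unfolding lcd lcS lcN 2(2) a by simp
      moreover have "axis (Some a) 1 - axis None 1 \<in> (PhiA :: (real ^ 'n option) set)" unfolding PhiA_def by blast
      ultimately show ?thesis by (intro bexI[of _ m] exI[of _ 1]) auto
    qed
  next
    fix m assume "m \<in> lc ` PhiA"
    then obtain q r where qr: "q \<noteq> r" "m = lc (axis q 1 - axis r 1)" unfolding PhiA_def by auto
    have vX: "v i \<in> ?X" for i unfolding v_def using eF \<tau>n by blast
    show "\<exists>n\<in>?X. \<exists>c. c \<noteq> 0 \<and> m = c *\<^sub>R n"
    proof (cases q)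
      case None
      obtain j where j: "r = Some j" using qr(1) None by (cases r) auto
      have "m = (- 1) *\<^sub>R v j" unfolding qr(2) None j lcd lcS lcN by simp
      then show ?thesis using vX[of j] by (intro bexI[of _ "v j"] exI[of _ "- 1"]) auto
    next
      case (Some i)
      show ?thesis
      proof (cases r)
        case None
        have "m = v i" unfolding qr(2) None Some lcd lcS lcN by simp
        then show ?thesis using vX[of i] by (intro bexI[of _ "v i"] exI[of _ 1]) auto
      next
        case r: (Some j)
        have "m = e (\<tau> j) - e (\<tau> i)" unfolding qr(2) Some r lcd lcS vd ..
        moreover have "e (\<tau> j) \<noteq> e (\<tau> i)" using inj \<tau>n \<tau>i[of i j] qr(1) Some r by (auto dest: inj_onD)
        ultimately have "m \<in> ?X" using eF \<tau>n by blast
        then show ?thesis by (intro bexI[of _ m] exI[of _ 1]) auto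
      qed
    qed
  qed
  show "linearly_isomorphic V A coxeter_A_space (coxeter_A :: (real ^ 'n option) set set)" "crystallographic_arr V A"
    using type_A[OF subspace_V spv _ A[unfolded lc_eq] simplicial] card dimV by auto
qed

text \<open>The basis consists of \<open>p - c0\<close> at \<open>p0\<close> and the half diagonals
  \<open>E i\<close> elsewhere. Then each \<open>p - f\<close> with \<open>f \<noteq> c0\<close> is
  a sum or difference of two basis vectors, opposite points differ by \<open>2 E i\<close>, and only
  the centre yields the hyperplane of the coordinate \<open>p0\<close>.\<close>

lemma type_C_of_cross:
  fixes E :: "nat \<Rightarrow> 'a" and p0 :: "'n::finite"
  assumes irr: "irreducible_arr V A" and card: "CARD('n) = Suc n" and dimV: "dim V = Suc n"
    and F: "F = {c0 + s *\<^sub>R E i | i s. i < n \<and> (s = 1 \<or> s = - 1)} \<union> (if B then {c0} else {})"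
    and c0: "c0 \<in> W" and sp: "W \<subseteq> span (E ` {..<n})"
  shows "linearly_isomorphic V A UNIV ((\<lambda>y. {z. y \<bullet> z = 0}) ` PhiC (\<lambda>i. B \<or> i \<noteq> p0))" "crystallographic_arr V A"
proof -
  have "card (UNIV - {p0}) = n" using card by (simp add: card_Diff_singleton)
  then obtain \<tau> :: "'n \<Rightarrow> nat" where \<tau>: "bij_betw \<tau> (UNIV - {p0}) {..<n}"
    using finite_same_card_bij[of "UNIV - {p0}" "{..<n}"] by auto
  define v where "v j = (if j = p0 then p - c0 else E (\<tau> j))" for j
  have \<tau>n: "\<tau> j < n" if "j \<noteq> p0" for j using \<tau> that unfolding bij_betw_def by auto
  have Ev: "\<exists>j. j \<noteq> p0 \<and> E i = v j" if "i < n" for i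
  proof -
    have "i \<in> \<tau> ` (UNIV - {p0})" using \<tau> that unfolding bij_betw_def by auto
    then show ?thesis unfolding v_def by auto
  qed
  have EF: "c0 + s *\<^sub>R v j \<in> F" if "j \<noteq> p0" "s = 1 \<or> s = - 1" for j s
    unfolding F v_def using that \<tau>n[OF that(1)] by auto
  have EW: "v j \<in> W" if "j \<noteq> p0" for j
  proof -
    have "(c0 + 1 *\<^sub>R v j) - c0 \<in> W" using EF[OF that, of 1] F_sub c0 sub_W by (intro subspace_diff) auto
    then show ?thesis by simp
  qed
  have v0: "v p0 = p - c0" unfolding v_def by simp
  have vV: "range v \<subseteq> V"
  proof
    fix x assume "x \<in> range v"
    then obtain j where j: "x = v j" by blast
    show "x \<in> V"
    proof (cases "j = p0")
      case True
      then show ?thesis unfolding j using v0 p_V c0 W_V subspace_V by (auto intro: subspace_diff)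
    qed (use j EW W_V in auto)
  qed
  have Wv: "W \<subseteq> span (range v)"
    using sp by (rule order_trans) (intro span_minimal, use Ev in \<open>auto intro: span_base\<close>, metis rangeI span_base)
  have "p \<in> span (range v)"
  proof -
    have "c0 \<in> span (range v)" using Wv c0 by blast
    then have "v p0 + c0 \<in> span (range v)" by (intro span_add span_base[of "v p0"]) auto
    then show ?thesis unfolding v0 by simp
  qed
  then have spv: "span (range v) = V" using W_p_span[OF Wv] vV subspace_V by (simp add: span_minimal subset_antisym)
  have dimn: "dim V = CARD('n)" using card dimV by simp
  have vne: "s *\<^sub>R v i + t *\<^sub>R v j \<noteq> 0" if "i \<noteq> j" "s \<noteq> 0" for i j s t
  proof
    assume z: "s *\<^sub>R v i + t *\<^sub>R v j = 0"
    have "axis i 1 \<in> (\<lambda>x. \<chi> i. v i \<bullet> x) ` V"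
      using bij_betw_imp_surj_on[OF coordinates_bij(2)[OF subspace_V spv dimn]] by simp
    then obtain x where x: "axis i 1 = (\<chi> i. v i \<bullet> x)" by (rule imageE)
    have "v i \<bullet> x = 1" "v j \<bullet> x = 0" using arg_cong[OF x, of "\<lambda>u. u $ i"] arg_cong[OF x, of "\<lambda>u. u $ j"] that(1)
      by (auto simp: axis_def)
    then have "(s *\<^sub>R v i + t *\<^sub>R v j) \<bullet> x = s" by (simp add: inner_add_left)
    then show False using z that(2) by simp
  qed
  define lc where lc_eq: "lc = (\<lambda>y :: real ^ 'n. \<Sum>i\<in>UNIV. y $ i *\<^sub>R v i)"
  have lc1: "lc (axis i 1) = v i" for i
  proof -
    have "lc (axis i 1) = (\<Sum>j\<in>UNIV. if j = i then v i else 0)" unfolding lc_eq by (intro sum.cong) (auto simp: axis_def)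
    then show ?thesis by simp
  qed
  have lin: "linear lc" unfolding lc_eq by (intro linearI) (auto simp: scaleR_add_left sum.distrib scaleR_sum_right)
  have lc: "lc (s *\<^sub>R axis i 1 + t *\<^sub>R axis j 1) = s *\<^sub>R v i + t *\<^sub>R v j" for s t i j
    unfolding linear_add[OF lin] linear_scale[OF lin] lc1 ..
  let ?X = "{f - g | f g. f \<in> F \<and> g \<in> F \<and> f \<noteq> g} \<union> (\<lambda>f. p - f) ` F" and ?P = "\<lambda>i. B \<or> i \<noteq> p0"
  have inY: "\<exists>y\<in>lc ` PhiC ?P. \<exists>c. c \<noteq> 0 \<and> m = c *\<^sub>R y"
    if mm: "m = c *\<^sub>R (s *\<^sub>R v i + t *\<^sub>R v j)" "c \<noteq> 0" "s = 1 \<or> s = - 1" "t = 1 \<or> t = - 1" "i = j \<Longrightarrow> s = t \<and> ?P i" for m c s t i j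
  proof -
    have "s *\<^sub>R axis i 1 + t *\<^sub>R axis j 1 \<in> PhiC ?P" by (rule PhiC_I) (use mm in auto)
    then have "s *\<^sub>R v i + t *\<^sub>R v j \<in> lc ` PhiC ?P" unfolding lc[symmetric] by (rule imageI)
    then show ?thesis using mm(1,2) by blast
  qed
  have Fc: "(\<exists>j s. j \<noteq> p0 \<and> (s = 1 \<or> s = - 1) \<and> f = c0 + s *\<^sub>R v j) \<or> (B \<and> f = c0)" if "f \<in> F" for f
  proof -
    from that consider i s where "i < n" "s = 1 \<or> s = - 1" "f = c0 + s *\<^sub>R E i" | "B" "f = c0" unfolding F by (auto split: if_splits)
    then show ?thesis
    proof cases
      case (1 i s)
      then show ?thesis using Ev[OF 1(1)] by metis
    qed auto
  qed
  have A: "A = (\<lambda>n. {x\<in>V. n \<bullet> x = 0}) ` (lc ` PhiC ?P)"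
    unfolding A_differences[OF irr]
  proof (rule hyperplanes_eq)
    fix m assume "m \<in> ?X"
    then consider f g where "f \<in> F" "g \<in> F" "f \<noteq> g" "m = f - g" | f where "f \<in> F" "m = p - f" by blast
    then show "\<exists>y\<in>lc ` PhiC ?P. \<exists>c. c \<noteq> 0 \<and> m = c *\<^sub>R y"
    proof cases
      case (1 f g)
      from Fc[OF 1(1)] consider j s where "j \<noteq> p0" "s = 1 \<or> s = - 1" "f = c0 + s *\<^sub>R v j" | "B" "f = c0" by blast
      then show ?thesis
      proof cases
        case f: (1 j s)
        from Fc[OF 1(2)] consider k t where "k \<noteq> p0" "t = 1 \<or> t = - 1" "g = c0 + t *\<^sub>R v k" | "B" "g = c0" by blast
        then show ?thesis
        proof cases
          case g: (1 k t)
          have t: "- t = 1 \<or> - t = - 1" using g(2) by auto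
          have ne: "s = - t \<and> ?P j" if "j = k" using 1(3) f g that by auto
          have "m = 1 *\<^sub>R (s *\<^sub>R v j + (- t) *\<^sub>R v k)" unfolding 1(4) f(3) g(3) by simp
          then show ?thesis by (rule inY[OF _ _ f(2) t ne]) auto
        next
          case g: 2
          have "m = (1/2) *\<^sub>R (s *\<^sub>R v j + s *\<^sub>R v j)" unfolding 1(4) f(3) g(2) by (simp add: scaleR_add_left[symmetric])
          then show ?thesis by (rule inY[OF _ _ f(2) f(2)]) (use g in auto)
        qed
      next
        case f: 2
        from Fc[OF 1(2)] consider k t where "k \<noteq> p0" "t = 1 \<or> t = - 1" "g = c0 + t *\<^sub>R v k" | "B" "g = c0" by blast
        then show ?thesis
        proof cases
          case g: (1 k t)
          have "m = (- 1/2) *\<^sub>R (t *\<^sub>R v k + t *\<^sub>R v k)" unfolding 1(4) f(2) g(3) by (simp add: scaleR_add_left[symmetric])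
          then show ?thesis by (rule inY[OF _ _ g(2) g(2)]) (use f in auto)
        next
          case g: 2
          then show ?thesis using f 1 by simp
        qed
      qed
    next
      case (2 f)
      from Fc[OF 2(1)] consider j s where "j \<noteq> p0" "s = 1 \<or> s = - 1" "f = c0 + s *\<^sub>R v j" | "B" "f = c0" by blast
      then show ?thesis
      proof cases
        case f: (1 j s)
        have s: "- s = 1 \<or> - s = - 1" using f(2) by auto
        have "m = 1 *\<^sub>R (1 *\<^sub>R v p0 + (- s) *\<^sub>R v j)" unfolding 2(2) f(3) v0 by simp
        then show ?thesis by (rule inY[OF _ _ _ s]) (use f in auto)
      next
        case f: 2
        have "m = (1/2) *\<^sub>R (1 *\<^sub>R v p0 + 1 *\<^sub>R v p0)" unfolding 2(2) f(2) v0 by (simp add: scaleR_add_left[symmetric])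
        then show ?thesis by (rule inY) (use f in auto)
      qed
    qed
  next
    fix m assume "m \<in> lc ` PhiC ?P"
    then obtain i j s t where r: "s = 1 \<or> s = - 1" "t = 1 \<or> t = - 1" "i = j \<longrightarrow> s = t \<and> ?P i"
      and m: "m = lc (s *\<^sub>R axis i 1 + t *\<^sub>R axis j 1)" unfolding PhiC_def by auto
    have m: "m = s *\<^sub>R v i + t *\<^sub>R v j" using m lc by simp
    have st: "- (s * t) = 1 \<or> - (s * t) = - 1" using r(1,2) by (elim disjE) simp_all
    have nz: "s \<noteq> 0" "t \<noteq> 0" using r(1,2) by (elim disjE, simp_all)+
    have rr: "- s = 1 \<or> - s = - 1" "- t = 1 \<or> - t = - 1" using r by auto
    have dX: "f - g \<in> ?X" if "f \<in> F" "g \<in> F" "f - g \<noteq> 0" for f g using that by auto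
    have pX: "p - f \<in> ?X" if "f \<in> F" for f using that by blast
    have one: "\<exists>n\<in>?X. \<exists>c. c \<noteq> 0 \<and> m = c *\<^sub>R n" if "m = c *\<^sub>R n" "c \<noteq> 0" "n \<in> ?X" for n c using that by blast
    show "\<exists>n\<in>?X. \<exists>c. c \<noteq> 0 \<and> m = c *\<^sub>R n"
    proof (cases "i = p0")
      case ip: True
      show ?thesis
      proof (cases "j = p0")
        case True
        then have "B" "s = t" using r ip by auto
        then have "c0 \<in> F" unfolding F by simp
        moreover have "m = (2 * s) *\<^sub>R (p - c0)"
          unfolding m ip True v0 \<open>s = t\<close> by (simp flip: scaleR_add_left)
        ultimately show ?thesis using r(1) by (intro one[of "2 * s" "p - c0"] pX) auto
      next
        case False
        have "m = s *\<^sub>R (p - (c0 + (- (s * t)) *\<^sub>R v j))" unfolding m ip v0 using r by (auto simp: algebra_simps)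
        then show ?thesis by (rule one[OF _ nz(1) pX[OF EF[OF False st]]])
      qed
    next
      case ip: False
      show ?thesis
      proof (cases "j = p0")
        case True
        have "m = t *\<^sub>R (p - (c0 + (- (s * t)) *\<^sub>R v i))" unfolding m True v0 using r by (auto simp: algebra_simps)
        then show ?thesis by (rule one[OF _ nz(2) pX[OF EF[OF ip st]]])
      next
        case jp: False
        have eq: "m = 1 *\<^sub>R ((c0 + s *\<^sub>R v i) - (c0 + (- t) *\<^sub>R v j))" unfolding m by simp
        have "m \<noteq> 0"
        proof (cases "i = j")
          case True
          then have "m = (2 * s) *\<^sub>R v i" unfolding m using r by (auto simp: scaleR_add_left[symmetric])
          moreover have "1 *\<^sub>R v i + 0 *\<^sub>R v p0 \<noteq> 0" by (rule vne) (use ip in auto)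
          ultimately show ?thesis using r by auto
        next
          case False
          then show ?thesis unfolding m by (intro vne) (use r in auto)
        qed
        then have "(c0 + s *\<^sub>R v i) - (c0 + (- t) *\<^sub>R v j) \<noteq> 0" using eq by auto
        then show ?thesis by (intro one[OF eq] dX EF ip jp r rr) auto
      qed
    qed
  qed
  show "linearly_isomorphic V A UNIV ((\<lambda>y. {z. y \<bullet> z = 0}) ` PhiC ?P)" "crystallographic_arr V A"
    using type_C[OF subspace_V spv dimn A[unfolded lc_eq] simplicial] by auto
qed

theorem high_rank:
  fixes p0 :: "'n::finite"
  assumes irr: "irreducible_arr V A" and card: "CARD('n) = dim V" and dim4: "4 \<le> dim V"
  shows "(linearly_isomorphic V A coxeter_A_space (coxeter_A :: (real ^ 'n option) set set) \<or>
      linearly_isomorphic V A UNIV (coxeter_C :: (real ^ 'n) set set) \<or> linearly_isomorphic V A UNIV (coxeter_C_minus p0)) \<and>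
     crystallographic_arr V A"
proof -
  obtain w where w: "regular w" using ex_regular by blast
  obtain D where D: "simple w D" using regular_simple_ex[OF w] by blast
  obtain e where e: "chamber_word W R F w D e" using ex_chamber_word[OF w D] by blast
  interpret C: chamber_word W R F w D e by (rule e)
  have let_D: "C.letter ` {..<card F - 1} = D" by (rule all_letters[OF irr e])
  have cD: "card D = dim W" using simpleD(1,2)[OF D] by (metis dim_eq_card_independent dim_span)
  define n where "n = dim W"
  have n: "3 \<le> n" "dim V = Suc n" using dim_W dim4 unfolding n_def by auto
  interpret P: path_word C.letter "card F - 1" C.adjacent order2
    by (rule C.path_word) (use let_D cD n n_def in simp)
  have Pn: "P.n = n"
  proof -
    have "card (C.letter ` {..<P.n}) = P.n" using P.n_props(2) by (simp add: card_image)
    then show ?thesis using P.classification(2) let_D cD n_def by simp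
  qed
  define N where "N = card F - 1"
  have cF: "card F = Suc N" using P.N_ge unfolding N_def by simp
  have cl: "(N = n \<and> order2 (C.letter (n - 2)) (C.letter (n - 1)) = 3) \<or>
    (N = 2 * n - 1 \<and> (\<forall>i<n. C.letter (2 * n - 2 - i) = C.letter i) \<and> order2 (C.letter (n - 2)) (C.letter (n - 1)) = 4) \<or>
    (N = 2 * n \<and> (\<forall>i<n. C.letter (2 * n - 1 - i) = C.letter i) \<and> order2 (C.letter (n - 2)) (C.letter (n - 1)) = 4)"
    using P.classification(1) unfolding Pn N_def .
  have lD: "D \<subseteq> C.letter ` {..<n}" using P.classification(2) let_D unfolding Pn by simp
  have eF: "F = e ` {..N}"
    using C.bij_e unfolding bij_betw_def cF lessThan_Suc_atMost by simp
  have einj: "inj_on e {..N}" using C.bij_e unfolding bij_betw_def cF lessThan_Suc_atMost by simp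
  have ediff: "e (Suc i) - e i = C.len i *\<^sub>R C.letter i" "0 < C.len i" if "i < N" for i using C.len cF that by auto
  show ?thesis
  proof (cases "N = n")
    case True
    have "W \<subseteq> span ((\<lambda>i. e (Suc i) - e i) ` {..<n})"
    proof -
      have "C.letter i \<in> span ((\<lambda>i. e (Suc i) - e i) ` {..<n})" if "i < n" for i
      proof -
        have "(1 / C.len i) *\<^sub>R (e (Suc i) - e i) \<in> span ((\<lambda>i. e (Suc i) - e i) ` {..<n})"
          using that by (intro span_scale span_base) auto
        then show ?thesis using ediff[of i] that True by simp
      qed
      then have "D \<subseteq> span ((\<lambda>i. e (Suc i) - e i) ` {..<n})" by (intro subset_trans[OF lD]) auto
      then have "span D \<subseteq> span ((\<lambda>i. e (Suc i) - e i) ` {..<n})" by (intro span_minimal) auto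
      then show ?thesis using simpleD(2)[OF D] by simp
    qed
    then show ?thesis using type_A_of_simplex[OF irr, where n = n and e = e and 'n = 'n] card n eF einj True by auto
  next
    case False
    then have N: "N = 2 * n - 1 \<or> N = 2 * n" and o4: "order2 (C.letter (n - 2)) (C.letter (n - 1)) = 4" using cl by auto
    have pal0: "C.letter (N - 1 - i) = C.letter i" if "i < n" for i
      using cl False that
    proof (elim disjE conjE)
      assume "N = 2 * n - 1" "\<forall>i<n. C.letter (2 * n - 2 - i) = C.letter i"
      moreover have "2 * n - 1 - 1 - i = 2 * n - 2 - i" by simp
      ultimately show ?thesis using that by metis
    qed auto
    have pal: "C.letter (N - 1 - i) = C.letter i" if "i < N" for i
    proof (cases "i < n")
      case False
      have "N - 1 - i < n" "N - 1 - (N - 1 - i) = i" using N False that by auto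
      then show ?thesis using pal0[of "N - 1 - i"] by simp
    qed (use pal0 in simp)
    have len0: "C.len (N - 1 - i) = C.len i" if "i < n" for i
    proof (rule C.palindrome_len[OF n(1) cF N pal _ _ o4 that])
      show "inj_on C.letter {..<n}" using P.n_props(2) Pn by simp
      show "order2 (C.letter i) (C.letter (i + 1)) = 3" if "i + 2 < n" for i
        using P.kk_path[of i] that Pn by simp
    qed auto
    have len: "C.len (N - 1 - i) = C.len i" if "i < N" for i
    proof (cases "i < n")
      case False
      have "N - 1 - i < n" "N - 1 - (N - 1 - i) = i" using N False that by auto
      then show ?thesis using len0[of "N - 1 - i"] by simp
    qed (use len0 in simp)
    have sym: "e j + e (N - j) = e 0 + e N" if "j \<le> N" for j
      using that
    proof (induction j)
      case (Suc j)
      then have j: "j < N" "Suc (N - Suc j) = N - j" "N - 1 - j = N - Suc j" "N - Suc j < N" by auto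
      have "e (Suc j) - e j = C.len j *\<^sub>R C.letter j" using ediff j by blast
      moreover have "e (Suc (N - Suc j)) - e (N - Suc j) = C.len (N - Suc j) *\<^sub>R C.letter (N - Suc j)" using ediff[OF j(4)] by blast
      moreover have "C.len (N - Suc j) = C.len j" "C.letter (N - Suc j) = C.letter j" using len[OF j(1)] pal[OF j(1)] j(3) by auto
      ultimately have "e (Suc j) - e j = e (N - j) - e (N - Suc j)" unfolding j(2) by simp
      then have "e (Suc j) + e (N - Suc j) = e j + e (N - j)" by (simp add: algebra_simps)
      then show ?case using Suc by simp
    qed simp
    \<comment> \<open>By \<open>sym\<close> the points are paired symmetrically about this midpoint;
      if \<open>N = 2 * n\<close>, the point in the middle is the midpoint itself.\<close>
    define c0 where "c0 = (1/2) *\<^sub>R (e 0 + e N)"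
    define E where "E i = e (N - i) - c0" for i
    have cc: "c0 + c0 = e 0 + e N" unfolding c0_def by (simp add: scaleR_add_left[symmetric])
    have e_lo: "e i = c0 + (- 1) *\<^sub>R E i" if "i \<le> N" for i
    proof -
      have "c0 + (- 1) *\<^sub>R E i = (c0 + c0) - e (N - i)" unfolding E_def by simp
      then show ?thesis unfolding cc sym[OF that, symmetric] by simp
    qed
    have e_hi: "e (N - i) = c0 + 1 *\<^sub>R E i" for i unfolding E_def by simp
    define B where "B \<longleftrightarrow> N = 2 * n"
    have mid: "e n = c0" if B
    proof -
      have "e n + e n = c0 + c0" using sym[of n] that unfolding B_def cc by simp
      then have "2 *\<^sub>R e n = 2 *\<^sub>R c0" by (simp add: scaleR_2)
      then show ?thesis by simp
    qed
    have F: "F = {c0 + s *\<^sub>R E i | i s. i < n \<and> (s = 1 \<or> s = - 1)} \<union> (if B then {c0} else {})"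
    proof
      show "F \<subseteq> {c0 + s *\<^sub>R E i | i s. i < n \<and> (s = 1 \<or> s = - 1)} \<union> (if B then {c0} else {})"
      proof
        fix f assume "f \<in> F"
        then obtain i where i: "i \<le> N" "f = e i" unfolding eF by auto
        consider "i < n" | "B" "i = n" | "N - i < n" using i(1) N unfolding B_def by linarith
        then show "f \<in> {c0 + s *\<^sub>R E i | i s. i < n \<and> (s = 1 \<or> s = - 1)} \<union> (if B then {c0} else {})"
        proof cases
          case 1
          then show ?thesis using e_lo[OF i(1)] i(2) by blast
        next
          case 2
          then show ?thesis using mid i(2) by simp
        next
          case 3
          have "f = c0 + 1 *\<^sub>R E (N - i)" using e_hi[of "N - i"] i by simp
          then show ?thesis using 3 by blast
        qed
      qed
      have "n \<le> N" using N n(1) by auto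
      have "c0 + s *\<^sub>R E i \<in> F" if "i < n" "s = 1 \<or> s = - 1" for i s
        using that e_lo[of i] e_hi[of i] \<open>n \<le> N\<close> unfolding eF by (metis atMost_iff diff_le_self imageI less_imp_le_nat order_trans)
      moreover have "c0 \<in> F" if B using mid[OF that] \<open>n \<le> N\<close> unfolding eF by auto
      ultimately show "{c0 + s *\<^sub>R E i | i s. i < n \<and> (s = 1 \<or> s = - 1)} \<union> (if B then {c0} else {}) \<subseteq> F" by auto
    qed
    have c0W: "c0 \<in> W" unfolding c0_def using eF F_sub sub_W by (intro subspace_scale subspace_add) auto
    have "W \<subseteq> span (E ` {..<n})"
    proof -
      have in1: "E i \<in> span (E ` {..<n})" if "i < n" for i using that by (intro span_base) auto
      have "C.letter i \<in> span (E ` {..<n})" if i: "i < n" for i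
      proof -
        have "\<exists>c. c \<noteq> 0 \<and> c *\<^sub>R C.letter i \<in> span (E ` {..<n})"
        proof (cases "Suc i < n")
          case True
          have iN: "i < N" using N n(1) i by auto
          have "C.len i *\<^sub>R C.letter i = E i - E (Suc i)" using ediff(1)[OF iN] e_lo[of i] e_lo[of "Suc i"] iN by simp
          then show ?thesis using ediff(2)[OF iN] in1[OF i] in1[OF True] by (intro exI[of _ "C.len i"]) (auto intro: span_diff)
        next
          case False
          then have in': "i = n - 1" using i by simp
          have iN: "i < N" "Suc i = n" using N n(1) i in' by auto
          show ?thesis
          proof (cases B)
            case True
            have "C.len i *\<^sub>R C.letter i = E i" using ediff(1)[OF iN(1)] e_lo[of i] iN mid[OF True] by simp
            then show ?thesis using ediff(2)[OF iN(1)] in1[OF i] by (intro exI[of _ "C.len i"]) auto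
          next
            case False
            \<comment> \<open>Without a centre the middle step joins two opposite points and equals
              \<open>2 E i\<close>.\<close>
            then have "N - i = Suc i" using N in' n(1) unfolding B_def by auto
            then have "e (Suc i) = c0 + 1 *\<^sub>R E i" using e_hi[of i] by simp
            then have "C.len i *\<^sub>R C.letter i = E i + E i" using ediff(1)[OF iN(1)] e_lo[of i] iN by simp
            then show ?thesis using ediff(2)[OF iN(1)] in1[OF i] by (intro exI[of _ "C.len i"]) (auto intro: span_add)
          qed
        qed
        then obtain c where c: "c \<noteq> 0" "c *\<^sub>R C.letter i \<in> span (E ` {..<n})" by blast
        have "(1/c) *\<^sub>R (c *\<^sub>R C.letter i) \<in> span (E ` {..<n})" by (rule span_scale[OF c(2)])
        then show ?thesis using c(1) by simp
      qed
      then have "D \<subseteq> span (E ` {..<n})" by (intro subset_trans[OF lD]) auto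
      then have "span D \<subseteq> span (E ` {..<n})" by (intro span_minimal) auto
      then show ?thesis using simpleD(2)[OF D] by simp
    qed
    note T = type_C_of_cross[OF irr _ n(2) F c0W this]
    have T1: "linearly_isomorphic V A UNIV ((\<lambda>y. {z. y \<bullet> z = 0}) ` PhiC (\<lambda>i. B \<or> i \<noteq> p0))" "crystallographic_arr V A"
      using T(1)[where ?p0.0 = p0] T(2)[where 'n = 'n] card n(2) by auto
    show ?thesis
    proof (cases B)
      case True
      then show ?thesis using T1 unfolding coxeter_C_eq by simp
    next
      case False
      then show ?thesis using T1 unfolding coxeter_C_minus_eq by simp
    qed
  qed
qed

end

section \<open>Rank three\<close>

lemma int_lattice_image:
  assumes "A = h ` I"
  shows "int_lattice V A = {V \<inter> \<Inter>(h ` S) | S. S \<subseteq> I}"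
proof -
  have "\<exists>S\<subseteq>I. B = h ` S" if "B \<subseteq> A" for B using that unfolding assms by (simp add: subset_image_iff)
  then show ?thesis unfolding int_lattice_def using assms by blast
qed

text \<open>A lattice element corresponds to the set of indices of all hyperplanes containing it, so
  the lattice is determined by which index sets are closed.\<close>

lemma L_equivalent_of_closure:
  assumes A: "A = h ` I" and A': "A' = h' ` I"
    and cl: "\<And>S i. S \<subseteq> I \<Longrightarrow> i \<in> I \<Longrightarrow> V \<inter> \<Inter>(h ` S) \<subseteq> h i \<longleftrightarrow> V' \<inter> \<Inter>(h' ` S) \<subseteq> h' i"
  shows "L_equivalent V A V' A'"
proof -
  define X where "X S = V \<inter> \<Inter>(h ` S)" for S
  define X' where "X' S = V' \<inter> \<Inter>(h' ` S)" for S
  define f where "f Y = X' {i\<in>I. Y \<subseteq> h i}" for Y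
  have c: "X S \<subseteq> h i \<longleftrightarrow> X' S \<subseteq> h' i" if "S \<subseteq> I" "i \<in> I" for S i using cl[OF that] unfolding X_def X'_def .
  have lat: "int_lattice V A = X ` Pow I" "int_lattice V' A' = X' ` Pow I"
    unfolding int_lattice_image[OF A] int_lattice_image[OF A'] X_def X'_def by auto
  have f: "f (X S) = X' S" if S: "S \<subseteq> I" for S
  proof
    have "S \<subseteq> {i\<in>I. X S \<subseteq> h i}" using S unfolding X_def by auto
    then show "f (X S) \<subseteq> X' S" unfolding f_def X'_def by blast
    have "X' S \<subseteq> h' i" if "i \<in> I" "X S \<subseteq> h i" for i using c[OF S that(1)] that(2) by simp
    moreover have "X' S \<subseteq> V'" unfolding X'_def by simp
    ultimately show "X' S \<subseteq> f (X S)" unfolding f_def X'_def by blast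
  qed
  have le: "X T \<subseteq> X S \<longleftrightarrow> X' T \<subseteq> X' S" if S: "S \<subseteq> I" and T: "T \<subseteq> I" for S T
  proof -
    have "X T \<subseteq> X S \<longleftrightarrow> (\<forall>i\<in>S. X T \<subseteq> h i)" unfolding X_def by blast
    also have "\<dots> \<longleftrightarrow> (\<forall>i\<in>S. X' T \<subseteq> h' i)" using c[OF T] S by blast
    also have "\<dots> \<longleftrightarrow> X' T \<subseteq> X' S" unfolding X'_def by blast
    finally show ?thesis .
  qed
  have order: "\<forall>Y\<in>X ` Pow I. \<forall>Z\<in>X ` Pow I. Z \<subseteq> Y \<longleftrightarrow> f Z \<subseteq> f Y" using le f by auto
  have "inj_on f (X ` Pow I)" using order by (intro inj_onI) (metis order_refl subset_antisym)
  moreover have "f ` X ` Pow I = X' ` Pow I" unfolding image_image using f by (intro image_cong) auto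
  ultimately show ?thesis unfolding L_equivalent_def lat bij_betw_def using order by blast
qed

lemma plane_triple:
  fixes H :: "'a::euclidean_space set"
  assumes V: "subspace V" "dim V = 3" and H: "hyperplane_of V H" "hyperplane_of V K" "hyperplane_of V L" "H \<noteq> K"
    and n: "\<not> H \<inter> K \<subseteq> L"
  shows "H \<inter> K \<inter> L = {0}"
proof -
  have s: "subspace H" "subspace K" "subspace L" "H \<subseteq> V" "K \<subseteq> V" "dim H = 2" "dim K = 2"
    using H V unfolding hyperplane_of_def by auto
  have "H \<noteq> {x + y | x y. x \<in> H \<and> y \<in> K}" (is "H \<noteq> ?S")
  proof
    assume e: "H = ?S"
    have "K \<subseteq> H"
    proof
      fix y assume "y \<in> K"
      then have "0 + y \<in> ?S" using subspace_0[OF s(1)] by blast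
      then show "y \<in> H" using e by simp
    qed
    then have "K = H" using s by (intro subspace_dim_equal) auto
    then show False using H(4) by simp
  qed
  moreover have HS: "H \<subseteq> ?S"
  proof
    fix x assume "x \<in> H"
    then have "x + 0 \<in> ?S" using subspace_0[OF s(2)] by blast
    then show "x \<in> ?S" by simp
  qed
  moreover have "subspace ?S" using subspace_sums[OF s(1,2)] .
  ultimately have "2 < dim ?S" using s(1,6) subspace_dim_equal[of H ?S] by linarith
  moreover have "dim ?S + dim (H \<inter> K) = 4" using dim_sums_Int[OF s(1,2)] s by simp
  ultimately have d: "dim (H \<inter> K) \<le> 1" by simp
  have i: "subspace (H \<inter> K)" "subspace (H \<inter> K \<inter> L)" using s by (auto intro: subspace_inter)
  have "dim (H \<inter> K \<inter> L) \<noteq> dim (H \<inter> K)"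
  proof
    assume "dim (H \<inter> K \<inter> L) = dim (H \<inter> K)"
    then have "H \<inter> K \<inter> L = H \<inter> K" by (intro subspace_dim_equal[OF i(2,1)]) auto
    then show False using n by blast
  qed
  moreover have "dim (H \<inter> K \<inter> L) \<le> dim (H \<inter> K)" by (rule dim_subset) blast
  ultimately have "dim (H \<inter> K \<inter> L) = 0" using d by linarith
  then show ?thesis using i(2) subspace_0 by (auto simp: dim_eq_0)
qed

text \<open>If \<open>S\<close> has two planes, their common line either lies in all planes of
  \<open>S\<close> and is the intersection, or the intersection is zero and lies in every plane. The
  implication covers both cases, and any pair from \<open>S\<close> gives the same answer.\<close>

lemma closure_rank_three:
  fixes h :: "'i \<Rightarrow> 'a::euclidean_space set"
  assumes V: "subspace V" "dim V = 3" and h: "\<And>x. x \<in> I \<Longrightarrow> hyperplane_of V (h x)" and inj: "inj_on h I"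
    and S: "S \<subseteq> I" and i: "i \<in> I"
  shows "V \<inter> \<Inter>(h ` S) \<subseteq> h i \<longleftrightarrow>
    S = {i} \<or> (\<exists>x\<in>S. \<exists>y\<in>S. x \<noteq> y \<and> ((\<forall>z\<in>S. h x \<inter> h y \<subseteq> h z) \<longrightarrow> h x \<inter> h y \<subseteq> h i))"
proof -
  have hV: "h x \<subseteq> V" "h x \<noteq> V" "subspace (h x)" "dim (h x) = 2" if "x \<in> I" for x using h[OF that] V(2) unfolding hyperplane_of_def by auto
  consider "S = {}" | j where "S = {j}" | x y where "x \<in> S" "y \<in> S" "x \<noteq> y" by blast
  then show ?thesis
  proof cases
    case 1
    then show ?thesis using hV[OF i] by auto
  next
    case (2 j)
    then have j: "j \<in> I" using S by simp
    have "h j \<subseteq> h i \<Longrightarrow> j = i" using subspace_dim_equal[of "h j" "h i"] hV[OF i] hV[OF j] inj i j by (auto dest: inj_onD)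
    then show ?thesis using 2 hV(1)[OF j] by auto
  next
    case (3 x y)
    have eq: "V \<inter> \<Inter>(h ` S) \<subseteq> h i \<longleftrightarrow> ((\<forall>z\<in>S. h x \<inter> h y \<subseteq> h z) \<longrightarrow> h x \<inter> h y \<subseteq> h i)"
      if xy: "x \<in> S" "y \<in> S" "x \<noteq> y" for x y
    proof (cases "\<forall>z\<in>S. h x \<inter> h y \<subseteq> h z")
      case True
      have "h x \<inter> h y \<subseteq> V" using hV(1) xy(1) S by auto
      then have "h x \<inter> h y \<subseteq> V \<inter> \<Inter>(h ` S)" using True by auto
      moreover have "V \<inter> \<Inter>(h ` S) \<subseteq> h x \<inter> h y" using xy by auto
      ultimately have "V \<inter> \<Inter>(h ` S) = h x \<inter> h y" by (rule subset_antisym[rotated])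
      then show ?thesis using True by simp
    next
      case False
      then obtain z where z: "z \<in> S" "\<not> h x \<inter> h y \<subseteq> h z" by blast
      have I: "x \<in> I" "y \<in> I" "z \<in> I" using S xy z by auto
      have "h x \<noteq> h y" using inj_onD[OF inj _ I(1,2)] xy(3) by auto
      then have "h x \<inter> h y \<inter> h z = {0}" using plane_triple[OF V h[OF I(1)] h[OF I(2)] h[OF I(3)]] z(2) by blast
      moreover have "0 \<in> h i" using hV(3)[OF i] subspace_0 by blast
      moreover have "V \<inter> \<Inter>(h ` S) \<subseteq> h x \<inter> h y \<inter> h z" using xy z(1) by auto
      ultimately have "V \<inter> \<Inter>(h ` S) \<subseteq> h i" by auto
      then show ?thesis using False by blast
    qed
    have ne: "S \<noteq> {i}" using 3 by auto
    show ?thesis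
    proof
      assume "V \<inter> \<Inter>(h ` S) \<subseteq> h i"
      then have "(\<forall>z\<in>S. h x \<inter> h y \<subseteq> h z) \<longrightarrow> h x \<inter> h y \<subseteq> h i" using eq[OF 3] by iprover
      then show "S = {i} \<or> (\<exists>x\<in>S. \<exists>y\<in>S. x \<noteq> y \<and> ((\<forall>z\<in>S. h x \<inter> h y \<subseteq> h z) \<longrightarrow> h x \<inter> h y \<subseteq> h i))"
        by (intro disjI2 bexI[OF _ 3(1)] bexI[OF _ 3(2)] conjI 3(3))
    next
      assume "S = {i} \<or> (\<exists>x\<in>S. \<exists>y\<in>S. x \<noteq> y \<and> ((\<forall>z\<in>S. h x \<inter> h y \<subseteq> h z) \<longrightarrow> h x \<inter> h y \<subseteq> h i))"
      then show "V \<inter> \<Inter>(h ` S) \<subseteq> h i" using ne eq by (elim disjE bexE conjE) (iprover+)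
    qed
  qed
qed

lemma L_equivalent_of_incidence:
  fixes h :: "'i \<Rightarrow> 'a::euclidean_space set" and h' :: "'i \<Rightarrow> 'b::euclidean_space set"
  assumes V: "subspace V" "dim V = 3" "\<And>x. x \<in> I \<Longrightarrow> hyperplane_of V (h x)" "inj_on h I"
    and V': "subspace V'" "dim V' = 3" "\<And>x. x \<in> I \<Longrightarrow> hyperplane_of V' (h' x)" "inj_on h' I"
    and inc: "\<And>x y z. x \<in> I \<Longrightarrow> y \<in> I \<Longrightarrow> z \<in> I \<Longrightarrow> x \<noteq> y \<Longrightarrow> h x \<inter> h y \<subseteq> h z \<longleftrightarrow> h' x \<inter> h' y \<subseteq> h' z"
  shows "L_equivalent V (h ` I) V' (h' ` I)"
proof (rule L_equivalent_of_closure[OF refl refl])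
  fix S i assume S: "S \<subseteq> I" and i: "i \<in> I"
  have k: "((\<forall>z\<in>S. h x \<inter> h y \<subseteq> h z) \<longrightarrow> h x \<inter> h y \<subseteq> h i) =
      ((\<forall>z\<in>S. h' x \<inter> h' y \<subseteq> h' z) \<longrightarrow> h' x \<inter> h' y \<subseteq> h' i)" if "x \<in> S" "y \<in> S" "x \<noteq> y" for x y
  proof -
    have "h x \<inter> h y \<subseteq> h z \<longleftrightarrow> h' x \<inter> h' y \<subseteq> h' z" if "z \<in> I" for z
      using inc[of x y z] that \<open>x \<in> S\<close> \<open>y \<in> S\<close> \<open>x \<noteq> y\<close> S by auto
    then show ?thesis using S i by (intro arg_cong2[where f = "(\<longrightarrow>)"] ball_cong refl) auto
  qed
  show "V \<inter> \<Inter>(h ` S) \<subseteq> h i \<longleftrightarrow> V' \<inter> \<Inter>(h' ` S) \<subseteq> h' i"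
    by (rule box_equals[OF _ closure_rank_three[OF V S i, symmetric] closure_rank_three[OF V' S i, symmetric]],
      intro arg_cong2[where f = "(\<or>)"] refl bex_cong conj_cong, rule k) assumption+
qed

section \<open>The number of hyperplanes as an invariant of the lattice\<close>

lemma hyperplane_in_lattice: "arrangement V A \<Longrightarrow> H \<in> A \<Longrightarrow> H \<in> int_lattice V A"
  unfolding int_lattice_def arrangement_def hyperplane_of_def by (auto intro!: exI[of _ "{H}"])

text \<open>Characterises hyperplanes by the order alone: above a hyperplane are only itself and
  \<open>V\<close>, above \<open>V\<close> only \<open>V\<close>, and above a smaller element also
  some hyperplane.\<close>

lemma hyperplane_card_upset:
  assumes A: "arrangement V A" and X: "X \<in> int_lattice V A"
  shows "card {Y\<in>int_lattice V A. X \<subseteq> Y} = 2 \<longleftrightarrow> X \<in> A"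
proof -
  have V: "subspace V" and h: "\<And>H. H \<in> A \<Longrightarrow> subspace H \<and> H \<subseteq> V \<and> dim H + 1 = dim V"
    using A unfolding arrangement_def hyperplane_of_def by auto
  have fin: "finite (int_lattice V A)"
  proof -
    have "int_lattice V A = (\<lambda>B. V \<inter> \<Inter>B) ` Pow A" unfolding int_lattice_def by auto
    then show ?thesis using A unfolding arrangement_def by simp
  qed
  have Vl: "V \<in> int_lattice V A" unfolding int_lattice_def by (auto intro!: exI[of _ "{}"])
  note Al = hyperplane_in_lattice[OF A]
  have up: "Y \<subseteq> V" "Y = V \<or> (\<exists>H\<in>A. Y \<subseteq> H)" if "Y \<in> int_lattice V A" for Y
    using that unfolding int_lattice_def by auto
  have max: "K = H" if "H \<in> A" "K \<in> A" "H \<subseteq> K" for H K using subspace_dim_equal[of H K] h[OF that(1)] h[OF that(2)] that(3) by auto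
  show ?thesis
  proof (cases "X \<in> A")
    case True
    have "{Y\<in>int_lattice V A. X \<subseteq> Y} = {X, V}" (is "?U = _")
    proof
      show "?U \<subseteq> {X, V}"
      proof
        fix Y assume Y: "Y \<in> ?U"
        show "Y \<in> {X, V}"
        proof (cases "Y = V")
          case False
          then obtain H where "H \<in> A" "Y \<subseteq> H" using up(2)[of Y] Y by blast
          then show ?thesis using max[OF True, of H] Y by blast
        qed simp
      qed
      show "{X, V} \<subseteq> ?U" using X Vl up(1)[OF X] by auto
    qed
    moreover have "X \<noteq> V" using h[OF True] by auto
    ultimately show ?thesis using True by simp
  next
    case False
    have "card {Y\<in>int_lattice V A. X \<subseteq> Y} \<noteq> 2"
    proof (cases "X = V")
      case True
      have "{Y\<in>int_lattice V A. X \<subseteq> Y} = {V}" using Vl up(1) True by auto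
      then show ?thesis by simp
    next
      case X': False
      then obtain H where H: "H \<in> A" "X \<subseteq> H" using up(2)[OF X] by blast
      have "H \<noteq> V" "X \<noteq> H" using h[OF H(1)] H False by auto
      then have "card {X, H, V} = 3" using X' by simp
      moreover have "{X, H, V} \<subseteq> {Y\<in>int_lattice V A. X \<subseteq> Y}" using X Vl Al[OF H(1)] H(2) up(1)[OF X] by auto
      ultimately show ?thesis using card_mono[of "{Y\<in>int_lattice V A. X \<subseteq> Y}" "{X, H, V}"] fin by simp
    qed
    then show ?thesis using False by simp
  qed
qed

lemma L_equivalent_card:
  assumes A: "arrangement V A" and B: "arrangement W B" and L: "L_equivalent V A W B"
  shows "card A = card B"
proof -
  let ?L = "int_lattice V A" and ?M = "int_lattice W B"
  obtain f where f: "bij_betw f ?L ?M" and f_le: "\<forall>X\<in>?L. \<forall>Y\<in>?L. Y \<subseteq> X \<longleftrightarrow> f Y \<subseteq> f X"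
    using L unfolding L_equivalent_def by (elim exE conjE) (rule that)
  have o: "Y \<subseteq> X \<longleftrightarrow> f Y \<subseteq> f X" if "X \<in> ?L" "Y \<in> ?L" for X Y using f_le that by simp
  have inj: "inj_on f ?L" and im: "f ` ?L = ?M" using f unfolding bij_betw_def by auto
  have c: "card {Z\<in>?M. f X \<subseteq> Z} = card {Y\<in>?L. X \<subseteq> Y}" if X: "X \<in> ?L" for X
  proof -
    have "{Z\<in>?M. f X \<subseteq> Z} = f ` {Y\<in>?L. X \<subseteq> Y}" unfolding im[symmetric] using o[OF _ X] by auto
    then show ?thesis using inj by (simp add: card_image inj_on_subset)
  qed
  have "f ` A = B"
  proof
    show "f ` A \<subseteq> B"
    proof
      fix Z assume "Z \<in> f ` A"
      then obtain H where H: "H \<in> A" "Z = f H" by blast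
      have "H \<in> ?L" using hyperplane_in_lattice[OF A H(1)] .
      moreover have "f H \<in> ?M" using bij_betwE[OF f] calculation by simp
      ultimately show "Z \<in> B" using c[of H] hyperplane_card_upset[OF A, of H] hyperplane_card_upset[OF B, of "f H"] H by simp
    qed
    show "B \<subseteq> f ` A"
    proof
      fix Z assume Z: "Z \<in> B"
      have ZM: "Z \<in> ?M" using hyperplane_in_lattice[OF B Z] .
      then obtain X where X: "X \<in> ?L" "Z = f X" unfolding im[symmetric] by (rule imageE)
      then have "X \<in> A" using c[of X] hyperplane_card_upset[OF A, of X] hyperplane_card_upset[OF B ZM] Z by simp
      then show "Z \<in> f ` A" using X by blast
    qed
  qed
  moreover have "inj_on f A" using inj_on_subset[OF inj] hyperplane_in_lattice[OF A] by (simp add: subset_eq)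
  ultimately show ?thesis using card_image by metis
qed

lemma ker_inter_subset:
  fixes a b c :: "'a::euclidean_space"
  assumes V: "subspace V" "a \<in> V" "b \<in> V" "c \<in> V"
  shows "{v\<in>V. a \<bullet> v = 0} \<inter> {v\<in>V. b \<bullet> v = 0} \<subseteq> {v\<in>V. c \<bullet> v = 0} \<longleftrightarrow> (\<exists>x y. c = x *\<^sub>R a + y *\<^sub>R b)"
proof
  assume k: "{v\<in>V. a \<bullet> v = 0} \<inter> {v\<in>V. b \<bullet> v = 0} \<subseteq> {v\<in>V. c \<bullet> v = 0}"
  obtain y z where yz: "y \<in> span {a, b}" "\<And>w. w \<in> span {a, b} \<Longrightarrow> orthogonal z w" "c = y + z"
    using orthogonal_subspace_decomp_exists[of "{a, b}" c] by metis
  have "y \<in> V" using yz(1) span_minimal[of "{a, b}" V] V by auto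
  then have "z \<in> V" using yz(3) subspace_diff[OF V(1) V(4), of y] by simp
  moreover have "a \<bullet> z = 0" "b \<bullet> z = 0" "y \<bullet> z = 0" using yz(1,2) span_base[of _ "{a, b}"] by (auto simp: orthogonal_def inner_commute)
  ultimately have "c \<bullet> z = 0" using k by auto
  then have "z = 0" using yz(3) \<open>y \<bullet> z = 0\<close> by (simp add: inner_add_left)
  then have "c \<in> span {a, b}" using yz by simp
  then obtain x where "c - x *\<^sub>R a \<in> span {b}" using span_breakdown_eq[of c a "{b}"] by blast
  then obtain y where "c - x *\<^sub>R a = y *\<^sub>R b" using span_breakdown_eq[of "c - x *\<^sub>R a" b "{}"] by auto
  then show "\<exists>x y. c = x *\<^sub>R a + y *\<^sub>R b" by (metis add.commute diff_add_cancel)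
next
  assume "\<exists>x y. c = x *\<^sub>R a + y *\<^sub>R b"
  then show "{v\<in>V. a \<bullet> v = 0} \<inter> {v\<in>V. b \<bullet> v = 0} \<subseteq> {v\<in>V. c \<bullet> v = 0}" by (auto simp: inner_add_left)
qed

text \<open>For distinct \<open>x\<close> and \<open>y\<close> this describes when the plane \<open>z\<close> contains the common line of \<open>x\<close> and \<open>y\<close>. The
  index \<open>Inl i\<close> is a plane through the modular line, \<open>Inr a\<close> a plane of the fibre.\<close>

fun fan_collinear :: "(nat \<Rightarrow> nat \<Rightarrow> nat) \<Rightarrow> nat + nat \<Rightarrow> nat + nat \<Rightarrow> nat + nat \<Rightarrow> bool" where
  "fan_collinear \<delta> (Inl i) (Inl j) z = isl z"
| "fan_collinear \<delta> (Inl i) (Inr a) (Inl j) = (j = i)"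
| "fan_collinear \<delta> (Inl i) (Inr a) (Inr b) = (b = a \<or> \<delta> a b = i)"
| "fan_collinear \<delta> (Inr a) (Inl i) (Inl j) = (j = i)"
| "fan_collinear \<delta> (Inr a) (Inl i) (Inr b) = (b = a \<or> \<delta> a b = i)"
| "fan_collinear \<delta> (Inr a) (Inr b) (Inl i) = (\<delta> a b = i)"
| "fan_collinear \<delta> (Inr a) (Inr b) (Inr c) = (c = a \<or> \<delta> a c = \<delta> a b)"

text \<open>A rank three arrangement read as a planar configuration of points and directions. All
  incidences are functions of \<open>\<delta>\<close>, so fans with equal \<open>\<delta>\<close>
  have isomorphic lattices whatever their metric shape.\<close>

locale fan =
  fixes V :: "'a::euclidean_space set" and p :: 'a and k :: nat and J :: "nat set" and \<rho> P :: "nat \<Rightarrow> 'a" and \<delta> :: "nat \<Rightarrow> nat \<Rightarrow> nat"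
  assumes subspace_V: "subspace V" and dim_V: "dim V = 3" and p_V: "p \<in> V" and p_unit: "p \<bullet> p = 1"
    and \<rho>: "i < k \<Longrightarrow> \<rho> i \<in> V" "i < k \<Longrightarrow> p \<bullet> \<rho> i = 0" "i < k \<Longrightarrow> \<rho> i \<noteq> 0"
    and \<rho>_parallel: "i < k \<Longrightarrow> j < k \<Longrightarrow> \<rho> i = x *\<^sub>R \<rho> j \<Longrightarrow> i = j"
    and P: "a \<in> J \<Longrightarrow> P a \<in> V" "a \<in> J \<Longrightarrow> p \<bullet> P a = 0"
    and \<delta>: "a \<in> J \<Longrightarrow> b \<in> J \<Longrightarrow> a \<noteq> b \<Longrightarrow> \<delta> a b < k \<and> (\<exists>c. c \<noteq> 0 \<and> P b - P a = c *\<^sub>R \<rho> (\<delta> a b))"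
    and fin_J: "finite J"
begin

definition normal :: "nat + nat \<Rightarrow> 'a" where "normal = case_sum \<rho> (\<lambda>a. p - P a)"

definition plane :: "nat + nat \<Rightarrow> 'a set" where "plane x = {v\<in>V. normal x \<bullet> v = 0}"

definition idx :: "(nat + nat) set" where "idx = Inl ` {..<k} \<union> Inr ` J"

lemma normal_simps [simp]: "normal (Inl i) = \<rho> i" "normal (Inr a) = p - P a"
  unfolding normal_def by simp_all

lemma idx_simps [simp]: "Inl i \<in> idx \<longleftrightarrow> i < k" "Inr a \<in> idx \<longleftrightarrow> a \<in> J"
  unfolding idx_def by auto

lemma normal_V: "x \<in> idx \<Longrightarrow> normal x \<in> V"
  by (cases x) (use \<rho> P p_V subspace_V in \<open>auto intro: subspace_diff\<close>)

lemma p_normal: "i < k \<Longrightarrow> p \<bullet> \<rho> i = 0" "a \<in> J \<Longrightarrow> p \<bullet> (p - P a) = 1"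
  using \<rho> P p_unit by (auto simp: inner_diff_right)

lemma normal_nz: "x \<in> idx \<Longrightarrow> normal x \<noteq> 0"
proof (cases x)
  case (Inr a)
  assume "x \<in> idx"
  then have "p \<bullet> normal x = 1" using Inr p_normal by simp
  then show ?thesis by auto
qed (use \<rho> in auto)

lemma hyperplane: "x \<in> idx \<Longrightarrow> hyperplane_of V (plane x)"
proof -
  assume x: "x \<in> idx"
  have "normal x \<bullet> normal x \<noteq> 0" using normal_nz[OF x] by simp
  from dim_ker_Suc[OF subspace_V normal_V[OF x] this] show ?thesis
    unfolding hyperplane_of_def plane_def using subspace_V by (auto simp: subspace_def inner_add_right)
qed

lemma P_eq_iff: "a \<in> J \<Longrightarrow> b \<in> J \<Longrightarrow> P a = P b \<longleftrightarrow> a = b"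
  using \<delta>[of a b] \<rho>(3) by fastforce

lemma \<delta>_eqI:
  assumes "a \<in> J" "b \<in> J" "a \<noteq> b" "i < k" "P b - P a = c *\<^sub>R \<rho> i"
  shows "\<delta> a b = i"
proof -
  obtain e where e: "\<delta> a b < k" "e \<noteq> 0" "P b - P a = e *\<^sub>R \<rho> (\<delta> a b)" using \<delta>[OF assms(1-3)] by blast
  then have "\<rho> (\<delta> a b) = (1/e) *\<^sub>R (c *\<^sub>R \<rho> i)" using assms(5) by simp
  then show ?thesis using \<rho>_parallel[OF e(1) assms(4), of "c / e"] by simp
qed

lemma \<rho>_combination:
  assumes "i < k" "j < k" "l < k" "i \<noteq> j"
  shows "\<exists>x y. \<rho> l = x *\<^sub>R \<rho> i + y *\<^sub>R \<rho> j"
proof -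
  let ?W = "{v\<in>V. p \<bullet> v = 0}"
  have W: "subspace ?W" using subspace_V by (auto simp: subspace_def inner_add_right)
  have "dim ?W + 1 = 3" using dim_ker_Suc[OF subspace_V p_V, of p] p_unit dim_V by simp
  then have dW: "dim ?W \<le> 2" by simp
  have "\<rho> i \<notin> span {\<rho> j}"
  proof
    assume "\<rho> i \<in> span {\<rho> j}"
    then obtain x where "\<rho> i - x *\<^sub>R \<rho> j \<in> span {}" using span_breakdown_eq by blast
    then have "\<rho> i = x *\<^sub>R \<rho> j" by simp
    then show False using \<rho>_parallel assms by blast
  qed
  then have ind: "independent {\<rho> i, \<rho> j}" using \<rho>(3)[OF assms(2)] by (intro independent_insertI independent_empty) auto
  have ne: "\<rho> i \<noteq> \<rho> j" using \<rho>_parallel[OF assms(1,2), of 1] assms(4) by auto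
  have "?W \<subseteq> span {\<rho> i, \<rho> j}"
    by (rule card_ge_dim_independent[OF _ ind]) (use \<rho> assms dW ne in auto)
  then have "\<rho> l \<in> span {\<rho> i, \<rho> j}" using \<rho> assms by auto
  then obtain x where "\<rho> l - x *\<^sub>R \<rho> i \<in> span {\<rho> j}" using span_breakdown_eq[of _ "\<rho> i" "{\<rho> j}"] by blast
  then obtain y where "\<rho> l - x *\<^sub>R \<rho> i = y *\<^sub>R \<rho> j" using span_breakdown_eq[of "\<rho> l - x *\<^sub>R \<rho> i" "\<rho> j" "{}"] by auto
  then show ?thesis by (metis add.commute diff_add_cancel)
qed

lemma line_point:
  assumes "i < k" "a \<in> J" "z \<in> idx"
  shows "(\<exists>x y. normal z = x *\<^sub>R \<rho> i + y *\<^sub>R (p - P a)) \<longleftrightarrow> fan_collinear \<delta> (Inl i) (Inr a) z"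
proof (cases z)
  case z: (Inl j)
  then have j: "j < k" using assms by simp
  have "j = i" if "\<rho> j = x *\<^sub>R \<rho> i + y *\<^sub>R (p - P a)" for x y
  proof -
    have "p \<bullet> \<rho> j = y" unfolding that using p_normal assms by (simp add: inner_add_right)
    then show ?thesis using that \<rho>_parallel[OF j assms(1), of x] p_normal(1)[OF j] by simp
  qed
  moreover have "\<exists>x y. \<rho> i = x *\<^sub>R \<rho> i + y *\<^sub>R (p - P a)" by (intro exI[of _ 1] exI[of _ 0]) simp
  ultimately show ?thesis unfolding z normal_simps fan_collinear.simps by blast
next
  case z: (Inr b)
  then have b: "b \<in> J" using assms by simp
  have "b = a \<or> \<delta> a b = i" if h: "p - P b = x *\<^sub>R \<rho> i + y *\<^sub>R (p - P a)" for x y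
  proof -
    have "p \<bullet> (p - P b) = y" unfolding h using p_normal assms by (simp add: inner_add_right)
    then have y: "y = 1" using p_normal(2)[OF b] by simp
    have "P b - P a = (- x) *\<^sub>R \<rho> i" using h unfolding y by (simp add: algebra_simps)
    then show ?thesis using \<delta>_eqI[OF assms(2) b _ assms(1)] by metis
  qed
  moreover have "\<exists>x y. p - P b = x *\<^sub>R \<rho> i + y *\<^sub>R (p - P a)" if d: "\<delta> a b = i" "b \<noteq> a"
  proof -
    obtain c where "P b - P a = c *\<^sub>R \<rho> i" using \<delta>[OF assms(2) b] d by auto
    then have "p - P b = (- c) *\<^sub>R \<rho> i + 1 *\<^sub>R (p - P a)" by (simp add: algebra_simps)
    then show ?thesis by blast
  qed
  moreover have "p - P a = 0 *\<^sub>R \<rho> i + 1 *\<^sub>R (p - P a)" by simp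
  ultimately show ?thesis unfolding z normal_simps fan_collinear.simps by metis
qed

text \<open>Comparing components along \<open>p\<close>, the two coefficients add up to
  \<open>0\<close> for a plane through the modular line and to \<open>1\<close> otherwise; linear
  dependence thus becomes parallelism or collinearity of the points.\<close>

lemma point_point:
  assumes "a \<in> J" "b \<in> J" "a \<noteq> b" "z \<in> idx"
  shows "(\<exists>x y. normal z = x *\<^sub>R (p - P a) + y *\<^sub>R (p - P b)) \<longleftrightarrow> fan_collinear \<delta> (Inr a) (Inr b) z"
proof -
  obtain e where e: "\<delta> a b < k" "e \<noteq> 0" "P b - P a = e *\<^sub>R \<rho> (\<delta> a b)" using \<delta>[OF assms(1-3)] by blast
  have r: "\<rho> (\<delta> a b) = (1/e) *\<^sub>R (P b - P a)" unfolding e(3) using e(2) by simp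
  show ?thesis
  proof (cases z)
    case z: (Inl i)
    then have i: "i < k" using assms by simp
    have "\<delta> a b = i" if h: "\<rho> i = x *\<^sub>R (p - P a) + y *\<^sub>R (p - P b)" for x y
    proof -
      have "p \<bullet> \<rho> i = x + y" unfolding h using p_normal assms by (simp add: inner_add_right)
      then have x: "x = - y" using p_normal(1)[OF i] by simp
      have "\<rho> i = (- y) *\<^sub>R (P b - P a)" using h unfolding x by (simp add: algebra_simps)
      then show ?thesis unfolding e(3) using \<rho>_parallel[OF i e(1)] by (metis scaleR_scaleR)
    qed
    moreover have "\<rho> (\<delta> a b) = (1/e) *\<^sub>R (p - P a) + (- (1/e)) *\<^sub>R (p - P b)" unfolding r by (simp add: algebra_simps)
    ultimately show ?thesis unfolding z normal_simps fan_collinear.simps by metis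
  next
    case z: (Inr c)
    then have c: "c \<in> J" using assms by simp
    have "c = a \<or> \<delta> a c = \<delta> a b" if h: "p - P c = x *\<^sub>R (p - P a) + y *\<^sub>R (p - P b)" for x y
    proof -
      have "p \<bullet> (p - P c) = x + y" unfolding h using p_normal assms by (simp add: inner_add_right)
      then have x: "x = 1 - y" using p_normal(2)[OF c] by simp
      have "P c - P a = y *\<^sub>R (P b - P a)" using h unfolding x by (simp add: algebra_simps)
      then have "P c - P a = (y * e) *\<^sub>R \<rho> (\<delta> a b)" unfolding e(3) by simp
      then show ?thesis using \<delta>_eqI[OF assms(1) c _ e(1)] by metis
    qed
    moreover have "\<exists>x y. p - P c = x *\<^sub>R (p - P a) + y *\<^sub>R (p - P b)" if d: "\<delta> a c = \<delta> a b" "c \<noteq> a"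
    proof -
      obtain c' where "P c - P a = c' *\<^sub>R \<rho> (\<delta> a b)" using \<delta>[OF assms(1) c] d by auto
      then have "P c - P a = (c'/e) *\<^sub>R (P b - P a)" unfolding r by simp
      then have "p - P c = (1 - c'/e) *\<^sub>R (p - P a) + (c'/e) *\<^sub>R (p - P b)" by (simp add: algebra_simps)
      then show ?thesis by blast
    qed
    moreover have "p - P a = 1 *\<^sub>R (p - P a) + 0 *\<^sub>R (p - P b)" by simp
    ultimately show ?thesis unfolding z normal_simps fan_collinear.simps by metis
  qed
qed

lemma incidence:
  assumes "x \<in> idx" "y \<in> idx" "z \<in> idx" "x \<noteq> y"
  shows "plane x \<inter> plane y \<subseteq> plane z \<longleftrightarrow> fan_collinear \<delta> x y z"
proof -
  have eq: "plane x \<inter> plane y \<subseteq> plane z \<longleftrightarrow> (\<exists>r s. normal z = r *\<^sub>R normal x + s *\<^sub>R normal y)" if "x \<in> idx" "y \<in> idx" for x y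
    unfolding plane_def by (rule ker_inter_subset[OF subspace_V]) (use normal_V assms that in auto)
  have sw: "plane x \<inter> plane y \<subseteq> plane z \<longleftrightarrow> plane y \<inter> plane x \<subseteq> plane z" by (simp add: Int_commute)
  show ?thesis
  proof (cases x)
    case x: (Inl i)
    show ?thesis
    proof (cases y)
      case y: (Inl j)
      show ?thesis
      proof (cases z)
        case z: (Inl l)
        then show ?thesis unfolding eq[OF assms(1,2)] using \<rho>_combination[of i j l] assms x y z by simp
      next
        case z: (Inr a)
        have "p - P a \<noteq> r *\<^sub>R \<rho> i + s *\<^sub>R \<rho> j" for r s
        proof
          assume h: "p - P a = r *\<^sub>R \<rho> i + s *\<^sub>R \<rho> j"
          have "p \<bullet> (p - P a) = 0" unfolding h using p_normal(1) assms x y by (simp add: inner_add_right)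
          then show False using p_normal(2) assms z by simp
        qed
        then show ?thesis unfolding eq[OF assms(1,2)] using x y z by simp
      qed
    next
      case y: (Inr a)
      then show ?thesis unfolding eq[OF assms(1,2)] using line_point[of i a z] assms x by simp
    qed
  next
    case x: (Inr a)
    show ?thesis
    proof (cases y)
      case y: (Inl i)
      have "fan_collinear \<delta> x y z = fan_collinear \<delta> y x z" unfolding x y by (cases z) auto
      then show ?thesis unfolding sw eq[OF assms(2,1)] using line_point[of i a z] assms x y by simp
    next
      case y: (Inr b)
      then show ?thesis unfolding eq[OF assms(1,2)] using point_point[of a b z] assms x by simp
    qed
  qed
qed

lemma inj_plane: "inj_on plane idx"
proof (rule inj_onI)
  fix x y assume xy: "x \<in> idx" "y \<in> idx" "plane x = plane y"
  obtain c where c: "normal y = c *\<^sub>R normal x"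
    using parallel_of_ker_subset[OF subspace_V normal_V[OF xy(1)] normal_V[OF xy(2)] normal_nz[OF xy(1)]] xy(3)
    unfolding plane_def by blast
  have pc: "p \<bullet> normal y = c * (p \<bullet> normal x)" unfolding c by simp
  show "x = y"
  proof (cases x)
    case x: (Inl i)
    show ?thesis
    proof (cases y)
      case y: (Inl j)
      then show ?thesis using \<rho>_parallel[of j i c] c xy x by simp
    next
      case y: (Inr b)
      then show ?thesis using pc p_normal xy x by simp
    qed
  next
    case x: (Inr a)
    show ?thesis
    proof (cases y)
      case y: (Inl j)
      then have "c = 0" using pc p_normal xy x by simp
      then show ?thesis using c normal_nz[OF xy(2)] by simp
    next
      case y: (Inr b)
      then have "c = 1" using pc p_normal xy x by simp
      then show ?thesis using c P_eq_iff[of b a] xy x y by simp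
    qed
  qed
qed

lemma arrangement_planes: "arrangement V (plane ` idx)"
  unfolding arrangement_def using subspace_V hyperplane fin_J unfolding idx_def by auto

lemma card_planes: "card (plane ` idx) = k + card J"
proof -
  have "card idx = card (Inl ` {..<k} :: (nat + nat) set) + card (Inr ` J :: (nat + nat) set)"
    unfolding idx_def by (rule card_Un_disjoint) (use fin_J in auto)
  then show ?thesis using inj_plane by (simp add: card_image)
qed

lemma planes_eq: "plane ` idx = (\<lambda>n. {v\<in>V. n \<bullet> v = 0}) ` (\<rho> ` {..<k} \<union> (\<lambda>a. p - P a) ` J)"
  unfolding idx_def image_Un image_image plane_def by simp

end

lemma fan_L_equivalent:
  assumes "fan V p k J \<rho> P \<delta>" "fan V' p' k J \<rho>' P' \<delta>"
  shows "L_equivalent V (fan.plane V p \<rho> P ` fan.idx k J) V' (fan.plane V' p' \<rho>' P' ` fan.idx k J)"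
proof -
  interpret X: fan V p k J \<rho> P \<delta> by (rule assms)
  interpret Y: fan V' p' k J \<rho>' P' \<delta> by (rule assms)
  have i: "X.idx = Y.idx" unfolding X.idx_def Y.idx_def ..
  show ?thesis
    by (rule L_equivalent_of_incidence)
      (use X.subspace_V X.dim_V X.hyperplane X.inj_plane Y.subspace_V Y.dim_V Y.hyperplane Y.inj_plane X.incidence Y.incidence i in auto)
qed

section \<open>The arrangements of regular polygons as fans\<close>

definition spoke :: "nat \<Rightarrow> nat \<Rightarrow> real ^ 3" where "spoke n m = vector [- sn n m, cs n m, 0]"

definition vertex :: "nat \<Rightarrow> nat \<Rightarrow> real ^ 3" where "vertex n a = vector [cs n (2 * a + 1), sn n (2 * a + 1), 0]"

definition apex :: "real ^ 3" where "apex = vector [0, 0, 1]"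

text \<open>The bisector of the angles \<open>(2 a + 1) pi / n\<close> and
  \<open>(2 b + 1) pi / n\<close> is at \<open>(a + b + 1) pi / n\<close>, and both the chord and
  the spoke of this index are perpendicular to it.\<close>

definition even_dir :: "nat \<Rightarrow> nat \<Rightarrow> nat \<Rightarrow> nat" where "even_dir n a b = (a + b + 1) mod n"

text \<open>The index \<open>2 * m\<close> stands for the centre of the regular \<open>2 * m\<close>-gon.\<close>

definition odd_dir :: "nat \<Rightarrow> nat \<Rightarrow> nat \<Rightarrow> nat" where
  "odd_dir m a b = (if b = 2 * m then (2 * a + 1 + m) mod (2 * m) else if a = 2 * m then (2 * b + 1 + m) mod (2 * m)
    else even_dir (2 * m) a b)"

lemma cs_sn: "cs n m = cos (pi * real m / real n)" "sn n m = sin (pi * real m / real n)"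
  unfolding cs_def sn_def by (simp_all add: mult.assoc)

lemma sin_angle_diff:
  assumes "a < n" "b < n" "a \<noteq> b"
  shows "sin (pi * real a / real n - pi * real b / real n) \<noteq> 0"
proof -
  have pos: "0 < sin (pi * real j / real n - pi * real i / real n)" if "i < j" "j < n" for i j
  proof (rule sin_gt_zero)
    have e: "pi * real j / real n - pi * real i / real n = pi * (real (j - i) / real n)"
      using that by (simp add: of_nat_diff right_diff_distrib diff_divide_distrib)
    show "0 < pi * real j / real n - pi * real i / real n" unfolding e using that by simp
    have "real (j - i) / real n < 1" using that by simp
    then have "pi * (real (j - i) / real n) < pi * 1" by (intro mult_strict_left_mono) auto
    then show "pi * real j / real n - pi * real i / real n < pi" unfolding e by simp
  qed
  show ?thesis
  proof (cases "b < a")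
    case False
    then have "0 < sin (pi * real b / real n - pi * real a / real n)" using assms by (intro pos) auto
    moreover have "sin (pi * real b / real n - pi * real a / real n) = - sin (pi * real a / real n - pi * real b / real n)"
      by (metis minus_diff_eq sin_minus)
    ultimately show ?thesis by simp
  qed (use pos[of b a] assms in auto)
qed

text \<open>Raising the index by \<open>n\<close> is a half turn, which only changes the
  sign.\<close>

lemma spoke_mod:
  assumes "0 < n"
  shows "\<exists>c. c \<noteq> 0 \<and> spoke n m = c *\<^sub>R spoke n (m mod n)"
proof -
  let ?q = "m div n" and ?x = "pi * real (m mod n) / real n"
  have "real m = real (m mod n) + real ?q * real n"
    by (metis mod_mult_div_eq mult.commute of_nat_add of_nat_mult)
  then have e: "pi * real m / real n = ?x + real ?q * pi"
    using assms by (simp add: field_simps)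
  have "sn n m = (- 1) ^ ?q * sn n (m mod n)" "cs n m = (- 1) ^ ?q * cs n (m mod n)"
    unfolding cs_sn e by (simp_all add: sin_add cos_add)
  then have "spoke n m = ((- 1) ^ ?q) *\<^sub>R spoke n (m mod n)"
    unfolding spoke_def by (simp add: vec_eq_iff forall_3)
  then show ?thesis by (intro exI[of _ "(- 1) ^ ?q"]) simp
qed

lemma spoke_parallel:
  assumes "i < n" "j < n" "spoke n i = x *\<^sub>R spoke n j"
  shows "i = j"
proof (rule ccontr)
  assume ne: "i \<noteq> j"
  have "sn n i = x * sn n j" "cs n i = x * cs n j"
    using assms(3) unfolding spoke_def by (simp_all add: vec_eq_iff forall_3)
  then have "sn n i * cs n j - cs n i * sn n j = 0" by simp
  then have "sin (pi * real i / real n - pi * real j / real n) = 0" unfolding cs_sn sin_diff .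
  then show False using sin_angle_diff[OF assms(1,2) ne] by simp
qed

lemma spoke_nz: "spoke n m \<noteq> 0"
proof
  assume "spoke n m = 0"
  then have "sn n m = 0" "cs n m = 0" unfolding spoke_def by (simp_all add: vec_eq_iff forall_3)
  then show False using sin_cos_squared_add[of "pi * real m / real n"] unfolding cs_sn by simp
qed

lemma apex_inner: "apex \<bullet> apex = 1" "apex \<bullet> spoke n m = 0" "apex \<bullet> vertex n m = 0"
  unfolding apex_def spoke_def vertex_def by (simp_all add: inner_vec_def sum_3)

lemma vertex_diff:
  assumes "a < n" "b < n" "a \<noteq> b"
  shows "\<exists>c. c \<noteq> 0 \<and> vertex n a - vertex n b = c *\<^sub>R spoke n (even_dir n a b)"
proof -
  let ?\<alpha> = "pi * real (2 * a + 1) / real n" and ?\<beta> = "pi * real (2 * b + 1) / real n"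
  have n: "0 < real n" using assms by simp
  have g: "(?\<alpha> + ?\<beta>) / 2 = pi * real (a + b + 1) / real n" "(?\<alpha> - ?\<beta>) / 2 = pi * real a / real n - pi * real b / real n"
    "(?\<beta> - ?\<alpha>) / 2 = - (pi * real a / real n - pi * real b / real n)"
    using n by (simp_all add: field_simps)
  define r where "r = 2 * sin (pi * real a / real n - pi * real b / real n)"
  have r: "r \<noteq> 0" unfolding r_def using sin_angle_diff[OF assms] by simp
  have "cs n (2 * a + 1) - cs n (2 * b + 1) = r * - sn n (a + b + 1)"
    unfolding cs_sn cos_diff_cos g r_def sin_minus by simp
  moreover have "sn n (2 * a + 1) - sn n (2 * b + 1) = r * cs n (a + b + 1)"
    unfolding cs_sn sin_diff_sin g r_def by simp
  ultimately have e: "vertex n a - vertex n b = r *\<^sub>R spoke n (a + b + 1)"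
    unfolding vertex_def spoke_def by (simp add: vec_eq_iff forall_3)
  obtain c where "c \<noteq> 0" "spoke n (a + b + 1) = c *\<^sub>R spoke n (even_dir n a b)"
    using spoke_mod[of n "a + b + 1"] n unfolding even_dir_def by auto
  then show ?thesis using e r by (intro exI[of _ "r * c"]) simp
qed

text \<open>A spoke is perpendicular to the angle of its index. Raising the index by
  \<open>m\<close>, a right angle in steps of \<open>pi / (2 m)\<close>, makes it parallel to the
  radius.\<close>

lemma vertex_spoke:
  assumes "0 < m"
  shows "\<exists>c. c \<noteq> 0 \<and> vertex (2 * m) a = c *\<^sub>R spoke (2 * m) ((2 * a + 1 + m) mod (2 * m))"
proof -
  let ?\<alpha> = "pi * real (2 * a + 1) / real (2 * m)"
  have e: "pi * real (2 * a + 1 + m) / real (2 * m) = ?\<alpha> + pi / 2" using assms by (simp add: field_simps)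
  have "sn (2 * m) (2 * a + 1 + m) = cs (2 * m) (2 * a + 1)" "cs (2 * m) (2 * a + 1 + m) = - sn (2 * m) (2 * a + 1)"
    unfolding cs_sn e by (simp_all add: sin_add cos_add)
  then have s: "vertex (2 * m) a = (- 1) *\<^sub>R spoke (2 * m) (2 * a + 1 + m)"
    unfolding vertex_def spoke_def by (simp add: vec_eq_iff forall_3)
  obtain c where "c \<noteq> 0" "spoke (2 * m) (2 * a + 1 + m) = c *\<^sub>R spoke (2 * m) ((2 * a + 1 + m) mod (2 * m))"
    using spoke_mod[of "2 * m" "2 * a + 1 + m"] assms by auto
  then show ?thesis using s by (intro exI[of _ "- c"]) simp
qed

text \<open>The sign comes from writing the normals \<open>(cos, sin, 1)\<close> in the form
  \<open>apex - P\<close>.\<close>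

definition centred_vertex :: "nat \<Rightarrow> nat \<Rightarrow> real ^ 3" where
  "centred_vertex m a = (if a = 2 * m then 0 else - vertex (2 * m) a)"

lemma fan_even:
  assumes "0 < n"
  shows "fan (UNIV :: (real ^ 3) set) apex n {..<n} (spoke n) (\<lambda>a. - vertex n a) (even_dir n)"
proof (unfold_locales, goal_cases)
  case (11 a b)
  then show ?case using vertex_diff[of a n b] assms by (simp add: even_dir_def)
qed (use apex_inner spoke_nz spoke_parallel in auto)

lemma fan_odd:
  assumes "0 < m"
  shows "fan (UNIV :: (real ^ 3) set) apex (2 * m) {..2 * m} (spoke (2 * m)) (centred_vertex m) (odd_dir m)"
proof (unfold_locales, goal_cases)
  case (11 a b)
  have "odd_dir m a b < 2 * m" using assms unfolding odd_dir_def even_dir_def by simp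
  moreover have "\<exists>c. c \<noteq> 0 \<and> centred_vertex m b - centred_vertex m a = c *\<^sub>R spoke (2 * m) (odd_dir m a b)"
  proof -
    consider "b = 2 * m" "a \<noteq> 2 * m" | "a = 2 * m" "b \<noteq> 2 * m" | "a < 2 * m" "b < 2 * m" using 11 by fastforce
    then show ?thesis
    proof cases
      case 1
      then show ?thesis using vertex_spoke[OF assms, of a] unfolding centred_vertex_def odd_dir_def by simp
    next
      case 2
      obtain c where "c \<noteq> 0" "vertex (2 * m) b = c *\<^sub>R spoke (2 * m) ((2 * b + 1 + m) mod (2 * m))"
        using vertex_spoke[OF assms, of b] by blast
      then show ?thesis using 2 unfolding centred_vertex_def odd_dir_def by (intro exI[of _ "- c"]) simp
    next
      case 3
      then show ?thesis using vertex_diff[of a "2 * m" b] 11 unfolding centred_vertex_def odd_dir_def by simp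
    qed
  qed
  ultimately show ?case by blast
qed (use apex_inner spoke_nz spoke_parallel in \<open>auto simp: centred_vertex_def\<close>)

text \<open>The arrangement numbers its vertices from \<open>1\<close> and the fan from
  \<open>0\<close>, which turns \<open>2 * j - 1\<close> into \<open>2 * a + 1\<close>.\<close>

lemma arr_even_planes:
  assumes "0 < n"
  shows "arr_even n = fan.plane UNIV apex (spoke n) (\<lambda>a. - vertex n a) ` fan.idx n {..<n}"
proof -
  interpret fan "UNIV :: (real ^ 3) set" apex n "{..<n}" "spoke n" "\<lambda>a. - vertex n a" "even_dir n" by (rule fan_even[OF assms])
  have "apex - - vertex n a = vector [cs n (2 * Suc a - 1), sn n (2 * Suc a - 1), 1]" for a
    unfolding apex_def vertex_def by (simp add: vec_eq_iff forall_3)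
  then have "(\<lambda>a. apex - - vertex n a) ` {..<n} = (\<lambda>j. vector [cs n (2 * j - 1), sn n (2 * j - 1), 1]) ` Suc ` {..<n}"
    unfolding image_image by simp
  also have "Suc ` {..<n} = {1..n}" by (simp add: image_Suc_lessThan)
  finally show ?thesis unfolding planes_eq arr_even_def normal_arr_def spoke_def atLeast0LessThan by simp
qed

lemma arr_odd_planes:
  assumes "0 < m"
  shows "arr_odd m = fan.plane UNIV apex (spoke (2 * m)) (centred_vertex m) ` fan.idx (2 * m) {..2 * m}"
proof -
  interpret O: fan "UNIV :: (real ^ 3) set" apex "2 * m" "{..2 * m}" "spoke (2 * m)" "centred_vertex m" "odd_dir m" by (rule fan_odd[OF assms])
  have m: "0 < 2 * m" using assms by simp
  interpret E: fan "UNIV :: (real ^ 3) set" apex "2 * m" "{..<2 * m}" "spoke (2 * m)" "\<lambda>a. - vertex (2 * m) a" "even_dir (2 * m)" by (rule fan_even[OF m])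
  have "{..2 * m} = insert (2 * m) {..<2 * m}" by auto
  moreover have "(\<lambda>a. apex - centred_vertex m a) ` {..<2 * m} = (\<lambda>a. apex - - vertex (2 * m) a) ` {..<2 * m}"
    by (intro image_cong) (auto simp: centred_vertex_def)
  ultimately have "spoke (2 * m) ` {..<2 * m} \<union> (\<lambda>a. apex - centred_vertex m a) ` {..2 * m} =
      (spoke (2 * m) ` {..<2 * m} \<union> (\<lambda>a. apex - - vertex (2 * m) a) ` {..<2 * m}) \<union> {apex}"
    by (simp add: centred_vertex_def)
  then have "O.plane ` O.idx = E.plane ` E.idx \<union> normal_arr {apex}"
    unfolding O.planes_eq E.planes_eq by (simp add: normal_arr_def image_Un)
  then show ?thesis unfolding arr_odd_def arr_even_planes[OF m] apex_def by simp
qed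

lemma arr_even_arrangement: "0 < n \<Longrightarrow> arrangement UNIV (arr_even n) \<and> card (arr_even n) = 2 * n"
  using fan.arrangement_planes[OF fan_even] fan.card_planes[OF fan_even] arr_even_planes by simp

lemma arr_odd_arrangement: "0 < m \<Longrightarrow> arrangement UNIV (arr_odd m) \<and> card (arr_odd m) = 4 * m + 1"
  using fan.arrangement_planes[OF fan_odd] fan.card_planes[OF fan_odd] arr_odd_planes by simp

text \<open>The lattice gives the number of hyperplanes, \<open>2 n\<close> or
  \<open>4 m + 1\<close>; its parity tells the family and its value the member.\<close>

lemma family_unique:
  assumes A: "arrangement V A" and B: "B \<in> family_R1 \<union> family_R2" "L_equivalent V A UNIV B"
    and C: "C \<in> family_R1 \<union> family_R2" "L_equivalent V A UNIV C"
  shows "B = C"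
proof -
  have f: "(\<exists>n. 3 \<le> n \<and> X = arr_even n \<and> card A = 2 * n) \<or> (\<exists>m. 2 \<le> m \<and> X = arr_odd m \<and> card A = 4 * m + 1)"
    if X: "X \<in> family_R1 \<union> family_R2" "L_equivalent V A UNIV X" for X
  proof -
    consider n where "3 \<le> n" "X = arr_even n" | m where "2 \<le> m" "X = arr_odd m"
      using X(1) unfolding family_R1_def family_R2_def by blast
    then show ?thesis
    proof cases
      case (1 n)
      then have "arrangement UNIV X" "card X = 2 * n" using arr_even_arrangement[of n] by auto
      then show ?thesis using L_equivalent_card[OF A _ X(2)] 1 by auto
    next
      case (2 m)
      then have "arrangement UNIV X" "card X = 4 * m + 1" using arr_odd_arrangement[of m] by auto
      then show ?thesis using L_equivalent_card[OF A _ X(2)] 2 by auto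
    qed
  qed
  have par: "2 * n \<noteq> 4 * m + 1" for n m :: nat by presburger
  show ?thesis using f[OF B] f[OF C]
  proof (elim disjE exE conjE)
    fix n n' assume "B = arr_even n" "C = arr_even n'" "card A = 2 * n" "card A = 2 * n'"
    then show ?thesis by simp
  next
    fix m m' assume "B = arr_odd m" "C = arr_odd m'" "card A = 4 * m + 1" "card A = 4 * m' + 1"
    then show ?thesis by simp
  qed (use par in metis)+
qed

section \<open>Matching a fibre with a polygon\<close>

lemma residue_unique:
  fixes k i j x :: nat
  assumes "k dvd x + i" "k dvd x + j" "i < k" "j < k" shows "i = j"
proof -
  have "i = j" if d: "k dvd x + i" "k dvd x + j" "i \<le> j" "j < k" for i j
  proof -
    have "k dvd (x + j) - (x + i)" using d by (intro dvd_diff_nat)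
    then have "k dvd j - i" by simp
    then show ?thesis using d by (metis diff_is_0_eq dvd_imp_le le_antisym less_imp_diff_less linorder_not_less neq0_conv)
  qed
  then show ?thesis using assms by (metis nat_le_linear)
qed

lemma residue_exists:
  fixes k x :: nat
  assumes "0 < k" shows "\<exists>i<k. k dvd x + i"
proof -
  let ?i = "(k - x mod k) mod k"
  have "(x + (k - x mod k)) mod k = (x mod k + (k - x mod k)) mod k" by (simp add: mod_add_left_eq)
  also have "x mod k + (k - x mod k) = k" using assms by (simp add: less_imp_le)
  finally have "(x + ?i) mod k = 0" by (simp add: mod_add_right_eq)
  then show ?thesis using assms by (intro exI[of _ ?i]) auto
qed

context modular_fibration
begin

text \<open>The planar view numbers directions in the opposite sense and from another starting point
  than the polygon. The offset is \<open>h\<close>, and the bijection \<open>\<sigma>\<close> of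
  residues renumbers the roots so that \<open>\<delta>\<close> becomes exact.\<close>

lemma fan_of_labels:
  assumes X: "rank_two_view W R F w D s t" and dim: "dim V = 3" and D: "D = {s, t}"
    and J: "finite J" and P: "bij_betw P J F"
    and \<delta>: "\<And>a b. a \<in> J \<Longrightarrow> b \<in> J \<Longrightarrow> a \<noteq> b \<Longrightarrow> \<delta> a b < rank_two_view.k R s t \<and>
      rank_two_view.k R s t dvd \<delta> a b + h + rank_two_view.dir R s t (P a) (P b)"
  shows "\<exists>\<rho>. fan V p (rank_two_view.k R s t) J \<rho> P \<delta> \<and> A = fan.plane V p \<rho> P ` fan.idx (rank_two_view.k R s t) J"
proof -
  interpret X: rank_two_view W R F w D s t by (rule X)
  have x0: "X.x0 = 0" unfolding X.x0_def by (simp add: D)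
  have k: "0 < X.k" using X.k_ge_2 by simp
  have "\<forall>c. \<exists>i. i < X.k \<and> X.k dvd (c + h) + i" using residue_exists[OF k] by blast
  from choice[OF this] obtain \<sigma> where "\<forall>c. \<sigma> c < X.k \<and> X.k dvd (c + h) + \<sigma> c" by (elim exE)
  then have \<sigma>: "\<sigma> c < X.k \<and> X.k dvd (c + h) + \<sigma> c" for c by simp
  have \<sigma>_eq: "\<sigma> c = d" if "d < X.k" "X.k dvd c + h + d" for c d
    using residue_unique[OF _ that(2)] \<sigma> that(1) by blast
  have \<sigma>_inj: "i = j" if "i < X.k" "j < X.k" "\<sigma> i = \<sigma> j" for i j
  proof (rule residue_unique[of X.k "h + \<sigma> i"])
    show "X.k dvd h + \<sigma> i + i" using \<sigma>[of i] by (simp add: ac_simps)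
    show "X.k dvd h + \<sigma> i + j" using \<sigma>[of j] that(3) by (simp add: ac_simps)
  qed (use that in auto)
  have \<sigma>_surj: "\<exists>c<X.k. \<sigma> c = d" if d: "d < X.k" for d
  proof -
    obtain c where c: "c < X.k" "X.k dvd h + d + c" using residue_exists[OF k] by blast
    have "X.k dvd c + h + d" using c(2) by (simp add: ac_simps)
    then show ?thesis using \<sigma>_eq[OF d] c(1) by blast
  qed
  define \<rho> where "\<rho> c = X.ray (X.tau (\<sigma> c))" for c
  have \<rho>_root: "root_of R (\<rho> c)" for c unfolding \<rho>_def using X.root_ray \<sigma> by blast
  have \<rho>_W: "\<rho> c \<in> W" for c using root_R_W[OF \<rho>_root] .
  have PJ: "P ` J = F" by (rule bij_betw_imp_surj_on[OF P])
  have PF: "P a \<in> F" if "a \<in> J" for a using bij_betwE[OF P] that by blast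
  have PW: "P a \<in> W" if "a \<in> J" for a using PF[OF that] F_sub by blast
  have WV: "x \<in> V" "p \<bullet> x = 0" if "x \<in> W" for x using that unfolding W_def by auto
  have f: "fan V p X.k J \<rho> P \<delta>"
  proof (unfold_locales, goal_cases)
    case (8 i j x)
    have "1 *\<^sub>R X.ray (X.tau (\<sigma> i)) = x *\<^sub>R X.ray (X.tau (\<sigma> j))" using 8(3) unfolding \<rho>_def by simp
    then have "X.tau (\<sigma> i) = X.tau (\<sigma> j)" by (rule X.scale_ray_eq(2)) simp
    then have "\<sigma> i = \<sigma> j" using X.tau_eq_iff \<sigma> by blast
    then show ?case using \<sigma>_inj 8 by blast
  next
    case (11 a b)
    have "P a \<noteq> P b" using bij_betw_imp_inj_on[OF P] 11 by (auto dest: inj_onD)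
    moreover have "P a \<in> X.Q 0" "P b \<in> X.Q 0" unfolding X.Q_def x0 using PF 11 by auto
    ultimately obtain c where c: "c \<noteq> 0" "P b - P a = c *\<^sub>R X.ray (X.tau (X.dir (P a) (P b)))" "X.dir (P a) (P b) < X.k"
      using X.dir_ex by blast
    have "\<sigma> (\<delta> a b) = X.dir (P a) (P b)" using \<sigma>_eq[OF c(3)] \<delta>[OF 11] by blast
    then show ?case using c(1,2) \<delta>[OF 11] unfolding \<rho>_def by metis
  qed (use subspace_V dim p_V p_unit WV[OF \<rho>_W] WV[OF PW] X.ray_nz J in \<open>auto simp: \<rho>_def\<close>)
  interpret fan V p X.k J \<rho> P \<delta> by (rule f)
  have "A = plane ` idx"
    unfolding A_eq planes_eq
  proof (rule hyperplanes_eq)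
    fix n assume "n \<in> N"
    then consider "n \<in> R" | g where "g \<in> F" "n = p - g" unfolding N_def by blast
    then show "\<exists>m\<in>\<rho> ` {..<X.k} \<union> (\<lambda>a. p - P a) ` J. \<exists>c. c \<noteq> 0 \<and> n = c *\<^sub>R m"
    proof cases
      case 1
      have "n \<bullet> X.x0 = 0" unfolding x0 by simp
      then obtain d c where d: "d < X.k" "c \<noteq> 0" "n = c *\<^sub>R X.ray (X.tau d)" using X.root_plane[OF root_of_base[OF 1]] by blast
      obtain i where "i < X.k" "\<sigma> i = d" using \<sigma>_surj[OF d(1)] by blast
      then have "\<rho> i \<in> \<rho> ` {..<X.k}" "n = c *\<^sub>R \<rho> i" using d(3) unfolding \<rho>_def by auto
      then show ?thesis using d(2) by blast
    next
      case (2 g)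
      then obtain a where "a \<in> J" "g = P a" unfolding PJ[symmetric] by blast
      then show ?thesis using 2 by (intro bexI[of _ "p - P a"] exI[of _ 1]) auto
    qed
  next
    fix m assume "m \<in> \<rho> ` {..<X.k} \<union> (\<lambda>a. p - P a) ` J"
    then consider i where "m = \<rho> i" | a where "a \<in> J" "m = p - P a" by blast
    then show "\<exists>n\<in>N. \<exists>c. c \<noteq> 0 \<and> m = c *\<^sub>R n"
    proof cases
      case (1 i)
      then show ?thesis using \<rho>_root[of i] unfolding root_of_def N_def by blast
    next
      case (2 a)
      then show ?thesis using PF[of a] unfolding N_def by (intro bexI[of _ m] exI[of _ 1]) auto
    qed
  qed
  then show ?thesis using f by blast
qed

text \<open>There are two simple roots and both are letters, so somewhere two neighbouring letters
  differ. Their plane is all of \<open>W\<close> and, by \<open>letter_adjacent_Suc\<close>,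
  contains at least three roots.\<close>

lemma rank_three_view:
  assumes irr: "irreducible_arr V A" and dim: "dim V = 3"
  shows "\<exists>w D s t. rank_two_view W R F w D s t \<and> D = {s, t} \<and> 3 \<le> rank_two_view.k R s t \<and> 2 \<le> card F"
proof -
  obtain w where w: "regular w" using ex_regular by blast
  obtain D where D: "simple w D" using regular_simple_ex[OF w] by blast
  obtain e where e: "chamber_word W R F w D e" using ex_chamber_word[OF w D] by blast
  interpret C: chamber_word W R F w D e by (rule e)
  have let_D: "C.letter ` {..<card F - 1} = D" by (rule all_letters[OF irr e])
  have "card D = dim W" using simpleD(1,2)[OF D] by (metis dim_eq_card_independent dim_span)
  then have cD: "card D = 2" using dim_W dim by simp
  have "\<exists>i. Suc (Suc i) < card F \<and> C.letter i \<noteq> C.letter (Suc i)"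
  proof (rule ccontr)
    assume "\<not> ?thesis"
    then have c: "C.letter (Suc i) = C.letter i" if "Suc (Suc i) < card F" for i using that by metis
    have const: "C.letter i = C.letter 0" if "Suc i < card F" for i
      using that
    proof (induction i)
      case (Suc i)
      show ?case using trans[OF c[OF Suc.prems] Suc.IH] Suc.prems by simp
    qed (rule refl)
    have "C.letter ` {..<card F - 1} \<subseteq> {C.letter 0}"
    proof (rule image_subsetI)
      fix i assume "i \<in> {..<card F - 1}"
      then have "Suc i < card F" by auto
      then show "C.letter i \<in> {C.letter 0}" unfolding singleton_iff by (rule const)
    qed
    then have "card D \<le> card {C.letter 0}" unfolding let_D by (intro card_mono) auto
    then show False using cD by simp
  qed
  then obtain i where i: "Suc (Suc i) < card F" "C.letter i \<noteq> C.letter (Suc i)" by blast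
  have adj: "C.adjacent (C.letter i) (C.letter (Suc i))" by (rule C.letter_adjacent_Suc[OF i])
  then have st: "C.letter i \<in> D" "C.letter (Suc i) \<in> D" "3 \<le> order2 (C.letter i) (C.letter (Suc i))"
    unfolding C.adjacent_def by auto
  interpret Y: chamber_word_view W R F w D e "C.letter i" "C.letter (Suc i)" by (rule C.view[OF st(1,2) i(2)])
  have "{C.letter i, C.letter (Suc i)} = D"
    by (rule card_subset_eq) (use st cD i simpleD(3)[OF D] in auto)
  then show ?thesis using Y.rank_two_view_axioms st(3) Y.k_order2 i(1)
    by (intro exI[of _ w] exI[of _ D] exI[of _ "C.letter i"] exI[of _ "C.letter (Suc i)"]) simp
qed

lemma rank_three:
  assumes irr: "irreducible_arr V A" and dim: "dim V = 3"
  shows "(\<exists>n \<rho> P. 3 \<le> n \<and> fan V p n {..<n} \<rho> P (even_dir n) \<and> A = fan.plane V p \<rho> P ` fan.idx n {..<n}) \<or>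
    (\<exists>m \<rho> P. 2 \<le> m \<and> fan V p (2 * m) {..2 * m} \<rho> P (odd_dir m) \<and> A = fan.plane V p \<rho> P ` fan.idx (2 * m) {..2 * m})"
proof -
  obtain w D s t where X: "rank_two_view W R F w D s t" and D: "D = {s, t}" and k: "3 \<le> rank_two_view.k R s t"
    and cF: "2 \<le> card F" using rank_three_view[OF irr dim] by blast
  interpret X: rank_two_view W R F w D s t by (rule X)
  \<comment> \<open>With no simple roots besides \<open>s\<close> and \<open>t\<close> there is a
    single level, and the view shows the whole fibre.\<close>
  have "X.x0 = 0" unfolding X.x0_def by (simp add: D)
  then have Q: "X.Q 0 = F" unfolding X.Q_def by simp
  interpret S: allowable_sequence F X.k X.L X.dir using X.allowable[OF k, of 0] unfolding Q .
  show ?thesis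
    using cF
  proof (cases rule: S.alternating_or_centred)
    case 1
    interpret T: alternating_sequence F X.k X.L X.dir by (rule 1)
    define P where "P = the_inv_into F T.label"
    have ck: "card F = X.k" by (rule T.card_eq_k)
    have P: "bij_betw P {..<X.k} F" unfolding P_def using bij_betw_the_inv_into[OF T.bij_label] unfolding ck .
    have lP: "T.label (P a) = a" if "a < X.k" for a
      unfolding P_def using f_the_inv_into_f_bij_betw[OF T.bij_label, of a] that unfolding ck by simp
    have "\<exists>\<rho>. fan V p X.k {..<X.k} \<rho> P (even_dir X.k) \<and> A = fan.plane V p \<rho> P ` fan.idx X.k {..<X.k}"
    proof (rule fan_of_labels[OF X dim D _ P])
      fix a b assume ab: "a \<in> {..<X.k}" "b \<in> {..<X.k}" "a \<noteq> b"
      have "P a \<in> F" "P b \<in> F" "P a \<noteq> P b" using P ab by (auto simp: bij_betw_def dest: inj_onD)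
      then have "X.k dvd T.label (P a) + T.label (P b) + T.phase + X.dir (P a) (P b) + 1" by (rule T.dvd_label_sum)
      then have "X.k dvd (a + b + 1) + (T.phase + X.dir (P a) (P b))" using lP ab by (simp add: ac_simps)
      then have "X.k dvd (a + b + 1) mod X.k + (T.phase + X.dir (P a) (P b))" by (simp add: dvd_eq_mod_eq_0 mod_add_left_eq)
      then show "even_dir X.k a b < X.k \<and> X.k dvd even_dir X.k a b + T.phase + X.dir (P a) (P b)"
        unfolding even_dir_def using k by (simp add: ac_simps)
    qed simp
    then show ?thesis using k by blast
  next
    case (2 c)
    obtain m where m: "m \<in> F" "S.pos 0 m = c" using S.ex_pos[of c 0] 2 by auto
    note cm = 2(1-3) m
    interpret T: alternating_sequence "F - {m}" X.k X.L X.dir by (rule S.remove_centre[OF cm])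
    have kc: "X.k = 2 * c" by (rule S.k_centred[OF cm])
    have ck: "card (F - {m}) = 2 * c" using T.card_eq_k kc by simp
    \<comment> \<open>The centre receives the label \<open>2 * c\<close>, which
      \<open>odd_dir\<close> reserves for it.\<close>
    define P where "P a = (if a = 2 * c then m else the_inv_into (F - {m}) T.label a)" for a
    have P0: "bij_betw (the_inv_into (F - {m}) T.label) {..<2 * c} (F - {m})"
      using bij_betw_the_inv_into[OF T.bij_label] unfolding ck .
    then have P1: "bij_betw P {..<2 * c} (F - {m})" by (rule bij_betw_cong[THEN iffD1, rotated]) (auto simp: P_def)
    have "bij_betw P ({..<2 * c} \<union> {2 * c}) ((F - {m}) \<union> {m})"
      by (rule bij_betw_combine[OF P1]) (auto simp: P_def)
    moreover have "{..<2 * c} \<union> {2 * c} = {..2 * c}" "(F - {m}) \<union> {m} = F" using m by auto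
    ultimately have P: "bij_betw P {..2 * c} F" by simp
    have lP: "T.label (P a) = a" if "a < 2 * c" for a
      unfolding P_def using f_the_inv_into_f_bij_betw[OF T.bij_label, of a] that unfolding ck by simp
    have PF: "P a \<in> F - {m}" if "a < 2 * c" for a using bij_betwE[OF P1] that by simp
    have Pm: "P (2 * c) = m" unfolding P_def by simp
    have centre: "2 * c dvd (2 * a + 1 + c) mod (2 * c) + T.phase + X.dir m (P a)" if a: "a < 2 * c" for a
    proof -
      have "X.k dvd 2 * T.label (P a) + T.phase + X.dir m (P a) + 1 + c"
        using PF[OF a] by (intro S.dvd_label_centre[OF cm]) auto
      then have "2 * c dvd (2 * a + 1 + c) + (T.phase + X.dir m (P a))" using lP[OF a] kc by (simp add: ac_simps)
      then have "2 * c dvd (2 * a + 1 + c) mod (2 * c) + (T.phase + X.dir m (P a))" by (simp add: dvd_eq_mod_eq_0 mod_add_left_eq)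
      then show ?thesis by (simp add: ac_simps)
    qed
    have "\<exists>\<rho>. fan V p X.k {..2 * c} \<rho> P (odd_dir c) \<and> A = fan.plane V p \<rho> P ` fan.idx X.k {..2 * c}"
    proof (rule fan_of_labels[OF X dim D _ P])
      fix a b assume ab: "a \<in> {..2 * c}" "b \<in> {..2 * c}" "a \<noteq> b"
      have "odd_dir c a b < 2 * c" using 2(1) unfolding odd_dir_def even_dir_def by simp
      moreover have "2 * c dvd odd_dir c a b + T.phase + X.dir (P a) (P b)"
      proof -
        consider "b = 2 * c" "a < 2 * c" | "a = 2 * c" "b < 2 * c" | "a < 2 * c" "b < 2 * c" using ab by fastforce
        then show ?thesis
        proof cases
          case 1
          have "X.dir (P a) m = X.dir m (P a)" using S.d_sym PF[OF 1(2)] m(1) by blast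
          then show ?thesis using centre[OF 1(2)] 1 Pm unfolding odd_dir_def by simp
        next
          case 2
          then show ?thesis using centre[OF 2(2)] Pm unfolding odd_dir_def by simp
        next
          case 3
          have "P a \<noteq> P b" using bij_betw_imp_inj_on[OF P1] 3 ab(3) by (auto dest: inj_onD)
          then have "X.k dvd T.label (P a) + T.label (P b) + T.phase + X.dir (P a) (P b) + 1" by (intro T.dvd_label_sum PF 3)
          then have "2 * c dvd (a + b + 1) + (T.phase + X.dir (P a) (P b))" using lP 3 kc by (simp add: ac_simps)
          then have "2 * c dvd (a + b + 1) mod (2 * c) + (T.phase + X.dir (P a) (P b))" by (simp add: dvd_eq_mod_eq_0 mod_add_left_eq)
          then show ?thesis using 3 unfolding odd_dir_def even_dir_def by (simp add: ac_simps)
        qed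
      qed
      ultimately show "odd_dir c a b < X.k \<and> X.k dvd odd_dir c a b + T.phase + X.dir (P a) (P b)" unfolding kc by blast
    qed simp
    then have "\<exists>\<rho>. fan V p (2 * c) {..2 * c} \<rho> P (odd_dir c) \<and> A = fan.plane V p \<rho> P ` fan.idx (2 * c) {..2 * c}" unfolding kc .
    moreover have "2 \<le> c" using k kc by simp
    ultimately show ?thesis by blast
  qed
qed

end

theorem theorem1p2:
  fixes V :: "'v::euclidean_space set" and A :: "'v set set" and l :: nat and p :: "'n::finite"
  assumes "arrangement V A"
    and "dim V = l" and "CARD('n) = l" and "l \<ge> 3"
    and "irreducible_arr V A"
    and "supersolvable_arr V A"
    and "simplicial_arr V A"
  shows "(l = 3 \<and> (\<exists>!B. B \<in> family_R1 \<union> family_R2 \<and> L_equivalent V A (UNIV :: (real^3) set) B)) \<or>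
         (l \<ge> 4 \<and>
          exactly_one
            [linearly_isomorphic V A coxeter_A_space (coxeter_A :: (real ^ ('n option)) set set),
             linearly_isomorphic V A UNIV (coxeter_C :: (real ^ 'n) set set),
             linearly_isomorphic V A UNIV (coxeter_C_minus p)] \<and>
          crystallographic_arr V A)"
proof -
  obtain q W R F N where M: "modular_fibration V A q W R F N"
    using ex_modular_fibration[OF assms(1) _ assms(6,7)] assms(2,4) by auto
  interpret modular_fibration V A q W R F N by (rule M)
  show ?thesis
  proof (cases "l = 3")
    case True
    then have dim: "dim V = 3" using assms(2) by simp
    have "\<exists>B. B \<in> family_R1 \<union> family_R2 \<and> L_equivalent V A (UNIV :: (real^3) set) B"
      using rank_three[OF assms(5) dim]
    proof (elim disjE exE conjE)
      fix n \<rho> P assume n: "3 \<le> n" "fan V q n {..<n} \<rho> P (even_dir n)" "A = fan.plane V q \<rho> P ` fan.idx n {..<n}"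
      have "0 < n" using n(1) by simp
      then have "L_equivalent V A UNIV (arr_even n)"
        using fan_L_equivalent[OF n(2) fan_even] arr_even_planes n(3) by metis
      then show ?thesis using n(1) unfolding family_R1_def by blast
    next
      fix m \<rho> P assume m: "2 \<le> m" "fan V q (2 * m) {..2 * m} \<rho> P (odd_dir m)" "A = fan.plane V q \<rho> P ` fan.idx (2 * m) {..2 * m}"
      have "0 < m" using m(1) by simp
      then have "L_equivalent V A UNIV (arr_odd m)"
        using fan_L_equivalent[OF m(2) fan_odd] arr_odd_planes m(3) by metis
      then show ?thesis using m(1) unfolding family_R2_def by blast
    qed
    then show ?thesis using family_unique[OF assms(1)] True by blast
  next
    case False
    then have l: "4 \<le> l" using assms(4) by simp
    then have h: "(linearly_isomorphic V A coxeter_A_space (coxeter_A :: (real ^ 'n option) set set) \<or>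
        linearly_isomorphic V A UNIV (coxeter_C :: (real ^ 'n) set set) \<or> linearly_isomorphic V A UNIV (coxeter_C_minus p)) \<and>
      crystallographic_arr V A"
      using high_rank[OF assms(5)] assms(2,3) by blast
    have A_V: "H \<subseteq> V" if "H \<in> A" for H using assms(1) that unfolding arrangement_def hyperplane_of_def by simp
    have "4 \<le> CARD('n)" using l assms(3) by simp
    from exactly_one_coxeter[OF this A_V conjunct1[OF h]] show ?thesis using l conjunct2[OF h] by simp
  qed
qed

end
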